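(* Consider a continuous-time two-player nonzero-sum stochastic game on $S=\{1,2,\dots\}$ with data $(U_k,U_k(i),\bar\pi_{ij},\bar c_k)$ as described in the context. Assume the following. (A) There are $\tilde W:S\to[1,\infty)$ and constants $C_1\neq 0$, $C_2\ge 0$, $C_3>0$ such that $\sum_{j\in S}\tilde W(j)\bar\pi_{ij}(u_1,u_2)\le C_1\tilde W(i)+C_2$ and $\bar\pi_i\le C_3\tilde W(i)$ for all $i\in S$ and $(u_1,u_2)\in U_1(i)\times U_2(i)$. (B) The process $\{Y(t)\}_{t\ge0}$ is irreducible under every pair of stationary Markov strategies $(v_1,v_2)\in\mathcal S_1\times\mathcal S_2$, and there exist a constant $C_4>0$, a function $W:S\to[1,\infty)$ and a finite set $\mathscr K\subset S$ such that one of the following holds: (a) $\bar c_1,\bar c_2$ are bounded and, for some constant $\gamma>\max\{\|\bar c_1\|_\infty,\|\bar c_2\|_\infty\}$, $\sup_{(u_1,u_2)\in U_1(i)\times U_2(i)}\sum_{j\in S}W(j)\bar\pi_{ij}(u_1,u_2)\le C_4 I_{\mathscr K}(i)-\gamma W(i)$ for all $i\in S$; (b) for some norm-like function $\ell:S\to\mathbb R_+$, $\sup_{(u_1,u_2)\in U_1(i)\times U_2(i)}\sum_{j\in S}W(j)\bar\pi_{ij}(u_1,u_2)\le C_4 I_{\mathscr K}(i)-\ell(i)W(i)$ for all $i\in S$, and the functions $i\mapsto \ell(i)-\max_{(u_1,u_2)\in U_1(i)\times U_2(i)}\bar c_k(i,u_1,u_2)$, $k=1,2$, are norm-like. (C)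 For all $i,j\in S$ and $k=1,2$, the functions $\bar\pi_{ij}(u_1,u_2)$, $\bar c_k(i,u_1,u_2)$ and $\sum_{j\in S}W(j)\bar\pi_{ij}(u_1,u_2)$ are continuous in $(u_1,u_2)\in U_1(i)\times U_2(i)$; and there exists $i_0\in S$ such that $\bar\pi_{i_0j}(u_1,u_2)>0$ for all $j\ne i_0$ and all $(u_1,u_2)\in U_1(i_0)\times U_2(i_0)$. Let $(\underline v_1^*,\underline v_2^* )\in\mathcal S_1\times\mathcal S_2$ be a Nash equilibrium, i.e. $\rho_1^{v_1,\underline v_2^*}\ge\rho_1^{\underline v_1^*,\underline v_2^*}$ for all $v_1\in\mathcal A_1$ and $\rho_2^{\underline v_1^*,v_2}\ge\rho_2^{\underline v_1^*,\underline v_2^*}$ for all $v_2\in\mathcal A_2$ (for every initial state). Let $(\rho_1,\psi_1)$ be the minimal eigenpair of player 1's HJB equation for the fixed strategy $\underline v_2^*$, and $(\rho_2,\psi_2)$ the minimal eigenpair of player 2's HJB equation for the fixed strategy $\underline v_1^*$ (both defined in the context). Then $\underline v_1^*$ and $\underline v_2^*$ are minimizing selectors of these equations: for every $i\in S$, $$\sum_{j\in S}\psi_1(j)\pi_{ij}(\underline v_1^*(i),\underline v_2^*(i))+c_1(i,\underline v_1^*(i),\underline v_2^*(i))\psi_1(i)=\inf_{v_1\in V_1(i)}\Big[\sum_{j\in S}\psi_1(j)\pi_{ij}(v_1,\underline v_2^*(i))+c_1(i,v_1,\underline v_2^*(i))\psi_1(i)\Big]$$ and $$\sum_{j\in S}\psi_2(j)\pi_{ij}(\underline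 v_1^*(i),\underline v_2^*(i))+c_2(i,\underline v_1^*(i),\underline v_2^*(i))\psi_2(i)=\inf_{v_2\in V_2(i)}\Big[\sum_{j\in S}\psi_2(j)\pi_{ij}(\underline v_1^*(i),v_2)+c_2(i,\underline v_1^*(i),v_2)\psi_2(i)\Big].$$
   Context: Game model. The state space is $S=\{1,2,\dots\}$ with the discrete topology. $U_1,U_2$ are Borel spaces (action sets of players 1 and 2). For each $i\in S$ and $k=1,2$, $U_k(i)\subset U_k$ is a nonempty compact set of admissible actions. $K=\{(i,u_1,u_2): i\in S,\ u_1\in U_1(i),\ u_2\in U_2(i)\}$. The transition rates $\bar\pi_{ij}(u_1,u_2)$, $(u_1,u_2)\in U_1(i)\times U_2(i)$, satisfy $\bar\pi_{ij}(u_1,u_2)\ge 0$ for $i\ne j$, are conservative ($\sum_{j\in S}\bar\pi_{ij}(u_1,u_2)=0$), and $\bar\pi_i:=\sup_{(u_1,u_2)\in U_1(i)\times U_2(i)}[-\bar\pi_{ii}(u_1,u_2)]<\infty$ for each $i$. The cost rates $\bar c_k:K\to\mathbb R_+$, $k=1,2$, are measurable; $\|\cdot\|_\infty$ is the sup norm. Relaxed actions. $V_k(i)=\mathcal P(U_k(i))$ is the space of probability measures on $U_k(i)$ with the Prohorov topology. For $v_1\in V_1(i)$, $v_2\in V_2(i)$, $\pi_{ij}(v_1,v_2)=\int\int\bar\pi_{ij}(u_1,u_2)v_1(du_1)v_2(du_2)$ and $c_k(i,v_1,v_2)=\int\int\bar c_k(i,u_1,u_2)v_1(du_1)v_2(du_2)$.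 State process. On the canonical space $\Omega$ of sequences $(i_0,\theta_1,i_1,\theta_2,i_2,\dots)$ of states in $S$ and sojourn times in $(0,\infty)$ (with finitely many jumps also allowed, the remaining entries then being $\infty$ and a cemetery point $\Delta\notin S$), put $T_0=0$, $T_n=T_{n-1}+\theta_n$, $T_\infty=\lim_n T_n$, $Y(t)=i_m$ for $T_m\le t<T_{m+1}$ and $Y(t)=\Delta$ for $t\ge T_\infty$. At $\Delta$ all rates and costs are zero and the only action of player $k$ is an added isolated point $u_k^\Delta$; $U_k^\Delta=U_k\cup\{u_k^\Delta\}$. $\{\mathscr F_t\}$ is the filtration generated by the jump times and post-jump states. Strategies. An admissible strategy for player $k$ is a transition probability $v_k(du_k|\omega,t)$ from $\Omega\times[0,\infty)$ with the $\{\mathscr F_t\}$-predictable $\sigma$-algebra to $U_k^\Delta$ with $v_k(U_k(Y(t-)(\omega))|\omega,t)=1$; $v_k(t)$ denotes the random measure $v_k(\cdot|\omega,t)$, and $\mathcal A_k$ the set of all admissible strategies. A stationary Markov strategy is one of the form $v_k(\cdot|\omega,t)=v_k(Y(t-)(\omega))$, identified with a map $v_k$ on $S$ with $v_k(i)\in V_k(i)$ for all $i$; $\mathcal S_k$ is the set of these. For $(v_1,v_2)\in\mathcal A_1\times\mathcal A_2$ and $i\in S$, $P_i^{v_1,v_2}$ is the unique probability measure on $\Omega$ under which $Y(0)=i$ and, given the past, $Y$ jumps from $Y(t-)$ to $j\neq Y(t-)$ at rate $\pi_{Y(t-)j}(v_1(t),v_2(t))$ (it exists and is unique under (A)); $E_i^{v_1,v_2}$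 is its expectation. Irreducibility under $(v_1,v_2)\in\mathcal S_1\times\mathcal S_2$ is that of the chain with rates $\pi_{ij}(v_1(i),v_2(i))$. Cost. The risk-sensitive ergodic cost of player $k$ is $\rho_k^{v_1,v_2}(i)=\limsup_{T\to\infty}\frac1T\ln E_i^{v_1,v_2}\big[e^{\int_0^Tc_k(Y(t),v_1(t),v_2(t))dt}\big]$. A function $f:S\to\mathbb R$ is norm-like if $\{i: f(i)\le r\}$ is finite for every $r\in\mathbb R$. $I_{\mathscr K}$ is the indicator function of $\mathscr K$. HJB equations. $L^\infty_W=\{u:S\to\mathbb R:\ \sup_{i}|u(i)|/W(i)<\infty\}$. For $\hat v_2\in\mathcal S_2$, player 1's HJB equation is $\rho\,\psi(i)=\inf_{v_1\in V_1(i)}[\sum_{j\in S}\psi(j)\pi_{ij}(v_1,\hat v_2(i))+c_1(i,v_1,\hat v_2(i))\psi(i)]$ for all $i\in S$, with $\psi(i_0)=1$. An eigenpair is a solution $(\rho,\psi)\in\mathbb R_+\times L^\infty_W$ with $\psi>0$; the minimal eigenpair is the one with the smallest $\rho$ among eigenpairs; under the assumptions its value satisfies $\rho=\inf_{v_1\in\mathcal A_1}\rho_1^{v_1,\hat v_2}(i)$ for every $i$. For $\hat v_1\in\mathcal S_1$, player 2's HJB equation is $\rho\,\psi(i)=\inf_{v_2\in V_2(i)}[\sum_{j\in S}\psi(j)\pi_{ij}(\hat v_1(i),v_2)+c_2(i,\hat v_1(i),v_2)\psi(i)]$ for all $i\in S$, with $\psi(i_0)=1$, and its minimal eigenpair is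 defined in the same way. *)

theory Defs
  imports "HOL-Probability.Probability"
begin

text \<open>
  The state space is \<open>states\<close> = {1, 2, ...} inside \<^typ>\<open>nat\<close>, and the number 0 serves as the
  cemetery point. Functions on the state space are functions on \<^typ>\<open>nat\<close> whose value at 0 is
  irrelevant. The Borel space of actions of a player is a Borel subset \<open>U\<close> of a Polish space, and
  \<open>A i\<close> is the set of admissible actions in state \<open>i\<close>.
\<close>

definition states :: "nat set"
  where "states = {1..}"

definition cemetery :: nat
  where "cemetery = 0"

definition norm_like :: "(nat \<Rightarrow> real) \<Rightarrow> bool"
  where "norm_like f \<longleftrightarrow> (\<forall>r. finite {i \<in> states. f i \<le> r})"

definition K_graph :: "(nat \<Rightarrow> 'a set) \<Rightarrow> (nat \<Rightarrow> 'b set) \<Rightarrow> (nat \<times> 'a \<times> 'b) set"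
  where "K_graph A1 A2 = {(i, u1, u2). i \<in> states \<and> u1 \<in> A1 i \<and> u2 \<in> A2 i}"

definition max_rate :: "(nat \<Rightarrow> 'a set) \<Rightarrow> (nat \<Rightarrow> 'b set) \<Rightarrow>
    (nat \<Rightarrow> nat \<Rightarrow> 'a \<Rightarrow> 'b \<Rightarrow> real) \<Rightarrow> nat \<Rightarrow> real"
  where "max_rate A1 A2 q i = (SUP (u1, u2) \<in> A1 i \<times> A2 i. - q i i u1 u2)"

definition sup_norm :: "(nat \<Rightarrow> 'a set) \<Rightarrow> (nat \<Rightarrow> 'b set) \<Rightarrow> (nat \<Rightarrow> 'a \<Rightarrow> 'b \<Rightarrow> real) \<Rightarrow> real"
  where "sup_norm A1 A2 c = (SUP (i, u1, u2) \<in> K_graph A1 A2. \<bar>c i u1 u2\<bar>)"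

definition bounded_cost :: "(nat \<Rightarrow> 'a set) \<Rightarrow> (nat \<Rightarrow> 'b set) \<Rightarrow> (nat \<Rightarrow> 'a \<Rightarrow> 'b \<Rightarrow> real) \<Rightarrow> bool"
  where "bounded_cost A1 A2 c \<longleftrightarrow> bounded ((\<lambda>(i, u1, u2). c i u1 u2) ` K_graph A1 A2)"

locale nonzero_sum_game =
  fixes U1 :: "'a::polish_space set" and U2 :: "'b::polish_space set"
    and A1 :: "nat \<Rightarrow> 'a set" and A2 :: "nat \<Rightarrow> 'b set"
    and q :: "nat \<Rightarrow> nat \<Rightarrow> 'a \<Rightarrow> 'b \<Rightarrow> real"
    and c1 c2 :: "nat \<Rightarrow> 'a \<Rightarrow> 'b \<Rightarrow> real"
  assumes borel_U1: "U1 \<in> sets borel"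
    and borel_U2: "U2 \<in> sets borel"
    and admissible1: "\<And>i. i \<in> states \<Longrightarrow> A1 i \<subseteq> U1 \<and> A1 i \<noteq> {} \<and> compact (A1 i)"
    and admissible2: "\<And>i. i \<in> states \<Longrightarrow> A2 i \<subseteq> U2 \<and> A2 i \<noteq> {} \<and> compact (A2 i)"
    and rate_nonneg: "\<And>i j u1 u2. (i, u1, u2) \<in> K_graph A1 A2 \<Longrightarrow> j \<in> states \<Longrightarrow> i \<noteq> j \<Longrightarrow>
      q i j u1 u2 \<ge> 0"
    and conservative: "\<And>i u1 u2. (i, u1, u2) \<in> K_graph A1 A2 \<Longrightarrow>
      ((\<lambda>j. q i j u1 u2) has_sum 0) states"
    and stable: "\<And>i. i \<in> states \<Longrightarrow> bdd_above ((\<lambda>(u1, u2). - q i i u1 u2) ` (A1 i \<times> A2 i))"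
    and cost_nonneg: "\<And>i u1 u2. (i, u1, u2) \<in> K_graph A1 A2 \<Longrightarrow>
      c1 i u1 u2 \<ge> 0 \<and> c2 i u1 u2 \<ge> 0"
    and cost1_measurable: "(\<lambda>(i, u1, u2). c1 i u1 u2) \<in> borel_measurable
      (restrict_space (count_space UNIV \<Otimes>\<^sub>M borel \<Otimes>\<^sub>M borel) (K_graph A1 A2))"
    and cost2_measurable: "(\<lambda>(i, u1, u2). c2 i u1 u2) \<in> borel_measurable
      (restrict_space (count_space UNIV \<Otimes>\<^sub>M borel \<Otimes>\<^sub>M borel) (K_graph A1 A2))"

definition relaxed_actions :: "(nat \<Rightarrow> 'a::topological_space set) \<Rightarrow> nat \<Rightarrow> 'a measure set"
  where "relaxed_actions A i = space (prob_algebra (restrict_space borel (A i)))"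

definition relaxed :: "('a \<Rightarrow> 'b \<Rightarrow> real) \<Rightarrow> 'a measure \<Rightarrow> 'b measure \<Rightarrow> real"
  where "relaxed f v1 v2 = (\<integral>u2. (\<integral>u1. f u1 u2 \<partial>v1) \<partial>v2)"

definition stationary :: "(nat \<Rightarrow> 'a::topological_space set) \<Rightarrow> (nat \<Rightarrow> 'a measure) set"
  where "stationary A = {v. \<forall>i\<in>states. v i \<in> relaxed_actions A i}"

text \<open>The action space with the additional isolated point, which is encoded as \<open>None\<close>.\<close>

definition ext_actions :: "'a::topological_space set \<Rightarrow> 'a option measure"
  where "ext_actions U = sigma (insert None (Some ` U))
    (insert {None} {Some ` B | B. B \<in> sets borel \<and> B \<subseteq> U})"

definition ext_admissible :: "(nat \<Rightarrow> 'a set) \<Rightarrow> nat \<Rightarrow> 'a option set"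
  where "ext_admissible A x = (if x = cemetery then {None} else Some ` A x)"

text \<open>Extension of a rate or cost on \<open>K\<close> by zero, in particular to the cemetery point.\<close>

definition ext_zero :: "(nat \<Rightarrow> 'a set) \<Rightarrow> (nat \<Rightarrow> 'b set) \<Rightarrow> (nat \<Rightarrow> 'a \<Rightarrow> 'b \<Rightarrow> real) \<Rightarrow>
    nat \<Rightarrow> 'a option \<Rightarrow> 'b option \<Rightarrow> real"
  where "ext_zero A1 A2 f x a1 a2 =
    (case (a1, a2) of
       (Some u1, Some u2) \<Rightarrow> if (x, u1, u2) \<in> K_graph A1 A2 then f x u1 u2 else 0
     | _ \<Rightarrow> 0)"

text \<open>
  The sequence \<open>(i\<^sub>0, \<theta>\<^sub>1, i\<^sub>1, \<theta>\<^sub>2, \<dots>)\<close> is encoded as the function that maps \<open>n\<close> to the pair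
  of \<open>i\<^sub>n\<close> and \<open>\<theta>\<^sub>n\<^sub>+\<^sub>1\<close>.
\<close>

type_synonym path = "nat \<Rightarrow> nat \<times> ennreal"

definition post_jump :: "path \<Rightarrow> nat \<Rightarrow> nat"
  where "post_jump \<omega> n = fst (\<omega> n)"

definition sojourn :: "path \<Rightarrow> nat \<Rightarrow> ennreal"
  where "sojourn \<omega> n = snd (\<omega> n)"

definition paths :: "path set"
  where "paths = {\<omega>. post_jump \<omega> 0 \<in> states \<and>
    (\<forall>n. (0 < sojourn \<omega> n \<and> sojourn \<omega> n < \<infinity> \<and> post_jump \<omega> (Suc n) \<in> states) \<or>
         (sojourn \<omega> n = \<infinity> \<and> post_jump \<omega> (Suc n) = cemetery \<and> sojourn \<omega> (Suc n) = \<infinity>))}"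

definition path_space :: "path measure"
  where "path_space =
    restrict_space (\<Pi>\<^sub>M n\<in>UNIV. count_space UNIV \<Otimes>\<^sub>M borel) paths"

definition jump_time :: "path \<Rightarrow> nat \<Rightarrow> ennreal"
  where "jump_time \<omega> n = (\<Sum>k<n. sojourn \<omega> k)"

definition Y :: "path \<Rightarrow> real \<Rightarrow> nat"
  where "Y \<omega> t =
    (if \<exists>m. jump_time \<omega> m \<le> ennreal t \<and> ennreal t < jump_time \<omega> (Suc m)
     then post_jump \<omega> (THE m. jump_time \<omega> m \<le> ennreal t \<and> ennreal t < jump_time \<omega> (Suc m))
     else cemetery)"

text \<open>
  The state just before time \<open>t\<close>. By convention it is \<open>Y(0)\<close> for \<open>t = 0\<close>, and the cemetery point
  from the explosion time on (the left limit at the explosion time need not exist).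
\<close>

definition Y_left :: "path \<Rightarrow> real \<Rightarrow> nat"
  where "Y_left \<omega> t =
    (if t = 0 then Y \<omega> 0
     else if \<exists>m. jump_time \<omega> m < ennreal t \<and> ennreal t \<le> jump_time \<omega> (Suc m)
     then post_jump \<omega> (THE m. jump_time \<omega> m < ennreal t \<and> ennreal t \<le> jump_time \<omega> (Suc m))
     else cemetery)"

definition history :: "real \<Rightarrow> path measure"
  where "history t = sigma paths
    {{\<omega> \<in> paths. jump_time \<omega> n \<le> ennreal s \<and> post_jump \<omega> n = j} | n s j. 0 \<le> s \<and> s \<le> t}"

definition predictable :: "(path \<times> real) measure"
  where "predictable = sigma (paths \<times> {0..})
    ({H \<times> {0} | H. H \<in> sets (history 0)} \<union>
     {H \<times> {s<..t} | H s t. 0 \<le> s \<and> s < t \<and> H \<in> sets (history s)})"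

definition strategies :: "'a::topological_space set \<Rightarrow> (nat \<Rightarrow> 'a set) \<Rightarrow>
    (path \<times> real \<Rightarrow> 'a option measure) set"
  where "strategies U A = {v. v \<in> predictable \<rightarrow>\<^sub>M prob_algebra (ext_actions U) \<and>
    (\<forall>\<omega>\<in>paths. \<forall>t\<ge>0. emeasure (v (\<omega>, t)) (ext_admissible A (Y_left \<omega> t)) = 1)}"

definition markov :: "'a::topological_space set \<Rightarrow> (nat \<Rightarrow> 'a measure) \<Rightarrow>
    path \<times> real \<Rightarrow> 'a option measure"
  where "markov U v = (\<lambda>(\<omega>, t).
    if Y_left \<omega> t = cemetery then return (ext_actions U) None
    else distr (v (Y_left \<omega> t)) (ext_actions U) Some)"

definition jump_rate :: "(nat \<Rightarrow> 'a set) \<Rightarrow> (nat \<Rightarrow> 'b set) \<Rightarrow>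
    (nat \<Rightarrow> nat \<Rightarrow> 'a \<Rightarrow> 'b \<Rightarrow> real) \<Rightarrow>
    (path \<times> real \<Rightarrow> 'a option measure) \<Rightarrow> (path \<times> real \<Rightarrow> 'b option measure) \<Rightarrow>
    path \<Rightarrow> real \<Rightarrow> nat \<Rightarrow> real"
  where "jump_rate A1 A2 q v1 v2 \<omega> t j =
    (if j = Y_left \<omega> t then 0
     else relaxed (ext_zero A1 A2 (\<lambda>i. q i j) (Y_left \<omega> t)) (v1 (\<omega>, t)) (v2 (\<omega>, t)))"

text \<open>
  That the process jumps to \<open>j\<close> at the given rate, given the past, is expressed by saying that the
  rate is the density of the compensator (dual predictable projection) of the random measure of
  jumps: the expected number of jumps to \<open>j\<close> at times picked out by a predictable set is the
  expected integral of the rate over that set.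
\<close>

definition is_law :: "(nat \<Rightarrow> 'a set) \<Rightarrow> (nat \<Rightarrow> 'b set) \<Rightarrow>
    (nat \<Rightarrow> nat \<Rightarrow> 'a \<Rightarrow> 'b \<Rightarrow> real) \<Rightarrow>
    (path \<times> real \<Rightarrow> 'a option measure) \<Rightarrow> (path \<times> real \<Rightarrow> 'b option measure) \<Rightarrow>
    nat \<Rightarrow> path measure \<Rightarrow> bool"
  where "is_law A1 A2 q v1 v2 i P \<longleftrightarrow>
    sets P = sets path_space \<and> prob_space P \<and>
    emeasure P {\<omega> \<in> paths. Y \<omega> 0 = i} = 1 \<and>
    (\<forall>j\<in>states. \<forall>D\<in>sets predictable.
      (\<integral>\<^sup>+\<omega>. (\<Sum>n. if jump_time \<omega> (Suc n) < \<infinity> \<and> post_jump \<omega> (Suc n) = j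
               then indicator D (\<omega>, enn2real (jump_time \<omega> (Suc n))) else 0) \<partial>P) =
      (\<integral>\<^sup>+\<omega>. (\<integral>\<^sup>+t\<in>{0<..}. indicator D (\<omega>, t) * ennreal (jump_rate A1 A2 q v1 v2 \<omega> t j) \<partial>lborel) \<partial>P))"

definition law :: "(nat \<Rightarrow> 'a set) \<Rightarrow> (nat \<Rightarrow> 'b set) \<Rightarrow>
    (nat \<Rightarrow> nat \<Rightarrow> 'a \<Rightarrow> 'b \<Rightarrow> real) \<Rightarrow>
    (path \<times> real \<Rightarrow> 'a option measure) \<Rightarrow> (path \<times> real \<Rightarrow> 'b option measure) \<Rightarrow>
    nat \<Rightarrow> path measure"
  where "law A1 A2 q v1 v2 i = (THE P. is_law A1 A2 q v1 v2 i P)"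

definition irreducible_under :: "'a::topological_space set \<Rightarrow> 'b::topological_space set \<Rightarrow>
    (nat \<Rightarrow> 'a set) \<Rightarrow> (nat \<Rightarrow> 'b set) \<Rightarrow> (nat \<Rightarrow> nat \<Rightarrow> 'a \<Rightarrow> 'b \<Rightarrow> real) \<Rightarrow>
    (nat \<Rightarrow> 'a measure) \<Rightarrow> (nat \<Rightarrow> 'b measure) \<Rightarrow> bool"
  where "irreducible_under U1 U2 A1 A2 q v1 v2 \<longleftrightarrow>
    (\<forall>i\<in>states. \<forall>j\<in>states. \<exists>t\<ge>0.
      emeasure (law A1 A2 q (markov U1 v1) (markov U2 v2) i) {\<omega> \<in> paths. Y \<omega> t = j} > 0)"

definition exp_ennreal :: "ennreal \<Rightarrow> ennreal"
  where "exp_ennreal x = (if x = \<infinity> then \<infinity> else ennreal (exp (enn2real x)))"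

definition ln_ennreal :: "ennreal \<Rightarrow> ereal"
  where "ln_ennreal x =
    (if x = \<infinity> then \<infinity> else if x = 0 then - \<infinity> else ereal (ln (enn2real x)))"

definition accumulated_cost :: "(nat \<Rightarrow> 'a set) \<Rightarrow> (nat \<Rightarrow> 'b set) \<Rightarrow> (nat \<Rightarrow> 'a \<Rightarrow> 'b \<Rightarrow> real) \<Rightarrow>
    (path \<times> real \<Rightarrow> 'a option measure) \<Rightarrow> (path \<times> real \<Rightarrow> 'b option measure) \<Rightarrow>
    real \<Rightarrow> path \<Rightarrow> ennreal"
  where "accumulated_cost A1 A2 c v1 v2 T \<omega> =
    (\<integral>\<^sup>+t\<in>{0..T}. ennreal (relaxed (ext_zero A1 A2 c (Y \<omega> t)) (v1 (\<omega>, t)) (v2 (\<omega>, t))) \<partial>lborel)"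

definition risk_cost :: "(nat \<Rightarrow> 'a set) \<Rightarrow> (nat \<Rightarrow> 'b set) \<Rightarrow>
    (nat \<Rightarrow> nat \<Rightarrow> 'a \<Rightarrow> 'b \<Rightarrow> real) \<Rightarrow> (nat \<Rightarrow> 'a \<Rightarrow> 'b \<Rightarrow> real) \<Rightarrow>
    (path \<times> real \<Rightarrow> 'a option measure) \<Rightarrow> (path \<times> real \<Rightarrow> 'b option measure) \<Rightarrow>
    nat \<Rightarrow> ereal"
  where "risk_cost A1 A2 q c v1 v2 i = Limsup at_top (\<lambda>T::real. ereal (1 / T) *
    ln_ennreal (\<integral>\<^sup>+\<omega>. exp_ennreal (accumulated_cost A1 A2 c v1 v2 T \<omega>)
      \<partial>(law A1 A2 q v1 v2 i)))"

definition nash_equilibrium :: "'a::topological_space set \<Rightarrow> 'b::topological_space set \<Rightarrow>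
    (nat \<Rightarrow> 'a set) \<Rightarrow> (nat \<Rightarrow> 'b set) \<Rightarrow> (nat \<Rightarrow> nat \<Rightarrow> 'a \<Rightarrow> 'b \<Rightarrow> real) \<Rightarrow>
    (nat \<Rightarrow> 'a \<Rightarrow> 'b \<Rightarrow> real) \<Rightarrow> (nat \<Rightarrow> 'a \<Rightarrow> 'b \<Rightarrow> real) \<Rightarrow>
    (nat \<Rightarrow> 'a measure) \<Rightarrow> (nat \<Rightarrow> 'b measure) \<Rightarrow> bool"
  where "nash_equilibrium U1 U2 A1 A2 q c1 c2 v1 v2 \<longleftrightarrow>
    (\<forall>w\<in>strategies U1 A1. \<forall>i\<in>states.
      risk_cost A1 A2 q c1 w (markov U2 v2) i \<ge>
      risk_cost A1 A2 q c1 (markov U1 v1) (markov U2 v2) i) \<and>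
    (\<forall>w\<in>strategies U2 A2. \<forall>i\<in>states.
      risk_cost A1 A2 q c2 (markov U1 v1) w i \<ge>
      risk_cost A1 A2 q c2 (markov U1 v1) (markov U2 v2) i)"

text \<open>
  Once the strategy of the opponent is fixed, a player faces a one-player problem, in which
  \<open>V i\<close> is the set of relaxed actions of the player in state \<open>i\<close>, \<open>p i j v\<close> is the transition
  rate and \<open>c i v\<close> the cost rate.
\<close>

definition hjb_term :: "(nat \<Rightarrow> nat \<Rightarrow> 'v \<Rightarrow> real) \<Rightarrow> (nat \<Rightarrow> 'v \<Rightarrow> real) \<Rightarrow> (nat \<Rightarrow> real) \<Rightarrow>
    nat \<Rightarrow> 'v \<Rightarrow> real"
  where "hjb_term p c \<psi> i v = (\<Sum>\<^sub>\<infinity>j\<in>states. \<psi> j * p i j v) + c i v * \<psi> i"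

definition weighted_bounded :: "(nat \<Rightarrow> real) \<Rightarrow> (nat \<Rightarrow> real) set"
  where "weighted_bounded W = {u. bdd_above ((\<lambda>i. \<bar>u i\<bar> / W i) ` states)}"

definition eigenpair :: "(nat \<Rightarrow> 'v set) \<Rightarrow> (nat \<Rightarrow> nat \<Rightarrow> 'v \<Rightarrow> real) \<Rightarrow> (nat \<Rightarrow> 'v \<Rightarrow> real) \<Rightarrow>
    (nat \<Rightarrow> real) \<Rightarrow> nat \<Rightarrow> real \<Rightarrow> (nat \<Rightarrow> real) \<Rightarrow> bool"
  where "eigenpair V p c W i\<^sub>0 \<rho> \<psi> \<longleftrightarrow>
    \<rho> \<ge> 0 \<and> \<psi> \<in> weighted_bounded W \<and> (\<forall>i\<in>states. \<psi> i > 0) \<and> \<psi> i\<^sub>0 = 1 \<and>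
    (\<forall>i\<in>states. \<rho> * \<psi> i = (INF v\<in>V i. hjb_term p c \<psi> i v))"

definition minimal_eigenpair :: "(nat \<Rightarrow> 'v set) \<Rightarrow> (nat \<Rightarrow> nat \<Rightarrow> 'v \<Rightarrow> real) \<Rightarrow>
    (nat \<Rightarrow> 'v \<Rightarrow> real) \<Rightarrow> (nat \<Rightarrow> real) \<Rightarrow> nat \<Rightarrow> real \<Rightarrow> (nat \<Rightarrow> real) \<Rightarrow> bool"
  where "minimal_eigenpair V p c W i\<^sub>0 \<rho> \<psi> \<longleftrightarrow> eigenpair V p c W i\<^sub>0 \<rho> \<psi> \<and>
    (\<forall>\<rho>' \<psi>'. eigenpair V p c W i\<^sub>0 \<rho>' \<psi>' \<longrightarrow> \<rho> \<le> \<rho>')"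

end

theory Submission
  imports Defs
begin

text \<open>
  Under stationary strategies the compensator determines the law of the process, which is therefore
  that of the Markov chain built from independent exponential sojourns. By the Feynman-Kac
  representation, a positive supersolution of the linear equation of a chain that is bounded below
  by 1 bounds the risk-sensitive cost by its eigenvalue \<open>\<mu>\<close>, and conversely the resolvent of the chain
  is a positive supersolution for every \<open>\<mu>\<close> above the cost. If \<open>\<phi>\<close> is a positive supersolution
  for \<open>\<mu>\<close> and some stationary strategy of the player, then \<open>W + M \<phi>\<close> is one for \<open>\<mu> + \<epsilon>\<close> when
  \<open>M\<close> is large, by the drift condition, and it is at least 1. Optimality in the class of
  stationary strategies hence says that every \<open>\<mu>\<close> that has a supersolution for some
  strategy is approached by eigenvalues that have one for the equilibrium strategy. The claim then
  becomes a purely deterministic statement about supersolutions: the least eigenvalue is attained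
  by the equilibrium strategy, and the eigenfunction of the minimal eigenpair is a multiple of the
  one attaining it.
\<close>

section \<open>Paths\<close>

text \<open>\<open>law\<close> is a definite description, so nothing can be said about costs before
  a probability with the prescribed compensator has been both built and shown unique; this is done
  for pairs of stationary strategies, since the deviations from the equilibrium that enter are all
  stationary. The probabilistic part delivers no eigenfunctions: from a cost below \<mu> the
  resolvent gives a positive function that need not be bounded by a multiple of \<open>W\<close>.
  Truncating it at such a multiple keeps it a supersolution, and the row of
  \<open>i\<^sub>0\<close>, where all rates are positive, makes the multiple uniform, so that the
  infimum of the eigenvalues is attained through infima of tails. Supersolutions are considered for
  all \<mu> above -\<delta> and not only for nonnegative ones: lowering an eigenvalue near 0 could
  leave the nonnegative range, and the contradiction then comes from \<open>0 \<le> \<mu>\<close>,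
  which nonnegative costs enforce. The value of the game is never identified with the eigenvalue of
  the given minimal eigenpair; minimality only serves to compare it with an eigenpair constructed
  for the equilibrium strategy.\<close>

definition dead_path :: path where "dead_path = (\<lambda>_. (cemetery, \<infinity>))"

text \<open>Prepending a state with its sojourn undoes the shift at the first jump; all recursions
  on the first jump are phrased through it.\<close>

definition path_cons :: "nat \<Rightarrow> ennreal \<Rightarrow> path \<Rightarrow> path"
  where "path_cons i \<theta> \<omega> = case_nat (i, \<theta>) \<omega>"

lemma jump_time_0 [simp]: "jump_time \<omega> 0 = 0"
  by (simp add: jump_time_def)

lemma jump_time_Suc: "jump_time \<omega> (Suc n) = jump_time \<omega> n + sojourn \<omega> n"
  by (simp add: jump_time_def)

lemma jump_time_mono: "m \<le> n \<Longrightarrow> jump_time \<omega> m \<le> jump_time \<omega> n"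
  unfolding jump_time_def by (rule sum_mono2) auto

lemma path_cons_simps [simp]:
  "post_jump (path_cons i \<theta> \<omega>) 0 = i" "post_jump (path_cons i \<theta> \<omega>) (Suc n) = post_jump \<omega> n"
  "sojourn (path_cons i \<theta> \<omega>) 0 = \<theta>" "sojourn (path_cons i \<theta> \<omega>) (Suc n) = sojourn \<omega> n"
  by (auto simp: path_cons_def post_jump_def sojourn_def)

lemma jump_time_path_cons [simp]:
  "jump_time (path_cons i \<theta> \<omega>) (Suc n) = \<theta> + jump_time \<omega> n"
  unfolding jump_time_def by (subst sum.lessThan_Suc_shift) simp

lemma dead_path_simps [simp]:
  "post_jump dead_path n = cemetery" "sojourn dead_path n = \<infinity>"
  by (auto simp: dead_path_def post_jump_def sojourn_def)

lemma sojourn_pos: "\<omega> \<in> paths \<Longrightarrow> 0 < sojourn \<omega> n"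
  unfolding paths_def by auto

lemma jump_time_finite_imp_states:
  assumes "\<omega> \<in> paths" "jump_time \<omega> n < \<infinity>"
  shows "post_jump \<omega> n \<in> states"
proof (cases n)
  case 0
  then show ?thesis using assms by (simp add: paths_def)
next
  case (Suc m)
  then have "sojourn \<omega> m < \<infinity>" using assms by (auto simp: jump_time_Suc)
  then show ?thesis using assms Suc by (auto simp: paths_def)
qed

lemma sojourn_infinite_later:
  assumes "\<omega> \<in> paths" "sojourn \<omega> m = \<infinity>"
  shows "sojourn \<omega> (m + k) = \<infinity> \<and> post_jump \<omega> (Suc (m + k)) = cemetery"
proof (induction k)
  case 0
  have "post_jump \<omega> (Suc m) = cemetery"
    using assms unfolding paths_def by (metis (mono_tags, lifting) less_irrefl mem_Collect_eq)
  then show ?case using assms(2) by simp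
next
  case (Suc k)
  have "sojourn \<omega> (Suc (m + k)) = \<infinity>" using Suc assms(1)
    unfolding paths_def by (metis (mono_tags, lifting) less_irrefl mem_Collect_eq)
  moreover from this have "post_jump \<omega> (Suc (Suc (m + k))) = cemetery"
    using assms(1) unfolding paths_def by (metis (mono_tags, lifting) less_irrefl mem_Collect_eq)
  ultimately show ?case by simp
qed

text \<open>A finite sum is infinite only through an infinite summand, that is, through absorption,
  which then persists. Explosion is different: there all jump times are finite and merely
  accumulate.\<close>

lemma jump_time_infinite_imp_cemetery:
  assumes "\<omega> \<in> paths" "jump_time \<omega> n = \<infinity>"
  shows "post_jump \<omega> n = cemetery" "sojourn \<omega> n = \<infinity>"
proof -
  have "\<exists>k<n. sojourn \<omega> k = \<infinity>"
  proof (rule ccontr)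
    assume "\<not> ?thesis"
    then have "\<And>k. k < n \<Longrightarrow> sojourn \<omega> k < \<infinity>" by (auto simp: less_top)
    then have "jump_time \<omega> n < \<infinity>" unfolding jump_time_def by (simp add: less_top)
    then show False using assms by simp
  qed
  then obtain k where k: "k < n" "sojourn \<omega> k = \<infinity>" by auto
  obtain d where d: "n = Suc (k + d)" using less_imp_Suc_add[OF k(1)] by auto
  from sojourn_infinite_later[OF assms(1) k(2), of d] sojourn_infinite_later[OF assms(1) k(2), of "Suc d"]
  show "post_jump \<omega> n = cemetery" "sojourn \<omega> n = \<infinity>" by (auto simp: d)
qed

lemma cemetery_notin_states [simp]: "cemetery \<notin> states"
  by (simp add: cemetery_def states_def)

lemma states_iff: "i \<in> states \<longleftrightarrow> i \<noteq> cemetery"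
  by (auto simp: cemetery_def states_def)

lemma post_jump_in_states_iff: "\<omega> \<in> paths \<Longrightarrow> post_jump \<omega> n \<in> states \<longleftrightarrow> jump_time \<omega> n < \<infinity>"
  by (metis jump_time_finite_imp_states jump_time_infinite_imp_cemetery(1) cemetery_notin_states
      infinity_ennreal_def less_top)

lemma jump_time_less_Suc:
  assumes "\<omega> \<in> paths" "jump_time \<omega> n < \<infinity>"
  shows "jump_time \<omega> n < jump_time \<omega> (Suc n)"
  using sojourn_pos[OF assms(1), of n] assms(2) unfolding jump_time_Suc
  by (metis add_0_right ennreal_add_left_cancel_less infinity_ennreal_def less_irrefl)

text \<open>The half-open intervals between consecutive jump times are disjoint because jump times
  are monotone, so the description inside \<open>Y\<close> has a unique witness.\<close>

lemma Y_eqI: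
  assumes "jump_time \<omega> m \<le> ennreal t" "ennreal t < jump_time \<omega> (Suc m)"
  shows "Y \<omega> t = post_jump \<omega> m"
proof -
  have "m' = m" if "jump_time \<omega> m' \<le> ennreal t" "ennreal t < jump_time \<omega> (Suc m')" for m'
  proof (rule ccontr)
    assume "m' \<noteq> m"
    then consider "Suc m' \<le> m" | "Suc m \<le> m'" by linarith
    then show False
      using assms that jump_time_mono[of "Suc m'" m \<omega>] jump_time_mono[of "Suc m" m' \<omega>]
      by cases (meson leD order.trans)+
  qed
  then have "(THE m. jump_time \<omega> m \<le> ennreal t \<and> ennreal t < jump_time \<omega> (Suc m)) = m"
    using assms by blast
  then show ?thesis unfolding Y_def using assms by auto
qed

lemma jump_interval_left_unique:
  assumes "jump_time \<omega> m < t" "t \<le> jump_time \<omega> (Suc m)"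
    and "jump_time \<omega> m' < t" "t \<le> jump_time \<omega> (Suc m')"
  shows "m' = m"
proof (rule ccontr)
  assume "m' \<noteq> m"
  then consider "Suc m' \<le> m" | "Suc m \<le> m'" by linarith
  then show False
    using assms jump_time_mono[of "Suc m'" m \<omega>] jump_time_mono[of "Suc m" m' \<omega>]
    by cases (meson leD order.trans)+
qed

lemma Y_left_eqI:
  assumes "0 < t" "jump_time \<omega> m < ennreal t" "ennreal t \<le> jump_time \<omega> (Suc m)"
  shows "Y_left \<omega> t = post_jump \<omega> m"
proof -
  have "m' = m" if "jump_time \<omega> m' < ennreal t" "ennreal t \<le> jump_time \<omega> (Suc m')" for m'
    using jump_interval_left_unique[OF assms(2,3) that] .
  then have "(THE m. jump_time \<omega> m < ennreal t \<and> ennreal t \<le> jump_time \<omega> (Suc m)) = m"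
    using assms by blast
  then show ?thesis unfolding Y_left_def using assms by auto
qed

lemma ex_jump_interval:
  assumes "t < jump_time \<omega> n"
  shows "\<exists>m. jump_time \<omega> m \<le> t \<and> t < jump_time \<omega> (Suc m)"
  using assms
proof (induction n)
  case (Suc n)
  then show ?case by (cases "t < jump_time \<omega> n") (auto simp: not_less)
qed simp

lemma ex_jump_interval_left:
  assumes "t \<le> jump_time \<omega> n" "0 < t"
  shows "\<exists>m. jump_time \<omega> m < t \<and> t \<le> jump_time \<omega> (Suc m)"
  using assms
proof (induction n)
  case (Suc n)
  then show ?case by (cases "t \<le> jump_time \<omega> n") (auto simp: not_le)
qed simp

lemma Y_cemetery_iff:
  assumes "\<omega> \<in> paths"
  shows "Y \<omega> t = cemetery \<longleftrightarrow> (\<forall>n. jump_time \<omega> n \<le> ennreal t)"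
proof
  assume *: "\<forall>n. jump_time \<omega> n \<le> ennreal t"
  then show "Y \<omega> t = cemetery" unfolding Y_def by (auto simp: not_less[symmetric])
next
  assume Y: "Y \<omega> t = cemetery"
  show "\<forall>n. jump_time \<omega> n \<le> ennreal t"
  proof (rule ccontr)
    assume "\<not> ?thesis"
    then obtain n where "ennreal t < jump_time \<omega> n" by (auto simp: not_le)
    then obtain m where m: "jump_time \<omega> m \<le> ennreal t" "ennreal t < jump_time \<omega> (Suc m)"
      using ex_jump_interval by blast
    then have "jump_time \<omega> m < \<infinity>" by (metis ennreal_less_top infinity_ennreal_def le_less_trans)
    with Y Y_eqI[OF m] jump_time_finite_imp_states[OF assms] show False by force
  qed
qed

lemma Y_0: "\<omega> \<in> paths \<Longrightarrow> Y \<omega> 0 = post_jump \<omega> 0"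
  by (intro Y_eqI) (auto simp: jump_time_Suc sojourn_pos)

lemma Y_left_cases:
  assumes "0 < t"
  obtains (alive) m where "jump_time \<omega> m < ennreal t" "ennreal t \<le> jump_time \<omega> (Suc m)" "Y_left \<omega> t = post_jump \<omega> m"
  | (exploded) "\<And>m. jump_time \<omega> m < ennreal t" "Y_left \<omega> t = cemetery"
proof (cases "\<exists>m. jump_time \<omega> m < ennreal t \<and> ennreal t \<le> jump_time \<omega> (Suc m)")
  case True
  then show ?thesis using Y_left_eqI[OF assms] alive by blast
next
  case False
  then have "\<And>m. jump_time \<omega> m < ennreal t"
    using ex_jump_interval_left[of "ennreal t" \<omega>] assms by (auto simp: not_le[symmetric])
  moreover have "Y_left \<omega> t = cemetery" unfolding Y_left_def using False assms by auto
  ultimately show ?thesis using exploded by blast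
qed

lemma Y_eq_Y_left:
  assumes "0 < t" "\<And>n. jump_time \<omega> n \<noteq> ennreal t"
  shows "Y \<omega> t = Y_left \<omega> t"
proof (cases \<omega> rule: Y_left_cases[OF assms(1)])
  case (1 m)
  then show ?thesis using Y_eqI[of \<omega> m t] assms(2)[of "Suc m"] by (simp add: order.strict_iff_order)
next
  case 2
  then have "\<not> ennreal t < jump_time \<omega> (Suc m)" for m by (meson order.asym)
  then show ?thesis unfolding Y_def using 2 by auto
qed

lemma countable_jump_times: "countable {t. 0 \<le> t \<and> (\<exists>n. jump_time \<omega> n = ennreal t)}"
proof -
  have "{t. 0 \<le> t \<and> (\<exists>n. jump_time \<omega> n = ennreal t)} \<subseteq> range (\<lambda>n. enn2real (jump_time \<omega> n))"
  proof clarify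
    fix t n assume "0 \<le> t" "jump_time \<omega> n = ennreal t"
    then have "t = enn2real (jump_time \<omega> n)" by (simp only: enn2real_ennreal)
    then show "t \<in> range (\<lambda>n. enn2real (jump_time \<omega> n))" by (metis rangeI)
  qed
  then show ?thesis by (rule countable_subset) simp
qed

text \<open>Costs are charged along \<open>Y\<close>, while strategies and jump rates look at
  \<open>Y_left\<close>. At positive times the two can differ only at jump times, which are
  countably many, so time integrals do not distinguish them.\<close>

lemma AE_Y_eq_Y_left: "AE t in lborel. 0 \<le> t \<longrightarrow> Y \<omega> t = Y_left \<omega> t"
proof (rule AE_I')
  let ?N = "insert 0 {t. 0 \<le> t \<and> (\<exists>n. jump_time \<omega> n = ennreal t)}"
  show "?N \<in> null_sets lborel"
    by (intro countable_imp_null_set_lborel countable_insert countable_jump_times)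
  show "{t \<in> space lborel. \<not> (0 \<le> t \<longrightarrow> Y \<omega> t = Y_left \<omega> t)} \<subseteq> ?N"
    using Y_eq_Y_left by (auto simp: less_le)
qed

lemma Y_path_cons:
  assumes "0 \<le> t" "0 < \<theta>"
  shows "Y (path_cons i \<theta> \<omega>) t = (if ennreal t < \<theta> then i else Y \<omega> (t - enn2real \<theta>))"
proof (cases "ennreal t < \<theta>")
  case True
  then show ?thesis using assms by (subst Y_eqI[of _ 0]) auto
next
  case False
  then obtain r where r: "\<theta> = ennreal r" "0 < r" "r \<le> t"
    using assms by (cases \<theta>) (auto simp: not_less)
  have eq: "ennreal t = ennreal r + ennreal (t - r)"
    using r by (simp add: ennreal_plus[symmetric] del: ennreal_plus)
  have le_iff: "ennreal r + x \<le> ennreal t \<longleftrightarrow> x \<le> ennreal (t - r)" for x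
    unfolding eq by (rule ennreal_add_left_cancel_le[THEN trans]) simp
  have less_iff: "ennreal t < ennreal r + x \<longleftrightarrow> ennreal (t - r) < x" for x
    unfolding eq by (rule ennreal_add_left_cancel_less[THEN trans]) simp
  have r': "enn2real \<theta> = r" using r by simp
  show ?thesis
  proof (cases "\<exists>m. jump_time \<omega> m \<le> ennreal (t - r) \<and> ennreal (t - r) < jump_time \<omega> (Suc m)")
    case True
    then obtain m where m: "jump_time \<omega> m \<le> ennreal (t - r)" "ennreal (t - r) < jump_time \<omega> (Suc m)"
      by blast
    have "Y (path_cons i \<theta> \<omega>) t = post_jump (path_cons i \<theta> \<omega>) (Suc m)"
      by (rule Y_eqI) (simp_all only: jump_time_path_cons r(1) le_iff less_iff m)
    then show ?thesis using False Y_eqI[OF m] by (simp only: r' path_cons_simps if_False)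
  next
    case no: False
    have "\<not> (jump_time (path_cons i \<theta> \<omega>) m \<le> ennreal t \<and> ennreal t < jump_time (path_cons i \<theta> \<omega>) (Suc m))" for m
    proof (cases m)
      case 0
      have "jump_time (path_cons i \<theta> \<omega>) (Suc m) = \<theta>"
        by (simp only: 0 jump_time_path_cons jump_time_0 add_0_right)
      then show ?thesis using False by metis
    next
      case (Suc k)
      have "\<not> (jump_time \<omega> k \<le> ennreal (t - r) \<and> ennreal (t - r) < jump_time \<omega> (Suc k))"
        using no by blast
      then show ?thesis by (simp only: Suc jump_time_path_cons r(1) le_iff less_iff) simp
    qed
    then have "Y (path_cons i \<theta> \<omega>) t = cemetery"
      unfolding Y_def by (subst if_not_P) blast+
    moreover have "Y \<omega> (t - r) = cemetery"
      using no unfolding Y_def by (subst if_not_P) blast+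
    ultimately show ?thesis using False by (simp only: r' if_False)
  qed
qed

lemma path_cons_in_paths:
  assumes "i \<in> states" "0 < \<theta>" "\<theta> < \<infinity>" "\<omega> \<in> paths"
  shows "path_cons i \<theta> \<omega> \<in> paths"
proof -
  have "(0 < sojourn (path_cons i \<theta> \<omega>) n \<and> sojourn (path_cons i \<theta> \<omega>) n < \<infinity> \<and>
      post_jump (path_cons i \<theta> \<omega>) (Suc n) \<in> states) \<or>
    (sojourn (path_cons i \<theta> \<omega>) n = \<infinity> \<and> post_jump (path_cons i \<theta> \<omega>) (Suc n) = cemetery \<and>
      sojourn (path_cons i \<theta> \<omega>) (Suc n) = \<infinity>)" for n
    using assms by (cases n) (auto simp: paths_def)
  moreover have "post_jump (path_cons i \<theta> \<omega>) 0 \<in> states"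
    using assms(1) by simp
  ultimately show ?thesis unfolding paths_def by blast
qed

section \<open>Measurability of states, sojourns and jump times\<close>

abbreviation raw_path_space :: "path measure"
  where "raw_path_space \<equiv> (\<Pi>\<^sub>M n\<in>UNIV. count_space UNIV \<Otimes>\<^sub>M borel)"

lemma space_path_space [simp]: "space path_space = paths"
  unfolding path_space_def by (auto simp: space_restrict_space space_PiM space_pair_measure)

lemma measurable_path_space_raw: "id \<in> path_space \<rightarrow>\<^sub>M raw_path_space"
  unfolding path_space_def by (simp add: id_def measurable_restrict_space1)

lemma measurable_into_path_space:
  assumes "\<And>n. (\<lambda>x. f x n) \<in> M \<rightarrow>\<^sub>M count_space UNIV \<Otimes>\<^sub>M borel" "\<And>x. x \<in> space M \<Longrightarrow> f x \<in> paths"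
  shows "f \<in> M \<rightarrow>\<^sub>M path_space"
  unfolding path_space_def
proof (rule measurable_restrict_space2)
  show "f \<in> space M \<rightarrow> paths" using assms(2) by auto
  have "(\<lambda>x. \<lambda>n\<in>UNIV. f x n) \<in> M \<rightarrow>\<^sub>M raw_path_space"
    by (rule measurable_restrict) (use assms(1) in auto)
  then show "f \<in> M \<rightarrow>\<^sub>M raw_path_space" unfolding restrict_UNIV .
qed

lemma measurable_path_component [measurable]: "(\<lambda>\<omega>. \<omega> n) \<in> path_space \<rightarrow>\<^sub>M count_space UNIV \<Otimes>\<^sub>M borel"
  using measurable_comp[OF measurable_path_space_raw measurable_component_singleton[of n UNIV]] by (simp add: comp_def)

lemma measurable_post_jump [measurable]: "(\<lambda>\<omega>. post_jump \<omega> n) \<in> path_space \<rightarrow>\<^sub>M count_space UNIV"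
  unfolding post_jump_def by measurable

lemma measurable_sojourn [measurable]: "(\<lambda>\<omega>. sojourn \<omega> n) \<in> borel_measurable path_space"
  unfolding sojourn_def by measurable

lemma measurable_jump_time [measurable]: "(\<lambda>\<omega>. jump_time \<omega> n) \<in> borel_measurable path_space"
  unfolding jump_time_def by measurable

text \<open>The value 1 for nonpositive \<open>r\<close> makes the map land in \<open>paths\<close>
  for every argument; it is only applied with \<open>0 < r\<close>.\<close>

lemma measurable_path_cons:
  assumes i: "i \<in> states"
  shows "(\<lambda>(r, \<omega>). path_cons i (ennreal (if 0 < r then r else 1)) \<omega>) \<in> borel \<Otimes>\<^sub>M path_space \<rightarrow>\<^sub>M path_space"
proof (rule measurable_into_path_space)
  fix x :: "real \<times> path" assume "x \<in> space (borel \<Otimes>\<^sub>M path_space)"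
  then show "(case x of (r, \<omega>) \<Rightarrow> path_cons i (ennreal (if 0 < r then r else 1)) \<omega>) \<in> paths"
    using i by (auto simp: space_pair_measure intro!: path_cons_in_paths)
next
  fix n
  show "(\<lambda>x. (case x of (r, \<omega>) \<Rightarrow> path_cons i (ennreal (if 0 < r then r else 1)) \<omega>) n)
      \<in> borel \<Otimes>\<^sub>M path_space \<rightarrow>\<^sub>M count_space UNIV \<Otimes>\<^sub>M borel"
    unfolding path_cons_def case_prod_beta by (cases n) simp_all
qed

lemma path_cons_dead_in_paths: "i \<in> states \<Longrightarrow> path_cons i \<infinity> dead_path \<in> paths"
proof -
  assume i: "i \<in> states"
  have "sojourn (path_cons i \<infinity> dead_path) n = \<infinity> \<and> post_jump (path_cons i \<infinity> dead_path) (Suc n) = cemetery" for n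
    by (cases n) auto
  then show ?thesis using i unfolding paths_def by simp
qed

section \<open>Construction of the chain\<close>

lemma nn_integral_exp_atLeast:
  assumes "0 < (l::real)"
  shows "(\<integral>\<^sup>+r. ennreal (exp (- l * r)) * indicator {s..} r \<partial>lborel) = ennreal (exp (- l * s) / l)"
proof -
  have "(\<integral>\<^sup>+r. ennreal (exp (- l * r)) * indicator {s..} r \<partial>lborel) = ennreal (0 - (- exp (- l * s) / l))"
  proof (rule nn_integral_FTC_atLeast)
    show "DERIV (\<lambda>r. - exp (- l * r) / l) x :> exp (- l * x)" for x
      using assms by (auto intro!: derivative_eq_intros)
    have "((\<lambda>r. exp (- (l * r))) \<longlongrightarrow> 0) at_top"
      using assms by (intro exp_at_bot[THEN filterlim_compose] filterlim_uminus_at_bot_at_top[THEN filterlim_compose] filterlim_tendsto_pos_mult_at_top[OF tendsto_const] filterlim_ident) auto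
    then have "((\<lambda>r. - exp (- (l * r)) / l) \<longlongrightarrow> - 0 / l) at_top"
      using assms by (intro tendsto_intros) auto
    then show "((\<lambda>r. - exp (- l * r) / l) \<longlongrightarrow> 0) at_top" by simp
  qed auto
  then show ?thesis by simp
qed

lemma nn_integral_exp_greaterThan:
  assumes "0 < (l::real)"
  shows "(\<integral>\<^sup>+r. ennreal (exp (- l * r)) * indicator {s<..} r \<partial>lborel) = ennreal (exp (- l * s) / l)"
  unfolding nn_integral_exp_atLeast[OF assms, symmetric]
  by (intro nn_integral_cong_AE eventually_mono[OF AE_lborel_singleton[of s]]) (auto simp: indicator_def)

text \<open>Transition rates without their diagonal, extended by zero to the cemetery. Row sums over
  all naturals are then the total jump rates, and no sum has to be restricted to
  \<open>states\<close>.\<close>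

locale jump_rates =
  fixes a :: "nat \<Rightarrow> nat \<Rightarrow> real"
  assumes rate_nonneg: "\<And>i j. 0 \<le> a i j"
    and rate_diagonal: "\<And>i. a i i = 0"
    and rate_from_cemetery: "\<And>j. a cemetery j = 0"
    and rate_to_cemetery: "\<And>i. a i cemetery = 0"
    and summable_rates: "\<And>i. summable (a i)"
begin

definition total_rate :: "nat \<Rightarrow> real"
  where "total_rate i = (\<Sum>j. a i j)"

lemma total_rate_nonneg: "0 \<le> total_rate i"
  unfolding total_rate_def by (intro suminf_nonneg summable_rates rate_nonneg)

lemma rate_le_total: "a i j \<le> total_rate i"
  unfolding total_rate_def using sum_le_suminf[OF summable_rates, of "{j}"] rate_nonneg by auto

lemma rate_zero: "total_rate i = 0 \<Longrightarrow> a i j = 0"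
  using rate_le_total[of i j] rate_nonneg[of i j] by simp

lemma total_rate_cemetery [simp]: "total_rate cemetery = 0"
  by (simp add: total_rate_def rate_from_cemetery)

lemma suminf_rates: "(\<Sum>j. ennreal (a i j)) = ennreal (total_rate i)"
  unfolding total_rate_def using rate_nonneg summable_rates by (rule suminf_ennreal2)

text \<open>Joint density of the first sojourn and its target: an exponential time of parameter
  \<open>total_rate i\<close> and, independently of it, the target \<open>j\<close> with probability
  \<open>a i j / total_rate i\<close>.\<close>

definition jump_density :: "nat \<Rightarrow> real \<times> nat \<Rightarrow> ennreal"
  where "jump_density i = (\<lambda>(r, j). ennreal (a i j) * (ennreal (exp (- total_rate i * r)) * indicator {0<..} r))"

lemma measurable_jump_density [measurable]:
  "jump_density i \<in> borel_measurable (lborel \<Otimes>\<^sub>M count_space UNIV)"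
  unfolding jump_density_def by measurable

text \<open>The point mass for an absorbing state is a dummy draw; \<open>clean\<close> turns it
  into an infinite sojourn.\<close>

definition first_jump :: "nat \<Rightarrow> (real \<times> nat) measure"
  where "first_jump i = (if total_rate i = 0 then return (lborel \<Otimes>\<^sub>M count_space UNIV) (1, 1)
    else density (lborel \<Otimes>\<^sub>M count_space UNIV) (jump_density i))"

lemma sets_first_jump [simp, measurable_cong]: "sets (first_jump i) = sets (lborel \<Otimes>\<^sub>M count_space UNIV)"
  by (simp add: first_jump_def)

lemma space_first_jump [simp]: "space (first_jump i) = UNIV"
  by (simp add: first_jump_def space_pair_measure)

lemma nn_integral_first_jump:
  assumes [measurable]: "f \<in> borel_measurable (lborel \<Otimes>\<^sub>M count_space UNIV)" and "total_rate i \<noteq> 0"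
  shows "(\<integral>\<^sup>+x. f x \<partial>first_jump i) =
    (\<Sum>j. ennreal (a i j) * (\<integral>\<^sup>+r\<in>{0<..}. ennreal (exp (- total_rate i * r)) * f (r, j) \<partial>lborel))"
proof -
  interpret pair_sigma_finite lborel "count_space (UNIV :: nat set)"
    by (intro pair_sigma_finite.intro sigma_finite_lborel sigma_finite_measure_count_space)
  have "(\<integral>\<^sup>+x. f x \<partial>first_jump i) = (\<integral>\<^sup>+x. jump_density i x * f x \<partial>(lborel \<Otimes>\<^sub>M count_space UNIV))"
    using assms(2) by (simp add: first_jump_def nn_integral_density)
  also have "\<dots> = (\<integral>\<^sup>+j. \<integral>\<^sup>+r. jump_density i (r, j) * f (r, j) \<partial>lborel \<partial>count_space UNIV)"
    by (rule nn_integral_snd[symmetric]) measurable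
  also have "\<dots> = (\<Sum>j. \<integral>\<^sup>+r. jump_density i (r, j) * f (r, j) \<partial>lborel)"
    by (rule nn_integral_count_space_nat)
  also have "\<dots> = (\<Sum>j. ennreal (a i j) * (\<integral>\<^sup>+r\<in>{0<..}. ennreal (exp (- total_rate i * r)) * f (r, j) \<partial>lborel))"
    by (intro suminf_cong) (simp add: jump_density_def nn_integral_cmult[symmetric] ac_simps)
  finally show ?thesis .
qed

lemma prob_space_first_jump: "prob_space (first_jump i)"
proof (cases "total_rate i = 0")
  case True
  then show ?thesis by (simp add: first_jump_def prob_space_return space_pair_measure)
next
  case False
  then have pos: "0 < total_rate i" using total_rate_nonneg[of i] by simp
  have "emeasure (first_jump i) (space (first_jump i)) = (\<integral>\<^sup>+x. 1 \<partial>first_jump i)" by simp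
  also have "\<dots> = (\<Sum>j. ennreal (a i j) * (\<integral>\<^sup>+r\<in>{0<..}. ennreal (exp (- total_rate i * r)) \<partial>lborel))"
    using False by (subst nn_integral_first_jump) auto
  also have "\<dots> = (\<Sum>j. ennreal (a i j)) * ennreal (1 / total_rate i)"
    using nn_integral_exp_greaterThan[OF pos, of 0] by (simp add: ennreal_suminf_multc)
  also have "\<dots> = 1"
    using pos by (simp add: suminf_rates ennreal_mult[symmetric])
  finally show ?thesis by (rule prob_spaceI)
qed

text \<open>
  Corrects the null event of a nonpositive sojourn or a jump to the cemetery, so that
  every path of the chain lies in \<^term>\<open>paths\<close>, and encodes absorption.
\<close>

definition clean :: "nat \<Rightarrow> real \<times> nat \<Rightarrow> ennreal \<times> nat"
  where "clean i = (\<lambda>(r, j). if total_rate i = 0 then (\<infinity>, cemetery)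
    else if 0 < r \<and> j \<in> states then (ennreal r, j) else (1, 1))"

lemma measurable_clean [measurable]: "clean i \<in> lborel \<Otimes>\<^sub>M count_space UNIV \<rightarrow>\<^sub>M borel \<Otimes>\<^sub>M count_space UNIV"
  unfolding clean_def by measurable

text \<open>
  At every step a potential jump is drawn for all states at once, which makes the draws
  identically distributed; the chain uses the draw for its current state.
\<close>

definition noise :: "(nat \<Rightarrow> real \<times> nat) measure"
  where "noise = (\<Pi>\<^sub>M i\<in>UNIV. first_jump i)"

lemma prob_space_noise: "prob_space noise"
  unfolding noise_def by (intro prob_space_PiM prob_space_first_jump)

lemma measurable_noise_component [measurable]: "(\<lambda>x. x i) \<in> noise \<rightarrow>\<^sub>M lborel \<Otimes>\<^sub>M count_space UNIV"
proof -
  have "(\<lambda>x. x i) \<in> noise \<rightarrow>\<^sub>M first_jump i" unfolding noise_def by measurable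
  then show ?thesis by (simp cong: measurable_cong_sets)
qed

text \<open>The recursion hands the tail of the stream to the chain restarted in the target of the
  first draw, so that prepending a draw to the stream acts on paths as
  \<open>path_cons\<close>.\<close>

primrec chain :: "nat \<Rightarrow> nat \<Rightarrow> (nat \<Rightarrow> real \<times> nat) stream \<Rightarrow> nat \<times> ennreal"
  where "chain 0 i s = (i, fst (clean i (shd s i)))"
  | "chain (Suc n) i s = chain n (snd (clean i (shd s i))) (stl s)"

lemma measurable_chain: "chain n i \<in> stream_space noise \<rightarrow>\<^sub>M count_space UNIV \<Otimes>\<^sub>M borel"
proof (induction n arbitrary: i)
  case 0
  show ?case unfolding chain.simps by measurable
next
  case (Suc n)
  show ?case unfolding chain.simps
    \<comment> \<open>The next start is random but takes countably many values, so the chains from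
      fixed starts can be glued along it.\<close>
    by (rule measurable_compose_countable[where g="\<lambda>s. snd (clean i (shd s i))"])
       (rule measurable_compose[OF measurable_stl Suc], measurable)
qed

definition chain_path :: "nat \<Rightarrow> (nat \<Rightarrow> real \<times> nat) stream \<Rightarrow> path"
  where "chain_path i s = (\<lambda>n. chain n i s)"

lemma chain_path_SCons:
  "chain_path i (x ## s) = path_cons i (fst (clean i (x i))) (chain_path (snd (clean i (x i))) s)"
  unfolding chain_path_def path_cons_def by (rule ext, case_tac n) auto

lemma chain_path_cemetery: "chain_path cemetery s = dead_path"
proof -
  have "chain n cemetery s = (cemetery, \<infinity>)" for n
    by (induction n arbitrary: s) (auto simp: clean_def case_prod_beta)
  then show ?thesis by (simp add: chain_path_def dead_path_def)
qed

text \<open>This holds for every stream and not just almost surely, because \<open>clean\<close>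
  removes nonpositive sojourns and targets outside \<open>states\<close>; after absorption the path
  continues as \<open>dead_path\<close>.\<close>

lemma chain_path_in_paths:
  assumes "i \<in> states"
  shows "chain_path i s \<in> paths"
proof -
  have "(0 < sojourn (chain_path i s) n \<and> sojourn (chain_path i s) n < \<infinity> \<and> post_jump (chain_path i s) (Suc n) \<in> states) \<or>
         (sojourn (chain_path i s) n = \<infinity> \<and> post_jump (chain_path i s) (Suc n) = cemetery \<and> sojourn (chain_path i s) (Suc n) = \<infinity>)"
    for n i s
  proof (induction n arbitrary: i s)
    case 0
    obtain x s' where s: "s = x ## s'" by (cases s)
    show ?case unfolding s chain_path_SCons
      by (auto simp: clean_def case_prod_beta chain_path_cemetery) (auto simp: chain_path_def post_jump_def states_def)
  next
    case (Suc n)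
    obtain x s' where s: "s = x ## s'" by (cases s)
    show ?case unfolding s chain_path_SCons path_cons_simps by (rule Suc)
  qed
  moreover have "post_jump (chain_path i s) 0 \<in> states" using assms by (simp add: chain_path_def post_jump_def)
  ultimately show ?thesis unfolding paths_def by blast
qed

lemma measurable_chain_path: "i \<in> states \<Longrightarrow> chain_path i \<in> stream_space noise \<rightarrow>\<^sub>M path_space"
  by (rule measurable_into_path_space) (auto simp: chain_path_def[abs_def] measurable_chain chain_path_in_paths[unfolded chain_path_def[abs_def]])

definition path_law :: "nat \<Rightarrow> path measure"
  where "path_law i = distr (stream_space noise) path_space (chain_path i)"

lemma sets_path_law [simp, measurable_cong]: "sets (path_law i) = sets path_space"
  by (simp add: path_law_def)

lemma space_path_law [simp]: "space (path_law i) = paths"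
  by (simp add: path_law_def)

lemma prob_space_path_law: "i \<in> states \<Longrightarrow> prob_space (path_law i)"
  unfolding path_law_def
  by (intro prob_space.prob_space_distr prob_space.prob_space_stream_space prob_space_noise measurable_chain_path)

lemma AE_path_law_start:
  assumes "i \<in> states"
  shows "AE \<omega> in path_law i. post_jump \<omega> 0 = i"
proof -
  have [measurable]: "chain_path i \<in> stream_space noise \<rightarrow>\<^sub>M path_space" using measurable_chain_path[OF assms] .
  show ?thesis unfolding path_law_def
  proof (subst AE_distr_iff)
    have "{\<omega> \<in> space path_space. post_jump \<omega> 0 = i} \<in> sets path_space" by measurable
    then show "{\<omega> \<in> space path_space. post_jump \<omega> 0 = i} \<in> sets path_space" .
  qed (auto simp: chain_path_def post_jump_def)
qed

text \<open>The Markov property at the first jump, from which the compensator and the renewal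
  equation are derived. The stream splits into its head, whose coordinate \<open>i\<close> has law
  \<open>first_jump i\<close>, and an independent tail that drives the chain from the target
  \<open>j\<close>.\<close>

lemma nn_integral_path_law:
  assumes i: "i \<in> states" and f: "f \<in> borel_measurable path_space"
  shows "(\<integral>\<^sup>+\<omega>. f \<omega> \<partial>path_law i) = (if total_rate i = 0 then f (path_cons i \<infinity> dead_path)
    else \<Sum>j. ennreal (a i j) * (\<integral>\<^sup>+r\<in>{0<..}. ennreal (exp (- total_rate i * r)) *
      (\<integral>\<^sup>+\<omega>. f (path_cons i (ennreal r) \<omega>) \<partial>path_law j) \<partial>lborel))"
proof -
  interpret noise: prob_space noise by (rule prob_space_noise)
  interpret S: prob_space "stream_space noise" by (rule noise.prob_space_stream_space)
  note [measurable] = measurable_chain_path[OF i] f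
  define h where "h = (\<lambda>y s. f (path_cons i (fst (clean i y)) (chain_path (snd (clean i y)) s)))"
  have h_meas: "(\<lambda>(y, s). h y s) \<in> borel_measurable ((lborel \<Otimes>\<^sub>M count_space UNIV) \<Otimes>\<^sub>M stream_space noise)"
    unfolding h_def case_prod_beta
  proof (rule measurable_compose[OF _ f], rule measurable_into_path_space)
    fix x :: "(real \<times> nat) \<times> (nat \<Rightarrow> real \<times> nat) stream"
    assume "x \<in> space ((lborel \<Otimes>\<^sub>M count_space UNIV) \<Otimes>\<^sub>M stream_space noise)"
    show "path_cons i (fst (clean i (fst x))) (chain_path (snd (clean i (fst x))) (snd x)) \<in> paths"
      using chain_path_in_paths[OF i, of "(\<lambda>_. fst x) ## snd x"] by (simp add: chain_path_SCons)
  next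
    fix n
    show "(\<lambda>x. path_cons i (fst (clean i (fst x))) (chain_path (snd (clean i (fst x))) (snd x)) n) \<in>
        (lborel \<Otimes>\<^sub>M count_space UNIV) \<Otimes>\<^sub>M stream_space noise \<rightarrow>\<^sub>M count_space UNIV \<Otimes>\<^sub>M borel"
    proof (cases n)
      case 0
      then show ?thesis by (simp add: path_cons_def)
    next
      case (Suc m)
      have "(\<lambda>x. chain m (snd (clean i (fst x))) (snd x)) \<in>
        (lborel \<Otimes>\<^sub>M count_space UNIV) \<Otimes>\<^sub>M stream_space noise \<rightarrow>\<^sub>M count_space UNIV \<Otimes>\<^sub>M borel"
        by (rule measurable_compose_countable[where g="\<lambda>x. snd (clean i (fst x))"])
          (rule measurable_compose[OF measurable_snd measurable_chain], measurable)
      then show ?thesis by (simp add: Suc path_cons_def chain_path_def)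
    qed
  qed
  have h_inner: "(\<lambda>y. \<integral>\<^sup>+s. h y s \<partial>stream_space noise) \<in> borel_measurable (lborel \<Otimes>\<^sub>M count_space UNIV)"
    by (rule S.borel_measurable_nn_integral) (use h_meas in auto)
  have "(\<integral>\<^sup>+\<omega>. f \<omega> \<partial>path_law i) = (\<integral>\<^sup>+s. f (chain_path i s) \<partial>stream_space noise)"
    unfolding path_law_def by (subst nn_integral_distr) auto
  also have "\<dots> = (\<integral>\<^sup>+x. \<integral>\<^sup>+s. f (chain_path i (x ## s)) \<partial>stream_space noise \<partial>noise)"
    by (rule noise.nn_integral_stream_space) measurable
  also have "\<dots> = (\<integral>\<^sup>+x. (\<integral>\<^sup>+s. h (x i) s \<partial>stream_space noise) \<partial>noise)"
    by (simp add: h_def chain_path_SCons)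
  also have "\<dots> = (\<integral>\<^sup>+y. (\<integral>\<^sup>+s. h y s \<partial>stream_space noise) \<partial>distr noise (first_jump i) (\<lambda>x. x i))"
    using h_inner by (subst nn_integral_distr) (auto cong: measurable_cong_sets)
  also have "distr noise (first_jump i) (\<lambda>x. x i) = first_jump i"
    unfolding noise_def by (rule distr_PiM_component) (auto intro: prob_space_first_jump)
  finally have eq: "(\<integral>\<^sup>+\<omega>. f \<omega> \<partial>path_law i) = (\<integral>\<^sup>+y. (\<integral>\<^sup>+s. h y s \<partial>stream_space noise) \<partial>first_jump i)" .
  show ?thesis
  proof (cases "total_rate i = 0")
    case True
    then have "h = (\<lambda>_ _. f (path_cons i \<infinity> dead_path))"
      by (simp add: h_def clean_def case_prod_beta chain_path_cemetery)
    then show ?thesis unfolding eq using True prob_space.emeasure_space_1[OF prob_space_first_jump] S.emeasure_space_1 by simp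
  next
    case False
    have inner: "(\<integral>\<^sup>+s. h (r, j) s \<partial>stream_space noise) = (\<integral>\<^sup>+\<omega>. f (path_cons i (ennreal r) \<omega>) \<partial>path_law j)"
      if "0 < r" "j \<in> states" for r j
    proof -
      have [measurable]: "chain_path j \<in> stream_space noise \<rightarrow>\<^sub>M path_space" using measurable_chain_path that by blast
      have [measurable]: "(\<lambda>\<omega>. f (path_cons i (ennreal r) \<omega>)) \<in> borel_measurable path_space"
        using measurable_compose[OF measurable_Pair1' measurable_path_cons[OF i], of r] that
        by (auto intro!: measurable_compose[OF _ f])
      show ?thesis unfolding path_law_def using that False
        by (subst nn_integral_distr) (auto simp: h_def clean_def)
    qed
    \<comment> \<open>Targets outside \<open>states\<close> have to be discarded through their zero
      rate: \<open>path_law cemetery\<close> carries no information, since \<open>dead_path\<close>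
      does not lie in \<open>paths\<close>.\<close>
    have "ennreal (a i j) * (\<integral>\<^sup>+r\<in>{0<..}. ennreal (exp (- total_rate i * r)) * (\<integral>\<^sup>+s. h (r, j) s \<partial>stream_space noise) \<partial>lborel) =
      ennreal (a i j) * (\<integral>\<^sup>+r\<in>{0<..}. ennreal (exp (- total_rate i * r)) * (\<integral>\<^sup>+\<omega>. f (path_cons i (ennreal r) \<omega>) \<partial>path_law j) \<partial>lborel)" for j
    proof (cases "j \<in> states")
      case True
      have "(\<integral>\<^sup>+r\<in>{0<..}. ennreal (exp (- total_rate i * r)) * (\<integral>\<^sup>+s. h (r, j) s \<partial>stream_space noise) \<partial>lborel) =
        (\<integral>\<^sup>+r\<in>{0<..}. ennreal (exp (- total_rate i * r)) * (\<integral>\<^sup>+\<omega>. f (path_cons i (ennreal r) \<omega>) \<partial>path_law j) \<partial>lborel)"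
        by (rule nn_integral_cong) (use inner[OF _ True] in \<open>simp split: split_indicator\<close>)
      then show ?thesis by simp
    next
      case False
      then have "a i j = 0" using rate_to_cemetery states_iff by blast
      then show ?thesis by simp
    qed
    then show ?thesis
      unfolding eq nn_integral_first_jump[OF h_inner False] if_not_P[OF False] by (intro suminf_cong)
  qed
qed

end

section \<open>The compensator of the chain\<close>

text \<open>A predictable set up to the time of jump \<open>n + 1\<close> depends only on the first \<open>n\<close> jumps.\<close>

definition stop_path :: "nat \<Rightarrow> path \<Rightarrow> path"
  where "stop_path n \<omega> k = (if k < n then \<omega> k else if k = n then (post_jump \<omega> n, \<infinity>) else (cemetery, \<infinity>))"

lemma stop_path_simps:
  "k \<le> n \<Longrightarrow> post_jump (stop_path n \<omega>) k = post_jump \<omega> k"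
  "n < k \<Longrightarrow> post_jump (stop_path n \<omega>) k = cemetery"
  "k < n \<Longrightarrow> sojourn (stop_path n \<omega>) k = sojourn \<omega> k"
  "n \<le> k \<Longrightarrow> sojourn (stop_path n \<omega>) k = \<infinity>"
  by (auto simp: stop_path_def post_jump_def sojourn_def)

lemma stop_path_0: "stop_path 0 \<omega> = path_cons (post_jump \<omega> 0) \<infinity> dead_path"
  by (auto simp: stop_path_def path_cons_def dead_path_def post_jump_def fun_eq_iff split: nat.split)

lemma stop_path_Suc: "stop_path (Suc n) (path_cons i \<theta> \<omega>) = path_cons i \<theta> (stop_path n \<omega>)"
  by (auto simp: stop_path_def path_cons_def post_jump_def fun_eq_iff split: nat.split)

lemma jump_time_stop_path: "k \<le> n \<Longrightarrow> jump_time (stop_path n \<omega>) k = jump_time \<omega> k"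
  unfolding jump_time_def by (intro sum.cong) (auto simp: stop_path_simps)

lemma jump_time_stop_path_infinite:
  assumes "n < k" shows "jump_time (stop_path n \<omega>) k = \<infinity>"
proof -
  have "jump_time (stop_path n \<omega>) (Suc n) = \<infinity>" by (simp add: jump_time_Suc stop_path_simps)
  then show ?thesis using jump_time_mono[of "Suc n" k "stop_path n \<omega>"] assms by (auto simp: top_unique)
qed

lemma stop_path_in_paths:
  assumes "\<omega> \<in> paths" shows "stop_path n \<omega> \<in> paths"
  unfolding paths_def mem_Collect_eq
proof (intro conjI allI)
  show "post_jump (stop_path n \<omega>) 0 \<in> states"
    using assms by (simp add: stop_path_simps paths_def)
  fix k
  have *: "(0 < sojourn \<omega> k \<and> sojourn \<omega> k < \<infinity> \<and> post_jump \<omega> (Suc k) \<in> states) \<or>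
         (sojourn \<omega> k = \<infinity> \<and> post_jump \<omega> (Suc k) = cemetery \<and> sojourn \<omega> (Suc k) = \<infinity>)"
    using assms unfolding paths_def by blast
  consider "Suc k < n" | "Suc k = n" | "n \<le> k" by linarith
  then show "(0 < sojourn (stop_path n \<omega>) k \<and> sojourn (stop_path n \<omega>) k < \<infinity> \<and> post_jump (stop_path n \<omega>) (Suc k) \<in> states) \<or>
         (sojourn (stop_path n \<omega>) k = \<infinity> \<and> post_jump (stop_path n \<omega>) (Suc k) = cemetery \<and> sojourn (stop_path n \<omega>) (Suc k) = \<infinity>)"
    using * by cases (auto simp: stop_path_simps)
qed

lemma measurable_stop_path [measurable]: "stop_path n \<in> path_space \<rightarrow>\<^sub>M path_space"
proof (rule measurable_into_path_space)
  show "(\<lambda>\<omega>. stop_path n \<omega> k) \<in> path_space \<rightarrow>\<^sub>M count_space UNIV \<Otimes>\<^sub>M borel" for k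
    unfolding stop_path_def by (cases "k < n"; cases "k = n"; simp)
qed (auto intro: stop_path_in_paths)

section \<open>Histories, predictable sets and their dependence on the stopped path\<close>

lemma sets_history: "sets (history t) = sigma_sets paths
    {{\<omega> \<in> paths. jump_time \<omega> n \<le> ennreal s \<and> post_jump \<omega> n = j} | n s j. 0 \<le> s \<and> s \<le> t}"
  unfolding history_def by (rule sets_measure_of) auto

lemma space_history [simp]: "space (history t) = paths"
  unfolding history_def by (rule space_measure_of) auto

lemma sets_history_subset: "sets (history t) \<subseteq> sets path_space"
  unfolding sets_history
proof (rule sets.sigma_sets_subset[of _ path_space, unfolded space_path_space], safe)
  fix n s j
  have "{\<omega> \<in> space path_space. jump_time \<omega> n \<le> ennreal s \<and> post_jump \<omega> n = j} \<in> sets path_space" by measurable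
  then show "{\<omega> \<in> paths. jump_time \<omega> n \<le> ennreal s \<and> post_jump \<omega> n = j} \<in> sets path_space" by simp
qed

text \<open>Generators of \<open>history s\<close> speak about jumps up to time \<open>s\<close>.
  Jumps up to index \<open>n\<close> are kept by stopping, and a later one happens after
  \<open>s\<close> on the original path and never on the stopped one.\<close>

lemma history_stop_path:
  assumes H: "H \<in> sets (history s)" and \<omega>: "\<omega> \<in> paths" and s: "ennreal s < jump_time \<omega> (Suc n)"
  shows "stop_path n \<omega> \<in> H \<longleftrightarrow> \<omega> \<in> H"
  using H unfolding sets_history
proof (induction rule: sigma_sets.induct)
  case (Basic A)
  then obtain m u j where A: "A = {\<omega> \<in> paths. jump_time \<omega> m \<le> ennreal u \<and> post_jump \<omega> m = j}" "0 \<le> u" "u \<le> s"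
    by blast
  show ?case
  proof (cases "m \<le> n")
    case True
    then show ?thesis using \<omega> stop_path_in_paths by (auto simp: A jump_time_stop_path stop_path_simps)
  next
    case False
    then have "ennreal s < jump_time \<omega> m"
      using jump_time_mono[of "Suc n" m \<omega>] s by simp
    then have "ennreal u < jump_time \<omega> m"
      using A(2,3) by (metis ennreal_leI le_less_trans)
    then show ?thesis using False by (auto simp: A jump_time_stop_path_infinite top_unique)
  qed
qed (use \<omega> stop_path_in_paths in auto)

definition predictable_generator :: "(path \<times> real) set set"
  where "predictable_generator = {H \<times> {0} | H. H \<in> sets (history 0)} \<union>
     {H \<times> {s<..t} | H s t. 0 \<le> s \<and> s < t \<and> H \<in> sets (history s)}"

lemma predictable_generator_subset: "predictable_generator \<subseteq> Pow (paths \<times> {0..})"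
  using sets.sets_into_space[of _ "history _"] by (fastforce simp: predictable_generator_def)

lemma sets_predictable: "sets predictable = sigma_sets (paths \<times> {0..}) predictable_generator"
  unfolding predictable_def predictable_generator_def[symmetric]
  by (rule sets_measure_of[OF predictable_generator_subset])

lemma space_predictable [simp]: "space predictable = paths \<times> {0..}"
  unfolding predictable_def predictable_generator_def[symmetric]
  by (rule space_measure_of[OF predictable_generator_subset])

text \<open>The generating intervals are open on the left: \<open>s < t\<close> puts
  \<open>s\<close> strictly before jump \<open>n + 1\<close> even if \<open>t\<close> equals that
  jump time, so the history at \<open>s\<close> does not see the jump.\<close>

lemma predictable_stop_path:
  assumes D: "D \<in> sets predictable" and \<omega>: "\<omega> \<in> paths" and t: "0 < t" "ennreal t \<le> jump_time \<omega> (Suc n)"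
  shows "(stop_path n \<omega>, t) \<in> D \<longleftrightarrow> (\<omega>, t) \<in> D"
  using D unfolding sets_predictable
proof (induction rule: sigma_sets.induct)
  case (Basic A)
  then consider H where "A = H \<times> {0}"
    | H s u where "A = H \<times> {s<..u}" "0 \<le> s" "s < u" "H \<in> sets (history s)"
    unfolding predictable_generator_def by blast
  then show ?case
  proof cases
    case 1
    then show ?thesis using t by auto
  next
    case 2
    show ?thesis
    proof (cases "s < t")
      case True
      then have "ennreal s < jump_time \<omega> (Suc n)"
        using t(2) 2(2) by (metis ennreal_less_iff less_le_trans)
      then show ?thesis using history_stop_path[OF 2(4) \<omega>] 2(1) by auto
    qed (use 2 in auto)
  qed
qed (use \<omega> t stop_path_in_paths in auto)

lemma sets_predictable_subset: "sets predictable \<subseteq> sets (path_space \<Otimes>\<^sub>M borel)"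
proof
  fix D assume "D \<in> sets predictable"
  then show "D \<in> sets (path_space \<Otimes>\<^sub>M borel)"
    unfolding sets_predictable
  proof (induction rule: sigma_sets.induct)
    case (Basic A)
    then show ?case
      unfolding predictable_generator_def using sets_history_subset by (auto intro!: pair_measureI)
  next
    case (Compl A)
    have "paths \<times> {0::real..} \<in> sets (path_space \<Otimes>\<^sub>M borel)"
      using sets.top[of path_space] by (intro pair_measureI) auto
    then show ?case using Compl by auto
  qed auto
qed

context jump_rates
begin

text \<open>Fubini: integrating the density \<open>q * exp (- q * r)\<close> over
  \<open>r \<ge> x\<close> leaves the probability \<open>exp (- q * x)\<close> that the sojourn
  lasts until \<open>x\<close>.\<close>

lemma nn_integral_exp_tail:
  assumes [measurable]: "g \<in> borel_measurable borel" and q: "0 < (q::real)"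
  shows "ennreal q * (\<integral>\<^sup>+r\<in>{0<..}. ennreal (exp (- q * r)) * (\<integral>\<^sup>+x\<in>{0<..}. g x * indicator {..r} x \<partial>lborel) \<partial>lborel) =
    (\<integral>\<^sup>+x\<in>{0<..}. ennreal (exp (- q * x)) * g x \<partial>lborel)"
proof -
  have "(\<integral>\<^sup>+r\<in>{0<..}. ennreal (exp (- q * r)) * (\<integral>\<^sup>+x\<in>{0<..}. g x * indicator {..r} x \<partial>lborel) \<partial>lborel) =
    (\<integral>\<^sup>+r. \<integral>\<^sup>+x. (ennreal (exp (- q * r)) * indicator {x..} r) * (g x * indicator {0<..} x) \<partial>lborel \<partial>lborel)"
  proof (rule nn_integral_cong)
    fix r
    have "ennreal (exp (- q * r)) * (\<integral>\<^sup>+x\<in>{0<..}. g x * indicator {..r} x \<partial>lborel) * indicator {0<..} r =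
      (\<integral>\<^sup>+x. (ennreal (exp (- q * r)) * (g x * indicator {..r} x * indicator {0<..} x)) * indicator {0<..} r \<partial>lborel)"
      by (simp add: nn_integral_cmult nn_integral_multc)
    also have "\<dots> = (\<integral>\<^sup>+x. (ennreal (exp (- q * r)) * indicator {x..} r) * (g x * indicator {0<..} x) \<partial>lborel)"
      by (rule nn_integral_cong) (auto split: split_indicator)
    finally show "ennreal (exp (- q * r)) * (\<integral>\<^sup>+x\<in>{0<..}. g x * indicator {..r} x \<partial>lborel) * indicator {0<..} r = \<dots>" .
  qed
  also have "\<dots> = (\<integral>\<^sup>+x. \<integral>\<^sup>+r. (ennreal (exp (- q * r)) * indicator {x..} r) * (g x * indicator {0<..} x) \<partial>lborel \<partial>lborel)"
    by (rule lborel_pair.Fubini') (simp add: indicator_def case_prod_beta)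
  also have "\<dots> = (\<integral>\<^sup>+x. ennreal (exp (- q * x) / q) * (g x * indicator {0<..} x) \<partial>lborel)"
    by (subst nn_integral_multc) (simp_all only: nn_integral_exp_atLeast[OF q], simp_all)
  finally have eq: "(\<integral>\<^sup>+r\<in>{0<..}. ennreal (exp (- q * r)) * (\<integral>\<^sup>+x\<in>{0<..}. g x * indicator {..r} x \<partial>lborel) \<partial>lborel) =
    (\<integral>\<^sup>+x. ennreal (exp (- q * x) / q) * (g x * indicator {0<..} x) \<partial>lborel)" .
  have "ennreal q * ennreal (exp (- q * x) / q) = ennreal (exp (- q * x))" for x
    using q by (simp add: ennreal_mult[symmetric])
  then show ?thesis unfolding eq
    by (subst nn_integral_cmult[symmetric]) (simp_all add: mult.assoc[symmetric])
qed

text \<open>Given the past, the sojourn in a state \<open>x\<close> is exponential, so jumps to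
  \<open>j\<close> occur with intensity \<open>a x j\<close> as long as the sojourn lasts. The test
  function \<open>f\<close> may depend on the earlier jumps through \<open>stop_path\<close>; this
  generality lets the induction absorb the first jump into \<open>f\<close>.\<close>

lemma compensator_nth_jump:
  assumes i: "i \<in> states" and j: "j \<in> states" and f: "f \<in> borel_measurable (path_space \<Otimes>\<^sub>M borel)"
  shows "(\<integral>\<^sup>+\<omega>. (if sojourn \<omega> n < \<infinity> \<and> post_jump \<omega> (Suc n) = j
        then f (stop_path n \<omega>, enn2real (sojourn \<omega> n)) else 0) \<partial>path_law i) =
    (\<integral>\<^sup>+\<omega>. (\<integral>\<^sup>+r\<in>{0<..}. (if ennreal r \<le> sojourn \<omega> n
        then f (stop_path n \<omega>, r) * ennreal (a (post_jump \<omega> n) j) else 0) \<partial>lborel) \<partial>path_law i)"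
    (is "(\<integral>\<^sup>+\<omega>. ?L n f \<omega> \<partial>_) = (\<integral>\<^sup>+\<omega>. ?R n f \<omega> \<partial>_)")
  using i f
proof (induction n arbitrary: i f)
  case (0 i f)
  note [measurable] = 0(2)
  have L_meas: "?L 0 f \<in> borel_measurable path_space" by measurable
  have R_meas: "?R 0 f \<in> borel_measurable path_space" by measurable
  show ?case
  proof (cases "total_rate i = 0")
    case True
    then show ?thesis
      by (subst (1 2) nn_integral_path_law) (use 0(1) L_meas R_meas rate_zero[OF True] in auto)
  next
    case False
    then have q: "0 < total_rate i" using total_rate_nonneg[of i] by simp
    \<comment> \<open>Stopping at index 0 forgets everything but the initial state, so
      \<open>f\<close> is evaluated along this single path.\<close>
    define \<kappa> where "\<kappa> = path_cons i \<infinity> dead_path"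
    have \<kappa>: "\<kappa> \<in> space path_space" using path_cons_dead_in_paths[OF 0(1)] by (simp add: \<kappa>_def)
    have [measurable]: "(\<lambda>r. f (\<kappa>, r)) \<in> borel_measurable borel"
      using measurable_compose[OF measurable_Pair1'[OF \<kappa>] 0(2)] by simp
    have L: "ennreal (a i k) * (\<integral>\<^sup>+r\<in>{0<..}. ennreal (exp (- total_rate i * r)) * (\<integral>\<^sup>+\<omega>. ?L 0 f (path_cons i (ennreal r) \<omega>) \<partial>path_law k) \<partial>lborel) =
      (if k = j then ennreal (a i j) * (\<integral>\<^sup>+r\<in>{0<..}. ennreal (exp (- total_rate i * r)) * f (\<kappa>, r) \<partial>lborel) else 0)" for k
    proof (cases "k \<in> states")
      case True
      have inner: "(\<integral>\<^sup>+\<omega>. ?L 0 f (path_cons i (ennreal r) \<omega>) \<partial>path_law k) = (if k = j then f (\<kappa>, r) else 0)" if "0 < r" for r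
      proof -
        have "(\<integral>\<^sup>+\<omega>. ?L 0 f (path_cons i (ennreal r) \<omega>) \<partial>path_law k) = (\<integral>\<^sup>+\<omega>. (if k = j then f (\<kappa>, r) else 0) \<partial>path_law k)"
          by (intro nn_integral_cong_AE eventually_mono[OF AE_path_law_start[OF True]]) (use that in \<open>auto simp: stop_path_0 \<kappa>_def cong: if_cong\<close>)
        then show ?thesis using prob_space.emeasure_space_1[OF prob_space_path_law[OF True]] by simp
      qed
      have "(\<integral>\<^sup>+r\<in>{0<..}. ennreal (exp (- total_rate i * r)) * (\<integral>\<^sup>+\<omega>. ?L 0 f (path_cons i (ennreal r) \<omega>) \<partial>path_law k) \<partial>lborel) =
        (\<integral>\<^sup>+r\<in>{0<..}. ennreal (exp (- total_rate i * r)) * (if k = j then f (\<kappa>, r) else 0) \<partial>lborel)"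
        (is "(\<integral>\<^sup>+r. ?f r \<partial>_) = (\<integral>\<^sup>+r. ?g r \<partial>_)")
      proof (rule nn_integral_cong)
        fix r :: real
        show "?f r = ?g r"
        proof (cases "0 < r")
          case True
          show ?thesis unfolding inner[OF True] ..
        qed simp
      qed
      then show ?thesis by (cases "k = j") auto
    next
      case False
      then show ?thesis using rate_to_cemetery j states_iff by auto
    qed
    have "(\<integral>\<^sup>+\<omega>. ?L 0 f \<omega> \<partial>path_law i) = ennreal (a i j) * (\<integral>\<^sup>+r\<in>{0<..}. ennreal (exp (- total_rate i * r)) * f (\<kappa>, r) \<partial>lborel)"
      unfolding nn_integral_path_law[OF 0(1) L_meas] if_not_P[OF False] L
      by (subst suminf_finite[of "{j}"]) auto
    also have "\<dots> = (\<integral>\<^sup>+r\<in>{0<..}. ennreal (exp (- total_rate i * r)) * (f (\<kappa>, r) * ennreal (a i j)) \<partial>lborel)"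
      by (subst nn_integral_cmult[symmetric]) (auto simp: ac_simps)
    finally have LHS: "(\<integral>\<^sup>+\<omega>. ?L 0 f \<omega> \<partial>path_law i) = (\<integral>\<^sup>+r\<in>{0<..}. ennreal (exp (- total_rate i * r)) * (f (\<kappa>, r) * ennreal (a i j)) \<partial>lborel)" .
    have R: "ennreal (a i k) * (\<integral>\<^sup>+r\<in>{0<..}. ennreal (exp (- total_rate i * r)) * (\<integral>\<^sup>+\<omega>. ?R 0 f (path_cons i (ennreal r) \<omega>) \<partial>path_law k) \<partial>lborel) =
      ennreal (a i k) * (\<integral>\<^sup>+r\<in>{0<..}. ennreal (exp (- total_rate i * r)) * (\<integral>\<^sup>+x\<in>{0<..}. (f (\<kappa>, x) * ennreal (a i j)) * indicator {..r} x \<partial>lborel) \<partial>lborel)" for k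
    proof (cases "k \<in> states")
      case True
      have inner: "(\<integral>\<^sup>+\<omega>. ?R 0 f (path_cons i (ennreal r) \<omega>) \<partial>path_law k) =
        (\<integral>\<^sup>+x\<in>{0<..}. (f (\<kappa>, x) * ennreal (a i j)) * indicator {..r} x \<partial>lborel)" if "0 < r" for r
      proof -
        have "?R 0 f (path_cons i (ennreal r) \<omega>) = (\<integral>\<^sup>+x\<in>{0<..}. (f (\<kappa>, x) * ennreal (a i j)) * indicator {..r} x \<partial>lborel)" for \<omega>
          by (intro nn_integral_cong) (use that in \<open>auto simp: stop_path_0 ennreal_le_iff \<kappa>_def split: split_indicator\<close>)
        then show ?thesis using prob_space.emeasure_space_1[OF prob_space_path_law[OF True]] by simp
      qed
      have "(\<integral>\<^sup>+r\<in>{0<..}. ennreal (exp (- total_rate i * r)) * (\<integral>\<^sup>+\<omega>. ?R 0 f (path_cons i (ennreal r) \<omega>) \<partial>path_law k) \<partial>lborel) =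
        (\<integral>\<^sup>+r\<in>{0<..}. ennreal (exp (- total_rate i * r)) * (\<integral>\<^sup>+x\<in>{0<..}. (f (\<kappa>, x) * ennreal (a i j)) * indicator {..r} x \<partial>lborel) \<partial>lborel)"
        (is "(\<integral>\<^sup>+r. ?f r \<partial>_) = (\<integral>\<^sup>+r. ?g r \<partial>_)")
      proof (rule nn_integral_cong)
        fix r :: real
        show "?f r = ?g r"
        proof (cases "0 < r")
          case True
          show ?thesis unfolding inner[OF True] ..
        qed simp
      qed
      then show ?thesis by simp
    next
      case False
      then show ?thesis using rate_to_cemetery states_iff by auto
    qed
    have "(\<integral>\<^sup>+\<omega>. ?R 0 f \<omega> \<partial>path_law i) = (\<Sum>k. ennreal (a i k)) *
      (\<integral>\<^sup>+r\<in>{0<..}. ennreal (exp (- total_rate i * r)) * (\<integral>\<^sup>+x\<in>{0<..}. (f (\<kappa>, x) * ennreal (a i j)) * indicator {..r} x \<partial>lborel) \<partial>lborel)"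
      unfolding nn_integral_path_law[OF 0(1) R_meas] if_not_P[OF False] R by (rule ennreal_suminf_multc)
    also have "\<dots> = (\<integral>\<^sup>+r\<in>{0<..}. ennreal (exp (- total_rate i * r)) * (f (\<kappa>, r) * ennreal (a i j)) \<partial>lborel)"
      unfolding suminf_rates using q by (intro nn_integral_exp_tail) auto
    finally show ?thesis using LHS by simp
  qed
next
  case (Suc n i f)
  note [measurable] = Suc(3)
  have L_meas: "?L (Suc n) f \<in> borel_measurable path_space" by measurable
  have R_meas: "?R (Suc n) f \<in> borel_measurable path_space" by measurable
  show ?case
  proof (cases "total_rate i = 0")
    case True
    then show ?thesis
      by (subst (1 2) nn_integral_path_law) (use Suc(2) L_meas R_meas rate_from_cemetery in auto)
  next
    case False
    have inner: "(\<integral>\<^sup>+\<omega>. ?L (Suc n) f (path_cons i (ennreal r) \<omega>) \<partial>path_law k) = (\<integral>\<^sup>+\<omega>. ?R (Suc n) f (path_cons i (ennreal r) \<omega>) \<partial>path_law k)"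
      if "0 < r" "k \<in> states" for r k
    proof -
      \<comment> \<open>Composing \<open>f\<close> with the first jump gives a test function for the
        remaining chain, to which the induction hypothesis applies.\<close>
      have "(\<lambda>\<omega>. path_cons i (ennreal r) \<omega>) \<in> path_space \<rightarrow>\<^sub>M path_space"
        using measurable_compose[OF measurable_Pair1' measurable_path_cons[OF Suc(2)], of r] that by simp
      then have "(\<lambda>x. f (path_cons i (ennreal r) (fst x), snd x)) \<in> borel_measurable (path_space \<Otimes>\<^sub>M borel)"
        by measurable
      from Suc(1)[OF that(2) this] show ?thesis by (simp add: stop_path_Suc cong: if_cong)
    qed
    have "ennreal (a i k) * (\<integral>\<^sup>+r\<in>{0<..}. ennreal (exp (- total_rate i * r)) * (\<integral>\<^sup>+\<omega>. ?L (Suc n) f (path_cons i (ennreal r) \<omega>) \<partial>path_law k) \<partial>lborel) =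
      ennreal (a i k) * (\<integral>\<^sup>+r\<in>{0<..}. ennreal (exp (- total_rate i * r)) * (\<integral>\<^sup>+\<omega>. ?R (Suc n) f (path_cons i (ennreal r) \<omega>) \<partial>path_law k) \<partial>lborel)" for k
    proof (cases "k \<in> states")
      case True
      have "(\<integral>\<^sup>+r\<in>{0<..}. ennreal (exp (- total_rate i * r)) * (\<integral>\<^sup>+\<omega>. ?L (Suc n) f (path_cons i (ennreal r) \<omega>) \<partial>path_law k) \<partial>lborel) =
        (\<integral>\<^sup>+r\<in>{0<..}. ennreal (exp (- total_rate i * r)) * (\<integral>\<^sup>+\<omega>. ?R (Suc n) f (path_cons i (ennreal r) \<omega>) \<partial>path_law k) \<partial>lborel)"
        by (rule nn_integral_cong) (use inner[OF _ True] in \<open>simp split: split_indicator\<close>)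
      then show ?thesis by simp
    next
      case False
      then show ?thesis using rate_to_cemetery states_iff by auto
    qed
    then show ?thesis
      unfolding nn_integral_path_law[OF Suc(2) L_meas] nn_integral_path_law[OF Suc(2) R_meas] if_not_P[OF False]
      by (intro suminf_cong)
  qed
qed

end

lemma jump_time_Suc_finite_iff:
  assumes "\<omega> \<in> paths" shows "jump_time \<omega> (Suc n) < \<infinity> \<longleftrightarrow> sojourn \<omega> n < \<infinity>"
proof (cases "jump_time \<omega> n = \<infinity>")
  case True
  then show ?thesis using jump_time_infinite_imp_cemetery(2)[OF assms] by (simp add: jump_time_Suc)
next
  case False
  then show ?thesis by (simp add: jump_time_Suc less_top)
qed

lemma measurable_section_indicator:
  assumes "D \<in> sets (M \<Otimes>\<^sub>M N)"
  shows "(\<lambda>t. indicator D (\<omega>, t) :: ennreal) \<in> borel_measurable N"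
proof -
  have "(\<lambda>t. indicator D (\<omega>, t) :: ennreal) = indicator (Pair \<omega> -` D)" by (auto simp: indicator_def)
  then show ?thesis using sets_Pair1[OF assms] by simp
qed

context jump_rates
begin

text \<open>The last clause of \<open>is_law\<close> for a jump rate that depends only on the state
  just before \<open>t\<close>.\<close>

definition compensated :: "path measure \<Rightarrow> bool"
  where "compensated P \<longleftrightarrow> (\<forall>j\<in>states. \<forall>D\<in>sets predictable.
      (\<integral>\<^sup>+\<omega>. (\<Sum>n. if jump_time \<omega> (Suc n) < \<infinity> \<and> post_jump \<omega> (Suc n) = j
               then indicator D (\<omega>, enn2real (jump_time \<omega> (Suc n))) else 0) \<partial>P) =
      (\<integral>\<^sup>+\<omega>. (\<integral>\<^sup>+t\<in>{0<..}. indicator D (\<omega>, t) * ennreal (a (Y_left \<omega> t) j) \<partial>lborel) \<partial>P))"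

text \<open>At most one of the left-open intervals between consecutive jumps contains
  \<open>t\<close>. If none does, the path has exploded, and the rate out of the cemetery is
  zero.\<close>

lemma rate_Y_left_eq_suminf:
  assumes "0 < t"
  shows "(\<Sum>n. if jump_time \<omega> n < ennreal t \<and> ennreal t \<le> jump_time \<omega> (Suc n)
    then ennreal (a (post_jump \<omega> n) j) else 0) = ennreal (a (Y_left \<omega> t) j)"
proof (cases \<omega> rule: Y_left_cases[OF assms])
  case (1 m)
  have "(if jump_time \<omega> n < ennreal t \<and> ennreal t \<le> jump_time \<omega> (Suc n)
    then ennreal (a (post_jump \<omega> n) j) else 0) = (if n = m then ennreal (a (Y_left \<omega> t) j) else 0)" for n
    using jump_interval_left_unique[OF 1(1,2), of n] 1 by (cases "n = m") (simp, metis)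
  then show ?thesis by (simp only:) (subst suminf_finite[of "{m}"], auto)
next
  case 2
  have "\<not> ennreal t \<le> jump_time \<omega> (Suc n)" for n using 2(1)[of "Suc n"] by simp
  then show ?thesis by (simp add: 2(2) rate_from_cemetery)
qed

text \<open>Passage from sojourns to absolute time: during the sojourn, membership in
  \<open>D\<close> is unchanged by \<open>stop_path\<close>, so \<open>D\<close> shifted by jump
  time \<open>n\<close> is a test function for \<open>compensator_nth_jump\<close>.\<close>

lemma compensator_path_law_nth:
  assumes i: "i \<in> states" and j: "j \<in> states" and D: "D \<in> sets predictable"
  shows "(\<integral>\<^sup>+\<omega>. (if jump_time \<omega> (Suc n) < \<infinity> \<and> post_jump \<omega> (Suc n) = j
               then indicator D (\<omega>, enn2real (jump_time \<omega> (Suc n))) else 0) \<partial>path_law i) =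
    (\<integral>\<^sup>+\<omega>. (\<integral>\<^sup>+t\<in>{0<..}. indicator D (\<omega>, t) * (if jump_time \<omega> n < ennreal t \<and> ennreal t \<le> jump_time \<omega> (Suc n)
      then ennreal (a (post_jump \<omega> n) j) else 0) \<partial>lborel) \<partial>path_law i)"
proof -
  have [measurable]: "D \<in> sets (path_space \<Otimes>\<^sub>M borel)" using D sets_predictable_subset by blast
  \<comment> \<open>The shift is read off the argument itself, a stopped path that still carries
    jump time \<open>n\<close>; the value 0 covers paths absorbed earlier.\<close>
  define f where "f = (\<lambda>(\<omega>, r). if jump_time \<omega> n < \<infinity> then indicator D (\<omega>, enn2real (jump_time \<omega> n) + r) else (0::ennreal))"
  have f: "f \<in> borel_measurable (path_space \<Otimes>\<^sub>M borel)"
    unfolding f_def by measurable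
  have "(\<integral>\<^sup>+\<omega>. (if jump_time \<omega> (Suc n) < \<infinity> \<and> post_jump \<omega> (Suc n) = j
               then indicator D (\<omega>, enn2real (jump_time \<omega> (Suc n))) else 0) \<partial>path_law i) =
    (\<integral>\<^sup>+\<omega>. (if sojourn \<omega> n < \<infinity> \<and> post_jump \<omega> (Suc n) = j
        then f (stop_path n \<omega>, enn2real (sojourn \<omega> n)) else 0) \<partial>path_law i)"
  proof (rule nn_integral_cong)
    fix \<omega> assume "\<omega> \<in> space (path_law i)"
    then have \<omega>: "\<omega> \<in> paths" by simp
    show "(if jump_time \<omega> (Suc n) < \<infinity> \<and> post_jump \<omega> (Suc n) = j
               then indicator D (\<omega>, enn2real (jump_time \<omega> (Suc n))) else 0) =
       (if sojourn \<omega> n < \<infinity> \<and> post_jump \<omega> (Suc n) = j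
        then f (stop_path n \<omega>, enn2real (sojourn \<omega> n)) else 0)"
    proof (cases "sojourn \<omega> n < \<infinity>")
      case True
      then have fin: "jump_time \<omega> (Suc n) < \<infinity>" using jump_time_Suc_finite_iff[OF \<omega>] by blast
      then have fin': "jump_time \<omega> n < \<infinity>" using jump_time_mono[of n "Suc n" \<omega>] by (simp add: le_less_trans)
      have eq: "enn2real (jump_time \<omega> (Suc n)) = enn2real (jump_time \<omega> n) + enn2real (sojourn \<omega> n)"
        unfolding jump_time_Suc using True fin' by (intro enn2real_plus) auto
      have "0 < enn2real (jump_time \<omega> (Suc n))"
        using fin jump_time_less_Suc[OF \<omega> fin'] by (simp add: enn2real_positive_iff) (metis zero_le le_less_trans)
      then have "(stop_path n \<omega>, enn2real (jump_time \<omega> (Suc n))) \<in> D \<longleftrightarrow> (\<omega>, enn2real (jump_time \<omega> (Suc n))) \<in> D"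
        using fin by (intro predictable_stop_path[OF D \<omega>]) auto
      then show ?thesis using True fin fin' eq by (auto simp: f_def jump_time_stop_path indicator_def)
    next
      case False
      then show ?thesis using jump_time_Suc_finite_iff[OF \<omega>] by auto
    qed
  qed
  also have "\<dots> = (\<integral>\<^sup>+\<omega>. (\<integral>\<^sup>+r\<in>{0<..}. (if ennreal r \<le> sojourn \<omega> n
        then f (stop_path n \<omega>, r) * ennreal (a (post_jump \<omega> n) j) else 0) \<partial>lborel) \<partial>path_law i)"
    by (rule compensator_nth_jump[OF i j f])
  also have "\<dots> = (\<integral>\<^sup>+\<omega>. (\<integral>\<^sup>+t\<in>{0<..}. indicator D (\<omega>, t) * (if jump_time \<omega> n < ennreal t \<and> ennreal t \<le> jump_time \<omega> (Suc n)
      then ennreal (a (post_jump \<omega> n) j) else 0) \<partial>lborel) \<partial>path_law i)"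
  proof (rule nn_integral_cong)
    fix \<omega> assume "\<omega> \<in> space (path_law i)"
    then have \<omega>: "\<omega> \<in> paths" by simp
    show "(\<integral>\<^sup>+r\<in>{0<..}. (if ennreal r \<le> sojourn \<omega> n
        then f (stop_path n \<omega>, r) * ennreal (a (post_jump \<omega> n) j) else 0) \<partial>lborel) =
      (\<integral>\<^sup>+t\<in>{0<..}. indicator D (\<omega>, t) * (if jump_time \<omega> n < ennreal t \<and> ennreal t \<le> jump_time \<omega> (Suc n)
      then ennreal (a (post_jump \<omega> n) j) else 0) \<partial>lborel)" (is "_ = (\<integral>\<^sup>+t. ?g t \<partial>lborel)")
    proof (cases "jump_time \<omega> n < \<infinity>")
      case False
      then have top: "jump_time \<omega> n = \<infinity>" by (simp add: less_top[symmetric])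
      then have "f (stop_path n \<omega>, r) = 0" for r by (simp add: f_def jump_time_stop_path)
      then show ?thesis using top by (simp cong: if_cong)
    next
      case True
      then obtain \<tau> where \<tau>: "jump_time \<omega> n = ennreal \<tau>" "0 \<le> \<tau>" by (cases "jump_time \<omega> n") auto
      have [measurable]: "\<omega> \<in> space path_space" using \<omega> by simp
      have "(\<lambda>t. indicator D (\<omega>, t) :: ennreal) \<in> borel_measurable (borel :: real measure)"
        by (rule measurable_section_indicator) measurable
      then have g: "?g \<in> borel_measurable borel" by measurable
      have "(\<integral>\<^sup>+t. ?g t \<partial>lborel) = (\<integral>\<^sup>+r. ?g (\<tau> + 1 * r) \<partial>lborel)"
        by (subst nn_integral_real_affine[OF g, of 1 \<tau>]) simp_all
      also have "\<dots> = (\<integral>\<^sup>+r\<in>{0<..}. (if ennreal r \<le> sojourn \<omega> n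
        then f (stop_path n \<omega>, r) * ennreal (a (post_jump \<omega> n) j) else 0) \<partial>lborel)"
      proof (rule nn_integral_cong)
        fix r :: real
        show "?g (\<tau> + 1 * r) = (if ennreal r \<le> sojourn \<omega> n
          then f (stop_path n \<omega>, r) * ennreal (a (post_jump \<omega> n) j) else 0) * indicator {0<..} r"
        proof (cases "0 < r")
          case True
          have eq: "ennreal (\<tau> + r) = ennreal \<tau> + ennreal r" using \<tau> True by (simp add: ennreal_plus)
          have le: "ennreal (\<tau> + r) \<le> jump_time \<omega> (Suc n) \<longleftrightarrow> ennreal r \<le> sojourn \<omega> n"
            unfolding jump_time_Suc \<tau>(1) eq by (simp add: ennreal_add_left_cancel_le)
          have less: "jump_time \<omega> n < ennreal (\<tau> + r)" using \<tau> True by (simp add: ennreal_less_iff)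
          have "(stop_path n \<omega>, \<tau> + r) \<in> D \<longleftrightarrow> (\<omega>, \<tau> + r) \<in> D" if "ennreal r \<le> sojourn \<omega> n"
            using predictable_stop_path[OF D \<omega>, of "\<tau> + r" n] \<tau> True le that by simp
          then show ?thesis using le less True \<tau> by (auto simp: f_def jump_time_stop_path indicator_def)
        next
          case False
          then have "\<not> jump_time \<omega> n < ennreal (\<tau> + r)"
            using \<tau> by (simp add: not_less ennreal_leI)
          then show ?thesis using False by simp
        qed
      qed
      finally show ?thesis by simp
    qed
  qed
  finally show ?thesis .
qed

lemma compensated_path_law:
  assumes i: "i \<in> states" shows "compensated (path_law i)"
  unfolding compensated_def
proof (intro ballI)
  fix j D assume j: "j \<in> states" and D: "D \<in> sets predictable"
  have [measurable]: "D \<in> sets (path_space \<Otimes>\<^sub>M borel)" using D sets_predictable_subset by blast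
  let ?r = "\<lambda>\<omega> t n. if jump_time \<omega> n < ennreal t \<and> ennreal t \<le> jump_time \<omega> (Suc n)
      then ennreal (a (post_jump \<omega> n) j) else 0"
  have "(\<integral>\<^sup>+\<omega>. (\<Sum>n. if jump_time \<omega> (Suc n) < \<infinity> \<and> post_jump \<omega> (Suc n) = j
               then indicator D (\<omega>, enn2real (jump_time \<omega> (Suc n))) else 0) \<partial>path_law i) =
    (\<Sum>n. \<integral>\<^sup>+\<omega>. (if jump_time \<omega> (Suc n) < \<infinity> \<and> post_jump \<omega> (Suc n) = j
               then indicator D (\<omega>, enn2real (jump_time \<omega> (Suc n))) else 0) \<partial>path_law i)"
    by (rule nn_integral_suminf) measurable
  also have "\<dots> = (\<Sum>n. \<integral>\<^sup>+\<omega>. (\<integral>\<^sup>+t\<in>{0<..}. indicator D (\<omega>, t) * ?r \<omega> t n \<partial>lborel) \<partial>path_law i)"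
    by (simp only: compensator_path_law_nth[OF i j D])
  also have "\<dots> = (\<integral>\<^sup>+\<omega>. (\<Sum>n. \<integral>\<^sup>+t\<in>{0<..}. indicator D (\<omega>, t) * ?r \<omega> t n \<partial>lborel) \<partial>path_law i)"
    by (rule nn_integral_suminf[symmetric]) measurable
  also have "\<dots> = (\<integral>\<^sup>+\<omega>. (\<integral>\<^sup>+t\<in>{0<..}. indicator D (\<omega>, t) * ennreal (a (Y_left \<omega> t) j) \<partial>lborel) \<partial>path_law i)"
  proof (rule nn_integral_cong)
    fix \<omega> assume "\<omega> \<in> space (path_law i)"
    then have \<omega>: "\<omega> \<in> space path_space" by simp
    have [measurable]: "(\<lambda>t. indicator D (\<omega>, t) :: ennreal) \<in> borel_measurable (borel :: real measure)"
      by (rule measurable_section_indicator) measurable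
    have "(\<Sum>n. \<integral>\<^sup>+t\<in>{0<..}. indicator D (\<omega>, t) * ?r \<omega> t n \<partial>lborel) =
      (\<integral>\<^sup>+t. (\<Sum>n. indicator D (\<omega>, t) * ?r \<omega> t n * indicator {0<..} t) \<partial>lborel)"
      by (rule nn_integral_suminf[symmetric]) measurable
    also have "\<dots> = (\<integral>\<^sup>+t\<in>{0<..}. indicator D (\<omega>, t) * ennreal (a (Y_left \<omega> t) j) \<partial>lborel)"
      by (rule nn_integral_cong) (simp add: rate_Y_left_eq_suminf split: split_indicator)
    finally show "(\<Sum>n. \<integral>\<^sup>+t\<in>{0<..}. indicator D (\<omega>, t) * ?r \<omega> t n \<partial>lborel) = \<dots>" .
  qed
  finally show "(\<integral>\<^sup>+\<omega>. (\<Sum>n. if jump_time \<omega> (Suc n) < \<infinity> \<and> post_jump \<omega> (Suc n) = j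
               then indicator D (\<omega>, enn2real (jump_time \<omega> (Suc n))) else 0) \<partial>path_law i) =
      (\<integral>\<^sup>+\<omega>. (\<integral>\<^sup>+t\<in>{0<..}. indicator D (\<omega>, t) * ennreal (a (Y_left \<omega> t) j) \<partial>lborel) \<partial>path_law i)" .
qed

end

section \<open>Uniqueness of the law with a given compensator\<close>

text \<open>A Gronwall argument: the distance of \<open>g\<close> and \<open>h\<close> is at most
  \<open>q\<close> times its own integral, and iterating this from the bound 1 yields
  \<open>(q * t) ^ n / fact n\<close>, which tends to 0.\<close>

lemma volterra_unique:
  fixes g h :: "real \<Rightarrow> ennreal" and q :: real
  assumes [measurable]: "g \<in> borel_measurable borel" "h \<in> borel_measurable borel"
    and bound: "\<And>t. g t \<le> 1" "\<And>t. h t \<le> 1" and q: "0 \<le> q"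
    and eq: "\<And>t. 0 < t \<Longrightarrow> g t + ennreal q * (\<integral>\<^sup>+r\<in>{0<..<t}. g r \<partial>lborel) = h t + ennreal q * (\<integral>\<^sup>+r\<in>{0<..<t}. h r \<partial>lborel)"
    and t: "0 < t"
  shows "g t = h t"
proof -
  \<comment> \<open>Subtraction in \<open>ennreal\<close> is truncated at 0, so the sum of both
    differences is the absolute difference.\<close>
  define e where "e t = (g t - h t) + (h t - g t)" for t
  have [measurable]: "e \<in> borel_measurable borel" unfolding e_def by measurable
  have gfin: "g t < \<top>" and hfin: "h t < \<top>" for t
    using bound[of t] by (auto simp: less_top[symmetric] top_unique)
  have cases: "(g t \<le> h t \<and> e t = h t - g t) \<or> (h t \<le> g t \<and> e t = g t - h t)" for t
    using le_cases[of "g t" "h t"] by (auto simp: e_def diff_eq_0_iff_ennreal gfin hfin)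
  have le_e: "h t \<le> g t + e t" "g t \<le> h t + e t" for t
    using cases[of t] by (metis add_diff_inverse_ennreal add_increasing2 order.refl zero_le)+
  have e_le_1: "e t \<le> 1" for t
    using cases[of t] bound[of t] by (auto intro: order.trans[OF diff_le_self_ennreal])
  have int_le: "(\<integral>\<^sup>+r\<in>{0<..<t}. u r \<partial>lborel) \<le> (\<integral>\<^sup>+r\<in>{0<..<t}. w r \<partial>lborel) + (\<integral>\<^sup>+r\<in>{0<..<t}. e r \<partial>lborel)"
    if "\<And>r. u r \<le> w r + e r" and [measurable]: "w \<in> borel_measurable borel" for u w t
    by (subst nn_integral_add[symmetric]) (auto intro!: nn_integral_mono that(1) split: split_indicator)
  have fin: "ennreal q * (\<integral>\<^sup>+r\<in>{0<..<t}. u r \<partial>lborel) \<noteq> \<top>" if "\<And>r. u r \<le> 1" for u :: "real \<Rightarrow> ennreal" and t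
  proof -
    have "(\<integral>\<^sup>+r\<in>{0<..<t}. u r \<partial>lborel) \<le> (\<integral>\<^sup>+r. indicator {0<..<t} r \<partial>lborel)"
      by (rule nn_integral_mono) (use that in \<open>auto split: split_indicator\<close>)
    also have "\<dots> = emeasure lborel {0<..<t}" by (rule nn_integral_indicator) simp
    also have "\<dots> < \<top>" by (cases "0 \<le> t") auto
    finally show ?thesis by (simp add: ennreal_mult_eq_top_iff)
  qed
  have step: "e t \<le> ennreal q * (\<integral>\<^sup>+r\<in>{0<..<t}. e r \<partial>lborel)" if t: "0 < t" for t
  proof -
    let ?E = "ennreal q * (\<integral>\<^sup>+r\<in>{0<..<t}. e r \<partial>lborel)"
    \<comment> \<open>Proved for an unspecified pair, so that it applies to \<open>g\<close> and
      \<open>h\<close> in both orders; the integral of a function bounded by 1 is finite and may be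
      cancelled.\<close>
    have "u t \<le> w t + ?E" if u: "\<And>r. w r \<le> u r + e r" "\<And>r. u r \<le> 1"
      and [measurable]: "u \<in> borel_measurable borel"
      and uw: "u t + ennreal q * (\<integral>\<^sup>+r\<in>{0<..<t}. u r \<partial>lborel) = w t + ennreal q * (\<integral>\<^sup>+r\<in>{0<..<t}. w r \<partial>lborel)" for u w
    proof -
      have "ennreal q * (\<integral>\<^sup>+r\<in>{0<..<t}. w r \<partial>lborel) \<le> ennreal q * (\<integral>\<^sup>+r\<in>{0<..<t}. u r \<partial>lborel) + ?E"
        unfolding distrib_left[symmetric] by (intro mult_left_mono int_le u) auto
      then have "w t + ennreal q * (\<integral>\<^sup>+r\<in>{0<..<t}. w r \<partial>lborel) \<le> w t + (ennreal q * (\<integral>\<^sup>+r\<in>{0<..<t}. u r \<partial>lborel) + ?E)"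
        by (rule add_left_mono)
      then have "ennreal q * (\<integral>\<^sup>+r\<in>{0<..<t}. u r \<partial>lborel) + u t \<le> ennreal q * (\<integral>\<^sup>+r\<in>{0<..<t}. u r \<partial>lborel) + (w t + ?E)"
        unfolding uw[symmetric] by (simp only: ac_simps)
      then show ?thesis using fin[of u t, OF u(2)] by (simp add: ennreal_add_left_cancel_le)
    qed
    from this[of h g] this[of g h] have "g t \<le> h t + ?E" "h t \<le> g t + ?E"
      using le_e bound eq[OF t] by auto
    then show ?thesis using cases[of t] gfin[of t] hfin[of t] by (auto simp: ennreal_minus_le_iff)
  qed
  have power_bound: "e t \<le> ennreal ((q * t) ^ n / fact n)" if "0 < t" for n t
    using that
  proof (induction n arbitrary: t)
    case 0
    then show ?case using e_le_1 by simp
  next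
    case (Suc n)
    have "(\<integral>\<^sup>+r\<in>{0<..<t}. e r \<partial>lborel) \<le> (\<integral>\<^sup>+r. ennreal (q ^ n / fact n * r ^ n) * indicator {0..t} r \<partial>lborel)"
      using Suc.IH by (intro nn_integral_mono) (auto simp: power_mult_distrib split: split_indicator)
    also have "\<dots> = ennreal (q ^ n / fact n * (t ^ Suc n / real (Suc n)) - q ^ n / fact n * (0 ^ Suc n / real (Suc n)))"
    proof (rule nn_integral_FTC_Icc)
      fix x :: real
      have "((\<lambda>x. x ^ Suc n / real (Suc n)) has_real_derivative x ^ n) (at x)"
        by (auto intro!: derivative_eq_intros simp del: of_nat_Suc power_Suc)
      then show "((\<lambda>x. q ^ n / fact n * (x ^ Suc n / real (Suc n))) has_real_derivative q ^ n / fact n * x ^ n) (at x)"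
        by (rule DERIV_cmult)
    qed (use Suc.prems q in auto)
    finally have "ennreal q * (\<integral>\<^sup>+r\<in>{0<..<t}. e r \<partial>lborel) \<le> ennreal q * ennreal (q ^ n / fact n * (t ^ Suc n / real (Suc n)))"
      by (intro mult_left_mono) auto
    also have "\<dots> = ennreal ((q * t) ^ Suc n / fact (Suc n))"
      using q Suc.prems by (subst ennreal_mult[symmetric]) (auto simp: power_mult_distrib field_simps)
    finally show ?case using step[OF Suc.prems] by (rule order.trans[rotated])
  qed
  have "(\<lambda>n. (q * t) ^ n / fact n) \<longlonglongrightarrow> 0"
    using summable_LIMSEQ_zero[OF summable_exp[of "q * t"]] by (simp add: field_simps)
  then have "(\<lambda>n. ennreal ((q * t) ^ n / fact n)) \<longlonglongrightarrow> ennreal 0" by (rule tendsto_ennrealI)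
  then have "e t \<le> ennreal 0" using power_bound[OF t] by (intro LIMSEQ_le_const) auto
  then have "e t = 0" by simp
  then show ?thesis using cases[of t] by (auto simp: diff_eq_0_iff_ennreal)
qed

section \<open>Cylinders as a generator of the path space\<close>

lemma le_ennreal_min: "x \<le> ennreal (min r s) \<longleftrightarrow> x \<le> ennreal r \<and> x \<le> ennreal s"
  by (cases "r \<le> s") (auto simp: min_def intro: order.trans[OF _ ennreal_leI])

lemma ennreal_max_0: "ennreal (max 0 r) = ennreal r"
  by (simp add: max_def ennreal_neg)

text \<open>Jump times rather than sojourns are bounded, because such events generate
  \<open>history\<close>. Intersecting two cylinders takes minima of the bounds, which keeps the
  family stable.\<close>

definition cylinder :: "nat \<Rightarrow> (nat \<Rightarrow> nat set) \<Rightarrow> (nat \<Rightarrow> real) \<Rightarrow> path set"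
  where "cylinder n B s = {\<omega> \<in> paths. \<forall>k\<le>n. post_jump \<omega> k \<in> B k \<and> jump_time \<omega> k \<le> ennreal (s k)}"

lemma cylinder_sets [measurable]: "cylinder n B s \<in> sets path_space"
proof -
  let ?A = "\<lambda>k. ((\<lambda>\<omega>. post_jump \<omega> k) -` B k \<inter> space path_space) \<inter>
      {\<omega> \<in> space path_space. jump_time \<omega> k \<le> ennreal (s k)}"
  have A: "?A k \<in> sets path_space" for k
    by (rule sets.Int[OF measurable_sets[OF measurable_post_jump]]) (simp, measurable)
  have "cylinder n B s = (\<Inter>k\<in>{..n}. ?A k)" by (auto simp: cylinder_def)
  also have "\<dots> \<in> sets path_space" by (rule sets.finite_INT, simp, simp, rule A)
  finally show ?thesis .
qed

lemma Int_stable_cylinders: "Int_stable {cylinder n B s | n B s. True}"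
proof (rule Int_stableI, clarify)
  fix n m :: nat and B C :: "nat \<Rightarrow> nat set" and s t :: "nat \<Rightarrow> real"
  define N where "N = max n m"
  define s' where "s' k = (if k \<le> n \<and> k \<le> m then min (s k) (t k) else if k \<le> n then s k else t k)" for k
  define B' where "B' k = (if k \<le> n \<and> k \<le> m then B k \<inter> C k else if k \<le> n then B k else C k)" for k
  have "cylinder n B s \<inter> cylinder m C t = cylinder N B' s'"
  proof (rule set_eqI)
    fix \<omega>
    have "post_jump \<omega> k \<in> B' k \<and> jump_time \<omega> k \<le> ennreal (s' k) \<longleftrightarrow>
      (k \<le> n \<longrightarrow> post_jump \<omega> k \<in> B k \<and> jump_time \<omega> k \<le> ennreal (s k)) \<and>
      (k \<le> m \<longrightarrow> post_jump \<omega> k \<in> C k \<and> jump_time \<omega> k \<le> ennreal (t k))" if "k \<le> N" for k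
      using that unfolding s'_def B'_def N_def
      by (cases "k \<le> n"; cases "k \<le> m") (simp_all add: le_ennreal_min le_max_iff_disj conj_ac)
    moreover have "k \<le> N" if "k \<le> n \<or> k \<le> m" for k using that by (auto simp: N_def)
    ultimately show "\<omega> \<in> cylinder n B s \<inter> cylinder m C t \<longleftrightarrow> \<omega> \<in> cylinder N B' s'"
      unfolding cylinder_def mem_Collect_eq Int_iff by metis
  qed
  then show "\<exists>n' B' s'. cylinder n B s \<inter> cylinder m C t = cylinder n' B' s' \<and> True" by blast
qed

text \<open>Cylinders only see finite jump times. Post-jump states in \<open>states\<close> are
  reached by letting the time bound grow, the cemetery is obtained as a complement, and sojourns are
  differences of jump times, or \<infinity> after absorption.\<close>

lemma sets_path_space_cylinders: "sets path_space = sigma_sets paths {cylinder n B s | n B s. True}"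
proof
  let ?G = "{cylinder n B s | n B s. True}"
  define M where "M = sigma paths ?G"
  have sub: "?G \<subseteq> Pow paths" by (auto simp: cylinder_def)
  have sets_M: "sets M = sigma_sets paths ?G" and space_M: "space M = paths"
    unfolding M_def by (rule sets_measure_of[OF sub], rule space_measure_of[OF sub])
  show "sigma_sets paths ?G \<subseteq> sets path_space"
    by (rule sets.sigma_sets_subset[of _ path_space, unfolded space_path_space]) (use cylinder_sets in blast)
  have E: "{\<omega> \<in> paths. jump_time \<omega> n \<le> ennreal s \<and> post_jump \<omega> n = j} \<in> sets M" for n s j
  proof -
    have "{\<omega> \<in> paths. jump_time \<omega> n \<le> ennreal s \<and> post_jump \<omega> n = j} =
      cylinder n (\<lambda>k. if k = n then {j} else UNIV) (\<lambda>_. s)"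
      by (auto simp: cylinder_def intro: order.trans[OF jump_time_mono])
    then show ?thesis unfolding sets_M by (simp only:) (rule sigma_sets.Basic, blast)
  qed
  have T_le: "{\<omega> \<in> paths. jump_time \<omega> n \<le> ennreal s} \<in> sets M" for n s
  proof -
    have "{\<omega> \<in> paths. jump_time \<omega> n \<le> ennreal s} = (\<Union>j. {\<omega> \<in> paths. jump_time \<omega> n \<le> ennreal s \<and> post_jump \<omega> n = j})"
      by auto
    also have "\<dots> \<in> sets M" using E by blast
    finally show ?thesis .
  qed
  have T [measurable]: "(\<lambda>\<omega>. jump_time \<omega> n) \<in> borel_measurable M" for n
  proof (rule borel_measurableI_le)
    fix y :: ennreal
    show "{\<omega> \<in> space M. jump_time \<omega> n \<le> y} \<in> sets M"
    proof (cases y)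
      case (real r)
      then show ?thesis using T_le[of n r] by (simp only: space_M)
    next
      case top
      then have "{\<omega> \<in> space M. jump_time \<omega> n \<le> y} = space M" by simp
      then show ?thesis by (simp only: sets.top)
    qed
  qed
  have X_eq: "{\<omega> \<in> paths. post_jump \<omega> n = j} \<in> sets M" if "j \<in> states" for n j
  proof -
    have "{\<omega> \<in> paths. post_jump \<omega> n = j} =
      (\<Union>s::nat. {\<omega> \<in> paths. jump_time \<omega> n \<le> ennreal (real s) \<and> post_jump \<omega> n = j})"
    proof (intro equalityI subsetI)
      fix \<omega> assume "\<omega> \<in> {\<omega> \<in> paths. post_jump \<omega> n = j}"
      moreover from this have "jump_time \<omega> n < \<infinity>" using post_jump_in_states_iff that by blast
      then obtain \<tau> where \<tau>: "jump_time \<omega> n = ennreal \<tau>" by (cases "jump_time \<omega> n") auto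
      obtain s :: nat where "\<tau> \<le> real s" using real_arch_simple by blast
      then have "jump_time \<omega> n \<le> ennreal (real s)" unfolding \<tau> by (rule ennreal_leI)
      ultimately show "\<omega> \<in> (\<Union>s::nat. {\<omega> \<in> paths. jump_time \<omega> n \<le> ennreal (real s) \<and> post_jump \<omega> n = j})"
        by blast
    qed auto
    also have "\<dots> \<in> sets M" using E by blast
    finally show ?thesis .
  qed
  have X [measurable]: "(\<lambda>\<omega>. post_jump \<omega> n) \<in> M \<rightarrow>\<^sub>M count_space UNIV" for n
  proof (rule measurable_count_space_eq2_countable[THEN iffD2], safe)
    fix j :: nat
    have "(\<lambda>\<omega>. post_jump \<omega> n) -` {j} \<inter> space M = {\<omega> \<in> paths. post_jump \<omega> n = j}" by (auto simp: space_M)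
    also have "\<dots> \<in> sets M"
    proof (cases "j \<in> states")
      case False
      then have "{\<omega> \<in> paths. post_jump \<omega> n = j} = space M - (\<Union>k\<in>states. {\<omega> \<in> paths. post_jump \<omega> n = k})"
        by (auto simp: space_M states_iff)
      also have "\<dots> \<in> sets M" using X_eq by (intro sets.Diff sets.top sets.countable_UN') auto
      finally show ?thesis .
    qed (rule X_eq)
    finally show "(\<lambda>\<omega>. post_jump \<omega> n) -` {j} \<inter> space M \<in> sets M" .
  qed auto
  have S [measurable]: "(\<lambda>\<omega>. sojourn \<omega> n) \<in> borel_measurable M" for n
  proof -
    have eq: "sojourn \<omega> n = (if jump_time \<omega> n = \<infinity> then \<infinity> else jump_time \<omega> (Suc n) - jump_time \<omega> n)"
      if "\<omega> \<in> space M" for \<omega>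
      using that by (simp add: space_M jump_time_Suc jump_time_infinite_imp_cemetery(2))
    show ?thesis by (subst measurable_cong[OF eq]) measurable
  qed
  have "(\<lambda>\<omega>. \<omega>) \<in> M \<rightarrow>\<^sub>M path_space"
  proof (rule measurable_into_path_space)
    fix n
    have "(\<lambda>\<omega>. (post_jump \<omega> n, sojourn \<omega> n)) \<in> M \<rightarrow>\<^sub>M count_space UNIV \<Otimes>\<^sub>M borel" by measurable
    then show "(\<lambda>\<omega>. \<omega> n) \<in> M \<rightarrow>\<^sub>M count_space UNIV \<Otimes>\<^sub>M borel" by (simp add: post_jump_def sojourn_def)
  qed (simp add: space_M)
  then have *: "(\<lambda>\<omega>. \<omega>) -` A \<inter> space M \<in> sets M" if "A \<in> sets path_space" for A
    using that by (rule measurable_sets)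
  have "A \<in> sets M" if "A \<in> sets path_space" for A
  proof -
    have "(\<lambda>\<omega>. \<omega>) -` A \<inter> space M = A" using sets.sets_into_space[OF that] by (auto simp: space_M)
    then show ?thesis using *[OF that] by (simp only:)
  qed
  then show "sets path_space \<subseteq> sigma_sets paths ?G" unfolding sets_M by blast
qed

lemma emeasure_partition_nat:
  fixes X :: "'a \<Rightarrow> nat"
  assumes "X \<in> M \<rightarrow>\<^sub>M count_space UNIV" "A \<in> sets M"
  shows "emeasure M A = (\<Sum>x. emeasure M {\<omega>\<in>A. X \<omega> = x})"
proof -
  have eq: "{\<omega>\<in>A. X \<omega> = x} = A \<inter> (X -` {x} \<inter> space M)" for x
    using sets.sets_into_space[OF assms(2)] by auto
  have "(\<Sum>x. emeasure M {\<omega>\<in>A. X \<omega> = x}) = emeasure M (\<Union>x. {\<omega>\<in>A. X \<omega> = x})"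
  proof (rule suminf_emeasure)
    show "range (\<lambda>x. {\<omega>\<in>A. X \<omega> = x}) \<subseteq> sets M"
      unfolding eq using assms by (auto intro!: sets.Int measurable_sets)
  qed (auto simp: disjoint_family_on_def)
  also have "(\<Union>x. {\<omega>\<in>A. X \<omega> = x}) = A" by auto
  finally show ?thesis ..
qed

text \<open>Once jump \<open>n\<close> is at most \<open>r\<close>, so are all earlier jumps, and
  each constraint becomes a generator of \<open>history r\<close>. The truncation
  \<open>max 0\<close> is there because generators use nonnegative times.\<close>

lemma cylinder_history:
  assumes "0 \<le> r"
  shows "{\<omega> \<in> cylinder n B s. jump_time \<omega> n \<le> ennreal r} \<in> sets (history r)"
proof -
  have E: "{\<omega> \<in> paths. jump_time \<omega> k \<le> ennreal (min (max 0 (s k)) r) \<and> post_jump \<omega> k = j} \<in> sets (history r)" for k j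
    unfolding sets_history
  proof (rule sigma_sets.Basic, intro CollectI exI conjI)
    show "0 \<le> min (max 0 (s k)) r" "min (max 0 (s k)) r \<le> r" using assms by auto
  qed (rule refl)
  have "{\<omega> \<in> cylinder n B s. jump_time \<omega> n \<le> ennreal r} =
    (\<Inter>k\<in>{..n}. \<Union>j\<in>B k. {\<omega> \<in> paths. jump_time \<omega> k \<le> ennreal (min (max 0 (s k)) r) \<and> post_jump \<omega> k = j})"
    (is "?L = ?R")
  proof (intro equalityI subsetI)
    fix \<omega> assume \<omega>: "\<omega> \<in> ?L"
    then have "jump_time \<omega> k \<le> ennreal r" if "k \<le> n" for k
      using jump_time_mono[OF that, of \<omega>] by (auto intro: order.trans)
    then show "\<omega> \<in> ?R"
      using \<omega> by (auto simp: cylinder_def le_ennreal_min ennreal_max_0)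
  next
    fix \<omega> assume "\<omega> \<in> ?R"
    then show "\<omega> \<in> ?L"
      by (auto simp: cylinder_def le_ennreal_min ennreal_max_0)
  qed
  also have "\<dots> \<in> sets (history r)"
    by (intro sets.countable_INT' sets.countable_UN' E) (auto intro!: sets.countable_UN' E)
  finally show ?thesis .
qed

lemma predictable_product_greaterThan:
  assumes "H \<in> sets (history r)" "0 \<le> r"
  shows "H \<times> {r<..} \<in> sets predictable"
proof -
  have "H \<times> {r<..} = (\<Union>m::nat. H \<times> {r<..r + 1 + real m})"
  proof (intro equalityI subsetI)
    fix x assume "x \<in> H \<times> {r<..}"
    moreover obtain m :: nat where "snd x \<le> real m" using real_arch_simple by blast
    ultimately show "x \<in> (\<Union>m::nat. H \<times> {r<..r + 1 + real m})"
      using assms(2) by (cases x) (auto intro!: exI[of _ m])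
  qed auto
  also have "\<dots> \<in> sets predictable"
    unfolding sets_predictable
  proof (intro sigma_sets.Union sigma_sets.Basic)
    fix m :: nat
    have "0 \<le> r \<and> r < r + 1 + real m \<and> H \<in> sets (history r)" using assms by simp
    then show "H \<times> {r<..r + 1 + real m} \<in> predictable_generator"
      unfolding predictable_generator_def by blast
  qed
  finally show ?thesis .
qed

text \<open>Whenever jump \<open>n\<close> lies strictly before \<open>t\<close>, a rational
  separates the two, which writes the set as a countable union of predictable rectangles.\<close>

lemma predictable_after_stopping:
  assumes "\<And>r. 0 \<le> r \<Longrightarrow> {\<omega>\<in>H. jump_time \<omega> n \<le> ennreal r} \<in> sets (history r)"
  shows "{(\<omega>, t). \<omega> \<in> H \<and> jump_time \<omega> n < ennreal t} \<in> sets predictable"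
proof -
  have "{(\<omega>, t). \<omega> \<in> H \<and> jump_time \<omega> n < ennreal t} =
    (\<Union>r\<in>\<rat> \<inter> {0..}. {\<omega>\<in>H. jump_time \<omega> n \<le> ennreal r} \<times> {r<..})" (is "?L = ?R")
  proof (intro equalityI subsetI)
    fix x assume "x \<in> ?L"
    then obtain \<omega> t where x: "x = (\<omega>, t)" "\<omega> \<in> H" "jump_time \<omega> n < ennreal t" by auto
    then obtain \<tau> where \<tau>: "jump_time \<omega> n = ennreal \<tau>" "0 \<le> \<tau>"
      by (cases "jump_time \<omega> n") auto
    then have "\<tau> < t" using x(3) by (simp add: ennreal_less_iff)
    then obtain r where "r \<in> \<rat>" "\<tau> < r" "r < t" using Rats_dense_in_real by blast
    then show "x \<in> ?R" using x \<tau> by (auto intro!: bexI[of _ r] ennreal_leI)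
  next
    fix x assume "x \<in> ?R"
    then show "x \<in> ?L" by (auto intro: le_less_trans simp: ennreal_less_iff)
  qed
  also have "\<dots> \<in> sets predictable"
  proof (rule sets.countable_UN')
    show "countable (\<rat> \<inter> {0::real..})" using countable_rat by (rule countable_subset[rotated]) auto
    show "(\<lambda>r. {\<omega>\<in>H. jump_time \<omega> n \<le> ennreal r} \<times> {r<..}) ` (\<rat> \<inter> {0..}) \<subseteq> sets predictable"
      using predictable_product_greaterThan assms by blast
  qed
  finally show ?thesis .
qed

lemma predictable_until:
  "{(\<omega>, t). \<omega> \<in> paths \<and> 0 \<le> t \<and> ennreal t \<le> jump_time \<omega> n} \<in> sets predictable"
proof -
  have "{(\<omega>, t). \<omega> \<in> paths \<and> jump_time \<omega> n < ennreal t} \<in> sets predictable"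
  proof (rule predictable_after_stopping)
    fix r :: real assume "0 \<le> r"
    then have "(\<Union>j. {\<omega> \<in> paths. jump_time \<omega> n \<le> ennreal r \<and> post_jump \<omega> n = j}) \<in> sets (history r)"
      unfolding sets_history by (intro sigma_sets.Union sigma_sets.Basic) blast
    also have "(\<Union>j. {\<omega> \<in> paths. jump_time \<omega> n \<le> ennreal r \<and> post_jump \<omega> n = j}) = {\<omega>\<in>paths. jump_time \<omega> n \<le> ennreal r}"
      by auto
    finally show "{\<omega>\<in>paths. jump_time \<omega> n \<le> ennreal r} \<in> sets (history r)" .
  qed
  then have "space predictable - {(\<omega>, t). \<omega> \<in> paths \<and> jump_time \<omega> n < ennreal t} \<in> sets predictable"
    by (rule sets.compl_sets)
  also have "space predictable - {(\<omega>, t). \<omega> \<in> paths \<and> jump_time \<omega> n < ennreal t} =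
    {(\<omega>, t). \<omega> \<in> paths \<and> 0 \<le> t \<and> ennreal t \<le> jump_time \<omega> n}"
    by (auto simp: not_less)
  finally show ?thesis .
qed

lemma predictable_time: "paths \<times> {0..u} \<in> sets predictable" "paths \<times> {0..<u} \<in> sets predictable"
proof -
  have *: "paths \<times> {0..u} \<in> sets predictable" for u :: real
  proof (cases "0 < u")
    case True
    have "paths \<times> {0} \<in> sets predictable" "paths \<times> {0<..u} \<in> sets predictable"
      unfolding sets_predictable using sets.top[of "history 0"] True
      by (auto intro!: sigma_sets.Basic simp: predictable_generator_def)
    then have "paths \<times> {0} \<union> paths \<times> {0<..u} \<in> sets predictable" by blast
    also have "paths \<times> {0} \<union> paths \<times> {0<..u} = paths \<times> {0..u}" using True by auto
    finally show ?thesis .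
  next
    case False
    have "paths \<times> {0::real} \<in> sets predictable"
      unfolding sets_predictable using sets.top[of "history 0"]
      by (auto intro!: sigma_sets.Basic simp: predictable_generator_def)
    then show ?thesis using False by (cases "u = 0") auto
  qed
  show "paths \<times> {0..u} \<in> sets predictable" by (rule *)
  have "paths \<times> {0..<u} = (\<Union>m::nat. paths \<times> {0..u - 1 / real (Suc m)})"
  proof (intro equalityI subsetI)
    fix x assume x: "x \<in> paths \<times> {0..<u}"
    then obtain m :: nat where "inverse (real (Suc m)) < u - snd x" using reals_Archimedean[of "u - snd x"] by auto
    then show "x \<in> (\<Union>m::nat. paths \<times> {0..u - 1 / real (Suc m)})"
      using x by (cases x) (auto intro!: exI[of _ m] simp: inverse_eq_divide simp del: of_nat_Suc)
  next
    fix x assume "x \<in> (\<Union>m::nat. paths \<times> {0..u - 1 / real (Suc m)})"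
    then obtain m :: nat where m: "fst x \<in> paths" "0 \<le> snd x" "snd x \<le> u - 1 / real (Suc m)" by auto
    have "0 < 1 / real (Suc m)" by simp
    then have "snd x < u" using m(3) by linarith
    then show "x \<in> paths \<times> {0..<u}" using m by (cases x) auto
  qed
  also have "\<dots> \<in> sets predictable" using * by blast
  finally show "paths \<times> {0..<u} \<in> sets predictable" .
qed

lemma only_jump_in_interval:
  assumes \<omega>: "\<omega> \<in> paths" and m: "jump_time \<omega> (Suc m) < \<infinity>"
    and int: "jump_time \<omega> n < jump_time \<omega> (Suc m)" "jump_time \<omega> (Suc m) \<le> jump_time \<omega> (Suc n)"
  shows "m = n"
proof (rule ccontr)
  assume "m \<noteq> n"
  then consider "Suc m \<le> n" | "Suc n \<le> m" by linarith
  then show False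
  proof cases
    case 1
    then show ?thesis using jump_time_mono[OF 1, of \<omega>] int(1) by simp
  next
    case 2
    have "jump_time \<omega> m < \<infinity>"
      using m jump_time_mono[of m "Suc m" \<omega>] by (simp add: le_less_trans)
    then show ?thesis using jump_time_mono[OF 2, of \<omega>] int(2) jump_time_less_Suc[OF \<omega>, of m] by simp
  qed
qed

context jump_rates
begin

text \<open>The compensator is tested on the times in \<open>I\<close> between jump \<open>n\<close>
  and jump \<open>n + 1\<close> on a cylinder. Only jump \<open>n + 1\<close> itself can fall into
  this set, and there the current state is the fixed \<open>x\<close>, so the rate comes out of the
  integral.\<close>

lemma compensated_jump_measure:
  assumes P: "sets P = sets path_space" "prob_space P" "compensated P"
    and j: "j \<in> states" and I: "paths \<times> I \<in> sets predictable" "I \<subseteq> {0..}" "I \<in> sets borel"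
    and B: "B n = {x}"
  shows "emeasure P {\<omega>\<in>cylinder n B s. post_jump \<omega> (Suc n) = j \<and> jump_time \<omega> (Suc n) < \<infinity> \<and> enn2real (jump_time \<omega> (Suc n)) \<in> I} =
    ennreal (a x j) * (\<integral>\<^sup>+t\<in>{0<..}. indicator I t *
      emeasure P {\<omega>\<in>cylinder n B s. jump_time \<omega> n < ennreal t \<and> ennreal t \<le> jump_time \<omega> (Suc n)} \<partial>lborel)"
proof -
  interpret P: prob_space P by fact
  have space_P: "space P = paths" using sets_eq_imp_space_eq[OF P(1)] by simp
  note [measurable_cong] = P(1)
  define D where "D = {(\<omega>, t). \<omega> \<in> cylinder n B s \<and> jump_time \<omega> n < ennreal t} \<inter>
    {(\<omega>, t). \<omega> \<in> paths \<and> 0 \<le> t \<and> ennreal t \<le> jump_time \<omega> (Suc n)} \<inter> paths \<times> I"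
  have D: "D \<in> sets predictable"
    unfolding D_def by (intro sets.Int predictable_after_stopping predictable_until I cylinder_history)
  have [measurable]: "D \<in> sets (path_space \<Otimes>\<^sub>M borel)" using D sets_predictable_subset by blast
  have D_iff: "(\<omega>, t) \<in> D \<longleftrightarrow> \<omega> \<in> cylinder n B s \<and> jump_time \<omega> n < ennreal t \<and> ennreal t \<le> jump_time \<omega> (Suc n) \<and> t \<in> I" for \<omega> t
    using I(2) by (auto simp: D_def cylinder_def)
  let ?J = "{\<omega>\<in>cylinder n B s. post_jump \<omega> (Suc n) = j \<and> jump_time \<omega> (Suc n) < \<infinity> \<and> enn2real (jump_time \<omega> (Suc n)) \<in> I}"
  let ?G = "\<lambda>t. {\<omega>\<in>cylinder n B s. jump_time \<omega> n < ennreal t \<and> ennreal t \<le> jump_time \<omega> (Suc n)}"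
  have "{\<omega> \<in> space path_space. \<omega> \<in> cylinder n B s \<and> post_jump \<omega> (Suc n) = j \<and> jump_time \<omega> (Suc n) < \<infinity> \<and> enn2real (jump_time \<omega> (Suc n)) \<in> I} \<in> sets path_space"
    using I(3) by measurable
  also have "{\<omega> \<in> space path_space. \<omega> \<in> cylinder n B s \<and> post_jump \<omega> (Suc n) = j \<and> jump_time \<omega> (Suc n) < \<infinity> \<and> enn2real (jump_time \<omega> (Suc n)) \<in> I} = ?J"
    by (auto simp: cylinder_def)
  finally have J: "?J \<in> sets P" using P(1) by simp
  have G: "?G t \<in> sets P" for t
  proof -
    have "{\<omega> \<in> space path_space. \<omega> \<in> cylinder n B s \<and> jump_time \<omega> n < ennreal t \<and> ennreal t \<le> jump_time \<omega> (Suc n)} \<in> sets path_space"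
      by measurable
    also have "{\<omega> \<in> space path_space. \<omega> \<in> cylinder n B s \<and> jump_time \<omega> n < ennreal t \<and> ennreal t \<le> jump_time \<omega> (Suc n)} = ?G t"
      by (auto simp: cylinder_def)
    finally show ?thesis using P(1) by simp
  qed
  have lhs: "(\<Sum>m. if jump_time \<omega> (Suc m) < \<infinity> \<and> post_jump \<omega> (Suc m) = j
               then indicator D (\<omega>, enn2real (jump_time \<omega> (Suc m))) else 0) = (indicator ?J \<omega> :: ennreal)"
    if \<omega>: "\<omega> \<in> paths" for \<omega>
  proof -
    have "(if jump_time \<omega> (Suc m) < \<infinity> \<and> post_jump \<omega> (Suc m) = j
               then indicator D (\<omega>, enn2real (jump_time \<omega> (Suc m))) else 0) = (if m = n then indicator ?J \<omega> else 0 :: ennreal)" for m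
    proof (cases "jump_time \<omega> (Suc m) < \<infinity>")
      case True
      have D_m: "(\<omega>, enn2real (jump_time \<omega> (Suc m))) \<in> D \<longleftrightarrow> \<omega> \<in> cylinder n B s \<and>
        jump_time \<omega> n < jump_time \<omega> (Suc m) \<and> jump_time \<omega> (Suc m) \<le> jump_time \<omega> (Suc n) \<and> enn2real (jump_time \<omega> (Suc m)) \<in> I"
        using True unfolding D_iff by simp
      show ?thesis
      proof (cases "m = n")
        case m: True
        have "jump_time \<omega> n < \<infinity>" using True m jump_time_mono[of n "Suc n" \<omega>] by (simp add: le_less_trans)
        then show ?thesis using D_m True m jump_time_less_Suc[OF \<omega>, of n] by (auto simp: indicator_def)
      next
        case False
        then have "(\<omega>, enn2real (jump_time \<omega> (Suc m))) \<notin> D" using only_jump_in_interval[OF \<omega> True, of n] D_m by blast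
        then show ?thesis using False by simp
      qed
    next
      case False
      then show ?thesis by auto
    qed
    then show ?thesis by (simp only:) (subst suminf_finite[of "{n}"], auto)
  qed
  have rhs: "indicator D (\<omega>, t) * ennreal (a (Y_left \<omega> t) j) = ennreal (a x j) * indicator D (\<omega>, t)"
    if "0 < t" for \<omega> t
  proof (cases "(\<omega>, t) \<in> D")
    case True
    then have "Y_left \<omega> t = post_jump \<omega> n" using D_iff that by (intro Y_left_eqI) auto
    moreover have "post_jump \<omega> n = x" using True B unfolding D_iff cylinder_def by blast
    ultimately show ?thesis by (simp add: mult.commute)
  qed simp
  have "emeasure P ?J = (\<integral>\<^sup>+\<omega>. indicator ?J \<omega> \<partial>P)" using J by simp
  also have "\<dots> = (\<integral>\<^sup>+\<omega>. (\<Sum>m. if jump_time \<omega> (Suc m) < \<infinity> \<and> post_jump \<omega> (Suc m) = j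
               then indicator D (\<omega>, enn2real (jump_time \<omega> (Suc m))) else 0) \<partial>P)"
    by (intro nn_integral_cong) (simp only: lhs space_P)
  also have "\<dots> = (\<integral>\<^sup>+\<omega>. (\<integral>\<^sup>+t\<in>{0<..}. indicator D (\<omega>, t) * ennreal (a (Y_left \<omega> t) j) \<partial>lborel) \<partial>P)"
    using P(3) j D unfolding compensated_def by blast
  also have "\<dots> = (\<integral>\<^sup>+\<omega>. (\<integral>\<^sup>+t. ennreal (a x j) * (indicator D (\<omega>, t) * indicator {0<..} t) \<partial>lborel) \<partial>P)"
    by (intro nn_integral_cong) (simp add: rhs mult.assoc[symmetric] split: split_indicator)
  also have "\<dots> = (\<integral>\<^sup>+t. \<integral>\<^sup>+\<omega>. ennreal (a x j) * (indicator D (\<omega>, t) * indicator {0<..} t) \<partial>P \<partial>lborel)"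
  proof -
    interpret PL: pair_sigma_finite P lborel
      by (intro pair_sigma_finite.intro sigma_finite_lborel P.sigma_finite_measure_axioms)
    have [measurable]: "D \<in> sets (P \<Otimes>\<^sub>M lborel)"
      using \<open>D \<in> sets (path_space \<Otimes>\<^sub>M borel)\<close> by (simp cong: sets_pair_measure_cong add: P(1))
    show ?thesis by (rule PL.Fubini'[symmetric]) (simp add: case_prod_beta)
  qed
  also have "\<dots> = (\<integral>\<^sup>+t. ennreal (a x j) * (indicator I t * emeasure P (?G t) * indicator {0<..} t) \<partial>lborel)"
  proof (rule nn_integral_cong)
    fix t
    have "(\<integral>\<^sup>+\<omega>. ennreal (a x j) * (indicator D (\<omega>, t) * indicator {0<..} t) \<partial>P) =
      (\<integral>\<^sup>+\<omega>. ennreal (a x j) * (indicator I t * indicator {0<..} t) * indicator (?G t) \<omega> \<partial>P)"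
      by (intro nn_integral_cong) (auto simp: indicator_def D_iff)
    also have "\<dots> = ennreal (a x j) * (indicator I t * indicator {0<..} t) * emeasure P (?G t)"
      using G by (subst nn_integral_cmult_indicator) auto
    finally show "(\<integral>\<^sup>+\<omega>. ennreal (a x j) * (indicator D (\<omega>, t) * indicator {0<..} t) \<partial>P) =
      ennreal (a x j) * (indicator I t * emeasure P (?G t) * indicator {0<..} t)" by (simp add: ac_simps)
  qed
  also have "\<dots> = ennreal (a x j) * (\<integral>\<^sup>+t\<in>{0<..}. indicator I t * emeasure P (?G t) \<partial>lborel)"
  proof (rule nn_integral_cmult)
    have "(\<lambda>t. emeasure P (?G t)) \<in> borel_measurable lborel"
    proof -
      have "(\<lambda>t. \<integral>\<^sup>+\<omega>. indicator (cylinder n B s) \<omega> * (if jump_time \<omega> n < ennreal t \<and> ennreal t \<le> jump_time \<omega> (Suc n) then 1 else 0) \<partial>P) \<in> borel_measurable lborel"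
        by measurable
      moreover have "(\<integral>\<^sup>+\<omega>. indicator (cylinder n B s) \<omega> * (if jump_time \<omega> n < ennreal t \<and> ennreal t \<le> jump_time \<omega> (Suc n) then 1 else 0) \<partial>P) = emeasure P (?G t)" for t
      proof -
        have "(\<integral>\<^sup>+\<omega>. indicator (cylinder n B s) \<omega> * (if jump_time \<omega> n < ennreal t \<and> ennreal t \<le> jump_time \<omega> (Suc n) then 1 else 0) \<partial>P) = (\<integral>\<^sup>+\<omega>. indicator (?G t) \<omega> \<partial>P)"
          by (intro nn_integral_cong) (auto simp: indicator_def)
        then show ?thesis using G by simp
      qed
      ultimately show ?thesis by simp
    qed
    then show "(\<lambda>t. indicator I t * emeasure P (?G t) * indicator {0<..} t) \<in> borel_measurable lborel"
      using I(3) by measurable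
  qed
  finally show ?thesis .
qed

text \<open>Let F(t) be the mass of the paths in a cylinder of length \<open>n\<close> whose jump
  \<open>n\<close> comes before \<open>t\<close>, and G(t) the part of it that has not jumped again
  before \<open>t\<close>. The compensator says that G plus the total rate times the integral of G
  equals F. As F is known by induction, \<open>volterra_unique\<close> determines G, and the law of
  the next jump is a rate times an integral of G.\<close>

lemma emeasure_cylinder_unique:
  assumes P: "sets P = sets path_space" "prob_space P" "compensated P" "AE \<omega> in P. post_jump \<omega> 0 = i"
    and Q: "sets Q = sets path_space" "prob_space Q" "compensated Q" "AE \<omega> in Q. post_jump \<omega> 0 = i"
  shows "emeasure P (cylinder n B s) = emeasure Q (cylinder n B s)"
proof (induction n arbitrary: B s)
  case 0
  have "emeasure R (cylinder 0 B s) = (if i \<in> B 0 then 1 else 0)"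
    if "sets R = sets path_space" "prob_space R" "AE \<omega> in R. post_jump \<omega> 0 = i" for R
  proof -
    interpret R: prob_space R by fact
    have space_R: "space R = paths" using sets_eq_imp_space_eq[OF that(1)] by simp
    have iff: "\<omega> \<in> cylinder 0 B s \<longleftrightarrow> post_jump \<omega> 0 \<in> B 0" if "\<omega> \<in> space R" for \<omega>
      using that by (simp add: cylinder_def space_R)
    have "emeasure R (cylinder 0 B s) = emeasure R {\<omega>\<in>space R. i \<in> B 0}"
    proof (rule emeasure_eq_AE)
      show "AE \<omega> in R. \<omega> \<in> cylinder 0 B s \<longleftrightarrow> \<omega> \<in> {\<omega>\<in>space R. i \<in> B 0}"
        using that(3) AE_space by eventually_elim (simp add: iff)
      show "cylinder 0 B s \<in> sets R" unfolding that(1) by (rule cylinder_sets)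
    qed simp
    then show ?thesis using R.emeasure_space_1 by simp
  qed
  from this[OF P(1,2,4)] this[OF Q(1,2,4)] show ?case by simp
next
  case (Suc n)
  \<comment> \<open>Fixing the state after jump \<open>n\<close> makes the rates of the next jump
    constants.\<close>
  have *: "emeasure P {\<omega>\<in>cylinder n C s. post_jump \<omega> (Suc n) = j \<and> jump_time \<omega> (Suc n) < \<infinity> \<and> enn2real (jump_time \<omega> (Suc n)) \<in> {0..u}} =
    emeasure Q {\<omega>\<in>cylinder n C s. post_jump \<omega> (Suc n) = j \<and> jump_time \<omega> (Suc n) < \<infinity> \<and> enn2real (jump_time \<omega> (Suc n)) \<in> {0..u}}"
    if C: "C n = {x}" and j: "j \<in> states" for C x j u
  proof -
    let ?G = "\<lambda>t. {\<omega>\<in>cylinder n C s. jump_time \<omega> n < ennreal t \<and> ennreal t \<le> jump_time \<omega> (Suc n)}"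
    let ?F = "\<lambda>t. {\<omega>\<in>cylinder n C s. jump_time \<omega> n < ennreal t}"
    have cyl_space: "{\<omega>\<in>cylinder n C s. Q \<omega>} = {\<omega>\<in>space path_space. \<omega> \<in> cylinder n C s \<and> Q \<omega>}" for Q
      by (auto simp: cylinder_def)
    \<comment> \<open>The strict inequality is approached from below by cylinders that bound jump
      \<open>n\<close> by \<open>t - 1 / real (Suc m)\<close>; the induction hypothesis applies to
      these.\<close>
    have F_eq: "emeasure P (?F t) = emeasure Q (?F t)" if t: "0 < t" for t
    proof -
      let ?A = "\<lambda>m::nat. cylinder n C (s(n := min (s n) (t - 1 / real (Suc m))))"
      have le: "jump_time \<omega> n < ennreal t" if "jump_time \<omega> n \<le> ennreal (t - 1 / real (Suc m))" for \<omega> m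
      proof -
        have "ennreal (t - 1 / real (Suc m)) < ennreal t" using t by (intro ennreal_lessI) auto
        then show ?thesis using that by simp
      qed
      have A_iff: "\<omega> \<in> ?A m \<longleftrightarrow> \<omega> \<in> cylinder n C s \<and> jump_time \<omega> n \<le> ennreal (t - 1 / real (Suc m))" for \<omega> m
        unfolding cylinder_def by (auto simp: le_ennreal_min)
      have F_UN: "?F t = (\<Union>m. ?A m)"
      proof (intro equalityI subsetI)
        fix \<omega> assume \<omega>: "\<omega> \<in> ?F t"
        then obtain \<tau> where \<tau>: "jump_time \<omega> n = ennreal \<tau>" "0 \<le> \<tau>" by (cases "jump_time \<omega> n") auto
        then have "\<tau> < t" using \<omega> by (simp add: ennreal_less_iff)
        then obtain m where "inverse (real (Suc m)) < t - \<tau>" using reals_Archimedean[of "t - \<tau>"] by auto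
        then have "\<tau> \<le> t - 1 / real (Suc m)" by (simp add: inverse_eq_divide del: of_nat_Suc)
        then have "jump_time \<omega> n \<le> ennreal (t - 1 / real (Suc m))" unfolding \<tau> by (rule ennreal_leI)
        then show "\<omega> \<in> (\<Union>m. ?A m)" using \<omega> A_iff by blast
      next
        fix \<omega> assume "\<omega> \<in> (\<Union>m. ?A m)"
        then show "\<omega> \<in> ?F t" using A_iff le by blast
      qed
      have inc: "incseq ?A"
      proof (rule incseq_SucI, rule subsetI)
        fix m \<omega> assume "\<omega> \<in> ?A m"
        moreover have "ennreal (t - 1 / real (Suc m)) \<le> ennreal (t - 1 / real (Suc (Suc m)))"
          by (intro ennreal_leI diff_left_mono divide_left_mono) auto
        ultimately show "\<omega> \<in> ?A (Suc m)" unfolding A_iff using order.trans by blast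
      qed
      have "emeasure R (?F t) = (SUP m. emeasure R (?A m))" if "sets R = sets path_space" for R
      proof -
        have "range ?A \<subseteq> sets R" using that cylinder_sets by blast
        from SUP_emeasure_incseq[OF this inc] show ?thesis by (simp only: F_UN)
      qed
      from this[OF P(1)] this[OF Q(1)] show ?thesis by (simp only: Suc.IH)
    qed
    \<comment> \<open>The paths are split according to whether jump \<open>n + 1\<close> comes
      before \<open>t\<close>; the mass of those where it does is the sum of
      \<open>compensated_jump_measure\<close> over all targets.\<close>
    have volterra: "emeasure R (?G t) + ennreal (total_rate x) * (\<integral>\<^sup>+r\<in>{0<..<t}. emeasure R (?G r) \<partial>lborel) = emeasure R (?F t)"
      if R: "sets R = sets path_space" "prob_space R" "compensated R" and t: "0 < t" for R t
    proof -
      note [measurable_cong] = R(1)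
      let ?L = "{\<omega>\<in>cylinder n C s. jump_time \<omega> (Suc n) < ennreal t}"
      let ?Lj = "\<lambda>j. {\<omega>\<in>cylinder n C s. post_jump \<omega> (Suc n) = j \<and> jump_time \<omega> (Suc n) < \<infinity> \<and> enn2real (jump_time \<omega> (Suc n)) \<in> {0..<t}}"
      have fin: "jump_time \<omega> (Suc n) < \<infinity> \<and> enn2real (jump_time \<omega> (Suc n)) < t \<longleftrightarrow> jump_time \<omega> (Suc n) < ennreal t" for \<omega>
        using t by (cases "jump_time \<omega> (Suc n)") (auto simp: ennreal_less_iff)
      have L: "?L \<in> sets R"
        unfolding cyl_space R(1) by measurable
      have G: "?G t \<in> sets R" unfolding cyl_space R(1) by measurable
      have X: "(\<lambda>\<omega>. post_jump \<omega> (Suc n)) \<in> R \<rightarrow>\<^sub>M count_space UNIV" by measurable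
      have "emeasure R ?L = (\<Sum>j. emeasure R {\<omega>\<in>?L. post_jump \<omega> (Suc n) = j})"
        by (rule emeasure_partition_nat[OF X L])
      also have "\<dots> = (\<Sum>j. ennreal (a x j) * (\<integral>\<^sup>+r\<in>{0<..<t}. emeasure R (?G r) \<partial>lborel))"
      proof (rule suminf_cong)
        fix j
        have eq: "{\<omega>\<in>?L. post_jump \<omega> (Suc n) = j} = ?Lj j" using fin by auto
        show "emeasure R {\<omega>\<in>?L. post_jump \<omega> (Suc n) = j} = ennreal (a x j) * (\<integral>\<^sup>+r\<in>{0<..<t}. emeasure R (?G r) \<partial>lborel)"
        proof (cases "j \<in> states")
          case True
          have "(\<integral>\<^sup>+r\<in>{0<..}. indicator {0..<t} r * emeasure R (?G r) \<partial>lborel) = (\<integral>\<^sup>+r\<in>{0<..<t}. emeasure R (?G r) \<partial>lborel)"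
            by (intro nn_integral_cong) (auto split: split_indicator)
          then show ?thesis
            unfolding eq using compensated_jump_measure[where B=C and n=n and x=x and s=s and I="{0..<t}", OF R True predictable_time(2) _ _ C]
            by (simp add: subset_iff)
        next
          case False
          have "\<not> jump_time \<omega> (Suc n) < \<infinity>" if "\<omega> \<in> paths" "post_jump \<omega> (Suc n) = j" for \<omega>
            using jump_time_finite_imp_states[OF that(1), of "Suc n"] that(2) False by blast
          then have "?Lj j = {}" unfolding cylinder_def by blast
          then have "emeasure R {\<omega>\<in>?L. post_jump \<omega> (Suc n) = j} = 0" unfolding eq by (simp only: emeasure_empty)
          moreover have "a x j = 0" using False rate_to_cemetery states_iff by blast
          ultimately show ?thesis by (simp only: ennreal_0 mult_zero_left)
        qed
      qed
      also have "\<dots> = ennreal (total_rate x) * (\<integral>\<^sup>+r\<in>{0<..<t}. emeasure R (?G r) \<partial>lborel)"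
        by (simp add: ennreal_suminf_multc suminf_rates)
      finally have L_eq: "emeasure R ?L = ennreal (total_rate x) * (\<integral>\<^sup>+r\<in>{0<..<t}. emeasure R (?G r) \<partial>lborel)" .
      have "?F t = ?G t \<union> ?L"
        using le_less_trans[OF jump_time_mono[of n "Suc n"]] by (auto simp: not_le)
      moreover have "?G t \<inter> ?L = {}" by auto
      ultimately show ?thesis using plus_emeasure[OF G L] L_eq by simp
    qed
    have meas: "(\<lambda>t. emeasure R (?G t)) \<in> borel_measurable borel" and le_1: "\<And>t. emeasure R (?G t) \<le> 1"
      if R: "sets R = sets path_space" "prob_space R" for R
    proof -
      interpret R: prob_space R by fact
      note [measurable_cong] = R(1)
      have G: "?G t \<in> sets R" for t unfolding cyl_space R(1) by measurable
      have "(\<lambda>t. \<integral>\<^sup>+\<omega>. indicator (cylinder n C s) \<omega> * (if jump_time \<omega> n < ennreal t \<and> ennreal t \<le> jump_time \<omega> (Suc n) then 1 else 0) \<partial>R) \<in> borel_measurable borel"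
        by measurable
      moreover have "(\<integral>\<^sup>+\<omega>. indicator (cylinder n C s) \<omega> * (if jump_time \<omega> n < ennreal t \<and> ennreal t \<le> jump_time \<omega> (Suc n) then 1 else 0) \<partial>R) = emeasure R (?G t)" for t
      proof -
        have "(\<integral>\<^sup>+\<omega>. indicator (cylinder n C s) \<omega> * (if jump_time \<omega> n < ennreal t \<and> ennreal t \<le> jump_time \<omega> (Suc n) then 1 else 0) \<partial>R) = (\<integral>\<^sup>+\<omega>. indicator (?G t) \<omega> \<partial>R)"
          by (intro nn_integral_cong) (auto simp: indicator_def)
        then show ?thesis using G by simp
      qed
      ultimately show "(\<lambda>t. emeasure R (?G t)) \<in> borel_measurable borel" by simp
      show "\<And>t. emeasure R (?G t) \<le> 1" by (rule R.emeasure_le_1)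
    qed
    have G_eq: "emeasure P (?G t) = emeasure Q (?G t)" if "0 < t" for t
    proof (rule volterra_unique[where q = "total_rate x"])
      show "0 < t" by fact
      show "emeasure P (?G t) + ennreal (total_rate x) * (\<integral>\<^sup>+r\<in>{0<..<t}. emeasure P (?G r) \<partial>lborel) =
        emeasure Q (?G t) + ennreal (total_rate x) * (\<integral>\<^sup>+r\<in>{0<..<t}. emeasure Q (?G r) \<partial>lborel)" if "0 < t" for t
        using volterra[OF P(1-3) that] volterra[OF Q(1-3) that] F_eq[OF that] by simp
    qed (use meas[OF P(1,2)] meas[OF Q(1,2)] le_1[OF P(1,2)] le_1[OF Q(1,2)] total_rate_nonneg in auto)
    have int: "(\<integral>\<^sup>+t\<in>{0<..}. indicator {0..u} t * emeasure P (?G t) \<partial>lborel) = (\<integral>\<^sup>+t\<in>{0<..}. indicator {0..u} t * emeasure Q (?G t) \<partial>lborel)"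
      by (intro nn_integral_cong) (auto simp: G_eq split: split_indicator)
    show ?thesis
      using compensated_jump_measure[where B=C and n=n and x=x and s=s and I="{0..u}", OF P(1-3) j predictable_time(1) _ _ C]
        compensated_jump_measure[where B=C and n=n and x=x and s=s and I="{0..u}", OF Q(1-3) j predictable_time(1) _ _ C] int by simp
  qed
  let ?C = "cylinder (Suc n) B s"
  \<comment> \<open>\<open>ennreal\<close> sends a negative bound to 0, so it is replaced by 0
    before the real interval is formed.\<close>
  let ?u = "max 0 (s (Suc n))"
  have sum: "emeasure R ?C = (\<Sum>x. \<Sum>j. emeasure R {\<omega>\<in>{\<omega>\<in>?C. post_jump \<omega> n = x}. post_jump \<omega> (Suc n) = j})"
    if R: "sets R = sets path_space" for R
  proof -
    note [measurable_cong] = R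
    have C_space: "{\<omega>\<in>?C. post_jump \<omega> n = x} = {\<omega>\<in>space path_space. \<omega> \<in> ?C \<and> post_jump \<omega> n = x}" for x
      by (auto simp: cylinder_def)
    have "emeasure R ?C = (\<Sum>x. emeasure R {\<omega>\<in>?C. post_jump \<omega> n = x})"
    proof (rule emeasure_partition_nat)
      show "cylinder (Suc n) B s \<in> sets R" unfolding R by (rule cylinder_sets)
    qed measurable
    also have "\<dots> = (\<Sum>x. \<Sum>j. emeasure R {\<omega>\<in>{\<omega>\<in>?C. post_jump \<omega> n = x}. post_jump \<omega> (Suc n) = j})"
    proof (intro suminf_cong emeasure_partition_nat)
      show "{\<omega>\<in>?C. post_jump \<omega> n = x} \<in> sets R" for x
        unfolding C_space R by measurable
    qed measurable
    finally show ?thesis .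
  qed
  have "emeasure P {\<omega>\<in>{\<omega>\<in>?C. post_jump \<omega> n = x}. post_jump \<omega> (Suc n) = j} =
    emeasure Q {\<omega>\<in>{\<omega>\<in>?C. post_jump \<omega> n = x}. post_jump \<omega> (Suc n) = j}" for x j
  proof (cases "x \<in> B n \<and> j \<in> B (Suc n) \<and> j \<in> states")
    case True
    have "{\<omega>\<in>{\<omega>\<in>?C. post_jump \<omega> n = x}. post_jump \<omega> (Suc n) = j} =
      {\<omega>\<in>cylinder n (B(n := {x})) s. post_jump \<omega> (Suc n) = j \<and> jump_time \<omega> (Suc n) < \<infinity> \<and> enn2real (jump_time \<omega> (Suc n)) \<in> {0..?u}}"
    proof -
      have "jump_time \<omega> (Suc n) < \<infinity> \<and> enn2real (jump_time \<omega> (Suc n)) \<in> {0..?u} \<longleftrightarrow> jump_time \<omega> (Suc n) \<le> ennreal (s (Suc n))" for \<omega>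
      proof (cases "jump_time \<omega> (Suc n)")
        case (real r)
        have "ennreal r \<le> ennreal (s (Suc n)) \<longleftrightarrow> r \<le> ?u"
          unfolding ennreal_max_0[of "s (Suc n)", symmetric] by (rule ennreal_le_iff) simp
        then show ?thesis using real by simp
      qed (simp add: top_unique)
      moreover have "(\<forall>k\<le>Suc n. post_jump \<omega> k \<in> B k \<and> jump_time \<omega> k \<le> ennreal (s k)) \<longleftrightarrow>
        (\<forall>k\<le>n. post_jump \<omega> k \<in> B k \<and> jump_time \<omega> k \<le> ennreal (s k)) \<and> post_jump \<omega> (Suc n) \<in> B (Suc n) \<and> jump_time \<omega> (Suc n) \<le> ennreal (s (Suc n))" for \<omega>
        by (auto simp: le_Suc_eq)
      ultimately show ?thesis using True unfolding cylinder_def by (auto split: if_splits)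
    qed
    then show ?thesis using *[of "B(n := {x})" x j ?u] True by simp
  next
    case False
    have "\<not> jump_time \<omega> (Suc n) < \<infinity>" if "\<omega> \<in> paths" "post_jump \<omega> (Suc n) = j" "j \<notin> states" for \<omega>
      using jump_time_finite_imp_states[OF that(1), of "Suc n"] that(2,3) by blast
    moreover have "jump_time \<omega> (Suc n) < \<infinity>" if "\<omega> \<in> ?C" for \<omega>
      using that le_less_trans[OF _ ennreal_less_top] by (auto simp: cylinder_def)
    ultimately have "{\<omega>\<in>{\<omega>\<in>?C. post_jump \<omega> n = x}. post_jump \<omega> (Suc n) = j} = {}"
      using False unfolding cylinder_def by fastforce
    then show ?thesis by (simp only: emeasure_empty)
  qed
  then show ?case by (simp only: sum[OF P(1)] sum[OF Q(1)])
qed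

lemma compensated_unique:
  assumes P: "sets P = sets path_space" "prob_space P" "compensated P" "AE \<omega> in P. post_jump \<omega> 0 = i"
    and Q: "sets Q = sets path_space" "prob_space Q" "compensated Q" "AE \<omega> in Q. post_jump \<omega> 0 = i"
  shows "P = Q"
proof (rule measure_eqI_generator_eq[OF Int_stable_cylinders])
  show "{cylinder n B s |n B s. True} \<subseteq> Pow paths" by (auto simp: cylinder_def)
  show "sets P = sigma_sets paths {cylinder n B s |n B s. True}" "sets Q = sigma_sets paths {cylinder n B s |n B s. True}"
    using P(1) Q(1) sets_path_space_cylinders by auto
  let ?A = "\<lambda>_::nat. cylinder 0 (\<lambda>_. UNIV) (\<lambda>_. 0)"
  show "range ?A \<subseteq> {cylinder n B s |n B s. True}" by blast
  show "(\<Union>m. ?A m) = paths" by (auto simp: cylinder_def)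
  show "emeasure P (?A m) \<noteq> \<infinity>" for m
    using prob_space.emeasure_le_1[OF P(2)] by (metis ennreal_one_less_top infinity_ennreal_def leD)
qed (use emeasure_cylinder_unique[OF P Q] in auto)

end

section \<open>Supersolutions\<close>

text \<open>
  The rates \<open>a\<close> carry no diagonal; \<open>d i\<close> is the total jump rate minus the cost rate. Stating the
  inequality for all finite partial sums includes the convergence of the series.
\<close>

definition supersolution :: "(nat \<Rightarrow> nat \<Rightarrow> real) \<Rightarrow> (nat \<Rightarrow> real) \<Rightarrow> real \<Rightarrow> (nat \<Rightarrow> real) \<Rightarrow> bool"
  where "supersolution a d \<mu> \<phi> \<longleftrightarrow> (\<forall>i\<in>states. \<forall>F. finite F \<and> F \<subseteq> states \<longrightarrow>
    (\<Sum>j\<in>F. a i j * \<phi> j) \<le> (\<mu> + d i) * \<phi> i)"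

text \<open>The gap \<open>s\<close> must not depend on \<open>F\<close>: strictness of each partial
  sum alone could be lost in the limit.\<close>

definition strict_at :: "(nat \<Rightarrow> nat \<Rightarrow> real) \<Rightarrow> (nat \<Rightarrow> real) \<Rightarrow> real \<Rightarrow> (nat \<Rightarrow> real) \<Rightarrow> nat \<Rightarrow> bool"
  where "strict_at a d \<mu> \<phi> i \<longleftrightarrow> (\<exists>s>0. \<forall>F. finite F \<and> F \<subseteq> states \<longrightarrow>
    (\<Sum>j\<in>F. a i j * \<phi> j) \<le> (\<mu> + d i) * \<phi> i - s)"

definition pos_bounded :: "(nat \<Rightarrow> real) \<Rightarrow> (nat \<Rightarrow> real) \<Rightarrow> bool"
  where "pos_bounded W \<phi> \<longleftrightarrow> (\<forall>i\<in>states. 0 < \<phi> i) \<and> (\<exists>C. \<forall>i\<in>states. \<phi> i \<le> C * W i)"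

lemma supersolutionD:
  "supersolution a d \<mu> \<phi> \<Longrightarrow> i \<in> states \<Longrightarrow> finite F \<Longrightarrow> F \<subseteq> states \<Longrightarrow>
    (\<Sum>j\<in>F. a i j * \<phi> j) \<le> (\<mu> + d i) * \<phi> i"
  unfolding supersolution_def by blast

lemma supersolution_coeff_nonneg:
  assumes "supersolution a d \<mu> \<phi>" "i \<in> states" "0 < \<phi> i"
  shows "0 \<le> \<mu> + d i"
  using supersolutionD[OF assms(1,2), of "{}"] assms(3) by (simp add: zero_le_mult_iff)

lemma supersolution_scale:
  assumes "supersolution a d \<mu> \<phi>" "0 \<le> t"
  shows "supersolution a d \<mu> (\<lambda>i. t * \<phi> i)"
  unfolding supersolution_def
proof (intro ballI allI impI)
  fix i F assume iF: "i \<in> states" "finite F \<and> F \<subseteq> states"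
  have "t * (\<Sum>j\<in>F. a i j * \<phi> j) \<le> t * ((\<mu> + d i) * \<phi> i)"
    using supersolutionD[OF assms(1), of i F] iF assms(2) by (intro mult_left_mono) auto
  then show "(\<Sum>j\<in>F. a i j * (t * \<phi> j)) \<le> (\<mu> + d i) * (t * \<phi> i)"
    by (simp add: sum_distrib_left algebra_simps)
qed

text \<open>With \<open>d i\<close> the total jump rate minus the cost rate, \<open>drift\<close>
  says that \<open>W\<close>, even after the cost is added, decays at rate \<open>\<delta>\<close>
  off the finite set \<open>B\<close>. Irreducibility enters in the form \<open>reach\<close>: a set
  without \<open>i\<^sub>0\<close> that is never left is empty.\<close>

locale stable_chain =
  fixes a :: "nat \<Rightarrow> nat \<Rightarrow> real" and d W :: "nat \<Rightarrow> real" and B :: "nat set" and \<delta> K :: real and i\<^sub>0 :: nat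
  assumes rate_nonneg: "\<And>i j. i \<in> states \<Longrightarrow> j \<in> states \<Longrightarrow> 0 \<le> a i j"
    and W_ge_1: "\<And>i. i \<in> states \<Longrightarrow> 1 \<le> W i"
    and finite_B: "finite B" and B_sub: "B \<subseteq> states" and \<delta>_pos: "0 < \<delta>" and K_nonneg: "0 \<le> K"
    and drift: "\<And>i F. i \<in> states \<Longrightarrow> finite F \<Longrightarrow> F \<subseteq> states \<Longrightarrow>
      (\<Sum>j\<in>F. a i j * W j) \<le> (d i - \<delta>) * W i + K * indicator B i"
    and i0_state: "i\<^sub>0 \<in> states"
    and i0_pos: "\<And>j. j \<in> states \<Longrightarrow> j \<noteq> i\<^sub>0 \<Longrightarrow> 0 < a i\<^sub>0 j"
    and reach: "\<And>Z. Z \<subseteq> states \<Longrightarrow> i\<^sub>0 \<notin> Z \<Longrightarrow> (\<And>i j. i \<in> Z \<Longrightarrow> j \<in> states - Z \<Longrightarrow> a i j = 0) \<Longrightarrow> Z = {}"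
begin

text \<open>Slack at \<open>j\<close> allows the value at \<open>j\<close> to be lowered by some
  \<open>e\<close>; a state \<open>i\<close> with a positive rate to \<open>j\<close> then gains the
  slack \<open>a i j * e\<close>. The other inequalities survive because lowering a value only
  decreases their left sides.\<close>

lemma strict_spread:
  assumes super: "supersolution a d \<mu> m" and pb: "pos_bounded W m" and strict: "strict_at a d \<mu> m j"
    and ij: "i \<in> states" "j \<in> states" "i \<noteq> j" "0 < a i j"
  shows "\<exists>m'. supersolution a d \<mu> m' \<and> pos_bounded W m' \<and> strict_at a d \<mu> m' i"
proof -
  obtain s where s: "0 < s" "\<And>F. finite F \<Longrightarrow> F \<subseteq> states \<Longrightarrow> (\<Sum>k\<in>F. a j k * m k) \<le> (\<mu> + d j) * m j - s"
    using strict unfolding strict_at_def by blast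
  have mj: "0 < m j" and mpos: "\<And>k. k \<in> states \<Longrightarrow> 0 < m k"
    using pb ij unfolding pos_bounded_def by auto
  have coeff: "0 \<le> \<mu> + d j" using supersolution_coeff_nonneg[OF super ij(2) mj] .
  \<comment> \<open>The first bound keeps the value at \<open>j\<close> positive, the second makes
    the loss \<open>(\<mu> + d j) * e\<close> at most \<open>s\<close>; the added 1 avoids a zero
    denominator.\<close>
  define e where "e = min (m j / 2) (s / (\<mu> + d j + 1))"
  have "0 < s / (\<mu> + d j + 1)" using s(1) coeff by simp
  then have e: "0 < e" "e < m j" using mj unfolding e_def by linarith+
  have "(\<mu> + d j) * e \<le> (\<mu> + d j) * (s / (\<mu> + d j + 1))"
    using coeff by (intro mult_left_mono) (auto simp: e_def)
  also have "\<dots> \<le> s" using coeff s(1) by (simp add: field_simps)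
  finally have e2: "(\<mu> + d j) * e \<le> s" .
  define m' where "m' = m(j := m j - e)"
  have le: "m' k \<le> m k" for k using e(1) by (simp add: m'_def)
  have sum_le: "(\<Sum>k\<in>F. a x k * m' k) \<le> (\<Sum>k\<in>F. a x k * m k)" if "x \<in> states" "F \<subseteq> states" for x F
    using that by (intro sum_mono mult_left_mono le rate_nonneg) auto
  have "supersolution a d \<mu> m'"
    unfolding supersolution_def
  proof (intro ballI allI impI)
    fix x F assume x: "x \<in> states" and F: "finite F \<and> F \<subseteq> states"
    show "(\<Sum>k\<in>F. a x k * m' k) \<le> (\<mu> + d x) * m' x"
    proof (cases "x = j")
      case True
      have "(\<Sum>k\<in>F. a x k * m' k) \<le> (\<mu> + d j) * m j - s"
        using order.trans[OF sum_le[OF x] s(2)[of F, folded True]] F True by simp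
      also have "\<dots> \<le> (\<mu> + d x) * m' x"
        using e2 True by (simp add: m'_def right_diff_distrib)
      finally show ?thesis .
    next
      case False
      then have "m' x = m x" by (simp add: m'_def)
      then show ?thesis using order.trans[OF sum_le[OF x] supersolutionD[OF super x, of F]] F by simp
    qed
  qed
  moreover have "pos_bounded W m'"
    using pb e(2) order.trans[OF le] unfolding pos_bounded_def by (metis diff_gt_0_iff_gt fun_upd_apply m'_def)
  moreover have "strict_at a d \<mu> m' i"
    unfolding strict_at_def
  proof (intro exI[of _ "a i j * e"] conjI allI impI)
    show "0 < a i j * e" using ij e by simp
    fix F assume F: "finite F \<and> F \<subseteq> states"
    let ?F = "insert j F"
    have "(\<Sum>k\<in>F. a i k * m' k) \<le> (\<Sum>k\<in>?F. a i k * m' k)"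
      using F ij e rate_nonneg mpos by (intro sum_mono2) (auto simp: m'_def)
    also have "\<dots> = (\<Sum>k\<in>?F. a i k * m k - (if k = j then a i j * e else 0))"
      by (intro sum.cong) (auto simp: m'_def algebra_simps)
    also have "\<dots> = (\<Sum>k\<in>?F. a i k * m k) - a i j * e"
      using F by (subst sum_subtractf) simp
    also have "\<dots> \<le> (\<mu> + d i) * m' i - a i j * e"
      using supersolutionD[OF super ij(1), of ?F] F ij by (simp add: m'_def)
    finally show "(\<Sum>k\<in>F. a i k * m' k) \<le> (\<mu> + d i) * m' i - a i j * e" .
  qed
  ultimately show ?thesis by blast
qed

lemma strict_everywhere:
  assumes super: "supersolution a d \<mu> m" and pb: "pos_bounded W m"
    and strict: "strict_at a d \<mu> m j" and j: "j \<in> states" and i: "i \<in> states"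
  shows "\<exists>m'. supersolution a d \<mu> m' \<and> pos_bounded W m' \<and> strict_at a d \<mu> m' i"
proof -
  \<comment> \<open>The states that cannot be made strict. By \<open>strict_spread\<close> none of
    them leads outside this set, and \<open>i\<^sub>0\<close> is not among them because it is
    \<open>j\<close> or leads directly to \<open>j\<close>; so \<open>reach\<close> applies.\<close>
  define Z where "Z = {i \<in> states. \<not> (\<exists>m'. supersolution a d \<mu> m' \<and> pos_bounded W m' \<and> strict_at a d \<mu> m' i)}"
  have j_notin: "j \<notin> Z" using assms by (auto simp: Z_def)
  have "Z = {}"
  proof (rule reach)
    show "Z \<subseteq> states" by (auto simp: Z_def)
    show closed: "a x y = 0" if xy: "x \<in> Z" "y \<in> states - Z" for x y
    proof (rule ccontr)
      assume "a x y \<noteq> 0"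
      then have "0 < a x y" using rate_nonneg[of x y] that by (auto simp: Z_def less_le)
      moreover obtain m' where "supersolution a d \<mu> m'" "pos_bounded W m'" "strict_at a d \<mu> m' y"
        using xy(2) unfolding Z_def by blast
      ultimately have "x \<notin> Z" using strict_spread[of \<mu> m' y x] that by (auto simp: Z_def)
      then show False using that by simp
    qed
    show "i\<^sub>0 \<notin> Z" using closed[of i\<^sub>0 j] i0_pos[of j] j j_notin by force
  qed
  then show ?thesis using i unfolding Z_def by blast
qed

text \<open>
  Strictness in one state spreads to all states by irreducibility, and adding a small multiple of
  \<open>W\<close> then lowers the eigenvalue in all states simultaneously.
\<close>

lemma strict_improves:
  assumes super: "supersolution a d \<mu> m" and pb: "pos_bounded W m"
    and strict: "strict_at a d \<mu> m j" and j: "j \<in> states" and \<mu>: "- \<delta> < \<mu>"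
  shows "\<exists>\<mu>' m'. - \<delta> < \<mu>' \<and> \<mu>' < \<mu> \<and> supersolution a d \<mu>' m' \<and> pos_bounded W m'"
proof -
  have "\<forall>i\<in>states. \<exists>m'. supersolution a d \<mu> m' \<and> pos_bounded W m' \<and> strict_at a d \<mu> m' i"
    using strict_everywhere[OF super pb strict j] by blast
  then obtain f where f: "\<And>i. i \<in> states \<Longrightarrow> supersolution a d \<mu> (f i)"
    "\<And>i. i \<in> states \<Longrightarrow> pos_bounded W (f i)" "\<And>i. i \<in> states \<Longrightarrow> strict_at a d \<mu> (f i) i"
    by metis
  \<comment> \<open>Inserting \<open>i\<^sub>0\<close> makes the set nonempty, as required for the
    least slack and for the positivity of the sum over it.\<close>
  define B' where "B' = insert i\<^sub>0 B"
  have B': "finite B'" "B' \<subseteq> states" "B' \<noteq> {}" using finite_B B_sub i0_state by (auto simp: B'_def)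
  have "\<exists>s. \<forall>b\<in>B'. s b > 0 \<and> (\<forall>F. finite F \<and> F \<subseteq> states \<longrightarrow>
      (\<Sum>k\<in>F. a b k * f b k) \<le> (\<mu> + d b) * f b b - s b)"
    using f(3) B'(2) unfolding strict_at_def by (intro bchoice) blast
  then obtain s where s: "\<And>b. b \<in> B' \<Longrightarrow> s b > 0" "\<And>b F. b \<in> B' \<Longrightarrow> finite F \<Longrightarrow> F \<subseteq> states \<Longrightarrow>
      (\<Sum>k\<in>F. a b k * f b k) \<le> (\<mu> + d b) * f b b - s b" by blast
  define s0 where "s0 = Min (s ` B')"
  have s0: "s0 > 0" "\<And>b. b \<in> B' \<Longrightarrow> s0 \<le> s b"
    using s(1) B' by (auto simp: s0_def)
  have "\<exists>C. \<forall>b\<in>B'. \<forall>i\<in>states. f b i \<le> C b * W i"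
    using f(2) B'(2) unfolding pos_bounded_def by (intro bchoice) blast
  then obtain C where C: "\<And>b i. b \<in> B' \<Longrightarrow> i \<in> states \<Longrightarrow> f b i \<le> C b * W i" by blast
  define m1 where "m1 k = (\<Sum>b\<in>B'. f b k)" for k
  define C1 where "C1 = (\<Sum>b\<in>B'. C b)"
  have m1_le: "m1 i \<le> C1 * W i" if "i \<in> states" for i
    unfolding m1_def C1_def sum_distrib_right using C that by (intro sum_mono) auto
  have m1_pos: "0 < m1 i" if "i \<in> states" for i
    unfolding m1_def using f(2) that B' by (intro sum_pos) (auto simp: pos_bounded_def)
  have W_pos: "0 < W i" if "i \<in> states" for i using W_ge_1[OF that] by simp
  have C1_pos: "0 < C1"
    using m1_le[OF i0_state] m1_pos[OF i0_state] W_pos[OF i0_state]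
    by (smt (verit) mult_nonneg_nonneg mult_nonpos_nonneg zero_less_mult_iff)
  have swap: "(\<Sum>k\<in>F. a i k * m1 k) = (\<Sum>b\<in>B'. \<Sum>k\<in>F. a i k * f b k)" for i F
    unfolding m1_def sum_distrib_left by (rule sum.swap)
  have m1_sup: "(\<Sum>k\<in>F. a i k * m1 k) \<le> (\<mu> + d i) * m1 i - s0 * indicator B' i"
    if "i \<in> states" "finite F" "F \<subseteq> states" for i F
  proof -
    have "(\<Sum>k\<in>F. a i k * f b k) \<le> (\<mu> + d i) * f b i - (if i = b then s0 else 0)" if "b \<in> B'" for b
      using supersolutionD[OF f(1), of b i F] s(2)[of b F] s0(2)[of b] that \<open>i \<in> states\<close> \<open>finite F\<close> \<open>F \<subseteq> states\<close> B'
      by (cases "i = b") force+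
    then have "(\<Sum>k\<in>F. a i k * m1 k) \<le> (\<Sum>b\<in>B'. (\<mu> + d i) * f b i - (if i = b then s0 else 0))"
      unfolding swap by (intro sum_mono) auto
    also have "\<dots> = (\<mu> + d i) * m1 i - s0 * indicator B' i"
      unfolding m1_def sum_distrib_left using B' by (subst sum_subtractf) (simp add: indicator_def)
    finally show ?thesis .
  qed
  \<comment> \<open>Chosen with \<open>\<kappa> * K \<le> s0\<close>: the slack of \<open>m1\<close>
    on \<open>B'\<close> outweighs the excess in the drift of \<open>\<kappa> * W\<close>.\<close>
  define \<kappa> where "\<kappa> = s0 / (K + 1)"
  have \<kappa>: "0 < \<kappa>" "\<kappa> * K \<le> s0" using s0 K_nonneg by (auto simp: \<kappa>_def field_simps)
  \<comment> \<open>Adding \<open>\<kappa> * W\<close> gains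
    \<open>\<kappa> * (\<mu> + \<delta>) * W\<close>, while lowering the eigenvalue by
    \<open>\<eta>\<close> costs at most \<open>\<eta> * (C1 + \<kappa>) * W\<close>;
    \<open>\<eta>\<close> balances the two. As \<open>C1\<close> is positive,
    \<open>\<eta> < \<mu> + \<delta>\<close>, and the new eigenvalue stays above
    \<open>- \<delta>\<close>.\<close>
  define \<eta> where "\<eta> = \<kappa> * (\<mu> + \<delta>) / (C1 + \<kappa>)"
  have \<eta>: "0 < \<eta>" "\<eta> * (C1 + \<kappa>) = \<kappa> * (\<mu> + \<delta>)" using \<kappa> C1_pos \<mu> by (auto simp: \<eta>_def)
  have "\<kappa> * (\<mu> + \<delta>) < (C1 + \<kappa>) * (\<mu> + \<delta>)"
    using C1_pos \<mu> by (intro mult_strict_right_mono) auto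
  then have "\<eta> < \<mu> + \<delta>" using \<kappa> C1_pos by (simp add: \<eta>_def divide_less_eq mult.commute)
  define m2 where "m2 i = m1 i + \<kappa> * W i" for i
  have "supersolution a d (\<mu> - \<eta>) m2"
    unfolding supersolution_def
  proof (intro ballI allI impI)
    fix i F assume i: "i \<in> states" and F: "finite F \<and> F \<subseteq> states"
    have "(\<Sum>k\<in>F. a i k * m2 k) = (\<Sum>k\<in>F. a i k * m1 k) + \<kappa> * (\<Sum>k\<in>F. a i k * W k)"
      unfolding m2_def by (simp add: sum.distrib sum_distrib_left algebra_simps)
    also have "\<dots> \<le> ((\<mu> + d i) * m1 i - s0 * indicator B' i) + \<kappa> * ((d i - \<delta>) * W i + K * indicator B i)"
      using m1_sup[OF i] drift[OF i] F \<kappa> by (intro add_mono mult_left_mono) auto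
    also have "\<dots> \<le> (\<mu> + d i) * m1 i + \<kappa> * (d i - \<delta>) * W i"
      using \<kappa>(2) s0 by (auto simp: indicator_def B'_def algebra_simps)
    also have "\<dots> = (\<mu> - \<eta> + d i) * m2 i + \<eta> * m1 i + (\<eta> * \<kappa> - \<kappa> * (\<mu> + \<delta>)) * W i"
      unfolding m2_def by (simp add: algebra_simps)
    also have "\<dots> \<le> (\<mu> - \<eta> + d i) * m2 i + \<eta> * (C1 * W i) + (\<eta> * \<kappa> - \<kappa> * (\<mu> + \<delta>)) * W i"
      using m1_le[OF i] \<eta>(1) by simp
    also have "\<dots> = (\<mu> - \<eta> + d i) * m2 i + (\<eta> * (C1 + \<kappa>) - \<kappa> * (\<mu> + \<delta>)) * W i"
      by (simp add: algebra_simps)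
    finally show "(\<Sum>k\<in>F. a i k * m2 k) \<le> (\<mu> - \<eta> + d i) * m2 i" using \<eta>(2) by simp
  qed
  moreover have "pos_bounded W m2"
    unfolding pos_bounded_def
  proof (intro conjI ballI exI[of _ "C1 + \<kappa>"])
    fix i assume i: "i \<in> states"
    show "0 < m2 i" using m1_pos[OF i] W_pos[OF i] \<kappa> by (simp add: m2_def add_pos_pos)
    show "m2 i \<le> (C1 + \<kappa>) * W i" using m1_le[OF i] by (simp add: m2_def algebra_simps)
  qed
  ultimately show ?thesis using \<eta>(1) \<open>\<eta> < \<mu> + \<delta>\<close>
    by (intro exI[of _ "\<mu> - \<eta>"] exI[of _ m2]) auto
qed

text \<open>A minimum of two supersolutions is one. Off \<open>B\<close> the drift condition makes
  \<open>M * W\<close> a supersolution for every eigenvalue that is at least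
  \<open>- \<delta>\<close>, and on \<open>B\<close> the minimum is \<open>u\<close> by the choice
  of \<open>M\<close>.\<close>

lemma supersolution_truncate:
  assumes super: "supersolution a d \<mu> u" and \<mu>: "- \<delta> \<le> \<mu>"
    and M: "\<And>i. i \<in> B \<Longrightarrow> u i \<le> M * W i" "0 \<le> M"
  shows "supersolution a d \<mu> (\<lambda>i. min (u i) (M * W i))"
  unfolding supersolution_def
proof (intro ballI allI impI)
  fix i F assume i: "i \<in> states" and F: "finite F \<and> F \<subseteq> states"
  show "(\<Sum>j\<in>F. a i j * min (u j) (M * W j)) \<le> (\<mu> + d i) * min (u i) (M * W i)"
  proof (cases "u i \<le> M * W i")
    case True
    have "(\<Sum>j\<in>F. a i j * min (u j) (M * W j)) \<le> (\<Sum>j\<in>F. a i j * u j)"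
      using F i rate_nonneg by (intro sum_mono mult_left_mono) auto
    then show ?thesis using supersolutionD[OF super i, of F] F True by simp
  next
    case False
    then have "i \<notin> B" using M by auto
    have "(\<Sum>j\<in>F. a i j * min (u j) (M * W j)) \<le> (\<Sum>j\<in>F. a i j * (M * W j))"
      using F i rate_nonneg by (intro sum_mono mult_left_mono) auto
    also have "\<dots> = M * (\<Sum>j\<in>F. a i j * W j)" by (simp add: sum_distrib_left algebra_simps)
    also have "\<dots> \<le> M * ((d i - \<delta>) * W i)"
      using drift[OF i, of F] F M(2) \<open>i \<notin> B\<close> by (intro mult_left_mono) auto
    also have "\<dots> \<le> (\<mu> + d i) * (M * W i)"
      using \<mu> M(2) W_ge_1[OF i] mult_right_mono[of "- \<delta>" \<mu> "M * W i"] by (simp add: algebra_simps)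
    finally show ?thesis using False by simp
  qed
qed

text \<open>After normalization at \<open>i\<^sub>0\<close>, the row of \<open>i\<^sub>0\<close>
  bounds all functions on the finite set \<open>B\<close> by one constant, and truncation puts them
  below a common multiple of \<open>W\<close>. Their lower limit along eigenvalues decreasing to
  \<open>\<rho>\<close> is a supersolution for \<open>\<rho>\<close>; its zero set misses
  \<open>i\<^sub>0\<close> and cannot be left, hence is empty.\<close>

lemma supersolution_closed:
  assumes \<rho>: "- \<delta> \<le> \<rho>"
    and ex: "\<And>\<mu>. \<rho> < \<mu> \<Longrightarrow> \<exists>u. supersolution a d \<mu> u \<and> (\<forall>i\<in>states. 0 < u i)"
  shows "\<exists>\<psi>. supersolution a d \<rho> \<psi> \<and> pos_bounded W \<psi> \<and> \<psi> i\<^sub>0 = 1"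
proof -
  define l where "l n = \<rho> + 1 / real (Suc n)" for n
  have l: "\<rho> < l n" "l n \<le> \<rho> + 1" for n by (auto simp: l_def)
  have l_mono: "l k \<le> l n" if "n \<le> k" for n k using that by (auto simp: l_def field_simps)
  have "\<exists>u. supersolution a d (l n) u \<and> (\<forall>i\<in>states. 0 < u i) \<and> u i\<^sub>0 = 1" for n
  proof -
    obtain u where u: "supersolution a d (l n) u" "\<forall>i\<in>states. 0 < u i" using ex[OF l(1)] by blast
    have "0 < u i\<^sub>0" using u i0_state by blast
    then show ?thesis using u supersolution_scale[OF u(1), of "1 / u i\<^sub>0"]
      by (intro exI[of _ "\<lambda>i. 1 / u i\<^sub>0 * u i"]) auto
  qed
  then obtain u where u: "\<And>n. supersolution a d (l n) (u n)" "\<And>n i. i \<in> states \<Longrightarrow> 0 < u n i" "\<And>n. u n i\<^sub>0 = 1"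
    by metis
  \<comment> \<open>A single term of the row of \<open>i\<^sub>0\<close> gives
    \<open>a i\<^sub>0 b * u n b \<le> \<rho> + 1 + d i\<^sub>0\<close>, since all eigenvalues used
    are at most \<open>\<rho> + 1\<close>. The leading 1 covers
    \<open>b = i\<^sub>0\<close>.\<close>
  define M where "M = 1 + (\<Sum>b\<in>B. \<bar>(\<rho> + 1 + d i\<^sub>0) / a i\<^sub>0 b\<bar>)"
  have M1: "1 \<le> M" unfolding M_def by (simp add: sum_nonneg)
  have M: "u n b \<le> M * W b" if b: "b \<in> B" for n b
  proof -
    have "u n b \<le> M"
    proof (cases "b = i\<^sub>0")
      case False
      have bs: "b \<in> states" using b B_sub by auto
      have pos: "0 < a i\<^sub>0 b" using i0_pos[OF bs False] .
      have "a i\<^sub>0 b * u n b \<le> \<rho> + 1 + d i\<^sub>0"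
        using supersolutionD[OF u(1) i0_state, of "{b}" n] bs l(2)[of n] by (simp add: u(3))
      then have "u n b \<le> (\<rho> + 1 + d i\<^sub>0) / a i\<^sub>0 b" using pos by (simp add: field_simps)
      also have "\<dots> \<le> \<bar>(\<rho> + 1 + d i\<^sub>0) / a i\<^sub>0 b\<bar>" by (rule abs_ge_self)
      also have "\<dots> \<le> (\<Sum>b\<in>B. \<bar>(\<rho> + 1 + d i\<^sub>0) / a i\<^sub>0 b\<bar>)"
        using b finite_B by (intro member_le_sum) auto
      finally show ?thesis by (simp add: M_def)
    qed (use M1 u(3) in auto)
    also have "M \<le> M * W b" using M1 W_ge_1[of b] b B_sub by auto
    finally show ?thesis .
  qed
  define w where "w n i = min (u n i) (M * W i)" for n i
  have w_super: "supersolution a d (l n) (w n)" for n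
    unfolding w_def using l(1)[of n] \<rho> M M1 by (intro supersolution_truncate u(1)) auto
  have MW: "1 \<le> M * W i" if "i \<in> states" for i
    using mult_mono[OF M1 W_ge_1[OF that]] M1 by simp
  have w_pos: "0 < w n i" if "i \<in> states" for n i
    using u(2)[OF that, of n] MW[OF that] by (auto simp: w_def)
  have w_le: "w n i \<le> M * W i" for n i by (simp add: w_def)
  have w_i0: "w n i\<^sub>0 = 1" for n using MW[OF i0_state] by (simp add: w_def u(3))
  \<comment> \<open>An infimum over a tail is still a supersolution, for the largest eigenvalue of
    the tail. It increases with \<open>n\<close> and is bounded, so it converges to the lower limit
    in every state.\<close>
  define g where "g n i = (INF k\<in>{n..}. w k i)" for n i
  have bdd: "bdd_below ((\<lambda>k. w k i) ` {n..})" if "i \<in> states" for n i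
    using w_pos[OF that] by (intro bdd_belowI[of _ 0]) (auto intro: less_imp_le)
  have g_le: "g n i \<le> w k i" if "i \<in> states" "n \<le> k" for n k i
    unfolding g_def using bdd[OF that(1)] that(2) by (intro cINF_lower) auto
  have g_nonneg: "0 \<le> g n i" if "i \<in> states" for n i
    unfolding g_def using w_pos[OF that] by (intro cINF_greatest) (auto intro: less_imp_le)
  have g_mono: "g n i \<le> g k i" if "i \<in> states" "n \<le> k" for n k i
    unfolding g_def using bdd[OF that(1)] that(2) by (intro cINF_superset_mono) auto
  have coeff: "0 \<le> l n + d i" if "i \<in> states" for n i
    using supersolution_coeff_nonneg[OF w_super that w_pos[OF that]] .
  have g_super: "(\<Sum>j\<in>F. a i j * g n j) \<le> (l n + d i) * g n i"
    if i: "i \<in> states" and F: "finite F" "F \<subseteq> states" for n i F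
  proof -
    have *: "(\<Sum>j\<in>F. a i j * g n j) \<le> (l n + d i) * w k i" if "n \<le> k" for k
    proof -
      have "(\<Sum>j\<in>F. a i j * g n j) \<le> (\<Sum>j\<in>F. a i j * w k j)"
        using F i rate_nonneg g_le that by (intro sum_mono mult_left_mono) auto
      also have "\<dots> \<le> (l k + d i) * w k i" using supersolutionD[OF w_super i] F by blast
      also have "\<dots> \<le> (l n + d i) * w k i"
        using l_mono[OF that] w_pos[OF i, of k] by (intro mult_right_mono) auto
      finally show ?thesis .
    qed
    show ?thesis
    \<comment> \<open>Passing to the infimum divides by this coefficient; if it is zero, the bound
      for one index is already the claim.\<close>
    proof (cases "l n + d i = 0")
      case True
      then show ?thesis using *[of n] by simp
    next
      case False
      then have pos: "0 < l n + d i" using coeff[OF i, of n] by simp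
      have "(\<Sum>j\<in>F. a i j * g n j) / (l n + d i) \<le> g n i"
        unfolding g_def[of n i] using * pos by (intro cINF_greatest) (auto simp: field_simps)
      then show ?thesis using pos by (simp add: field_simps)
    qed
  qed
  define \<psi> where "\<psi> i = lim (\<lambda>n. g n i)" for i
  have lim: "(\<lambda>n. g n i) \<longlonglongrightarrow> \<psi> i" if i: "i \<in> states" for i
  proof -
    have "convergent (\<lambda>n. g n i)"
    proof (rule Bseq_mono_convergent)
      show "Bseq (\<lambda>n. g n i)"
        using g_le[OF i order.refl] w_le[of _ i] g_nonneg[OF i]
        by (intro BseqI'[of _ "M * W i"]) (auto intro: order.trans)
      show "\<forall>m n. m \<le> n \<longrightarrow> g m i \<le> g n i" using g_mono[OF i] by blast
    qed
    then show ?thesis unfolding \<psi>_def by (simp add: convergent_LIMSEQ_iff)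
  qed
  have \<psi>_super: "supersolution a d \<rho> \<psi>"
    unfolding supersolution_def
  proof (intro ballI allI impI)
    fix i F assume i: "i \<in> states" and F: "finite F \<and> F \<subseteq> states"
    have "l \<longlonglongrightarrow> \<rho> + 0" unfolding l_def
      by (intro tendsto_add tendsto_const LIMSEQ_inverse_real_of_nat[unfolded inverse_eq_divide])
    then have "(\<lambda>n. (l n + d i) * g n i) \<longlonglongrightarrow> (\<rho> + d i) * \<psi> i"
      using lim[OF i] by (auto intro!: tendsto_intros)
    moreover have "(\<lambda>n. \<Sum>j\<in>F. a i j * g n j) \<longlonglongrightarrow> (\<Sum>j\<in>F. a i j * \<psi> j)"
      using lim F by (intro tendsto_sum tendsto_mult tendsto_const) auto
    ultimately show "(\<Sum>j\<in>F. a i j * \<psi> j) \<le> (\<rho> + d i) * \<psi> i"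
      using g_super[OF i] F by (intro LIMSEQ_le) auto
  qed
  have \<psi>_i0: "\<psi> i\<^sub>0 = 1"
    using lim[OF i0_state] by (auto simp: g_def w_i0 LIMSEQ_const_iff)
  have \<psi>_nonneg: "0 \<le> \<psi> i" if "i \<in> states" for i
    using lim[OF that] g_nonneg[OF that] by (intro LIMSEQ_le_const) auto
  have \<psi>_le: "\<psi> i \<le> M * W i" if "i \<in> states" for i
    using lim[OF that] order.trans[OF g_le[OF that order.refl] w_le] by (intro LIMSEQ_le_const2) auto
  \<comment> \<open>A zero at \<open>i\<close> forces \<open>\<psi>\<close> to vanish wherever the
    rate from \<open>i\<close> is positive.\<close>
  have "{i\<in>states. \<psi> i = 0} = {}"
  proof (rule reach)
    show "i\<^sub>0 \<notin> {i\<in>states. \<psi> i = 0}" using \<psi>_i0 by auto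
    fix i j assume ij: "i \<in> {i\<in>states. \<psi> i = 0}" "j \<in> states - {i\<in>states. \<psi> i = 0}"
    then have "a i j * \<psi> j \<le> 0" using supersolutionD[OF \<psi>_super, of i "{j}"] by auto
    moreover have "0 < \<psi> j" using \<psi>_nonneg[of j] ij by auto
    ultimately show "a i j = 0" using rate_nonneg[of i j] ij by (auto simp: mult_le_0_iff)
  qed auto
  then have "pos_bounded W \<psi>"
    unfolding pos_bounded_def using \<psi>_nonneg \<psi>_le by (auto simp: less_le)
  then show ?thesis using \<psi>_super \<psi>_i0 by blast
qed

end

section \<open>The one-player control problem in deterministic form\<close>

definition off_diagonal :: "(nat \<Rightarrow> nat \<Rightarrow> 'v \<Rightarrow> real) \<Rightarrow> (nat \<Rightarrow> 'v) \<Rightarrow> nat \<Rightarrow> nat \<Rightarrow> real"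
  where "off_diagonal p v i j = (if j = i then 0 else p i j (v i))"

text \<open>Moving the diagonal and the cost to the right side turns the bound
  \<open>hjb_term p c \<phi> i (v i) \<le> \<mu> * \<phi> i\<close> into the inequality of a
  supersolution with this \<open>d\<close>.\<close>

definition diagonal_deficit :: "(nat \<Rightarrow> nat \<Rightarrow> 'v \<Rightarrow> real) \<Rightarrow> (nat \<Rightarrow> 'v \<Rightarrow> real) \<Rightarrow> (nat \<Rightarrow> 'v) \<Rightarrow> nat \<Rightarrow> real"
  where "diagonal_deficit p c v i = - p i i (v i) - c i (v i)"

text \<open>\<open>vs_optimal\<close> is all that remains of the costs of the process and of the
  Nash property. Drift and irreducibility are demanded for every selector, because the argument
  mixes selectors state by state.\<close>

locale risk_sensitive_mdp =
  fixes V :: "nat \<Rightarrow> 'v set" and p :: "nat \<Rightarrow> nat \<Rightarrow> 'v \<Rightarrow> real" and c :: "nat \<Rightarrow> 'v \<Rightarrow> real"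
    and W :: "nat \<Rightarrow> real" and i\<^sub>0 :: nat and B :: "nat set" and \<delta> K :: real and vs :: "nat \<Rightarrow> 'v"
  assumes rates_nonneg: "\<And>i j v. i \<in> states \<Longrightarrow> j \<in> states \<Longrightarrow> i \<noteq> j \<Longrightarrow> v \<in> V i \<Longrightarrow> 0 \<le> p i j v"
    and W_ge_1: "\<And>i. i \<in> states \<Longrightarrow> 1 \<le> W i"
    and W_summable: "\<And>i v. i \<in> states \<Longrightarrow> v \<in> V i \<Longrightarrow> (\<lambda>j. W j * p i j v) summable_on states"
    and finite_B: "finite B" and B_sub: "B \<subseteq> states" and \<delta>_pos: "0 < \<delta>" and K_nonneg: "0 \<le> K"
    and W_drift: "\<And>i v. i \<in> states \<Longrightarrow> v \<in> V i \<Longrightarrow>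
      hjb_term p c W i v \<le> K * indicator B i - \<delta> * W i"
    and i0_state: "i\<^sub>0 \<in> states"
    and i0_rates_pos: "\<And>j v. j \<in> states \<Longrightarrow> j \<noteq> i\<^sub>0 \<Longrightarrow> v \<in> V i\<^sub>0 \<Longrightarrow> 0 < p i\<^sub>0 j v"
    and irreducible: "\<And>v Z. (\<forall>i\<in>states. v i \<in> V i) \<Longrightarrow> Z \<subseteq> states \<Longrightarrow> i\<^sub>0 \<notin> Z \<Longrightarrow>
      (\<And>i j. i \<in> Z \<Longrightarrow> j \<in> states - Z \<Longrightarrow> p i j (v i) = 0) \<Longrightarrow> Z = {}"
    and minimizer_exists: "\<And>\<psi> i. pos_bounded W \<psi> \<Longrightarrow> i \<in> states \<Longrightarrow>
      \<exists>v\<in>V i. \<forall>v'\<in>V i. hjb_term p c \<psi> i v \<le> hjb_term p c \<psi> i v'"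
    and vs_selector: "\<forall>i\<in>states. vs i \<in> V i"
    and vs_optimal: "\<And>v \<mu> \<phi>. (\<forall>i\<in>states. v i \<in> V i) \<Longrightarrow> - \<delta> < \<mu> \<Longrightarrow> pos_bounded W \<phi> \<Longrightarrow>
      supersolution (off_diagonal p v) (diagonal_deficit p c v) \<mu> \<phi> \<Longrightarrow>
      0 \<le> \<mu> \<and> (\<forall>\<mu>'>\<mu>. \<exists>u. supersolution (off_diagonal p vs) (diagonal_deficit p c vs) \<mu>' u \<and>
        (\<forall>i\<in>states. 0 < u i))"
begin

lemma weighted_summable:
  assumes i: "i \<in> states" "v \<in> V i" and \<phi>: "\<And>j. j \<in> states \<Longrightarrow> 0 \<le> \<phi> j" "\<And>j. j \<in> states \<Longrightarrow> \<phi> j \<le> C * W j"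
  shows "(\<lambda>j. \<phi> j * p i j v) summable_on states - {i}"
proof (rule summable_on_comparison_test)
  have "(\<lambda>j. W j * p i j v) summable_on states - {i}"
    by (rule summable_on_subset_banach[OF W_summable[OF i]]) auto
  then show "(\<lambda>j. C * (W j * p i j v)) summable_on states - {i}"
    by (rule summable_on_cmult_right)
  fix j assume j: "j \<in> states - {i}"
  have "0 \<le> p i j v" using rates_nonneg i j by auto
  then show "\<phi> j * p i j v \<le> C * (W j * p i j v)"
    using \<phi>(2)[of j] j by (simp add: mult_right_mono mult.assoc[symmetric])
  show "0 \<le> \<phi> j * p i j v" using \<phi>(1)[of j] j \<open>0 \<le> p i j v\<close> by simp
qed

text \<open>Apart from the diagonal all terms are nonnegative, so the series is the supremum of its
  finite partial sums.\<close>

lemma hjb_term_le_iff: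
  assumes i: "i \<in> states" "v i \<in> V i" and \<phi>: "\<And>j. j \<in> states \<Longrightarrow> 0 \<le> \<phi> j" "\<And>j. j \<in> states \<Longrightarrow> \<phi> j \<le> C * W j"
  shows "hjb_term p c \<phi> i (v i) \<le> x \<longleftrightarrow> (\<forall>F. finite F \<and> F \<subseteq> states \<longrightarrow>
    (\<Sum>j\<in>F. off_diagonal p v i j * \<phi> j) \<le> x + diagonal_deficit p c v i * \<phi> i)"
proof -
  let ?f = "\<lambda>j. \<phi> j * p i j (v i)"
  have sm: "?f summable_on states - {i}" using weighted_summable[OF i \<phi>] by simp
  have "infsum ?f states = infsum ?f (insert i (states - {i}))" using i by (simp add: insert_absorb)
  also have "\<dots> = ?f i + infsum ?f (states - {i})"
    by (rule infsum_insert) (use sm in auto)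
  finally have eq: "hjb_term p c \<phi> i (v i) = infsum ?f (states - {i}) - diagonal_deficit p c v i * \<phi> i"
    unfolding hjb_term_def diagonal_deficit_def by (simp add: algebra_simps)
  have nonneg: "0 \<le> ?f j" if "j \<in> states - {i}" for j
    using rates_nonneg[of i j "v i"] \<phi>(1)[of j] i that by auto
  have sum_eq: "(\<Sum>j\<in>F. off_diagonal p v i j * \<phi> j) = sum ?f (F - {i})" if "finite F" for F
  proof -
    have "(\<Sum>j\<in>F. off_diagonal p v i j * \<phi> j) = (\<Sum>j\<in>F - {i}. off_diagonal p v i j * \<phi> j)"
      by (rule sum.mono_neutral_right) (use that in \<open>auto simp: off_diagonal_def\<close>)
    also have "\<dots> = sum ?f (F - {i})" by (rule sum.cong) (auto simp: off_diagonal_def)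
    finally show ?thesis .
  qed
  have "infsum ?f (states - {i}) \<le> y \<longleftrightarrow>
    (\<forall>F. finite F \<and> F \<subseteq> states \<longrightarrow> (\<Sum>j\<in>F. off_diagonal p v i j * \<phi> j) \<le> y)" for y
  proof (intro iffI allI impI)
    fix F assume le: "infsum ?f (states - {i}) \<le> y" and F: "finite F \<and> F \<subseteq> states"
    have "sum ?f (F - {i}) \<le> infsum ?f (states - {i})"
      by (rule finite_sum_le_infsum[OF sm]) (use F nonneg in auto)
    then show "(\<Sum>j\<in>F. off_diagonal p v i j * \<phi> j) \<le> y" using sum_eq F le by simp
  next
    assume *: "\<forall>F. finite F \<and> F \<subseteq> states \<longrightarrow> (\<Sum>j\<in>F. off_diagonal p v i j * \<phi> j) \<le> y"
    show "infsum ?f (states - {i}) \<le> y"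
    proof (rule infsum_le_finite_sums[OF sm])
      fix F assume F: "finite F" "F \<subseteq> states - {i}"
      then have "F - {i} = F" "F \<subseteq> states" by auto
      then show "sum ?f F \<le> y" using * F sum_eq[of F] by auto
    qed
  qed
  then show ?thesis unfolding eq by (simp add: le_diff_eq diff_le_eq)
qed

text \<open>The constants do not depend on the selector, so strictness arguments apply to mixtures
  of two strategies as well.\<close>

lemma stable_chain_selector:
  assumes v: "\<forall>i\<in>states. v i \<in> V i"
  shows "stable_chain (off_diagonal p v) (diagonal_deficit p c v) W B \<delta> K i\<^sub>0"
proof
  show "\<And>i j. i \<in> states \<Longrightarrow> j \<in> states \<Longrightarrow> 0 \<le> off_diagonal p v i j"
    using v rates_nonneg by (auto simp: off_diagonal_def)
  fix i F assume i: "i \<in> states" and F: "finite F" "F \<subseteq> states"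
  have "\<And>j. j \<in> states \<Longrightarrow> 0 \<le> W j" using W_ge_1 by force
  moreover have "v i \<in> V i" using v i by blast
  moreover have "\<And>j. j \<in> states \<Longrightarrow> W j \<le> 1 * W j" by simp
  ultimately have "(\<Sum>j\<in>F. off_diagonal p v i j * W j) \<le>
      K * indicator B i - \<delta> * W i + diagonal_deficit p c v i * W i"
    using hjb_term_le_iff[of i v W 1 "K * indicator B i - \<delta> * W i"] W_drift[OF i] i F by blast
  then show "(\<Sum>j\<in>F. off_diagonal p v i j * W j) \<le> (diagonal_deficit p c v i - \<delta>) * W i + K * indicator B i"
    by (simp add: algebra_simps)
next
  fix j assume "j \<in> states" "j \<noteq> i\<^sub>0"
  then show "0 < off_diagonal p v i\<^sub>0 j" using i0_rates_pos v i0_state by (auto simp: off_diagonal_def)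
next
  fix Z assume Z: "Z \<subseteq> states" "i\<^sub>0 \<notin> Z" "\<And>i j. i \<in> Z \<Longrightarrow> j \<in> states - Z \<Longrightarrow> off_diagonal p v i j = 0"
  show "Z = {}"
  proof (rule irreducible[OF v Z(1,2)])
    fix i j assume "i \<in> Z" "j \<in> states - Z"
    moreover from this have "j \<noteq> i" by auto
    ultimately show "p i j (v i) = 0" using Z(3)[of i j] by (simp add: off_diagonal_def)
  qed
qed (fact W_ge_1 finite_B B_sub \<delta>_pos K_nonneg i0_state)+

lemma pos_boundedD:
  assumes "pos_bounded W \<phi>"
  obtains C where "\<And>j. j \<in> states \<Longrightarrow> 0 \<le> \<phi> j" "\<And>j. j \<in> states \<Longrightarrow> \<phi> j \<le> C * W j"
  using assms unfolding pos_bounded_def by (meson less_imp_le)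

lemma supersolution_iff:
  assumes "\<forall>i\<in>states. v i \<in> V i" "pos_bounded W \<phi>"
  shows "supersolution (off_diagonal p v) (diagonal_deficit p c v) \<mu> \<phi> \<longleftrightarrow>
    (\<forall>i\<in>states. hjb_term p c \<phi> i (v i) \<le> \<mu> * \<phi> i)"
proof -
  obtain C where C: "\<And>j. j \<in> states \<Longrightarrow> 0 \<le> \<phi> j" "\<And>j. j \<in> states \<Longrightarrow> \<phi> j \<le> C * W j"
    using pos_boundedD[OF assms(2)] by blast
  have "hjb_term p c \<phi> i (v i) \<le> \<mu> * \<phi> i \<longleftrightarrow> (\<forall>F. finite F \<and> F \<subseteq> states \<longrightarrow>
    (\<Sum>j\<in>F. off_diagonal p v i j * \<phi> j) \<le> (\<mu> + diagonal_deficit p c v i) * \<phi> i)" if "i \<in> states" for i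
    using hjb_term_le_iff[of i v \<phi> C, OF that _ C] assms(1) that by (simp add: distrib_right)
  then show ?thesis unfolding supersolution_def by blast
qed

lemma strict_at_iff:
  assumes "\<forall>i\<in>states. v i \<in> V i" "pos_bounded W \<phi>" "i \<in> states"
  shows "strict_at (off_diagonal p v) (diagonal_deficit p c v) \<mu> \<phi> i \<longleftrightarrow> hjb_term p c \<phi> i (v i) < \<mu> * \<phi> i"
proof -
  obtain C where C: "\<And>j. j \<in> states \<Longrightarrow> 0 \<le> \<phi> j" "\<And>j. j \<in> states \<Longrightarrow> \<phi> j \<le> C * W j"
    using pos_boundedD[OF assms(2)] by blast
  have *: "hjb_term p c \<phi> i (v i) \<le> \<mu> * \<phi> i - s \<longleftrightarrow> (\<forall>F. finite F \<and> F \<subseteq> states \<longrightarrow>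
    (\<Sum>j\<in>F. off_diagonal p v i j * \<phi> j) \<le> (\<mu> + diagonal_deficit p c v i) * \<phi> i - s)" for s
    using hjb_term_le_iff[of i v \<phi> C "\<mu> * \<phi> i - s", OF assms(3) _ C] assms(1,3) by (simp add: algebra_simps)
  have "hjb_term p c \<phi> i (v i) < \<mu> * \<phi> i \<longleftrightarrow> (\<exists>s>0. hjb_term p c \<phi> i (v i) \<le> \<mu> * \<phi> i - s)"
    by (intro iffI exI[of _ "\<mu> * \<phi> i - hjb_term p c \<phi> i (v i)"]) auto
  then show ?thesis unfolding strict_at_def * by blast
qed

text \<open>
  The least eigenvalue \<open>\<rho>\<close> admitting a supersolution is attained by \<open>vs\<close>, with eigenfunction
  \<open>\<psi>\<close>. If the eigenfunction \<open>\<psi>\<^sub>1\<close> of the equation differed from \<open>\<psi>\<close>, then for some \<open>t\<close> the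
  minimum of \<open>\<psi>\<^sub>1\<close> and \<open>t \<psi>\<close> would be a supersolution, for the strategy that follows a minimizer
  where \<open>\<psi>\<^sub>1\<close> is smaller and \<open>vs\<close> elsewhere, which is strict in \<open>i\<^sub>0\<close> because \<open>i\<^sub>0\<close> communicates
  with all states. This contradicts the minimality of \<open>\<rho>\<close>.
\<close>

lemma optimal_strategy_minimizes:
  assumes me: "minimal_eigenpair V p c W i\<^sub>0 \<rho>1 \<psi>1" and i: "i \<in> states"
  shows "hjb_term p c \<psi>1 i (vs i) = (INF v\<in>V i. hjb_term p c \<psi>1 i v)"
proof -
  let ?sel = "\<lambda>v. \<forall>i\<in>states. v i \<in> V i"
  let ?super = "\<lambda>v. supersolution (off_diagonal p v) (diagonal_deficit p c v)"
  have ep: "eigenpair V p c W i\<^sub>0 \<rho>1 \<psi>1" using me by (simp add: minimal_eigenpair_def)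
  have \<psi>1_pos: "\<And>i. i \<in> states \<Longrightarrow> 0 < \<psi>1 i" and \<psi>1_i0: "\<psi>1 i\<^sub>0 = 1" and "0 \<le> \<rho>1"
    and \<psi>1_eq: "\<And>i. i \<in> states \<Longrightarrow> \<rho>1 * \<psi>1 i = (INF v\<in>V i. hjb_term p c \<psi>1 i v)"
    using ep by (auto simp: eigenpair_def)
  have pb1: "pos_bounded W \<psi>1"
  proof -
    obtain C where "\<And>i. i \<in> states \<Longrightarrow> \<bar>\<psi>1 i\<bar> / W i \<le> C"
      using ep unfolding eigenpair_def weighted_bounded_def bdd_above_def by auto
    then have "\<psi>1 i \<le> C * W i" if "i \<in> states" for i
      using W_ge_1[OF that] that \<psi>1_pos[OF that] by (force simp: field_simps)
    then show ?thesis using \<psi>1_pos unfolding pos_bounded_def by blast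
  qed
  have "\<forall>i\<in>states. \<exists>v. v \<in> V i \<and> (\<forall>v'\<in>V i. hjb_term p c \<psi>1 i v \<le> hjb_term p c \<psi>1 i v')"
    using minimizer_exists[OF pb1] by blast
  then obtain vh where vh: "\<And>i. i \<in> states \<Longrightarrow> vh i \<in> V i"
    "\<And>i v'. i \<in> states \<Longrightarrow> v' \<in> V i \<Longrightarrow> hjb_term p c \<psi>1 i (vh i) \<le> hjb_term p c \<psi>1 i v'"
    by metis
  have vh_eq: "hjb_term p c \<psi>1 i (vh i) = \<rho>1 * \<psi>1 i" if "i \<in> states" for i
    unfolding \<psi>1_eq[OF that] using vh that
    by (intro antisym cINF_greatest cINF_lower bdd_belowI[of _ "hjb_term p c \<psi>1 i (vh i)"]) auto
  have sel_vh: "?sel vh" using vh by blast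
  have super1: "?super vh \<rho>1 \<psi>1"
    unfolding supersolution_iff[OF sel_vh pb1] using vh_eq by simp
  \<comment> \<open>Nonnegativity makes the infimum exist; for eigenvalues above
    \<open>- \<delta>\<close> it is automatic by \<open>vs_optimal\<close>.\<close>
  define R where "R = {\<mu>. 0 \<le> \<mu> \<and> (\<exists>v \<phi>. ?sel v \<and> pos_bounded W \<phi> \<and> ?super v \<mu> \<phi>)}"
  have "\<rho>1 \<in> R" using \<open>0 \<le> \<rho>1\<close> sel_vh pb1 super1 by (auto simp: R_def)
  have bddR: "bdd_below R" by (rule bdd_belowI[of _ 0]) (simp add: R_def)
  define \<rho> where "\<rho> = Inf R"
  have \<rho>: "0 \<le> \<rho>" "\<rho> \<le> \<rho>1"
    unfolding \<rho>_def using \<open>\<rho>1 \<in> R\<close> bddR by (auto intro!: cInf_greatest cInf_lower simp: R_def)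
  interpret s: stable_chain "off_diagonal p vs" "diagonal_deficit p c vs" W B \<delta> K i\<^sub>0
    by (rule stable_chain_selector[OF vs_selector])
  \<comment> \<open>The infimum runs over all selectors, but \<open>vs_optimal\<close> transfers
    every value above it to \<open>vs\<close>.\<close>
  have "\<exists>u. ?super vs \<mu> u \<and> (\<forall>i\<in>states. 0 < u i)" if "\<rho> < \<mu>" for \<mu>
  proof -
    obtain \<mu>0 where "\<mu>0 \<in> R" "\<mu>0 < \<mu>"
      using cInf_lessD[of R \<mu>] \<open>\<rho>1 \<in> R\<close> \<open>\<rho> < \<mu>\<close> unfolding \<rho>_def by blast
    then obtain v \<phi> where "0 \<le> \<mu>0" "?sel v" "pos_bounded W \<phi>" "?super v \<mu>0 \<phi>" by (auto simp: R_def)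
    then show ?thesis using vs_optimal[of v \<mu>0 \<phi>] \<delta>_pos \<open>\<mu>0 < \<mu>\<close> by auto
  qed
  then obtain \<psi> where \<psi>: "?super vs \<rho> \<psi>" "pos_bounded W \<psi>" "\<psi> i\<^sub>0 = 1"
    using s.supersolution_closed[of \<rho>] \<rho> \<delta>_pos by auto
  \<comment> \<open>Strictness anywhere would produce an eigenvalue below \<open>\<rho>\<close> that
    still exceeds \<open>- \<delta>\<close>; by \<open>vs_optimal\<close> it is nonnegative and
    hence belongs to \<open>R\<close>.\<close>
  have no_strict: "\<not> strict_at (off_diagonal p v) (diagonal_deficit p c v) \<rho> m j"
    if v: "?sel v" "?super v \<rho> m" "pos_bounded W m" "j \<in> states" for v m j
  proof
    assume strict: "strict_at (off_diagonal p v) (diagonal_deficit p c v) \<rho> m j"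
    interpret v: stable_chain "off_diagonal p v" "diagonal_deficit p c v" W B \<delta> K i\<^sub>0
      by (rule stable_chain_selector[OF that(1)])
    obtain \<mu> m' where m': "- \<delta> < \<mu>" "\<mu> < \<rho>" "?super v \<mu> m'" "pos_bounded W m'"
      using v.strict_improves[OF v(2,3) strict v(4)] \<rho> \<delta>_pos by auto
    then have "\<mu> \<in> R" using vs_optimal[OF that(1) m'(1,4,3)] that(1) by (auto simp: R_def)
    then have "\<rho> \<le> \<mu>" unfolding \<rho>_def using bddR by (rule cInf_lower)
    then show False using m' by simp
  qed
  have \<psi>_pos: "\<And>i. i \<in> states \<Longrightarrow> 0 < \<psi> i" using \<psi>(2) by (auto simp: pos_bounded_def)
  have \<psi>_le: "hjb_term p c \<psi> i (vs i) \<le> \<rho> * \<psi> i" if "i \<in> states" for i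
    using \<psi>(1) that unfolding supersolution_iff[OF vs_selector \<psi>(2)] by blast
  \<comment> \<open>Switching to \<open>v\<close> in the single state \<open>i\<close> would give a
    selector for which \<open>\<psi>\<close> is strict at \<open>i\<close>.\<close>
  have \<psi>_ge: "\<rho> * \<psi> i \<le> hjb_term p c \<psi> i v" if iv: "i \<in> states" "v \<in> V i" for i v
  proof (rule ccontr)
    assume "\<not> ?thesis"
    then have less: "hjb_term p c \<psi> i v < \<rho> * \<psi> i" by simp
    define v' where "v' = vs(i := v)"
    have sel: "?sel v'" using vs_selector iv by (auto simp: v'_def)
    have "?super v' \<rho> \<psi>"
      unfolding supersolution_iff[OF sel \<psi>(2)] using \<psi>_le less by (auto simp: v'_def)
    moreover have "strict_at (off_diagonal p v') (diagonal_deficit p c v') \<rho> \<psi> i"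
      unfolding strict_at_iff[OF sel \<psi>(2) iv(1)] using less by (simp add: v'_def)
    ultimately show False using no_strict sel \<psi>(2) iv(1) by blast
  qed
  have "eigenpair V p c W i\<^sub>0 \<rho> \<psi>"
    unfolding eigenpair_def
  proof (intro conjI ballI)
    show "0 \<le> \<rho>" "\<psi> i\<^sub>0 = 1" by fact+
    show "0 < \<psi> i" if "i \<in> states" for i using \<psi>_pos that .
    obtain C where "\<And>j. j \<in> states \<Longrightarrow> \<psi> j \<le> C * W j" using pos_boundedD[OF \<psi>(2)] by blast
    then show "\<psi> \<in> weighted_bounded W"
      unfolding weighted_bounded_def using \<psi>_pos W_ge_1
      by (auto intro!: bdd_aboveI2[of _ _ C] simp: divide_le_eq less_le_trans[OF zero_less_one] abs_of_pos)
    fix i assume i: "i \<in> states"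
    have "(INF v\<in>V i. hjb_term p c \<psi> i v) \<le> hjb_term p c \<psi> i (vs i)"
      using \<psi>_ge[OF i] vs_selector i by (intro cINF_lower bdd_belowI[of _ "\<rho> * \<psi> i"]) auto
    moreover have "\<rho> * \<psi> i \<le> (INF v\<in>V i. hjb_term p c \<psi> i v)"
      using \<psi>_ge[OF i] vs_selector i by (intro cINF_greatest) auto
    ultimately show "\<rho> * \<psi> i = (INF v\<in>V i. hjb_term p c \<psi> i v)" using \<psi>_le[OF i] by simp
  qed
  \<comment> \<open>The only place where minimality is used; the opposite inequality holds because
    \<open>\<rho>1\<close> lies in \<open>R\<close>.\<close>
  then have \<rho>1: "\<rho>1 = \<rho>" using me \<rho> by (auto simp: minimal_eigenpair_def intro: antisym)
  \<comment> \<open>The negated inequality says that the function attaining the minimum at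
    \<open>i\<^sub>0\<close> attains it at every \<open>j\<close>. Otherwise the row of
    \<open>i\<^sub>0\<close>, whose rate to \<open>j\<close> is positive, would be strict for the
    minimum.\<close>
  have hybrid: "\<not> (min (\<psi>1 j) (t * \<psi> j) < (if \<psi>1 i\<^sub>0 \<le> t * \<psi> i\<^sub>0 then \<psi>1 j else t * \<psi> j))"
    if t: "0 < t" and j: "j \<in> states" for t j
  proof
    assume less: "min (\<psi>1 j) (t * \<psi> j) < (if \<psi>1 i\<^sub>0 \<le> t * \<psi> i\<^sub>0 then \<psi>1 j else t * \<psi> j)"
    define m where "m k = min (\<psi>1 k) (t * \<psi> k)" for k
    define v where "v k = (if \<psi>1 k \<le> t * \<psi> k then vh k else vs k)" for k
    \<comment> \<open>\<open>g i\<close> is whichever of the two functions is smaller at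
      \<open>i\<close>. Its row inequality at \<open>i\<close> holds under the action
      \<open>v i\<close>, and replacing \<open>g i\<close> by the minimum \<open>m\<close> only
      lowers the left side.\<close>
    define g where "g i k = (if \<psi>1 i \<le> t * \<psi> i then \<psi>1 k else t * \<psi> k)" for i k
    have sel: "?sel v" using vh vs_selector by (auto simp: v_def)
    have g_super: "(\<Sum>k\<in>F. off_diagonal p v i k * g i k) \<le> (\<rho> + diagonal_deficit p c v i) * m i"
      if "i \<in> states" "finite F" "F \<subseteq> states" for i F
    proof (cases "\<psi>1 i \<le> t * \<psi> i")
      case True
      then have "v i = vh i" by (simp add: v_def)
      with True show ?thesis
        using supersolutionD[OF super1 that] by (simp add: g_def m_def off_diagonal_def diagonal_deficit_def \<rho>1 cong: if_cong)
    next
      case False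
      then have "v i = vs i" by (simp add: v_def)
      with False show ?thesis
        using supersolutionD[OF supersolution_scale[OF \<psi>(1), of t] that] t
        by (simp add: g_def m_def off_diagonal_def diagonal_deficit_def cong: if_cong)
    qed
    have m_le: "m k \<le> g i k" for i k by (simp add: g_def m_def)
    interpret v: stable_chain "off_diagonal p v" "diagonal_deficit p c v" W B \<delta> K i\<^sub>0
      by (rule stable_chain_selector[OF sel])
    have sum_le: "(\<Sum>k\<in>F. off_diagonal p v i k * m k) \<le> (\<Sum>k\<in>F. off_diagonal p v i k * g i k)"
      if "i \<in> states" "F \<subseteq> states" for i F
      using that by (intro sum_mono mult_left_mono m_le v.rate_nonneg) auto
    have super: "?super v \<rho> m"
      unfolding supersolution_def using order.trans[OF sum_le g_super] by blast
    have pb: "pos_bounded W m"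
    proof -
      obtain C where "\<And>j. j \<in> states \<Longrightarrow> \<psi>1 j \<le> C * W j" using pos_boundedD[OF pb1] by blast
      then have "\<forall>j\<in>states. m j \<le> C * W j" unfolding m_def by (meson min.coboundedI1)
      moreover have "\<forall>j\<in>states. 0 < m j" using \<psi>1_pos \<psi>_pos t by (simp add: m_def)
      ultimately show ?thesis unfolding pos_bounded_def by blast
    qed
    have "j \<noteq> i\<^sub>0" using less by (auto simp: min_def split: if_splits)
    then have pos: "0 < off_diagonal p v i\<^sub>0 j" using v.i0_pos[OF j] by simp
    have gap: "m j < g i\<^sub>0 j" using less by (simp add: m_def g_def)
    have "strict_at (off_diagonal p v) (diagonal_deficit p c v) \<rho> m i\<^sub>0"
      unfolding strict_at_def
    proof (intro exI[of _ "off_diagonal p v i\<^sub>0 j * (g i\<^sub>0 j - m j)"] conjI allI impI)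
      show "0 < off_diagonal p v i\<^sub>0 j * (g i\<^sub>0 j - m j)" using pos gap by simp
      fix F assume F: "finite F \<and> F \<subseteq> states"
      let ?F = "F - {j}"
      have mj: "0 < m j" using pb j by (auto simp: pos_bounded_def)
      have "(\<Sum>k\<in>F. off_diagonal p v i\<^sub>0 k * m k) \<le> (\<Sum>k\<in>insert j F. off_diagonal p v i\<^sub>0 k * m k)"
        using F pos mj by (intro sum_mono2) (auto intro: less_imp_le)
      also have "\<dots> = off_diagonal p v i\<^sub>0 j * m j + (\<Sum>k\<in>?F. off_diagonal p v i\<^sub>0 k * m k)"
        using F by (simp add: sum.insert_remove)
      also have "\<dots> \<le> off_diagonal p v i\<^sub>0 j * m j + (\<Sum>k\<in>?F. off_diagonal p v i\<^sub>0 k * g i\<^sub>0 k)"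
        using sum_le[OF i0_state, of ?F] F by auto
      also have "\<dots> = (\<Sum>k\<in>insert j F. off_diagonal p v i\<^sub>0 k * g i\<^sub>0 k) - off_diagonal p v i\<^sub>0 j * (g i\<^sub>0 j - m j)"
        using F by (simp add: sum.insert_remove algebra_simps)
      also have "\<dots> \<le> (\<rho> + diagonal_deficit p c v i\<^sub>0) * m i\<^sub>0 - off_diagonal p v i\<^sub>0 j * (g i\<^sub>0 j - m j)"
        using g_super[OF i0_state, of "insert j F"] F j by simp
      finally show "(\<Sum>k\<in>F. off_diagonal p v i\<^sub>0 k * m k) \<le> \<dots>" .
    qed
    then show False using no_strict[OF sel super pb i0_state] by blast
  qed
  have eq: "\<psi>1 j = \<psi> j" if j: "j \<in> states" for j
  proof (rule antisym)
    \<comment> \<open>Both functions are 1 at \<open>i\<^sub>0\<close>, so \<open>1 < t\<close>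
      selects \<open>\<psi>1\<close> there and \<open>t < 1\<close> selects the multiple of
      \<open>\<psi>\<close>; letting \<open>t\<close> tend to 1 gives both inequalities.\<close>
    have "\<psi>1 j \<le> t * \<psi> j" if "1 < t" for t
      using hybrid[of t j] that j \<psi>1_i0 \<psi>(3) by (auto simp: min_def split: if_splits)
    then have "\<psi>1 j / \<psi> j \<le> t" if "1 < t" for t using that \<psi>_pos[OF j] by (simp add: divide_le_eq)
    then have "\<psi>1 j / \<psi> j \<le> 1" by (rule dense_ge)
    then show "\<psi>1 j \<le> \<psi> j" using \<psi>_pos[OF j] by (simp add: divide_le_eq)
    have "t * \<psi> j \<le> \<psi>1 j" if "0 < t" "t < 1" for t
      using hybrid[of t j] that j \<psi>1_i0 \<psi>(3) by (auto simp: min_def split: if_splits)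
    then have "t \<le> \<psi>1 j / \<psi> j" if "0 < t" "t < 1" for t using that \<psi>_pos[OF j] by (simp add: le_divide_eq)
    then have "1 \<le> \<psi>1 j / \<psi> j" by (intro dense_le_bounded[of 0 1]) auto
    then show "\<psi> j \<le> \<psi>1 j" using \<psi>_pos[OF j] by (simp add: le_divide_eq)
  qed
  have "hjb_term p c \<psi>1 i (vs i) = hjb_term p c \<psi> i (vs i)"
    unfolding hjb_term_def using eq i by (metis (no_types, lifting) infsum_cong)
  also have "\<dots> \<le> \<rho>1 * \<psi>1 i" using \<psi>_le[OF i] eq[OF i] \<rho>1 by simp
  finally have "hjb_term p c \<psi>1 i (vs i) \<le> \<rho>1 * \<psi>1 i" .
  moreover have "\<rho>1 * \<psi>1 i \<le> hjb_term p c \<psi>1 i (vs i)"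
    using vh(2)[OF i, of "vs i"] vh_eq[OF i] vs_selector i by simp
  ultimately show ?thesis using \<psi>1_eq[OF i] by simp
qed

end

section \<open>Risk-sensitive cost of a chain\<close>

lemma exp_ennreal_add: "exp_ennreal (x + y) = exp_ennreal x * exp_ennreal y"
proof (cases "x = \<infinity> \<or> y = \<infinity>")
  case True
  then show ?thesis by (auto simp: exp_ennreal_def ennreal_mult_top ennreal_top_mult)
next
  case False
  then show ?thesis
    by (simp add: exp_ennreal_def enn2real_plus less_top exp_add ennreal_mult)
qed

lemma exp_ennreal_ennreal: "0 \<le> x \<Longrightarrow> exp_ennreal (ennreal x) = ennreal (exp x)"
  by (simp add: exp_ennreal_def)

lemma exp_ennreal_0 [simp]: "exp_ennreal 0 = 1"
  by (simp add: exp_ennreal_def)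

lemma measurable_exp_ennreal [measurable]: "exp_ennreal \<in> borel_measurable borel"
  unfolding exp_ennreal_def[abs_def] by measurable

lemma exp_ennreal_ge_1: "1 \<le> exp_ennreal x"
  by (simp add: exp_ennreal_def)

lemma exp_ennreal_mono: "x \<le> y \<Longrightarrow> exp_ennreal x \<le> exp_ennreal y"
  by (auto simp: exp_ennreal_def top_unique less_top intro!: ennreal_leI enn2real_mono)

text \<open>For \<open>j\<close> in \<open>states\<close> the event is a countable union over the
  index of the current jump interval; the cemetery is the complement of these events.\<close>

lemma measurable_Y [measurable]:
  "(\<lambda>x. Y (fst x) (snd x)) \<in> path_space \<Otimes>\<^sub>M borel \<rightarrow>\<^sub>M count_space UNIV"
proof -
  let ?M = "path_space \<Otimes>\<^sub>M borel :: (path \<times> real) measure"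
  have eq: "{x \<in> space ?M. Y (fst x) (snd x) = j} = {x \<in> space ?M. \<exists>m. jump_time (fst x) m \<le> ennreal (snd x) \<and>
      ennreal (snd x) < jump_time (fst x) (Suc m) \<and> post_jump (fst x) m = j}" if "j \<in> states" for j
  proof (intro Collect_cong conj_cong refl)
    fix x assume "x \<in> space ?M"
    then have x: "fst x \<in> paths" by (auto simp: space_pair_measure)
    show "Y (fst x) (snd x) = j \<longleftrightarrow> (\<exists>m. jump_time (fst x) m \<le> ennreal (snd x) \<and>
      ennreal (snd x) < jump_time (fst x) (Suc m) \<and> post_jump (fst x) m = j)"
    proof
      assume *: "Y (fst x) (snd x) = j"
      then have "Y (fst x) (snd x) \<noteq> cemetery" using that by auto
      then obtain n where "ennreal (snd x) < jump_time (fst x) n"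
        using Y_cemetery_iff[OF x] by (auto simp: not_le)
      then obtain m where m: "jump_time (fst x) m \<le> ennreal (snd x)" "ennreal (snd x) < jump_time (fst x) (Suc m)"
        using ex_jump_interval by blast
      have "post_jump (fst x) m = j" using * Y_eqI[OF m] by (simp only:)
      with m show "\<exists>m. jump_time (fst x) m \<le> ennreal (snd x) \<and>
        ennreal (snd x) < jump_time (fst x) (Suc m) \<and> post_jump (fst x) m = j" by blast
    next
      assume "\<exists>m. jump_time (fst x) m \<le> ennreal (snd x) \<and>
        ennreal (snd x) < jump_time (fst x) (Suc m) \<and> post_jump (fst x) m = j"
      then obtain m where "jump_time (fst x) m \<le> ennreal (snd x)" "ennreal (snd x) < jump_time (fst x) (Suc m)"
        "post_jump (fst x) m = j" by blast
      then show "Y (fst x) (snd x) = j" using Y_eqI by metis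
    qed
  qed
  have states: "{x \<in> space ?M. Y (fst x) (snd x) = j} \<in> sets ?M" if "j \<in> states" for j
    unfolding eq[OF that] by measurable
  have "{x \<in> space ?M. Y (fst x) (snd x) = j} \<in> sets ?M" for j
  proof (cases "j \<in> states")
    case False
    then have "{x \<in> space ?M. Y (fst x) (snd x) = j} = space ?M - (\<Union>k\<in>states. {x \<in> space ?M. Y (fst x) (snd x) = k})"
      by (auto simp: states_iff)
    also have "\<dots> \<in> sets ?M" using states by (intro sets.Diff sets.top sets.countable_UN') auto
    finally show ?thesis .
  qed (rule states)
  moreover have "(\<lambda>x. Y (fst x) (snd x)) -` {j} \<inter> space ?M = {x \<in> space ?M. Y (fst x) (snd x) = j}" for j
    by (rule set_eqI, rule iffI) (simp_all only: vimage_eq Int_iff mem_Collect_eq singleton_iff simp_thms)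
  ultimately have "(\<lambda>x. Y (fst x) (snd x)) -` {j} \<inter> space ?M \<in> sets ?M" for j by (simp only:)
  then show ?thesis
    by (intro measurable_count_space_eq2_countable[THEN iffD2] conjI ballI) simp_all
qed

lemma measurable_Y_section [measurable]:
  assumes "\<omega> \<in> paths"
  shows "(\<lambda>t. Y \<omega> t) \<in> borel \<rightarrow>\<^sub>M count_space UNIV"
proof -
  have "(\<lambda>t. (\<omega>, t)) \<in> borel \<rightarrow>\<^sub>M path_space \<Otimes>\<^sub>M borel" using assms by (intro measurable_Pair1') simp
  from measurable_compose[OF this measurable_Y] show ?thesis by simp
qed

text \<open>The cemetery is charged whatever \<open>c\<close> prescribes there, which is zero for
  \<open>relaxed_cost\<close>.\<close>

definition accumulated :: "(nat \<Rightarrow> real) \<Rightarrow> path \<Rightarrow> real \<Rightarrow> ennreal"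
  where "accumulated c \<omega> T = (\<integral>\<^sup>+t\<in>{0..T}. ennreal (c (Y \<omega> t)) \<partial>lborel)"

lemma measurable_accumulated [measurable]:
  "(\<lambda>x. accumulated c (fst x) (snd x)) \<in> borel_measurable (path_space \<Otimes>\<^sub>M borel)"
proof -
  have *: "(\<lambda>y. Y (fst (fst y)) (snd y)) \<in> (path_space \<Otimes>\<^sub>M borel) \<Otimes>\<^sub>M lborel \<rightarrow>\<^sub>M count_space UNIV"
    by (rule measurable_compose[OF _ measurable_Y, of "\<lambda>y. (fst (fst y), snd y)", simplified]) measurable
  have "(\<lambda>y. ennreal (c (Y (fst (fst y)) (snd y))) * (if 0 \<le> snd y \<and> snd y \<le> snd (fst y) then 1 else 0)) \<in>
      borel_measurable ((path_space \<Otimes>\<^sub>M borel) \<Otimes>\<^sub>M lborel)"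
    using * by measurable
  then have "(\<lambda>x. \<integral>\<^sup>+t. ennreal (c (Y (fst x) t)) * (if 0 \<le> t \<and> t \<le> snd x then 1 else 0) \<partial>lborel) \<in> borel_measurable (path_space \<Otimes>\<^sub>M borel)"
    by (intro lborel.borel_measurable_nn_integral) (simp add: case_prod_beta)
  moreover have "(if 0 \<le> t \<and> t \<le> T then 1 else 0) = (indicator {0..T} t :: ennreal)" for t T :: real
    by (simp add: indicator_def)
  ultimately show ?thesis by (simp add: accumulated_def)
qed

lemma accumulated_mono: "S \<le> T \<Longrightarrow> accumulated c \<omega> S \<le> accumulated c \<omega> T"
  unfolding accumulated_def by (intro nn_integral_mono) (auto split: split_indicator)

lemma accumulated_path_cons_before:
  assumes "0 \<le> T" "ennreal T < \<theta>"
  shows "accumulated c (path_cons i \<theta> \<omega>) T = ennreal (c i) * ennreal T"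
proof -
  have "accumulated c (path_cons i \<theta> \<omega>) T = (\<integral>\<^sup>+t\<in>{0..T}. ennreal (c i) \<partial>lborel)"
    unfolding accumulated_def
  proof (rule nn_integral_cong)
    fix t :: real
    have "Y (path_cons i \<theta> \<omega>) t = i" if "0 \<le> t" "t \<le> T"
    proof -
      have "ennreal t < \<theta>" using assms(2) ennreal_leI[OF that(2)] by simp
      then show ?thesis using that assms by (subst Y_path_cons) (auto intro: le_less_trans)
    qed
    then show "ennreal (c (Y (path_cons i \<theta> \<omega>) t)) * indicator {0..T} t = ennreal (c i) * indicator {0..T} t"
      by (auto split: split_indicator)
  qed
  then show ?thesis using assms by (simp add: nn_integral_cmult_indicator)
qed

lemma accumulated_path_cons_after:
  assumes r: "0 < r" "r \<le> T" and \<omega>: "\<omega> \<in> paths"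
  shows "accumulated c (path_cons i (ennreal r) \<omega>) T = ennreal (c i) * ennreal r + accumulated c \<omega> (T - r)"
proof -
  note [measurable] = measurable_Y_section[OF \<omega>]
  let ?f = "\<lambda>t. ennreal (c (Y \<omega> (t - r))) * indicator {r..T} t"
  have "accumulated c (path_cons i (ennreal r) \<omega>) T =
    (\<integral>\<^sup>+t. ennreal (c i) * indicator {0..<r} t + ?f t \<partial>lborel)"
    unfolding accumulated_def
  proof (rule nn_integral_cong)
    fix t :: real
    have "Y (path_cons i (ennreal r) \<omega>) t = (if t < r then i else Y \<omega> (t - r))" if "0 \<le> t"
      using that r by (simp add: Y_path_cons ennreal_less_iff)
    then show "ennreal (c (Y (path_cons i (ennreal r) \<omega>) t)) * indicator {0..T} t = ennreal (c i) * indicator {0..<r} t + ?f t"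
      using r by (cases "0 \<le> t"; cases "t < r") (auto split: split_indicator)
  qed
  also have "\<dots> = ennreal (c i) * ennreal r + (\<integral>\<^sup>+t. ?f t \<partial>lborel)"
    using r by (subst nn_integral_add) (simp_all add: nn_integral_cmult_indicator)
  also have "(\<integral>\<^sup>+t. ?f t \<partial>lborel) = (\<integral>\<^sup>+t. ?f (r + 1 * t) \<partial>lborel)"
    by (subst nn_integral_real_affine[of ?f 1 r]) simp_all
  also have "\<dots> = accumulated c \<omega> (T - r)"
    unfolding accumulated_def by (intro nn_integral_cong) (auto split: split_indicator)
  finally show ?thesis .
qed

text \<open>A terminal function that vanishes at the cemetery removes the paths that have exploded
  by time \<open>T\<close>.\<close>

definition feynman_kac :: "(nat \<Rightarrow> real) \<Rightarrow> (nat \<Rightarrow> ennreal) \<Rightarrow> path \<Rightarrow> real \<Rightarrow> ennreal"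
  where "feynman_kac c \<phi> \<omega> T = exp_ennreal (accumulated c \<omega> T) * \<phi> (Y \<omega> T)"

lemma measurable_feynman_kac [measurable]:
  "(\<lambda>x. feynman_kac c \<phi> (fst x) (snd x)) \<in> borel_measurable (path_space \<Otimes>\<^sub>M borel)"
  unfolding feynman_kac_def by measurable

lemma measurable_feynman_kac_section [measurable]: "(\<lambda>\<omega>. feynman_kac c \<phi> \<omega> T) \<in> borel_measurable path_space"
  using measurable_compose[OF measurable_Pair2'[of T borel path_space] measurable_feynman_kac[of c \<phi>]] by simp

lemma feynman_kac_path_cons_before:
  assumes "0 \<le> T" "ennreal T < \<theta>" "0 \<le> c i"
  shows "feynman_kac c \<phi> (path_cons i \<theta> \<omega>) T = ennreal (exp (c i * T)) * \<phi> i"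
proof -
  have "0 < \<theta>" using assms(2) by (auto intro: le_less_trans)
  then show ?thesis
    using assms unfolding feynman_kac_def
    by (simp add: accumulated_path_cons_before Y_path_cons ennreal_mult[symmetric] exp_ennreal_ennreal)
qed

lemma feynman_kac_path_cons_after:
  assumes r: "0 < r" "r \<le> T" and \<omega>: "\<omega> \<in> paths" and "0 \<le> c i"
  shows "feynman_kac c \<phi> (path_cons i (ennreal r) \<omega>) T = ennreal (exp (c i * r)) * feynman_kac c \<phi> \<omega> (T - r)"
  using assms unfolding feynman_kac_def
  by (simp add: accumulated_path_cons_after Y_path_cons ennreal_mult[symmetric] exp_ennreal_ennreal exp_ennreal_add
    ennreal_less_iff mult.assoc)

context jump_rates
begin

text \<open>The renewal equation: either there is no jump up to \<open>T\<close>, or a first jump at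
  \<open>r\<close>, after which \<open>F\<close> factors into a weight and a functional
  \<open>F'\<close> of the remaining path. Keeping \<open>F\<close> and \<open>F'\<close> abstract
  covers the Feynman-Kac functional as well as its restriction to paths with few jumps.\<close>

lemma first_jump_decomposition:
  assumes i: "i \<in> states" and T: "0 \<le> T"
    and F: "F \<in> borel_measurable path_space" and F': "(\<lambda>x. F' (fst x) (snd x)) \<in> borel_measurable (path_space \<Otimes>\<^sub>M borel)"
    and b: "b \<in> borel_measurable borel"
    and before: "\<And>\<theta> \<omega>. ennreal T < \<theta> \<Longrightarrow> F (path_cons i \<theta> \<omega>) = A"
    and after: "\<And>r \<omega>. 0 < r \<Longrightarrow> r \<le> T \<Longrightarrow> \<omega> \<in> paths \<Longrightarrow> F (path_cons i (ennreal r) \<omega>) = b r * F' \<omega> (T - r)"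
  shows "(\<integral>\<^sup>+\<omega>. F \<omega> \<partial>path_law i) = ennreal (exp (- total_rate i * T)) * A +
    (\<Sum>j. ennreal (a i j) * (\<integral>\<^sup>+r\<in>{0<..T}. ennreal (exp (- total_rate i * r)) * (b r * (\<integral>\<^sup>+\<omega>. F' \<omega> (T - r) \<partial>path_law j)) \<partial>lborel))"
proof (cases "total_rate i = 0")
  case True
  then show ?thesis
    using nn_integral_path_law[OF i F] before[of \<infinity>] rate_zero[OF True] by simp
next
  case False
  then have q: "0 < total_rate i" using total_rate_nonneg[of i] by simp
  have F'_meas: "(\<lambda>\<omega>. F' \<omega> t) \<in> borel_measurable path_space" for t
    using measurable_compose[OF measurable_Pair2'[of t borel path_space] F'] by simp
  have split: "ennreal (a i j) * (\<integral>\<^sup>+r\<in>{0<..}. ennreal (exp (- total_rate i * r)) * (\<integral>\<^sup>+\<omega>. F (path_cons i (ennreal r) \<omega>) \<partial>path_law j) \<partial>lborel) =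
    ennreal (a i j) * (ennreal (exp (- total_rate i * T) / total_rate i) * A) +
    ennreal (a i j) * (\<integral>\<^sup>+r\<in>{0<..T}. ennreal (exp (- total_rate i * r)) * (b r * (\<integral>\<^sup>+\<omega>. F' \<omega> (T - r) \<partial>path_law j)) \<partial>lborel)" for j
  proof (cases "j \<in> states")
    case True
    interpret P: prob_space "path_law j" by (rule prob_space_path_law[OF True])
    have inner_before: "(\<integral>\<^sup>+\<omega>. F (path_cons i (ennreal r) \<omega>) \<partial>path_law j) = A" if "T < r" for r
      using before[of "ennreal r"] that T P.emeasure_space_1 by (simp add: ennreal_lessI)
    have inner_after: "(\<integral>\<^sup>+\<omega>. F (path_cons i (ennreal r) \<omega>) \<partial>path_law j) = b r * (\<integral>\<^sup>+\<omega>. F' \<omega> (T - r) \<partial>path_law j)"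
      if "0 < r" "r \<le> T" for r
    proof -
      have "(\<integral>\<^sup>+\<omega>. F (path_cons i (ennreal r) \<omega>) \<partial>path_law j) = (\<integral>\<^sup>+\<omega>. b r * F' \<omega> (T - r) \<partial>path_law j)"
        by (rule nn_integral_cong) (use after[OF that] in simp)
      also have "\<dots> = b r * (\<integral>\<^sup>+\<omega>. F' \<omega> (T - r) \<partial>path_law j)"
        using F'_meas by (intro nn_integral_cmult) (simp cong: measurable_cong_sets)
      finally show ?thesis .
    qed
    have meas: "(\<lambda>r. \<integral>\<^sup>+\<omega>. F' \<omega> (T - r) \<partial>path_law j) \<in> borel_measurable borel"
    proof (rule P.borel_measurable_nn_integral)
      have "(\<lambda>x. F' (snd x) (T - fst x)) \<in> borel_measurable (borel \<Otimes>\<^sub>M path_space)"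
        by (rule measurable_compose[OF _ F', of "\<lambda>x. (snd x, T - fst x)", simplified]) measurable
      then show "(\<lambda>(r, \<omega>). F' \<omega> (T - r)) \<in> borel_measurable (borel \<Otimes>\<^sub>M path_law j)"
        by (simp add: case_prod_beta cong: measurable_cong_sets sets_pair_measure_cong)
    qed
    let ?g = "\<lambda>r. ennreal (exp (- total_rate i * r)) * (b r * (\<integral>\<^sup>+\<omega>. F' \<omega> (T - r) \<partial>path_law j)) * indicator {0<..T} r"
    have "(\<integral>\<^sup>+r\<in>{0<..}. ennreal (exp (- total_rate i * r)) * (\<integral>\<^sup>+\<omega>. F (path_cons i (ennreal r) \<omega>) \<partial>path_law j) \<partial>lborel) =
      (\<integral>\<^sup>+r. (ennreal (exp (- total_rate i * r)) * indicator {T<..} r) * A + ?g r \<partial>lborel)"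
    proof (rule nn_integral_cong)
      fix r :: real
      consider "r \<le> 0" | "0 < r" "r \<le> T" | "T < r" "0 < r" using T by linarith
      then show "ennreal (exp (- total_rate i * r)) * (\<integral>\<^sup>+\<omega>. F (path_cons i (ennreal r) \<omega>) \<partial>path_law j) * indicator {0<..} r =
        (ennreal (exp (- total_rate i * r)) * indicator {T<..} r) * A + ?g r"
      proof cases
        case 2
        then show ?thesis by (simp only: inner_after[OF 2]) simp
      next
        case 3
        then show ?thesis by (simp only: inner_before[OF 3(1)]) simp
      qed (use T in simp)
    qed
    also have "\<dots> = ennreal (exp (- total_rate i * T) / total_rate i) * A + (\<integral>\<^sup>+r. ?g r \<partial>lborel)"
      unfolding nn_integral_exp_greaterThan[OF q, symmetric]
    proof (subst nn_integral_add)
      show "?g \<in> borel_measurable lborel" using meas b by measurable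
    qed (simp_all add: nn_integral_multc)
    finally show ?thesis by (simp only: distrib_left)
  next
    case False
    then have "a i j = 0" using rate_to_cemetery states_iff by blast
    then show ?thesis by simp
  qed
  have "(\<integral>\<^sup>+\<omega>. F \<omega> \<partial>path_law i) = (\<Sum>j. ennreal (a i j) * (ennreal (exp (- total_rate i * T) / total_rate i) * A)) +
    (\<Sum>j. ennreal (a i j) * (\<integral>\<^sup>+r\<in>{0<..T}. ennreal (exp (- total_rate i * r)) * (b r * (\<integral>\<^sup>+\<omega>. F' \<omega> (T - r) \<partial>path_law j)) \<partial>lborel))"
    unfolding nn_integral_path_law[OF i F] if_not_P[OF False] split by (rule suminf_add[symmetric]) auto
  also have "(\<Sum>j. ennreal (a i j) * (ennreal (exp (- total_rate i * T) / total_rate i) * A)) =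
    ennreal (total_rate i) * ennreal (exp (- total_rate i * T) / total_rate i) * A"
    by (simp add: ennreal_suminf_multc suminf_rates mult.assoc)
  also have "ennreal (total_rate i) * ennreal (exp (- total_rate i * T) / total_rate i) = ennreal (exp (- total_rate i * T))"
    using q by (simp add: ennreal_mult[symmetric])
  finally show ?thesis .
qed

lemma suminf_supersolution:
  assumes super: "supersolution a d \<mu> \<phi>" and nonneg: "\<And>j. j \<in> states \<Longrightarrow> 0 \<le> \<phi> j" and i: "i \<in> states"
  shows "(\<Sum>j. ennreal (a i j) * ennreal (\<phi> j)) \<le> ennreal ((\<mu> + d i) * \<phi> i)"
  unfolding suminf_eq_SUP
proof (rule SUP_least)
  fix n
  have "(\<Sum>j<n. ennreal (a i j) * ennreal (\<phi> j)) = (\<Sum>j\<in>{..<n} \<inter> states. ennreal (a i j) * ennreal (\<phi> j))"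
    by (rule sum.mono_neutral_right) (auto simp: states_iff rate_to_cemetery)
  also have "\<dots> = ennreal (\<Sum>j\<in>{..<n} \<inter> states. a i j * \<phi> j)"
    using rate_nonneg nonneg by (subst sum_ennreal[symmetric]) (auto simp: ennreal_mult intro!: mult_nonneg_nonneg)
  also have "\<dots> \<le> ennreal ((\<mu> + d i) * \<phi> i)"
    by (intro ennreal_leI supersolutionD[OF super i]) auto
  finally show "(\<Sum>j<n. ennreal (a i j) * ennreal (\<phi> j)) \<le> ennreal ((\<mu> + d i) * \<phi> i)" .
qed

text \<open>The bound is proved for the functional restricted to fewer than \<open>n\<close> jumps
  up to \<open>T\<close>, by induction through the renewal equation, and then extended by monotone
  convergence. For \<open>n = 0\<close> the restricted functional is 0, so the induction starts
  without an a priori bound.\<close>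

lemma feynman_kac_supersolution:
  assumes c: "\<And>j. j \<in> states \<Longrightarrow> 0 \<le> c j" and nonneg: "\<And>j. j \<in> states \<Longrightarrow> 0 \<le> \<phi> j"
    and super: "supersolution a (\<lambda>i. total_rate i - c i) \<mu> \<phi>" and i: "i \<in> states" and T: "0 \<le> T"
  shows "(\<integral>\<^sup>+\<omega>. feynman_kac c (\<lambda>j. if j = cemetery then 0 else ennreal (\<phi> j)) \<omega> T \<partial>path_law i) \<le> ennreal (exp (\<mu> * T) * \<phi> i)"
proof -
  let ?\<phi> = "\<lambda>j. if j = cemetery then 0 else ennreal (\<phi> j)"
  define f where "f n \<omega> T = feynman_kac c ?\<phi> \<omega> T * (if ennreal T < jump_time \<omega> n then 1 else 0)" for n \<omega> T
  have f_meas: "(\<lambda>x. f n (fst x) (snd x)) \<in> borel_measurable (path_space \<Otimes>\<^sub>M borel)" for n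
    unfolding f_def by measurable
  have f_meas': "(\<lambda>\<omega>. f n \<omega> t) \<in> borel_measurable path_space" for n t
    using measurable_compose[OF measurable_Pair2'[of t borel path_space] f_meas] by simp
  have bound: "(\<integral>\<^sup>+\<omega>. f n \<omega> T \<partial>path_law i) \<le> ennreal (exp (\<mu> * T) * \<phi> i)" if "i \<in> states" "0 \<le> T" for n i T
    using that
  proof (induction n arbitrary: i T)
    case 0
    then show ?case by (simp add: f_def)
  next
    case (Suc n)
    have ne: "i \<noteq> cemetery" using Suc.prems states_iff by simp
    have ci: "0 \<le> c i" and \<phi>i: "0 \<le> \<phi> i" using c nonneg Suc.prems by auto
    \<comment> \<open>Survival, cost and the growth \<open>exp (\<mu> * (T - r))\<close> combine to
      \<open>exp (\<mu> * T) * exp (- \<kappa> * r)\<close>, and the same \<open>\<kappa>\<close> is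
      the coefficient in the supersolution inequality at \<open>i\<close>.\<close>
    define \<kappa> where "\<kappa> = \<mu> + (total_rate i - c i)"
    have before: "f (Suc n) (path_cons i \<theta> \<omega>) T = ennreal (exp (c i * T)) * ennreal (\<phi> i)"
      if "ennreal T < \<theta>" for \<theta> \<omega>
    proof -
      have "ennreal T < \<theta> + jump_time \<omega> n" using that by (metis add.right_neutral add_left_mono less_le_trans zero_le)
      then show ?thesis using feynman_kac_path_cons_before[where c=c and i=i, OF Suc.prems(2) that ci] ne by (simp add: f_def)
    qed
    have after: "f (Suc n) (path_cons i (ennreal r) \<omega>) T = ennreal (exp (c i * r)) * f n \<omega> (T - r)"
      if r: "0 < r" "r \<le> T" and \<omega>: "\<omega> \<in> paths" for r \<omega>
    proof -
      have eq: "ennreal T = ennreal r + ennreal (T - r)"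
        using r by (simp add: ennreal_plus[symmetric] del: ennreal_plus)
      have "ennreal T < ennreal r + jump_time \<omega> n \<longleftrightarrow> ennreal (T - r) < jump_time \<omega> n"
        unfolding eq by (rule ennreal_add_left_cancel_less[THEN trans]) simp
      then show ?thesis
        unfolding f_def feynman_kac_path_cons_after[where c=c and i=i, OF r \<omega> ci] jump_time_path_cons by (simp only: mult.assoc)
    qed
    have "(\<integral>\<^sup>+\<omega>. f (Suc n) \<omega> T \<partial>path_law i) = ennreal (exp (- total_rate i * T)) * (ennreal (exp (c i * T)) * ennreal (\<phi> i)) +
      (\<Sum>j. ennreal (a i j) * (\<integral>\<^sup>+r\<in>{0<..T}. ennreal (exp (- total_rate i * r)) * (ennreal (exp (c i * r)) * (\<integral>\<^sup>+\<omega>. f n \<omega> (T - r) \<partial>path_law j)) \<partial>lborel))"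
      by (rule first_jump_decomposition[OF Suc.prems f_meas' f_meas _ before after]) measurable
    also have "\<dots> \<le> ennreal (exp (- total_rate i * T)) * (ennreal (exp (c i * T)) * ennreal (\<phi> i)) +
      (\<Sum>j. ennreal (a i j) * (\<integral>\<^sup>+r\<in>{0<..T}. ennreal (exp (- total_rate i * r)) * (ennreal (exp (c i * r)) * ennreal (exp (\<mu> * (T - r)) * \<phi> j)) \<partial>lborel))"
    proof (intro add_mono order.refl suminf_le)
      fix j
      show "ennreal (a i j) * (\<integral>\<^sup>+r\<in>{0<..T}. ennreal (exp (- total_rate i * r)) * (ennreal (exp (c i * r)) * (\<integral>\<^sup>+\<omega>. f n \<omega> (T - r) \<partial>path_law j)) \<partial>lborel) \<le>
        ennreal (a i j) * (\<integral>\<^sup>+r\<in>{0<..T}. ennreal (exp (- total_rate i * r)) * (ennreal (exp (c i * r)) * ennreal (exp (\<mu> * (T - r)) * \<phi> j)) \<partial>lborel)"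
      proof (cases "j \<in> states")
        case True
        show ?thesis
        proof (rule mult_left_mono[OF nn_integral_mono])
          fix r :: real
          show "ennreal (exp (- total_rate i * r)) * (ennreal (exp (c i * r)) * (\<integral>\<^sup>+\<omega>. f n \<omega> (T - r) \<partial>path_law j)) * indicator {0<..T} r \<le>
            ennreal (exp (- total_rate i * r)) * (ennreal (exp (c i * r)) * ennreal (exp (\<mu> * (T - r)) * \<phi> j)) * indicator {0<..T} r"
            using Suc.IH[OF True, of "T - r"] by (auto split: split_indicator intro!: mult_left_mono)
        qed simp
      next
        case False
        then have "a i j = 0" using rate_to_cemetery states_iff by blast
        then show ?thesis by simp
      qed
    qed auto
    also have "\<dots> = ennreal (exp (- total_rate i * T)) * (ennreal (exp (c i * T)) * ennreal (\<phi> i)) +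
      (\<Sum>j. ennreal (a i j) * ennreal (\<phi> j)) * (\<integral>\<^sup>+r\<in>{0<..T}. ennreal (exp (\<mu> * T) * exp (- \<kappa> * r)) \<partial>lborel)"
    proof -
      have "ennreal (a i j) * (\<integral>\<^sup>+r\<in>{0<..T}. ennreal (exp (- total_rate i * r)) * (ennreal (exp (c i * r)) * ennreal (exp (\<mu> * (T - r)) * \<phi> j)) \<partial>lborel) =
        ennreal (a i j) * ennreal (\<phi> j) * (\<integral>\<^sup>+r\<in>{0<..T}. ennreal (exp (\<mu> * T) * exp (- \<kappa> * r)) \<partial>lborel)" for j
      proof (cases "j \<in> states")
        case True
        have "ennreal (exp (- total_rate i * r)) * (ennreal (exp (c i * r)) * ennreal (exp (\<mu> * (T - r)) * \<phi> j)) =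
          ennreal (\<phi> j) * ennreal (exp (\<mu> * T) * exp (- \<kappa> * r))" for r
        proof -
          have "exp (- total_rate i * r) * (exp (c i * r) * (exp (\<mu> * (T - r)) * \<phi> j)) = \<phi> j * (exp (\<mu> * T) * exp (- \<kappa> * r))"
            by (simp add: \<kappa>_def exp_add[symmetric] algebra_simps)
          then show ?thesis using nonneg[OF True] by (simp only: ennreal_mult[symmetric] exp_ge_zero mult_nonneg_nonneg)
        qed
        then have "(\<integral>\<^sup>+r\<in>{0<..T}. ennreal (exp (- total_rate i * r)) * (ennreal (exp (c i * r)) * ennreal (exp (\<mu> * (T - r)) * \<phi> j)) \<partial>lborel) =
          (\<integral>\<^sup>+r. ennreal (\<phi> j) * (ennreal (exp (\<mu> * T) * exp (- \<kappa> * r)) * indicator {0<..T} r) \<partial>lborel)"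
          by (simp only: mult.assoc)
        also have "\<dots> = ennreal (\<phi> j) * (\<integral>\<^sup>+r\<in>{0<..T}. ennreal (exp (\<mu> * T) * exp (- \<kappa> * r)) \<partial>lborel)"
          by (rule nn_integral_cmult) measurable
        finally show ?thesis by (simp only: mult.assoc)
      next
        case False
        then have "a i j = 0" using rate_to_cemetery states_iff by blast
        then show ?thesis by simp
      qed
      then show ?thesis by (simp only: ennreal_suminf_multc)
    qed
    also have "\<dots> \<le> ennreal (exp (- total_rate i * T)) * (ennreal (exp (c i * T)) * ennreal (\<phi> i)) +
      ennreal (\<kappa> * \<phi> i) * (\<integral>\<^sup>+r\<in>{0<..T}. ennreal (exp (\<mu> * T) * exp (- \<kappa> * r)) \<partial>lborel)"
      using suminf_supersolution[OF super nonneg Suc.prems(1)] unfolding \<kappa>_def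
      by (intro add_mono mult_right_mono order.refl) auto
    also have "\<dots> = ennreal (exp (\<mu> * T) * \<phi> i)"
    \<comment> \<open>The integral of \<open>\<kappa> * exp (- \<kappa> * r)\<close> up to
      \<open>T\<close> is exactly what the survival term lacks. The empty partial sum in
      \<open>super\<close> shows that the other case cannot occur.\<close>
    proof (cases "0 \<le> \<kappa> * \<phi> i")
      case True
      have "ennreal (\<kappa> * \<phi> i) * (\<integral>\<^sup>+r\<in>{0<..T}. ennreal (exp (\<mu> * T) * exp (- \<kappa> * r)) \<partial>lborel) =
        (\<integral>\<^sup>+r. ennreal (\<kappa> * \<phi> i * (exp (\<mu> * T) * exp (- \<kappa> * r))) * indicator {0..T} r \<partial>lborel)"
      proof (subst nn_integral_cmult[symmetric])
        show "(\<integral>\<^sup>+r. ennreal (\<kappa> * \<phi> i) * (ennreal (exp (\<mu> * T) * exp (- \<kappa> * r)) * indicator {0<..T} r) \<partial>lborel) =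
          (\<integral>\<^sup>+r. ennreal (\<kappa> * \<phi> i * (exp (\<mu> * T) * exp (- \<kappa> * r))) * indicator {0..T} r \<partial>lborel)"
        proof (rule nn_integral_cong_AE, rule eventually_mono[OF AE_lborel_singleton[of 0]])
          fix r :: real assume "r \<noteq> 0"
          then have "indicator {0<..T} r = (indicator {0..T} r :: ennreal)" by (auto simp: indicator_def)
          then show "ennreal (\<kappa> * \<phi> i) * (ennreal (exp (\<mu> * T) * exp (- \<kappa> * r)) * indicator {0<..T} r) =
            ennreal (\<kappa> * \<phi> i * (exp (\<mu> * T) * exp (- \<kappa> * r))) * indicator {0..T} r"
            unfolding ennreal_mult'[OF True] by (simp only: mult.assoc)
        qed
      qed measurable
      also have "\<dots> = ennreal (- \<phi> i * (exp (\<mu> * T) * exp (- \<kappa> * T)) - (- \<phi> i * (exp (\<mu> * T) * exp (- \<kappa> * 0))))"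
      proof (rule nn_integral_FTC_Icc)
        show "((\<lambda>r. - \<phi> i * (exp (\<mu> * T) * exp (- \<kappa> * r))) has_real_derivative \<kappa> * \<phi> i * (exp (\<mu> * T) * exp (- \<kappa> * x))) (at x)" for x
          by (auto intro!: derivative_eq_intros)
        show "0 \<le> \<kappa> * \<phi> i * (exp (\<mu> * T) * exp (- \<kappa> * x))" for x using True by simp
      qed (use Suc.prems in auto)
      finally have int: "ennreal (\<kappa> * \<phi> i) * (\<integral>\<^sup>+r\<in>{0<..T}. ennreal (exp (\<mu> * T) * exp (- \<kappa> * r)) \<partial>lborel) =
        ennreal (\<phi> i * exp (\<mu> * T) - \<phi> i * (exp (\<mu> * T) * exp (- \<kappa> * T)))" by (simp add: algebra_simps)
      have nn: "0 \<le> \<phi> i * exp (\<mu> * T) - \<phi> i * (exp (\<mu> * T) * exp (- \<kappa> * T))"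
      proof (cases "\<phi> i = 0")
        case False
        then have "0 \<le> \<kappa>" using True \<phi>i by (simp add: zero_le_mult_iff)
        then have "exp (- \<kappa> * T) \<le> 1" using Suc.prems by simp
        then have "\<phi> i * (exp (\<mu> * T) * exp (- \<kappa> * T)) \<le> \<phi> i * (exp (\<mu> * T) * 1)"
          using \<phi>i by (intro mult_left_mono) auto
        then show ?thesis by simp
      qed simp
      have eq: "exp (- total_rate i * T) * (exp (c i * T) * \<phi> i) = \<phi> i * (exp (\<mu> * T) * exp (- \<kappa> * T))"
        by (simp add: \<kappa>_def exp_add[symmetric] algebra_simps)
      have "ennreal (exp (- total_rate i * T)) * (ennreal (exp (c i * T)) * ennreal (\<phi> i)) = ennreal (\<phi> i * (exp (\<mu> * T) * exp (- \<kappa> * T)))"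
        unfolding eq[symmetric] using \<phi>i by (simp only: ennreal_mult exp_ge_zero mult_nonneg_nonneg)
      then show ?thesis unfolding int using nn \<phi>i by (simp add: ennreal_plus[symmetric] mult.commute del: ennreal_plus)
    next
      case False
      moreover have "0 \<le> \<kappa> * \<phi> i"
        using supersolutionD[OF super Suc.prems(1), of "{}"] by (simp add: \<kappa>_def)
      ultimately show ?thesis by simp
    qed
    finally show ?case .
  qed
  \<comment> \<open>A path alive at \<open>T\<close> has some jump time beyond \<open>T\<close>;
    otherwise the terminal function vanishes and both sides are 0.\<close>
  have "feynman_kac c ?\<phi> \<omega> T = (SUP n. f n \<omega> T)" if \<omega>: "\<omega> \<in> paths" for \<omega>
  proof (cases "Y \<omega> T = cemetery")
    case True
    then show ?thesis by (simp add: f_def feynman_kac_def)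
  next
    case False
    then obtain n where "ennreal T < jump_time \<omega> n" using Y_cemetery_iff[OF \<omega>] by (auto simp: not_le)
    then have "f n \<omega> T = feynman_kac c ?\<phi> \<omega> T" by (simp add: f_def)
    then have "feynman_kac c ?\<phi> \<omega> T \<le> (SUP n. f n \<omega> T)" using SUP_upper[of n UNIV "\<lambda>n. f n \<omega> T"] by simp
    moreover have "(SUP n. f n \<omega> T) \<le> feynman_kac c ?\<phi> \<omega> T" by (rule SUP_least) (simp add: f_def)
    ultimately show ?thesis by (rule antisym)
  qed
  then have "(\<integral>\<^sup>+\<omega>. feynman_kac c ?\<phi> \<omega> T \<partial>path_law i) = (\<integral>\<^sup>+\<omega>. (SUP n. f n \<omega> T) \<partial>path_law i)"
    by (intro nn_integral_cong) simp
  also have "\<dots> = (SUP n. \<integral>\<^sup>+\<omega>. f n \<omega> T \<partial>path_law i)"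
  proof (rule nn_integral_monotone_convergence_SUP)
    show "incseq (\<lambda>n \<omega>. f n \<omega> T)"
      unfolding incseq_def le_fun_def f_def
      by (auto intro!: mult_left_mono dest: less_le_trans[OF _ jump_time_mono])
  qed (use f_meas' in \<open>simp cong: measurable_cong_sets\<close>)
  also have "\<dots> \<le> ennreal (exp (\<mu> * T) * \<phi> i)" by (intro SUP_least bound i T)
  finally show ?thesis .
qed

end

section \<open>Growth rate of the exponential cost, and non-explosion\<close>

lemma ln_ennreal_mono: "x \<le> y \<Longrightarrow> ln_ennreal x \<le> ln_ennreal y"
proof (cases "x = 0 \<or> y = \<infinity>")
  case False
  assume "x \<le> y"
  moreover obtain r s where "x = ennreal r" "0 < r" "y = ennreal s" "0 \<le> s"
    using False \<open>x \<le> y\<close> by (cases x; cases y) (auto simp: top_unique less_le)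
  ultimately show ?thesis by (auto simp: ln_ennreal_def)
qed (auto simp: ln_ennreal_def)

lemma ln_ennreal_ennreal: "0 < x \<Longrightarrow> ln_ennreal (ennreal x) = ereal (ln x)"
  by (simp add: ln_ennreal_def)

context jump_rates
begin

definition expected_exp_cost :: "(nat \<Rightarrow> real) \<Rightarrow> nat \<Rightarrow> real \<Rightarrow> ennreal"
  where "expected_exp_cost c i T = (\<integral>\<^sup>+\<omega>. exp_ennreal (accumulated c \<omega> T) \<partial>path_law i)"

definition markov_risk :: "(nat \<Rightarrow> real) \<Rightarrow> nat \<Rightarrow> ereal"
  where "markov_risk c i = Limsup at_top (\<lambda>T. ereal (1 / T) * ln_ennreal (expected_exp_cost c i T))"

lemma expected_exp_cost_ge_1:
  assumes "i \<in> states" shows "1 \<le> expected_exp_cost c i T"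
proof -
  interpret P: prob_space "path_law i" by (rule prob_space_path_law[OF assms])
  have "1 = (\<integral>\<^sup>+\<omega>. 1 \<partial>path_law i)" using P.emeasure_space_1 by simp
  also have "\<dots> \<le> expected_exp_cost c i T"
    unfolding expected_exp_cost_def by (intro nn_integral_mono exp_ennreal_ge_1)
  finally show ?thesis .
qed

lemma expected_exp_cost_mono: "S \<le> T \<Longrightarrow> expected_exp_cost c i S \<le> expected_exp_cost c i T"
  unfolding expected_exp_cost_def by (intro nn_integral_mono exp_ennreal_mono accumulated_mono)

lemma markov_risk_nonneg:
  assumes "i \<in> states" shows "0 \<le> markov_risk c i"
  unfolding markov_risk_def
proof (rule le_Limsup)
  show "\<forall>\<^sub>F T in at_top. 0 \<le> ereal (1 / T) * ln_ennreal (expected_exp_cost c i T)"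
  proof (rule eventually_mono[OF eventually_gt_at_top[of 0]])
    fix T :: real assume "0 < T"
    moreover have "0 \<le> ln_ennreal (expected_exp_cost c i T)"
    proof -
      have "ln_ennreal 1 = 0" by (simp add: ln_ennreal_def zero_ereal_def)
      then show ?thesis using ln_ennreal_mono[OF expected_exp_cost_ge_1[OF assms, of c T]] by simp
    qed
    ultimately show "0 \<le> ereal (1 / T) * ln_ennreal (expected_exp_cost c i T)"
      by (intro ereal_0_le_mult) auto
  qed
qed simp

lemma markov_risk_le:
  assumes C: "0 < C" and bound: "\<And>T. 0 < T \<Longrightarrow> expected_exp_cost c i T \<le> ennreal (exp (\<mu> * T) * C)"
  shows "markov_risk c i \<le> ereal \<mu>"
proof -
  have "markov_risk c i \<le> Limsup at_top (\<lambda>T. ereal (\<mu> + ln C / T))"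
    unfolding markov_risk_def
  proof (rule Limsup_mono, rule eventually_mono[OF eventually_gt_at_top[of 0]])
    fix T :: real assume T: "0 < T"
    have "ln_ennreal (expected_exp_cost c i T) \<le> ln_ennreal (ennreal (exp (\<mu> * T) * C))"
      by (rule ln_ennreal_mono[OF bound[OF T]])
    also have "\<dots> = ereal (\<mu> * T + ln C)" using C by (simp add: ln_ennreal_ennreal ln_mult)
    finally have "ereal (1 / T) * ln_ennreal (expected_exp_cost c i T) \<le> ereal (1 / T) * ereal (\<mu> * T + ln C)"
      using T by (intro ereal_mult_left_mono) auto
    also have "\<dots> = ereal (\<mu> + ln C / T)" using T by (simp add: field_simps)
    finally show "ereal (1 / T) * ln_ennreal (expected_exp_cost c i T) \<le> ereal (\<mu> + ln C / T)" .
  qed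
  also have "\<dots> = ereal \<mu>"
  proof (rule lim_imp_Limsup)
    have "((\<lambda>T. ln C / T) \<longlongrightarrow> 0) at_top"
      by (intro tendsto_divide_0[OF tendsto_const] filterlim_at_top_imp_at_infinity filterlim_ident)
    then have "((\<lambda>T. \<mu> + ln C / T) \<longlongrightarrow> \<mu> + 0) at_top" by (intro tendsto_add tendsto_const)
    then show "((\<lambda>T. ereal (\<mu> + ln C / T)) \<longlongrightarrow> ereal \<mu>) at_top" by simp
  qed simp
  finally show ?thesis .
qed

text \<open>A path that explodes by time \<open>N\<close> has infinitely many jumps up to
  \<open>N\<close>. By the compensator their expected number is the expected integral of the total
  rate; this rate is dominated by \<open>Wt\<close>, whose expectation grows at most
  exponentially.\<close>

lemma AE_not_exploded:
  assumes i: "i \<in> states" and Wt: "\<And>j. j \<in> states \<Longrightarrow> 0 \<le> Wt j" "supersolution a total_rate \<mu> Wt"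
    and rate: "\<And>j. j \<in> states \<Longrightarrow> total_rate j \<le> C * Wt j" and C: "0 \<le> C"
  shows "AE \<omega> in path_law i. \<forall>T. Y \<omega> T \<noteq> cemetery"
proof -
  interpret P: prob_space "path_law i" by (rule prob_space_path_law[OF i])
  have "AE \<omega> in path_law i. \<exists>n. ennreal (real N) < jump_time \<omega> n" for N :: nat
  proof -
    let ?D = "paths \<times> {0..real N}"
    have D: "?D \<in> sets predictable" by (rule predictable_time)
    let ?J = "\<lambda>\<omega> n. if jump_time \<omega> (Suc n) < \<infinity> then indicator {..ennreal (real N)} (jump_time \<omega> (Suc n)) else (0::ennreal)"
    have Y_meas: "(\<lambda>x. Y (snd x) (fst x)) \<in> borel \<Otimes>\<^sub>M path_space \<rightarrow>\<^sub>M count_space UNIV"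
      by (rule measurable_compose[OF _ measurable_Y, of "\<lambda>x. (snd x, fst x)", simplified]) measurable
    \<comment> \<open>The compensator is stated for each target separately, so the count of jumps is
      regrouped by targets.\<close>
    have jumps: "(\<Sum>n. ?J \<omega> n) = (\<Sum>j. if j \<in> states then (\<Sum>n. if jump_time \<omega> (Suc n) < \<infinity> \<and> post_jump \<omega> (Suc n) = j
               then indicator ?D (\<omega>, enn2real (jump_time \<omega> (Suc n))) else 0) else 0)" (is "_ = (\<Sum>j. ?S \<omega> j)")
      if \<omega>: "\<omega> \<in> paths" for \<omega>
    proof -
      have J: "?J \<omega> n = (\<Sum>j. if jump_time \<omega> (Suc n) < \<infinity> \<and> post_jump \<omega> (Suc n) = j
               then indicator ?D (\<omega>, enn2real (jump_time \<omega> (Suc n))) else 0)" for n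
      proof -
        have "(if jump_time \<omega> (Suc n) < \<infinity> \<and> post_jump \<omega> (Suc n) = j
               then indicator ?D (\<omega>, enn2real (jump_time \<omega> (Suc n))) else 0) = (if j = post_jump \<omega> (Suc n) then ?J \<omega> n else 0)" for j
          using \<omega> by (cases "jump_time \<omega> (Suc n)") (auto simp: indicator_def ennreal_le_iff)
        then show ?thesis by (simp only:) (subst suminf_finite[of "{post_jump \<omega> (Suc n)}"], auto)
      qed
      have S: "(\<Sum>n. if jump_time \<omega> (Suc n) < \<infinity> \<and> post_jump \<omega> (Suc n) = j
               then indicator ?D (\<omega>, enn2real (jump_time \<omega> (Suc n))) else 0) = ?S \<omega> j" for j
      proof (cases "j \<in> states")
        case False
        then have "\<not> (jump_time \<omega> (Suc n) < \<infinity> \<and> post_jump \<omega> (Suc n) = j)" for n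
          using jump_time_finite_imp_states[OF \<omega>, of "Suc n"] by blast
        then show ?thesis using False by (simp only: if_False suminf_zero)
      qed simp
      have "(\<Sum>n. ?J \<omega> n) = (\<Sum>n. \<Sum>j. if jump_time \<omega> (Suc n) < \<infinity> \<and> post_jump \<omega> (Suc n) = j
               then indicator ?D (\<omega>, enn2real (jump_time \<omega> (Suc n))) else 0)"
        by (simp only: J)
      also have "\<dots> = (\<Sum>n. \<integral>\<^sup>+j. (if jump_time \<omega> (Suc n) < \<infinity> \<and> post_jump \<omega> (Suc n) = j
               then indicator ?D (\<omega>, enn2real (jump_time \<omega> (Suc n))) else 0) \<partial>count_space UNIV)"
        by (simp only: nn_integral_count_space_nat)
      also have "\<dots> = (\<integral>\<^sup>+j. (\<Sum>n. if jump_time \<omega> (Suc n) < \<infinity> \<and> post_jump \<omega> (Suc n) = j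
               then indicator ?D (\<omega>, enn2real (jump_time \<omega> (Suc n))) else 0) \<partial>count_space UNIV)"
        by (rule nn_integral_suminf[symmetric]) simp
      also have "\<dots> = (\<Sum>j. ?S \<omega> j)"
        unfolding nn_integral_count_space_nat by (rule suminf_cong) (rule S)
      finally show ?thesis .
    qed
    have "(\<integral>\<^sup>+\<omega>. (\<Sum>n. ?J \<omega> n) \<partial>path_law i) = (\<integral>\<^sup>+\<omega>. (\<Sum>j. ?S \<omega> j) \<partial>path_law i)"
      by (intro nn_integral_cong) (simp only: jumps space_path_law)
    also have "\<dots> = (\<Sum>j. \<integral>\<^sup>+\<omega>. ?S \<omega> j \<partial>path_law i)"
    proof (rule nn_integral_suminf)
      have "?D \<in> sets (path_space \<Otimes>\<^sub>M borel)" using D sets_predictable_subset by blast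
      then show "(\<lambda>\<omega>. ?S \<omega> j) \<in> borel_measurable (path_law i)" for j by measurable
    qed
    also have "\<dots> = (\<Sum>j. \<integral>\<^sup>+\<omega>. (\<integral>\<^sup>+t\<in>{0<..real N}. ennreal (a (Y \<omega> t) j) \<partial>lborel) \<partial>path_law i)"
    proof (rule suminf_cong)
      fix j
      show "(\<integral>\<^sup>+\<omega>. ?S \<omega> j \<partial>path_law i) = (\<integral>\<^sup>+\<omega>. (\<integral>\<^sup>+t\<in>{0<..real N}. ennreal (a (Y \<omega> t) j) \<partial>lborel) \<partial>path_law i)"
      proof (cases "j \<in> states")
        case True
        have "(\<integral>\<^sup>+\<omega>. ?S \<omega> j \<partial>path_law i) = (\<integral>\<^sup>+\<omega>. (\<integral>\<^sup>+t\<in>{0<..}. indicator ?D (\<omega>, t) * ennreal (a (Y_left \<omega> t) j) \<partial>lborel) \<partial>path_law i)"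
          using compensated_path_law[OF i] True D unfolding compensated_def by simp
        also have "\<dots> = (\<integral>\<^sup>+\<omega>. (\<integral>\<^sup>+t\<in>{0<..real N}. ennreal (a (Y \<omega> t) j) \<partial>lborel) \<partial>path_law i)"
        proof (rule nn_integral_cong)
          fix \<omega> assume "\<omega> \<in> space (path_law i)"
          then have \<omega>: "\<omega> \<in> paths" by simp
          show "(\<integral>\<^sup>+t\<in>{0<..}. indicator ?D (\<omega>, t) * ennreal (a (Y_left \<omega> t) j) \<partial>lborel) =
            (\<integral>\<^sup>+t\<in>{0<..real N}. ennreal (a (Y \<omega> t) j) \<partial>lborel)"
          proof (rule nn_integral_cong_AE, rule eventually_mono[OF AE_Y_eq_Y_left[of \<omega>]])
            fix t assume "0 \<le> t \<longrightarrow> Y \<omega> t = Y_left \<omega> t"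
            then show "indicator ?D (\<omega>, t) * ennreal (a (Y_left \<omega> t) j) * indicator {0<..} t =
              ennreal (a (Y \<omega> t) j) * indicator {0<..real N} t"
              using \<omega> by (auto simp: indicator_def)
          qed
        qed
        finally show ?thesis .
      next
        case False
        then show ?thesis by (simp add: states_iff rate_to_cemetery)
      qed
    qed
    also have "\<dots> = (\<Sum>j. \<integral>\<^sup>+t. \<integral>\<^sup>+\<omega>. ennreal (a (Y \<omega> t) j) * indicator {0<..real N} t \<partial>path_law i \<partial>lborel)"
    proof (rule suminf_cong)
      fix j
      interpret PL: pair_sigma_finite "path_law i" lborel
        by (intro pair_sigma_finite.intro sigma_finite_lborel P.sigma_finite_measure_axioms)
      have "(\<lambda>x. ennreal (a (Y (fst x) (snd x)) j) * indicator {0<..real N} (snd x)) \<in> borel_measurable (path_space \<Otimes>\<^sub>M borel)"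
        by measurable
      then show "(\<integral>\<^sup>+\<omega>. (\<integral>\<^sup>+t\<in>{0<..real N}. ennreal (a (Y \<omega> t) j) \<partial>lborel) \<partial>path_law i) =
        (\<integral>\<^sup>+t. \<integral>\<^sup>+\<omega>. ennreal (a (Y \<omega> t) j) * indicator {0<..real N} t \<partial>path_law i \<partial>lborel)"
        by (intro PL.Fubini'[symmetric]) (simp add: case_prod_beta cong: measurable_cong_sets sets_pair_measure_cong)
    qed
    also have "\<dots> = (\<integral>\<^sup>+t. (\<Sum>j. \<integral>\<^sup>+\<omega>. ennreal (a (Y \<omega> t) j) * indicator {0<..real N} t \<partial>path_law i) \<partial>lborel)"
    proof (rule nn_integral_suminf[symmetric])
      fix j
      have "(\<lambda>x. ennreal (a (Y (snd x) (fst x)) j) * indicator {0<..real N} (fst x)) \<in> borel_measurable (borel \<Otimes>\<^sub>M path_space)"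
        using Y_meas by measurable
      then show "(\<lambda>t. \<integral>\<^sup>+\<omega>. ennreal (a (Y \<omega> t) j) * indicator {0<..real N} t \<partial>path_law i) \<in> borel_measurable lborel"
        by (intro P.borel_measurable_nn_integral) (simp add: case_prod_beta cong: measurable_cong_sets sets_pair_measure_cong)
    qed
    \<comment> \<open>The expectation of \<open>Wt\<close> is bounded by the Feynman-Kac estimate
      with zero cost; the absolute value of \<open>\<mu>\<close> makes the bound uniform over the
      time interval.\<close>
    also have "\<dots> \<le> (\<integral>\<^sup>+t. ennreal (C * exp (\<bar>\<mu>\<bar> * real N) * Wt i) * indicator {0<..real N} t \<partial>lborel)"
    proof (rule nn_integral_mono)
      fix t :: real
      show "(\<Sum>j. \<integral>\<^sup>+\<omega>. ennreal (a (Y \<omega> t) j) * indicator {0<..real N} t \<partial>path_law i) \<le>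
        ennreal (C * exp (\<bar>\<mu>\<bar> * real N) * Wt i) * indicator {0<..real N} t"
      proof (cases "t \<in> {0<..real N}")
        case True
        have Yt: "(\<lambda>\<omega>. Y \<omega> t) \<in> path_space \<rightarrow>\<^sub>M count_space UNIV"
          using measurable_compose[OF measurable_Pair2'[of t borel path_space] measurable_Y] by simp
        have "(\<Sum>j. \<integral>\<^sup>+\<omega>. ennreal (a (Y \<omega> t) j) \<partial>path_law i) = (\<integral>\<^sup>+\<omega>. (\<Sum>j. ennreal (a (Y \<omega> t) j)) \<partial>path_law i)"
          by (rule nn_integral_suminf[symmetric]) (use Yt in measurable)
        also have "\<dots> \<le> (\<integral>\<^sup>+\<omega>. ennreal C * feynman_kac (\<lambda>_. 0) (\<lambda>j. if j = cemetery then 0 else ennreal (Wt j)) \<omega> t \<partial>path_law i)"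
        proof (rule nn_integral_mono)
          fix \<omega>
          have "accumulated (\<lambda>_. 0) \<omega> t = 0" by (simp add: accumulated_def)
          then show "(\<Sum>j. ennreal (a (Y \<omega> t) j)) \<le> ennreal C * feynman_kac (\<lambda>_. 0) (\<lambda>j. if j = cemetery then 0 else ennreal (Wt j)) \<omega> t"
            unfolding suminf_rates feynman_kac_def using rate[of "Y \<omega> t"] C
            by (auto simp: states_iff ennreal_mult'[symmetric] intro: ennreal_leI)
        qed
        also have "\<dots> = ennreal C * (\<integral>\<^sup>+\<omega>. feynman_kac (\<lambda>_. 0) (\<lambda>j. if j = cemetery then 0 else ennreal (Wt j)) \<omega> t \<partial>path_law i)"
          by (rule nn_integral_cmult) measurable
        also have "\<dots> \<le> ennreal C * ennreal (exp (\<mu> * t) * Wt i)"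
          using True Wt by (intro mult_left_mono feynman_kac_supersolution i) auto
        also have "\<dots> \<le> ennreal (C * exp (\<bar>\<mu>\<bar> * real N) * Wt i)"
        proof -
          have "\<mu> * t \<le> \<bar>\<mu>\<bar> * real N" using True by (intro mult_mono) auto
          then show ?thesis using C Wt(1)[OF i] by (subst ennreal_mult'[OF C, symmetric]) (auto intro!: ennreal_leI mult_left_mono mult_right_mono simp: mult.assoc)
        qed
        finally show ?thesis using True by simp
      qed simp
    qed
    also have "\<dots> < \<top>" by (simp add: nn_integral_cmult_indicator ennreal_mult_less_top)
    finally have "(\<integral>\<^sup>+\<omega>. (\<Sum>n. ?J \<omega> n) \<partial>path_law i) \<noteq> \<infinity>" by simp
    then have "AE \<omega> in path_law i. (\<Sum>n. ?J \<omega> n) \<noteq> \<infinity>"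
      by (rule nn_integral_PInf_AE[rotated]) measurable
    then show ?thesis
    proof (rule eventually_mono)
      fix \<omega> assume fin: "(\<Sum>n. ?J \<omega> n) \<noteq> \<infinity>"
      show "\<exists>n. ennreal (real N) < jump_time \<omega> n"
      proof (rule ccontr)
        assume "\<not> ?thesis"
        then have le: "jump_time \<omega> n \<le> ennreal (real N)" for n by (simp add: not_less)
        then have "?J \<omega> n = 1" for n using le_less_trans[OF le ennreal_less_top, of "Suc n"] by (simp add: indicator_def)
        then have "(\<Sum>n. ?J \<omega> n) = (\<Sum>n::nat. 1)" by (simp only:)
        also have "\<dots> = \<infinity>" using nn_integral_count_space_nat[of "\<lambda>_. 1"] by (simp add: emeasure_count_space_infinite)
        finally show False using fin by simp
      qed
    qed
  qed
  then have "AE \<omega> in path_law i. \<forall>N. \<exists>n. ennreal (real N) < jump_time \<omega> n" by (simp add: AE_all_countable)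
  then show ?thesis using AE_space
  proof eventually_elim
    case (elim \<omega>)
    show ?case
    proof
      fix T :: real
      obtain N :: nat where "T \<le> real N" using real_arch_simple by blast
      moreover obtain n where "ennreal (real N) < jump_time \<omega> n" using elim(1) by blast
      ultimately have "ennreal T < jump_time \<omega> n" using le_less_trans[OF ennreal_leI] by blast
      then show "Y \<omega> T \<noteq> cemetery" using Y_cemetery_iff[of \<omega> T] elim(2) by (auto simp: not_le)
    qed
  qed
qed

text \<open>Being at least 1, \<open>\<phi>\<close> may be inserted as a terminal function. This
  step uses non-explosion, since the Feynman-Kac bound drops the paths in the cemetery.\<close>

lemma markov_risk_supersolution:
  assumes c: "\<And>j. j \<in> states \<Longrightarrow> 0 \<le> c j" and \<phi>: "\<And>j. j \<in> states \<Longrightarrow> 1 \<le> \<phi> j"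
    and super: "supersolution a (\<lambda>i. total_rate i - c i) \<mu> \<phi>" and i: "i \<in> states"
    and alive: "AE \<omega> in path_law i. \<forall>T. Y \<omega> T \<noteq> cemetery"
  shows "markov_risk c i \<le> ereal \<mu>"
proof (rule markov_risk_le)
  show "0 < \<phi> i" using \<phi>[OF i] by simp
  fix T :: real assume T: "0 < T"
  have "expected_exp_cost c i T \<le> (\<integral>\<^sup>+\<omega>. feynman_kac c (\<lambda>j. if j = cemetery then 0 else ennreal (\<phi> j)) \<omega> T \<partial>path_law i)"
    unfolding expected_exp_cost_def
  proof (rule nn_integral_mono_AE, rule eventually_mono[OF alive])
    fix \<omega> assume "\<forall>T. Y \<omega> T \<noteq> cemetery"
    then have *: "Y \<omega> T \<noteq> cemetery" by blast
    then have "1 \<le> ennreal (\<phi> (Y \<omega> T))" using \<phi> by (simp add: states_iff)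
    then have "exp_ennreal (accumulated c \<omega> T) * 1 \<le> exp_ennreal (accumulated c \<omega> T) * ennreal (\<phi> (Y \<omega> T))"
      by (intro mult_left_mono) auto
    then show "exp_ennreal (accumulated c \<omega> T) \<le> feynman_kac c (\<lambda>j. if j = cemetery then 0 else ennreal (\<phi> j)) \<omega> T"
      using * by (simp add: feynman_kac_def)
  qed
  also have "\<dots> \<le> ennreal (exp (\<mu> * T) * \<phi> i)"
    using \<phi> T by (intro feynman_kac_supersolution c super i) (auto intro: order.trans[OF zero_le_one])
  finally show "expected_exp_cost c i T \<le> ennreal (exp (\<mu> * T) * \<phi> i)" .
qed

text \<open>With zero cost the indicator of the complement of \<open>Z\<close> is a supersolution
  with eigenvalue 0: rows in \<open>Z\<close> vanish, and elsewhere the row sums are at most the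
  total rate. Its expectation stays 0 when the chain starts in \<open>Z\<close>.\<close>

lemma closed_set_not_left:
  assumes i: "i \<in> Z" "Z \<subseteq> states" and closed: "\<And>k j. k \<in> Z \<Longrightarrow> j \<in> states - Z \<Longrightarrow> a k j = 0"
    and T: "0 \<le> T" and j: "j \<in> states - Z"
  shows "emeasure (path_law i) {\<omega> \<in> paths. Y \<omega> T = j} = 0"
proof -
  let ?\<phi> = "\<lambda>k. indicator (states - Z) k :: real"
  have Yt: "(\<lambda>\<omega>. Y \<omega> T) \<in> path_space \<rightarrow>\<^sub>M count_space UNIV"
    using measurable_compose[OF measurable_Pair2'[of T borel path_space] measurable_Y] by simp
  have "{\<omega> \<in> space path_space. Y \<omega> T = j} \<in> sets path_space" using Yt by measurable
  then have meas: "{\<omega> \<in> paths. Y \<omega> T = j} \<in> sets (path_law i)" by simp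
  have "supersolution a (\<lambda>i. total_rate i - 0) 0 ?\<phi>"
    unfolding supersolution_def
  proof (intro ballI allI impI)
    fix k F assume k: "k \<in> states" and F: "finite F \<and> F \<subseteq> states"
    show "(\<Sum>j\<in>F. a k j * ?\<phi> j) \<le> (0 + (total_rate k - 0)) * ?\<phi> k"
    proof (cases "k \<in> Z")
      case True
      then have "a k j * ?\<phi> j = 0" for j using closed[OF True, of j] by (auto simp: indicator_def)
      then have "(\<Sum>j\<in>F. a k j * ?\<phi> j) = 0" by (simp only: sum.neutral_const)
      then show ?thesis using True by simp
    next
      case False
      have "(\<Sum>j\<in>F. a k j * ?\<phi> j) \<le> (\<Sum>j\<in>F. a k j)"
        by (intro sum_mono) (auto simp: indicator_def rate_nonneg)
      also have "\<dots> \<le> total_rate k"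
        unfolding total_rate_def using F by (intro sum_le_suminf summable_rates) (auto simp: rate_nonneg)
      finally show ?thesis using False k by simp
    qed
  qed
  then have "(\<integral>\<^sup>+\<omega>. feynman_kac (\<lambda>_. 0) (\<lambda>j. if j = cemetery then 0 else ennreal (?\<phi> j)) \<omega> T \<partial>path_law i) \<le> ennreal (exp (0 * T) * ?\<phi> i)"
    using i T by (intro feynman_kac_supersolution) auto
  also have "\<dots> = 0" using i by simp
  finally have "(\<integral>\<^sup>+\<omega>. feynman_kac (\<lambda>_. 0) (\<lambda>j. if j = cemetery then 0 else ennreal (?\<phi> j)) \<omega> T \<partial>path_law i) = 0" by simp
  moreover have "emeasure (path_law i) {\<omega> \<in> paths. Y \<omega> T = j} = (\<integral>\<^sup>+\<omega>. indicator {\<omega> \<in> paths. Y \<omega> T = j} \<omega> \<partial>path_law i)"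
    using meas by simp
  moreover have "\<dots> \<le> (\<integral>\<^sup>+\<omega>. feynman_kac (\<lambda>_. 0) (\<lambda>j. if j = cemetery then 0 else ennreal (?\<phi> j)) \<omega> T \<partial>path_law i)"
    using j by (intro nn_integral_mono) (auto simp: indicator_def feynman_kac_def accumulated_def states_iff)
  ultimately show ?thesis by simp
qed

end

section \<open>The resolvent of the Feynman-Kac semigroup\<close>

context jump_rates
begin

text \<open>Laplace transform in time of the Feynman-Kac functional with terminal value 1 on
  \<open>states\<close>. Where finite, it solves the linear equation of the chain with inhomogeneity
  1.\<close>

definition resolvent :: "(nat \<Rightarrow> real) \<Rightarrow> real \<Rightarrow> nat \<Rightarrow> ennreal"
  where "resolvent c \<mu> i = (\<integral>\<^sup>+T\<in>{0..}. ennreal (exp (- \<mu> * T)) *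
    (\<integral>\<^sup>+\<omega>. feynman_kac c (\<lambda>j. if j = cemetery then 0 else 1) \<omega> T \<partial>path_law i) \<partial>lborel)"

text \<open>The renewal equation is a convolution in time, so its Laplace transform is a product.
  The exponential integral stays an \<open>ennreal\<close> factor because the sign of its exponent
  is not known yet.\<close>

lemma resolvent_eq:
  assumes c: "\<And>j. j \<in> states \<Longrightarrow> 0 \<le> c j" and i: "i \<in> states"
  shows "resolvent c \<mu> i = (\<integral>\<^sup>+r\<in>{0..}. ennreal (exp (- (\<mu> + total_rate i - c i) * r)) \<partial>lborel) *
    (1 + (\<Sum>j. ennreal (a i j) * resolvent c \<mu> j))"
proof -
  let ?\<phi> = "\<lambda>j. if j = cemetery then 0 else 1 :: ennreal"
  define v where "v j T = (\<integral>\<^sup>+\<omega>. feynman_kac c ?\<phi> \<omega> T \<partial>path_law j)" for j T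
  define \<kappa> where "\<kappa> = \<mu> + total_rate i - c i"
  have ci: "0 \<le> c i" using c i by blast
  have ne: "i \<noteq> cemetery" using i states_iff by simp
  have v_meas: "v j \<in> borel_measurable borel" if "j \<in> states" for j
  proof -
    interpret P: prob_space "path_law j" by (rule prob_space_path_law[OF that])
    have "(\<lambda>x. feynman_kac c ?\<phi> (snd x) (fst x)) \<in> borel_measurable (borel \<Otimes>\<^sub>M path_space)"
      by (rule measurable_compose[OF _ measurable_feynman_kac, of "\<lambda>x. (snd x, fst x)", simplified]) measurable
    then show ?thesis unfolding v_def[abs_def]
      by (intro P.borel_measurable_nn_integral) (simp add: case_prod_beta cong: measurable_cong_sets sets_pair_measure_cong)
  qed
  have rec: "v i T = ennreal (exp (- total_rate i * T)) * (ennreal (exp (c i * T)) * 1) +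
    (\<Sum>j. ennreal (a i j) * (\<integral>\<^sup>+r\<in>{0<..T}. ennreal (exp (- total_rate i * r)) * (ennreal (exp (c i * r)) * v j (T - r)) \<partial>lborel))"
    if T: "0 \<le> T" for T
    unfolding v_def
  proof (rule first_jump_decomposition[OF i T measurable_feynman_kac_section measurable_feynman_kac])
    show "feynman_kac c ?\<phi> (path_cons i \<theta> \<omega>) T = ennreal (exp (c i * T)) * 1" if "ennreal T < \<theta>" for \<theta> \<omega>
      using feynman_kac_path_cons_before[where c=c and i=i, OF T that ci] ne by simp
    show "feynman_kac c ?\<phi> (path_cons i (ennreal r) \<omega>) T = ennreal (exp (c i * r)) * feynman_kac c ?\<phi> \<omega> (T - r)"
      if "0 < r" "r \<le> T" "\<omega> \<in> paths" for r \<omega>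
      using feynman_kac_path_cons_after[where c=c and i=i, OF that ci] .
  qed measurable
  have exp_\<kappa>: "ennreal (exp (- \<mu> * r)) * (ennreal (exp (- total_rate i * r)) * (ennreal (exp (c i * r)) * x)) = ennreal (exp (- \<kappa> * r)) * x" for r x
  proof -
    have "exp (- \<mu> * r) * (exp (- total_rate i * r) * exp (c i * r)) = exp (- \<kappa> * r)"
      by (simp add: \<kappa>_def exp_add[symmetric] algebra_simps)
    then have "ennreal (exp (- \<mu> * r)) * (ennreal (exp (- total_rate i * r)) * ennreal (exp (c i * r))) = ennreal (exp (- \<kappa> * r))"
      by (simp only: ennreal_mult[symmetric] exp_ge_zero mult_nonneg_nonneg)
    then show ?thesis by (metis (no_types, lifting) mult.assoc)
  qed
  define I where "I = (\<integral>\<^sup>+r\<in>{0..}. ennreal (exp (- \<kappa> * r)) \<partial>lborel)"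
  let ?g = "\<lambda>j T. ennreal (exp (- \<mu> * T)) * (ennreal (a i j) * (\<integral>\<^sup>+r\<in>{0<..T}. ennreal (exp (- total_rate i * r)) * (ennreal (exp (c i * r)) * v j (T - r)) \<partial>lborel)) * indicator {0..} T"
  have g: "?g j \<in> borel_measurable lborel \<and> (\<integral>\<^sup>+T. ?g j T \<partial>lborel) = I * (ennreal (a i j) * resolvent c \<mu> j)" for j
  proof (cases "j \<in> states")
    case False
    then have "a i j = 0" using rate_to_cemetery states_iff by blast
    then show ?thesis by simp
  next
    case True
    note [measurable] = v_meas[OF True]
    let ?h = "\<lambda>T r. ennreal (exp (- \<mu> * T)) * (ennreal (exp (- total_rate i * r)) * (ennreal (exp (c i * r)) * v j (T - r))) * (if 0 < r \<and> r \<le> T then 1 else 0)"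
    have h_meas: "(\<lambda>(T, r). ?h T r) \<in> borel_measurable (lborel \<Otimes>\<^sub>M lborel)" by measurable
    have g_eq: "?g j T = ennreal (a i j) * (\<integral>\<^sup>+r. ?h T r \<partial>lborel)" for T
    proof (cases "0 \<le> T")
      case True
      have "(\<integral>\<^sup>+r. ?h T r \<partial>lborel) = (\<integral>\<^sup>+r. ennreal (exp (- \<mu> * T)) * (ennreal (exp (- total_rate i * r)) * (ennreal (exp (c i * r)) * v j (T - r)) * indicator {0<..T} r) \<partial>lborel)"
        by (intro nn_integral_cong) (simp add: indicator_def mult.assoc)
      also have "\<dots> = ennreal (exp (- \<mu> * T)) * (\<integral>\<^sup>+r\<in>{0<..T}. ennreal (exp (- total_rate i * r)) * (ennreal (exp (c i * r)) * v j (T - r)) \<partial>lborel)"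
        by (rule nn_integral_cmult) measurable
      finally show ?thesis using True by (simp add: ac_simps)
    next
      case False
      then have "(\<integral>\<^sup>+r. ?h T r \<partial>lborel) = (\<integral>\<^sup>+(r::real). 0 \<partial>lborel)" by (intro nn_integral_cong) auto
      then show ?thesis unfolding \<open>(\<integral>\<^sup>+r. ?h T r \<partial>lborel) = (\<integral>\<^sup>+(r::real). 0 \<partial>lborel)\<close> using False by simp
    qed
    \<comment> \<open>Shifting \<open>T\<close> by \<open>r\<close> separates the time of the first
      jump from the time that remains.\<close>
    have inner: "(\<integral>\<^sup>+T. ?h T r \<partial>lborel) = ennreal (exp (- \<kappa> * r)) * indicator {0<..} r * resolvent c \<mu> j" for r
    proof -
      have "(\<integral>\<^sup>+T. ?h T r \<partial>lborel) = (\<integral>\<^sup>+T. ?h (r + 1 * T) r \<partial>lborel)"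
        by (subst nn_integral_real_affine[of "\<lambda>T. ?h T r" 1 r]) simp_all
      also have "\<dots> = (\<integral>\<^sup>+T. ennreal (exp (- \<kappa> * r)) * indicator {0<..} r * (ennreal (exp (- \<mu> * T)) * v j T * indicator {0..} T) \<partial>lborel)"
      proof (rule nn_integral_cong)
        fix T
        have "exp (- \<mu> * (r + T)) = exp (- \<mu> * r) * exp (- \<mu> * T)" by (simp add: exp_add[symmetric] algebra_simps)
        then have "ennreal (exp (- \<mu> * (r + T))) = ennreal (exp (- \<mu> * r)) * ennreal (exp (- \<mu> * T))"
          by (simp only: ennreal_mult exp_ge_zero)
        then have "ennreal (exp (- \<mu> * (r + T))) * (ennreal (exp (- total_rate i * r)) * (ennreal (exp (c i * r)) * v j T)) =
          ennreal (exp (- \<mu> * r)) * (ennreal (exp (- total_rate i * r)) * (ennreal (exp (c i * r)) * (ennreal (exp (- \<mu> * T)) * v j T)))"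
          by (simp only: ac_simps)
        then show "?h (r + 1 * T) r = ennreal (exp (- \<kappa> * r)) * indicator {0<..} r * (ennreal (exp (- \<mu> * T)) * v j T * indicator {0..} T)"
          unfolding exp_\<kappa> by (auto simp: indicator_def)
      qed
      also have "\<dots> = ennreal (exp (- \<kappa> * r)) * indicator {0<..} r * (\<integral>\<^sup>+T. ennreal (exp (- \<mu> * T)) * v j T * indicator {0..} T \<partial>lborel)"
        by (rule nn_integral_cmult) measurable
      also have "(\<integral>\<^sup>+T. ennreal (exp (- \<mu> * T)) * v j T * indicator {0..} T \<partial>lborel) = resolvent c \<mu> j"
        by (simp add: resolvent_def v_def)
      finally show ?thesis .
    qed
    have "(\<integral>\<^sup>+T. ?g j T \<partial>lborel) = ennreal (a i j) * (\<integral>\<^sup>+T. \<integral>\<^sup>+r. ?h T r \<partial>lborel \<partial>lborel)"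
      unfolding g_eq using h_meas by (intro nn_integral_cmult lborel.borel_measurable_nn_integral)
    also have "(\<integral>\<^sup>+T. \<integral>\<^sup>+r. ?h T r \<partial>lborel \<partial>lborel) = (\<integral>\<^sup>+r. \<integral>\<^sup>+T. ?h T r \<partial>lborel \<partial>lborel)"
      by (rule lborel_pair.Fubini'[symmetric]) (rule h_meas)
    also have "\<dots> = (\<integral>\<^sup>+r. ennreal (exp (- \<kappa> * r)) * indicator {0<..} r \<partial>lborel) * resolvent c \<mu> j"
      unfolding inner by (rule nn_integral_multc) measurable
    also have "(\<integral>\<^sup>+r. ennreal (exp (- \<kappa> * r)) * indicator {0<..} r \<partial>lborel) = I"
      unfolding I_def by (intro nn_integral_cong_AE eventually_mono[OF AE_lborel_singleton[of 0]]) (auto simp: indicator_def)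
    finally have "(\<integral>\<^sup>+T. ?g j T \<partial>lborel) = I * (ennreal (a i j) * resolvent c \<mu> j)" by (simp only: ac_simps)
    moreover have "?g j \<in> borel_measurable lborel"
    proof -
      have "(\<lambda>T. \<integral>\<^sup>+r. ?h T r \<partial>lborel) \<in> borel_measurable lborel"
        by (rule lborel.borel_measurable_nn_integral[OF h_meas])
      then show ?thesis unfolding g_eq by (rule borel_measurable_times_ennreal[OF borel_measurable_const])
    qed
    ultimately show ?thesis by blast
  qed
  have "resolvent c \<mu> i = (\<integral>\<^sup>+T. ennreal (exp (- \<kappa> * T)) * indicator {0..} T + (\<Sum>j. ?g j T) \<partial>lborel)"
    unfolding resolvent_def v_def[symmetric]
  proof (rule nn_integral_cong)
    fix T :: real
    show "ennreal (exp (- \<mu> * T)) * v i T * indicator {0..} T = ennreal (exp (- \<kappa> * T)) * indicator {0..} T + (\<Sum>j. ?g j T)"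
    proof (cases "0 \<le> T")
      case True
      show ?thesis unfolding rec[OF True] distrib_left exp_\<kappa> using True by (simp add: ennreal_suminf_cmult)
    qed simp
  qed
  also have "\<dots> = I + (\<integral>\<^sup>+T. (\<Sum>j. ?g j T) \<partial>lborel)"
    unfolding I_def
  proof (rule nn_integral_add)
    show "(\<lambda>T. \<Sum>j. ?g j T) \<in> borel_measurable lborel"
      using g by (intro borel_measurable_suminf_order) blast
  qed measurable
  also have "(\<integral>\<^sup>+T. (\<Sum>j. ?g j T) \<partial>lborel) = (\<Sum>j. \<integral>\<^sup>+T. ?g j T \<partial>lborel)"
    using g by (intro nn_integral_suminf) blast
  also have "\<dots> = I * (\<Sum>j. ennreal (a i j) * resolvent c \<mu> j)"
    using g by (simp add: ennreal_suminf_cmult)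
  finally show ?thesis unfolding I_def \<kappa>_def by (simp add: distrib_left)
qed

text \<open>Finiteness forces the exponent in every state to be positive, since otherwise the
  exponential integral diverges. Multiplying by the exponent gives the linear equation with an extra
  1, which makes the solution positive and is dropped for the inequality.\<close>

lemma supersolution_resolvent:
  assumes c: "\<And>j. j \<in> states \<Longrightarrow> 0 \<le> c j" and fin: "\<And>j. j \<in> states \<Longrightarrow> resolvent c \<mu> j < \<infinity>"
  shows "supersolution a (\<lambda>i. total_rate i - c i) \<mu> (\<lambda>i. enn2real (resolvent c \<mu> i))"
    and "i \<in> states \<Longrightarrow> 0 < enn2real (resolvent c \<mu> i)"
proof -
  let ?u = "resolvent c \<mu>"
  have main: "0 < \<mu> + total_rate i - c i \<and>
    ennreal (\<mu> + total_rate i - c i) * ?u i = 1 + (\<Sum>j. ennreal (a i j) * ?u j)" if i: "i \<in> states" for i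
  proof -
    define \<kappa> where "\<kappa> = \<mu> + total_rate i - c i"
    let ?I = "\<integral>\<^sup>+r\<in>{0..}. ennreal (exp (- \<kappa> * r)) \<partial>lborel"
    have eq: "?u i = ?I * (1 + (\<Sum>j. ennreal (a i j) * ?u j))"
      unfolding \<kappa>_def by (rule resolvent_eq[OF c i])
    have "?I * 1 \<le> ?u i" unfolding eq by (intro mult_left_mono) auto
    then have I_fin: "?I < \<infinity>" using fin[OF i] by simp
    have pos: "0 < \<kappa>"
    proof (rule ccontr)
      assume neg: "\<not> 0 < \<kappa>"
      obtain x where x: "?I = ennreal x" "0 \<le> x" using I_fin by (cases ?I) auto
      \<comment> \<open>A rate so small that its exponential integral, \<open>1 / l = x + 1\<close>,
        exceeds the supposed value \<open>x\<close>.\<close>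
      define l where "l = 1 / (x + 1)"
      have l: "0 < l" using x by (simp add: l_def)
      have "(\<integral>\<^sup>+r. ennreal (exp (- l * r)) * indicator {0..} r \<partial>lborel) \<le> ?I"
      proof (rule nn_integral_mono)
        fix r :: real
        have "- l * r \<le> - \<kappa> * r" if "0 \<le> r" using neg l that by (intro mult_right_mono) auto
        then show "ennreal (exp (- l * r)) * indicator {0..} r \<le> ennreal (exp (- \<kappa> * r)) * indicator {0..} r"
          by (auto simp: indicator_def intro!: ennreal_leI)
      qed
      then have "ennreal (x + 1) \<le> ennreal x"
        unfolding nn_integral_exp_atLeast[OF l] x(1) using x(2) by (simp add: l_def)
      then show False using x(2) by (simp add: ennreal_le_iff)
    qed
    have "?I = ennreal (1 / \<kappa>)" using nn_integral_exp_atLeast[OF pos, of 0] by simp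
    then have "ennreal \<kappa> * ?u i = ennreal \<kappa> * ennreal (1 / \<kappa>) * (1 + (\<Sum>j. ennreal (a i j) * ?u j))"
      unfolding eq by (simp only: mult.assoc)
    also have "ennreal \<kappa> * ennreal (1 / \<kappa>) = 1" using pos by (simp add: ennreal_mult[symmetric])
    finally show ?thesis using pos unfolding \<kappa>_def by simp
  qed
  show "supersolution a (\<lambda>i. total_rate i - c i) \<mu> (\<lambda>i. enn2real (?u i))"
    unfolding supersolution_def
  proof (intro ballI allI impI)
    fix i F assume i: "i \<in> states" and F: "finite F \<and> F \<subseteq> states"
    have u: "?u j = ennreal (enn2real (?u j))" if "j \<in> states" for j using fin[OF that] by simp
    have "ennreal (\<Sum>j\<in>F. a i j * enn2real (?u j)) = (\<Sum>j\<in>F. ennreal (a i j) * ?u j)"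
    proof -
      have "ennreal (a i j) * ?u j = ennreal (a i j * enn2real (?u j))" if "j \<in> F" for j
        using u[of j] F that rate_nonneg[of i j] by (metis ennreal_mult enn2real_nonneg subsetD)
      then have "(\<Sum>j\<in>F. ennreal (a i j) * ?u j) = (\<Sum>j\<in>F. ennreal (a i j * enn2real (?u j)))"
        by (intro sum.cong) auto
      also have "\<dots> = ennreal (\<Sum>j\<in>F. a i j * enn2real (?u j))"
        by (rule sum_ennreal) (simp add: rate_nonneg)
      finally show ?thesis ..
    qed
    also have "\<dots> \<le> (\<Sum>j. ennreal (a i j) * ?u j)" using F by (intro sum_le_suminf) auto
    also have "\<dots> \<le> ennreal (\<mu> + total_rate i - c i) * ?u i" using main[OF i] by simp
    also have "\<dots> = ennreal ((\<mu> + total_rate i - c i) * enn2real (?u i))"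
      using main[OF i] u[OF i] by (metis ennreal_mult enn2real_nonneg less_imp_le)
    finally have "(\<Sum>j\<in>F. a i j * enn2real (?u j)) \<le> (\<mu> + total_rate i - c i) * enn2real (?u i)"
      using main[OF i] by (subst (asm) ennreal_le_iff) auto
    then show "(\<Sum>j\<in>F. a i j * enn2real (?u j)) \<le> (\<mu> + (total_rate i - c i)) * enn2real (?u i)"
      by (simp add: algebra_simps)
  qed
  show "0 < enn2real (?u i)" if i: "i \<in> states"
  proof -
    have "?u i \<noteq> 0" using main[OF i] by auto
    then show ?thesis using fin[OF i] by (simp add: enn2real_positive_iff zero_less_iff_neq_zero)
  qed
qed

text \<open>At large times the exponential moments stay below \<open>exp (\<mu>' * T)\<close> for
  some \<open>\<mu>' < \<mu>\<close>, and at small times they are bounded by monotonicity, so the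
  resolvent at \<open>\<mu>\<close> is finite.\<close>

lemma supersolution_above_markov_risk:
  assumes c: "\<And>j. j \<in> states \<Longrightarrow> 0 \<le> c j" and risk: "\<And>j. j \<in> states \<Longrightarrow> markov_risk c j < ereal \<mu>"
  shows "\<exists>u. supersolution a (\<lambda>i. total_rate i - c i) \<mu> u \<and> (\<forall>i\<in>states. 0 < u i)"
proof -
  have "resolvent c \<mu> i < \<infinity>" if i: "i \<in> states" for i
  proof -
    obtain \<mu>' where \<mu>': "markov_risk c i < ereal \<mu>'" "\<mu>' < \<mu>"
      using ereal_dense2[OF risk[OF i]] by auto
    have "\<forall>\<^sub>F T in at_top. ereal (1 / T) * ln_ennreal (expected_exp_cost c i T) < ereal \<mu>'"
      using \<mu>'(1) unfolding markov_risk_def by (rule Limsup_lessD)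
    then obtain T1 where T1: "\<And>T. T1 \<le> T \<Longrightarrow> ereal (1 / T) * ln_ennreal (expected_exp_cost c i T) < ereal \<mu>'"
      by (auto simp: eventually_at_top_linorder)
    \<comment> \<open>At least 1, so that all times considered are positive and the factor
      \<open>1 / T\<close> can be cleared.\<close>
    define T0 where "T0 = max 1 T1"
    have bound: "expected_exp_cost c i T \<le> ennreal (exp (\<mu>' * T))" if "T0 \<le> T" for T
    proof -
      have T: "0 < T" and lt: "ereal (1 / T) * ln_ennreal (expected_exp_cost c i T) < ereal \<mu>'"
        using that T1[of T] by (auto simp: T0_def)
      show ?thesis
      proof (cases "expected_exp_cost c i T")
        case (real w)
        show ?thesis
        proof (cases "w = 0")
          case False
          then have "0 < w" using real by simp
          then have "ereal (1 / T) * ereal (ln w) < ereal \<mu>'" using lt real by (simp add: ln_ennreal_ennreal)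
          then have "ln w < \<mu>' * T" using T by (simp add: field_simps)
          then have "w < exp (\<mu>' * T)" using \<open>0 < w\<close> by (metis exp_less_mono exp_ln)
          then show ?thesis using real by (simp add: ennreal_leI)
        qed (use real in simp)
      next
        case top
        then have "ln_ennreal (expected_exp_cost c i T) = \<infinity>" by (simp add: ln_ennreal_def)
        then show ?thesis using lt T by simp
      qed
    qed
    have le: "(\<integral>\<^sup>+\<omega>. feynman_kac c (\<lambda>j. if j = cemetery then 0 else 1) \<omega> T \<partial>path_law i) \<le> expected_exp_cost c i T" for T
      unfolding expected_exp_cost_def by (intro nn_integral_mono) (simp add: feynman_kac_def)
    have "resolvent c \<mu> i \<le> (\<integral>\<^sup>+T. ennreal (exp (\<bar>\<mu>\<bar> * T0)) * expected_exp_cost c i T0 * indicator {0..T0} T +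
      ennreal (exp (- (\<mu> - \<mu>') * T)) * indicator {T0..} T \<partial>lborel)"
      unfolding resolvent_def
    proof (rule nn_integral_mono)
      fix T :: real
      consider "T < 0" | "0 \<le> T" "T \<le> T0" | "T0 < T" "0 \<le> T" by linarith
      then show "ennreal (exp (- \<mu> * T)) * (\<integral>\<^sup>+\<omega>. feynman_kac c (\<lambda>j. if j = cemetery then 0 else 1) \<omega> T \<partial>path_law i) * indicator {0..} T \<le>
        ennreal (exp (\<bar>\<mu>\<bar> * T0)) * expected_exp_cost c i T0 * indicator {0..T0} T + ennreal (exp (- (\<mu> - \<mu>') * T)) * indicator {T0..} T"
      proof cases
        case 2
        have "- \<mu> * T \<le> \<bar>\<mu>\<bar> * T" using 2 by (intro mult_right_mono) auto
        also have "\<dots> \<le> \<bar>\<mu>\<bar> * T0" using 2 by (intro mult_left_mono) auto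
        finally have "ennreal (exp (- \<mu> * T)) \<le> ennreal (exp (\<bar>\<mu>\<bar> * T0))" by (intro ennreal_leI) simp
        then have "ennreal (exp (- \<mu> * T)) * (\<integral>\<^sup>+\<omega>. feynman_kac c (\<lambda>j. if j = cemetery then 0 else 1) \<omega> T \<partial>path_law i) \<le>
          ennreal (exp (\<bar>\<mu>\<bar> * T0)) * expected_exp_cost c i T0"
          using order.trans[OF le expected_exp_cost_mono[OF 2(2)]] by (intro mult_mono) auto
        then show ?thesis using 2 by (simp add: add_increasing2)
      next
        case 3
        have "ennreal (exp (- \<mu> * T)) * (\<integral>\<^sup>+\<omega>. feynman_kac c (\<lambda>j. if j = cemetery then 0 else 1) \<omega> T \<partial>path_law i) \<le>
          ennreal (exp (- \<mu> * T)) * ennreal (exp (\<mu>' * T))"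
          using order.trans[OF le bound[of T]] 3 by (intro mult_left_mono) auto
        also have "\<dots> = ennreal (exp (- (\<mu> - \<mu>') * T))"
          by (simp add: ennreal_mult[symmetric] exp_add[symmetric] algebra_simps)
        finally show ?thesis using 3 by simp
      qed simp
    qed
    also have "\<dots> = ennreal (exp (\<bar>\<mu>\<bar> * T0)) * expected_exp_cost c i T0 * ennreal T0 + ennreal (exp (- (\<mu> - \<mu>') * T0) / (\<mu> - \<mu>'))"
    proof (subst nn_integral_add)
      have "0 < \<mu> - \<mu>'" using \<mu>' by simp
      from nn_integral_exp_atLeast[OF this, of T0]
      show "(\<integral>\<^sup>+T. ennreal (exp (\<bar>\<mu>\<bar> * T0)) * expected_exp_cost c i T0 * indicator {0..T0} T \<partial>lborel) +
        (\<integral>\<^sup>+T. ennreal (exp (- (\<mu> - \<mu>') * T)) * indicator {T0..} T \<partial>lborel) = ennreal (exp (\<bar>\<mu>\<bar> * T0)) * expected_exp_cost c i T0 * ennreal T0 + ennreal (exp (- (\<mu> - \<mu>') * T0) / (\<mu> - \<mu>'))"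
        by (simp add: nn_integral_cmult_indicator T0_def)
    qed measurable
    also have "\<dots> < \<infinity>"
      using le_less_trans[OF bound[OF order.refl] ennreal_less_top] by (simp add: ennreal_mult_less_top)
    finally show ?thesis .
  qed
  then show ?thesis
    using supersolution_resolvent[where c=c and \<mu>=\<mu>, OF c] by blast
qed

end

section \<open>Relaxed actions\<close>

lemma has_sum_iff_sums:
  fixes h :: "nat \<Rightarrow> real"
  assumes "\<And>j. j \<in> J \<Longrightarrow> 0 \<le> h j"
  shows "(h has_sum s) J \<longleftrightarrow> (\<lambda>j. if j \<in> J then h j else 0) sums s"
proof -
  have "(h has_sum s) J \<longleftrightarrow> ((\<lambda>j. if j \<in> J then h j else 0) has_sum s) UNIV"
    by (rule has_sum_cong_neutral) auto
  also have "\<dots> \<longleftrightarrow> (\<lambda>j. if j \<in> J then h j else 0) sums s"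
    using assms by (auto intro: has_sum_imp_sums sums_nonneg_imp_has_sum)
  finally show ?thesis .
qed

text \<open>Monotone convergence in the form needed for real-valued integrals: the uniform bound
  \<open>B\<close> keeps the sum of the integrals finite.\<close>

lemma infsum_integral:
  fixes h :: "nat \<Rightarrow> 'x \<Rightarrow> real"
  assumes M: "prob_space M" and nonneg: "\<And>j x. j \<in> J \<Longrightarrow> x \<in> space M \<Longrightarrow> 0 \<le> h j x"
    and int: "\<And>j. j \<in> J \<Longrightarrow> integrable M (h j)"
    and summ: "\<And>x. x \<in> space M \<Longrightarrow> (\<lambda>j. h j x) summable_on J"
    and bound: "\<And>x. x \<in> space M \<Longrightarrow> (\<Sum>\<^sub>\<infinity>j\<in>J. h j x) \<le> B"
  shows "(\<lambda>j. \<integral>x. h j x \<partial>M) summable_on J"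
    and "(\<Sum>\<^sub>\<infinity>j\<in>J. \<integral>x. h j x \<partial>M) = (\<integral>x. (\<Sum>\<^sub>\<infinity>j\<in>J. h j x) \<partial>M)"
    and "integrable M (\<lambda>x. \<Sum>\<^sub>\<infinity>j\<in>J. h j x)"
proof -
  interpret M: prob_space M by fact
  define H where "H j x = (if j \<in> J then h j x else 0)" for j x
  have H_int: "integrable M (H j)" for j using int by (cases "j \<in> J") (auto simp: H_def[abs_def])
  have H_nonneg: "0 \<le> H j x" if "x \<in> space M" for j x using nonneg that by (simp add: H_def)
  have H_sums: "(\<lambda>j. H j x) sums (\<Sum>\<^sub>\<infinity>j\<in>J. h j x)" if "x \<in> space M" for x
    unfolding H_def using nonneg[OF _ that] has_sum_infsum[OF summ[OF that]] by (subst has_sum_iff_sums[symmetric]) auto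
  have int_H: "(\<integral>x. H j x \<partial>M) = (if j \<in> J then (\<integral>x. h j x \<partial>M) else 0)" for j by (simp add: H_def[abs_def])
  have int_nonneg: "0 \<le> (\<integral>x. H j x \<partial>M)" for j using H_nonneg by (rule Bochner_Integration.integral_nonneg)
  have partial: "(\<Sum>j<n. \<integral>x. H j x \<partial>M) \<le> B" for n
  proof -
    have "(\<Sum>j<n. \<integral>x. H j x \<partial>M) = (\<integral>x. (\<Sum>j<n. H j x) \<partial>M)"
      using H_int by (intro Bochner_Integration.integral_sum[symmetric]) auto
    also have "\<dots> \<le> (\<integral>x. B \<partial>M)"
    proof (rule integral_mono)
      fix x assume x: "x \<in> space M"
      have "(\<Sum>j<n. H j x) \<le> (\<Sum>\<^sub>\<infinity>j\<in>J. h j x)"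
        using sum_le_suminf[OF sums_summable[OF H_sums[OF x]], of "{..<n}"] H_nonneg[OF x] sums_unique[OF H_sums[OF x]] by auto
      then show "(\<Sum>j<n. H j x) \<le> B" using bound[OF x] by simp
    qed (use H_int in auto)
    finally show ?thesis by (simp add: M.prob_space)
  qed
  have summ_int: "summable (\<lambda>j. \<integral>x. H j x \<partial>M)"
    by (rule summableI_nonneg_bounded[OF int_nonneg partial])
  have norm_eq: "(\<integral>x. norm (H j x) \<partial>M) = (\<integral>x. H j x \<partial>M)" for j
    using H_nonneg by (intro Bochner_Integration.integral_cong) auto
  have ae: "AE x in M. summable (\<lambda>j. norm (H j x))"
  proof (rule AE_I2)
    fix x assume x: "x \<in> space M"
    have "(\<lambda>j. norm (H j x)) = (\<lambda>j. H j x)" using H_nonneg[OF x] by auto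
    then show "summable (\<lambda>j. norm (H j x))" using sums_summable[OF H_sums[OF x]] by simp
  qed
  have suminf_eq: "(\<Sum>j. H j x) = (\<Sum>\<^sub>\<infinity>j\<in>J. h j x)" if "x \<in> space M" for x
    using sums_unique[OF H_sums[OF that]] by simp
  have total: "(\<integral>x. (\<Sum>j. H j x) \<partial>M) = (\<Sum>j. \<integral>x. H j x \<partial>M)"
    using summ_int by (intro integral_suminf H_int ae) (simp only: norm_eq)
  have "integrable M (\<lambda>x. \<Sum>j. H j x)"
    using summ_int by (intro integrable_suminf H_int ae) (simp only: norm_eq)
  then show "integrable M (\<lambda>x. \<Sum>\<^sub>\<infinity>j\<in>J. h j x)"
    by (rule Bochner_Integration.integrable_cong[THEN iffD1, rotated 2]) (auto simp: suminf_eq)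
  have "(\<integral>x. (\<Sum>j. H j x) \<partial>M) = (\<integral>x. (\<Sum>\<^sub>\<infinity>j\<in>J. h j x) \<partial>M)"
    by (intro Bochner_Integration.integral_cong) (auto simp: suminf_eq)
  then have "(\<lambda>j. \<integral>x. H j x \<partial>M) sums (\<integral>x. (\<Sum>\<^sub>\<infinity>j\<in>J. h j x) \<partial>M)"
    using summable_sums[OF summ_int] total by simp
  then have "((\<lambda>j. \<integral>x. h j x \<partial>M) has_sum (\<integral>x. (\<Sum>\<^sub>\<infinity>j\<in>J. h j x) \<partial>M)) J"
    unfolding int_H using nonneg by (subst has_sum_iff_sums) (auto intro!: Bochner_Integration.integral_nonneg)
  then show "(\<lambda>j. \<integral>x. h j x \<partial>M) summable_on J" "(\<Sum>\<^sub>\<infinity>j\<in>J. \<integral>x. h j x \<partial>M) = (\<integral>x. (\<Sum>\<^sub>\<infinity>j\<in>J. h j x) \<partial>M)"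
    by (auto simp: summable_on_def infsumI)
qed

section \<open>Mixed actions on compact sets\<close>

abbreviation probs :: "'a::topological_space set \<Rightarrow> 'a measure set"
  where "probs A \<equiv> space (prob_algebra (restrict_space borel A))"

lemma probsD:
  assumes "v \<in> probs A"
  shows "sets v = sets (restrict_space borel A)" "prob_space v" "space v = A"
  using assms sets_eq_imp_space_eq[of v "restrict_space borel A"]
  by (auto simp: space_prob_algebra space_restrict_space)

lemma measurable_probs_id: "v \<in> probs A \<Longrightarrow> (\<lambda>x. x) \<in> v \<rightarrow>\<^sub>M borel"
  using measurable_restrict_space1[of "\<lambda>x. x" borel borel A] probsD(1)[of v A] by (simp cong: measurable_cong_sets)

lemma compact_continuous_bounded:
  fixes f :: "'a::topological_space \<Rightarrow> real"
  assumes "compact A" "continuous_on A f"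
  obtains M where "\<And>x. x \<in> A \<Longrightarrow> \<bar>f x\<bar> \<le> M"
proof -
  have "bounded (f ` A)" using assms by (intro compact_imp_bounded compact_continuous_image)
  then show ?thesis using that by (auto simp: bounded_iff)
qed

lemma measurable_probs_continuous:
  fixes f :: "'a::metric_space \<Rightarrow> real"
  assumes v: "v \<in> probs A" and f: "continuous_on A f"
  shows "f \<in> borel_measurable v"
  using borel_measurable_continuous_on_restrict[OF f] probsD(1)[OF v] by (simp cong: measurable_cong_sets)

lemma integrable_probs_continuous:
  fixes f :: "'a::metric_space \<Rightarrow> real"
  assumes v: "v \<in> probs A" and A: "compact A" and f: "continuous_on A f"
  shows "integrable v f"
proof -
  interpret prob_space v using probsD[OF v] by blast
  obtain M where "\<And>x. x \<in> A \<Longrightarrow> \<bar>f x\<bar> \<le> M" using compact_continuous_bounded[OF A f] by blast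
  then show ?thesis
    using measurable_probs_continuous[OF v f] by (intro integrable_const_bound[of _ M]) (auto simp: probsD(3)[OF v])
qed

lemma return_in_probs: "x \<in> A \<Longrightarrow> return (restrict_space borel A) x \<in> probs A"
  by (auto simp: space_prob_algebra space_restrict_space intro!: prob_space_return)

lemma integral_return_probs:
  fixes f :: "'a::metric_space \<Rightarrow> real"
  assumes "x \<in> A" "continuous_on A f"
  shows "(\<integral>y. f y \<partial>return (restrict_space borel A) x) = f x"
  using assms borel_measurable_continuous_on_restrict[OF assms(2)]
  by (intro integral_return) (auto simp: space_restrict_space)

context
  fixes A :: "'a::{metric_space, second_countable_topology} set" and C :: "'b::{metric_space, second_countable_topology} set"
    and f :: "'a \<Rightarrow> 'b \<Rightarrow> real"
  assumes A: "compact A" and C: "compact C" and f: "continuous_on (A \<times> C) (\<lambda>(x, y). f x y)"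
begin

lemma sections_continuous:
  "x \<in> A \<Longrightarrow> continuous_on C (f x)" "y \<in> C \<Longrightarrow> continuous_on A (\<lambda>x. f x y)"
proof -
  show "continuous_on C (f x)" if "x \<in> A"
    by (rule continuous_on_compose2[OF f, of C "\<lambda>y. (x, y)", simplified]) (use that in \<open>auto intro!: continuous_intros\<close>)
  show "continuous_on A (\<lambda>x. f x y)" if "y \<in> C"
    by (rule continuous_on_compose2[OF f, of A "\<lambda>x. (x, y)", simplified]) (use that in \<open>auto intro!: continuous_intros\<close>)
qed

lemma jointly_bounded: obtains M where "\<And>x y. x \<in> A \<Longrightarrow> y \<in> C \<Longrightarrow> \<bar>f x y\<bar> \<le> M"
  using compact_continuous_bounded[OF compact_Times[OF A C] f] by (metis (no_types, lifting) case_prod_conv mem_Sigma_iff)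

lemma integrable_pair_probs:
  assumes v: "v \<in> probs A" and w: "w \<in> probs C"
  shows "integrable (v \<Otimes>\<^sub>M w) (\<lambda>(x, y). f x y)"
proof -
  interpret v: prob_space v using probsD[OF v] by blast
  interpret w: prob_space w using probsD[OF w] by blast
  interpret vw: pair_prob_space v w ..
  have "A \<times> C \<in> sets borel" using compact_Times[OF A C] by (intro borel_closed compact_imp_closed)
  then have "(\<lambda>p. indicator (A \<times> C) p *\<^sub>R (case p of (x, y) \<Rightarrow> f x y)) \<in> borel_measurable borel"
    using f by (intro borel_measurable_continuous_on_indicator)
  then have meas: "(\<lambda>p. indicator (A \<times> C) p *\<^sub>R (case p of (x, y) \<Rightarrow> f x y)) \<in> borel_measurable (borel \<Otimes>\<^sub>M borel)"
    by (simp add: borel_prod)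
  have "(\<lambda>p. (fst p, snd p)) \<in> v \<Otimes>\<^sub>M w \<rightarrow>\<^sub>M borel \<Otimes>\<^sub>M borel"
    by (intro measurable_Pair measurable_compose[OF measurable_fst measurable_probs_id[OF v]]
        measurable_compose[OF measurable_snd measurable_probs_id[OF w]])
  from measurable_compose[OF this meas]
  have "(\<lambda>p. indicator (A \<times> C) p *\<^sub>R (case p of (x, y) \<Rightarrow> f x y)) \<in> borel_measurable (v \<Otimes>\<^sub>M w)" by simp
  then have "(\<lambda>(x, y). f x y) \<in> borel_measurable (v \<Otimes>\<^sub>M w)"
    by (rule measurable_cong[THEN iffD1, rotated]) (auto simp: space_pair_measure probsD(3)[OF v] probsD(3)[OF w])
  moreover obtain M where "\<And>x y. x \<in> A \<Longrightarrow> y \<in> C \<Longrightarrow> \<bar>f x y\<bar> \<le> M" using jointly_bounded by blast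
  ultimately show ?thesis
    by (intro vw.P.integrable_const_bound[of _ M]) (auto simp: space_pair_measure probsD(3)[OF v] probsD(3)[OF w])
qed

text \<open>\<open>relaxed\<close> integrates over the first player inside. The product form serves
  for estimates; the reversed order exhibits the value as an integral against the first player's
  mixed action.\<close>

lemma relaxed_pair:
  assumes v: "v \<in> probs A" and w: "w \<in> probs C"
  shows "relaxed f v w = (\<integral>p. f (fst p) (snd p) \<partial>(v \<Otimes>\<^sub>M w))"
    and "relaxed f v w = (\<integral>x. (\<integral>y. f x y \<partial>w) \<partial>v)"
proof -
  interpret v: prob_space v using probsD[OF v] by blast
  interpret w: prob_space w using probsD[OF w] by blast
  interpret vw: pair_prob_space v w ..
  show "relaxed f v w = (\<integral>p. f (fst p) (snd p) \<partial>(v \<Otimes>\<^sub>M w))"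
    unfolding relaxed_def using vw.integral_snd[OF integrable_pair_probs[OF v w]] by (simp add: case_prod_unfold)
  show "relaxed f v w = (\<integral>x. (\<integral>y. f x y \<partial>w) \<partial>v)"
    unfolding relaxed_def using vw.Fubini_integral[OF integrable_pair_probs[OF v w]] .
qed

lemma continuous_on_inner_integral1:
  assumes w: "w \<in> probs C"
  shows "continuous_on A (\<lambda>x. \<integral>y. f x y \<partial>w)"
proof (rule continuous_on_sequentiallyI)
  interpret w: prob_space w using probsD[OF w] by blast
  fix u x assume u: "\<forall>n. u n \<in> A" and x: "x \<in> A" and lim: "u \<longlonglongrightarrow> x"
  obtain M where M: "\<And>x y. x \<in> A \<Longrightarrow> y \<in> C \<Longrightarrow> \<bar>f x y\<bar> \<le> M" using jointly_bounded by blast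
  show "(\<lambda>n. \<integral>y. f (u n) y \<partial>w) \<longlonglongrightarrow> (\<integral>y. f x y \<partial>w)"
  proof (rule integral_dominated_convergence)
    show "f x \<in> borel_measurable w" "\<And>n. f (u n) \<in> borel_measurable w"
      using u x by (auto intro!: measurable_probs_continuous[OF w] sections_continuous)
    show "integrable w (\<lambda>_. M)" by simp
    show "AE y in w. (\<lambda>n. f (u n) y) \<longlonglongrightarrow> f x y"
    proof (rule AE_I2)
      fix y assume "y \<in> space w"
      then have "y \<in> C" using probsD(3)[OF w] by simp
      from sections_continuous(2)[OF this] show "(\<lambda>n. f (u n) y) \<longlonglongrightarrow> f x y"
        using u x lim unfolding continuous_on_sequentially by (auto simp: comp_def)
    qed
    show "AE y in w. norm (f (u n) y) \<le> M" for n
      using u M by (intro AE_I2) (auto simp: probsD(3)[OF w])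
  qed
qed

lemma continuous_on_inner_integral2:
  assumes v: "v \<in> probs A"
  shows "continuous_on C (\<lambda>y. \<integral>x. f x y \<partial>v)"
proof (rule continuous_on_sequentiallyI)
  interpret v: prob_space v using probsD[OF v] by blast
  fix u y assume u: "\<forall>n. u n \<in> C" and y: "y \<in> C" and lim: "u \<longlonglongrightarrow> y"
  obtain M where M: "\<And>x y. x \<in> A \<Longrightarrow> y \<in> C \<Longrightarrow> \<bar>f x y\<bar> \<le> M" using jointly_bounded by blast
  show "(\<lambda>n. \<integral>x. f x (u n) \<partial>v) \<longlonglongrightarrow> (\<integral>x. f x y \<partial>v)"
  proof (rule integral_dominated_convergence)
    show "(\<lambda>x. f x y) \<in> borel_measurable v" "\<And>n. (\<lambda>x. f x (u n)) \<in> borel_measurable v"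
      using u y by (auto intro!: measurable_probs_continuous[OF v] sections_continuous)
    show "integrable v (\<lambda>_. M)" by simp
    show "AE x in v. (\<lambda>n. f x (u n)) \<longlonglongrightarrow> f x y"
    proof (rule AE_I2)
      fix x assume "x \<in> space v"
      then have "x \<in> A" using probsD(3)[OF v] by simp
      from sections_continuous(1)[OF this] show "(\<lambda>n. f x (u n)) \<longlonglongrightarrow> f x y"
        using u y lim unfolding continuous_on_sequentially by (auto simp: comp_def)
    qed
    show "AE x in v. norm (f x (u n)) \<le> M" for n
      using u M by (intro AE_I2) (auto simp: probsD(3)[OF v])
  qed
qed

end

text \<open>The value of a mixed action is an average of the values \<open>S u\<close> of pure
  actions, so a minimizing pure action is enough. \<open>S\<close> is a supremum of continuous
  finite sums, hence lower semicontinuous, and attains its infimum on the compact set.\<close>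

lemma minimizer_probs:
  fixes A :: "'a::metric_space set" and g :: "nat \<Rightarrow> 'a \<Rightarrow> real"
  assumes A: "compact A" "A \<noteq> {}" and i: "i \<in> states"
    and g: "\<And>j. j \<in> states \<Longrightarrow> continuous_on A (g j)" and k: "continuous_on A k"
    and nonneg: "\<And>j u. j \<in> states \<Longrightarrow> j \<noteq> i \<Longrightarrow> u \<in> A \<Longrightarrow> 0 \<le> g j u"
    and summ: "\<And>u. u \<in> A \<Longrightarrow> (\<lambda>j. \<psi> j * g j u) summable_on states - {i}"
    and bound: "\<And>u. u \<in> A \<Longrightarrow> (\<Sum>\<^sub>\<infinity>j\<in>states - {i}. \<psi> j * g j u) \<le> B"
    and \<psi>: "\<And>j. j \<in> states \<Longrightarrow> 0 \<le> \<psi> j"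
  shows "\<exists>v\<in>probs A. \<forall>v'\<in>probs A.
    (\<Sum>\<^sub>\<infinity>j\<in>states. \<psi> j * (\<integral>u. g j u \<partial>v)) + (\<integral>u. k u \<partial>v) * \<psi> i \<le>
    (\<Sum>\<^sub>\<infinity>j\<in>states. \<psi> j * (\<integral>u. g j u \<partial>v')) + (\<integral>u. k u \<partial>v') * \<psi> i"
proof -
  let ?J = "states - {i}"
  define b where "b u = \<psi> i * g i u + k u * \<psi> i" for u
  define S where "S u = (\<Sum>\<^sub>\<infinity>j\<in>?J. \<psi> j * g j u) + b u" for u
  have b: "continuous_on A b" unfolding b_def using g[OF i] k by (intro continuous_intros)
  have term_nonneg: "0 \<le> \<psi> j * g j u" if "j \<in> ?J" "u \<in> A" for j u using nonneg \<psi> that by auto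
  obtain M where M: "\<And>u. u \<in> A \<Longrightarrow> \<bar>b u\<bar> \<le> M" using compact_continuous_bounded[OF A(1) b] by blast
  have S_ge: "- M \<le> S u" if "u \<in> A" for u
    using M[OF that] infsum_nonneg[of ?J "\<lambda>j. \<psi> j * g j u"] term_nonneg that unfolding S_def by force
  have val: "(\<Sum>\<^sub>\<infinity>j\<in>states. \<psi> j * (\<integral>u. g j u \<partial>v)) + (\<integral>u. k u \<partial>v) * \<psi> i = (\<integral>u. S u \<partial>v) \<and> integrable v S"
    if v: "v \<in> probs A" for v
  proof -
    note sp = probsD(3)[OF v]
    have int_g: "integrable v (g j)" if "j \<in> states" for j using integrable_probs_continuous[OF v A(1) g[OF that]] .
    have int_k: "integrable v k" using integrable_probs_continuous[OF v A(1) k] .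
    have int_b: "integrable v b" using integrable_probs_continuous[OF v A(1) b] .
    note I = infsum_integral[OF probsD(2)[OF v], of ?J "\<lambda>j u. \<psi> j * g j u" B, unfolded sp, OF term_nonneg _ summ bound]
    have eqs: "(\<lambda>j. \<psi> j * (\<integral>u. g j u \<partial>v)) summable_on ?J"
      "(\<Sum>\<^sub>\<infinity>j\<in>?J. \<psi> j * (\<integral>u. g j u \<partial>v)) = (\<integral>u. (\<Sum>\<^sub>\<infinity>j\<in>?J. \<psi> j * g j u) \<partial>v)"
      "integrable v (\<lambda>u. \<Sum>\<^sub>\<infinity>j\<in>?J. \<psi> j * g j u)"
      using I int_g by auto
    have "(\<Sum>\<^sub>\<infinity>j\<in>states. \<psi> j * (\<integral>u. g j u \<partial>v)) = (\<Sum>\<^sub>\<infinity>j\<in>insert i ?J. \<psi> j * (\<integral>u. g j u \<partial>v))"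
      using i by (simp add: insert_absorb)
    also have "\<dots> = \<psi> i * (\<integral>u. g i u \<partial>v) + (\<Sum>\<^sub>\<infinity>j\<in>?J. \<psi> j * (\<integral>u. g j u \<partial>v))"
      using eqs(1) by (intro infsum_insert) auto
    finally have "(\<Sum>\<^sub>\<infinity>j\<in>states. \<psi> j * (\<integral>u. g j u \<partial>v)) + (\<integral>u. k u \<partial>v) * \<psi> i =
      (\<integral>u. (\<Sum>\<^sub>\<infinity>j\<in>?J. \<psi> j * g j u) \<partial>v) + (\<integral>u. b u \<partial>v)"
      unfolding eqs(2) b_def using int_g[OF i] int_k by simp
    also have "\<dots> = (\<integral>u. S u \<partial>v)" unfolding S_def using eqs(3) int_b by simp
    finally show ?thesis unfolding S_def using eqs(3) int_b by simp
  qed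
  define m where "m = (INF u\<in>A. S u)"
  have bdd: "bdd_below (S ` A)" using S_ge by (intro bdd_belowI[of _ "- M"]) auto
  have m_le: "m \<le> S u" if "u \<in> A" for u unfolding m_def using bdd that by (rule cINF_lower)
  define G where "G F u = (\<Sum>j\<in>F. \<psi> j * g j u) + b u" for F u
  have G_le: "G F u \<le> S u" if "finite F" "F \<subseteq> ?J" "u \<in> A" for F u
    unfolding G_def S_def using finite_sum_le_infsum[OF summ[OF that(3)] that(1,2)] term_nonneg that(3) by simp
  \<comment> \<open>Closed sublevel sets of the finite sums, slightly above the infimum
    \<open>m\<close>. Finitely many of them meet where \<open>S\<close> is nearly minimal, and a
    point common to all minimizes \<open>S\<close>.\<close>
  define \<F> where "\<F> = {{u \<in> A. G F u \<le> m + 1 / real (Suc n)} | F n. finite F \<and> F \<subseteq> ?J}"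
  have "A \<inter> \<Inter>\<F> \<noteq> {}"
  proof (rule compact_imp_fip[OF A(1)])
    fix T assume "T \<in> \<F>"
    then obtain F n where T: "T = {u \<in> A. G F u \<le> m + 1 / real (Suc n)}" "finite F" "F \<subseteq> ?J"
      unfolding \<F>_def by blast
    have "continuous_on A (G F)" unfolding G_def using T b g by (intro continuous_intros) auto
    then show "closed T" unfolding T(1)
      using A(1) by (intro continuous_on_closed_Collect_le continuous_on_const compact_imp_closed)
  next
    fix \<F>' assume F': "finite \<F>'" "\<F>' \<subseteq> \<F>"
    have "\<forall>T\<in>\<F>'. \<exists>n F. T = {u \<in> A. G F u \<le> m + 1 / real (Suc n)} \<and> finite F \<and> F \<subseteq> ?J"
      using F'(2) unfolding \<F>_def by blast
    then obtain n F where nF: "\<And>T. T \<in> \<F>' \<Longrightarrow> T = {u \<in> A. G (F T) u \<le> m + 1 / real (Suc (n T))} \<and> finite (F T) \<and> F T \<subseteq> ?J"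
      by metis
    define N where "N = (\<Sum>T\<in>\<F>'. n T)"
    have "m < m + 1 / real (Suc N)" by simp
    then obtain u where u: "u \<in> A" "S u < m + 1 / real (Suc N)"
      unfolding m_def using cINF_less_iff[OF A(2) bdd] by blast
    have "u \<in> T" if T: "T \<in> \<F>'" for T
    proof -
      have "n T \<le> N" unfolding N_def using F'(1) T by (intro member_le_sum) auto
      then have "1 / real (Suc N) \<le> 1 / real (Suc (n T))" by (intro divide_left_mono) auto
      then have "G (F T) u \<le> m + 1 / real (Suc (n T))"
        using G_le[of "F T" u] nF[OF T] u by simp
      then show ?thesis using nF[OF T] u(1) by blast
    qed
    then show "A \<inter> \<Inter>\<F>' \<noteq> {}" using u(1) by blast
  qed
  then obtain u where u: "u \<in> A" and uF: "\<And>T. T \<in> \<F> \<Longrightarrow> u \<in> T" by blast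
  have "G F u \<le> m" if F: "finite F" "F \<subseteq> ?J" for F
  proof (rule field_le_epsilon)
    fix e :: real assume "0 < e"
    then obtain n where "inverse (real (Suc n)) < e" using reals_Archimedean by blast
    moreover have "G F u \<le> m + 1 / real (Suc n)"
      using uF[of "{u \<in> A. G F u \<le> m + 1 / real (Suc n)}"] F unfolding \<F>_def by blast
    ultimately show "G F u \<le> m + e" by (simp add: inverse_eq_divide)
  qed
  then have "(\<Sum>j\<in>F. \<psi> j * g j u) \<le> m - b u" if "finite F" "F \<subseteq> ?J" for F using that by (simp add: G_def le_diff_eq)
  then have "(\<Sum>\<^sub>\<infinity>j\<in>?J. \<psi> j * g j u) \<le> m - b u" by (intro infsum_le_finite_sums summ u)
  then have Su: "S u \<le> m" by (simp add: S_def)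
  show ?thesis
  proof (intro bexI[of _ "return (restrict_space borel A) u"] ballI return_in_probs u)
    fix v' assume v': "v' \<in> probs A"
    interpret v': prob_space v' using probsD[OF v'] by blast
    have "(\<Sum>\<^sub>\<infinity>j\<in>states. \<psi> j * (\<integral>y. g j y \<partial>return (restrict_space borel A) u)) + (\<integral>y. k y \<partial>return (restrict_space borel A) u) * \<psi> i =
      (\<Sum>\<^sub>\<infinity>j\<in>states. \<psi> j * g j u) + k u * \<psi> i"
      using integral_return_probs[OF u] g k by (auto intro!: arg_cong2[where f="(+)"] infsum_cong)
    also have "\<dots> = S u"
    proof -
      have "(\<Sum>\<^sub>\<infinity>j\<in>states. \<psi> j * g j u) = (\<Sum>\<^sub>\<infinity>j\<in>insert i ?J. \<psi> j * g j u)" using i by (simp add: insert_absorb)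
      also have "\<dots> = \<psi> i * g i u + (\<Sum>\<^sub>\<infinity>j\<in>?J. \<psi> j * g j u)" using summ[OF u] by (intro infsum_insert) auto
      finally show ?thesis by (simp add: S_def b_def)
    qed
    also have "\<dots> \<le> (\<integral>y. S u \<partial>v')" by (simp add: v'.prob_space)
    also have "\<dots> \<le> (\<integral>y. S y \<partial>v')"
      using val[OF v'] order.trans[OF Su m_le] by (intro integral_mono) (auto simp: probsD(3)[OF v'])
    finally show "(\<Sum>\<^sub>\<infinity>j\<in>states. \<psi> j * (\<integral>y. g j y \<partial>return (restrict_space borel A) u)) + (\<integral>y. k y \<partial>return (restrict_space borel A) u) * \<psi> i \<le>
      (\<Sum>\<^sub>\<infinity>j\<in>states. \<psi> j * (\<integral>u. g j u \<partial>v')) + (\<integral>u. k u \<partial>v') * \<psi> i"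
      using val[OF v'] by simp
  qed
qed

section \<open>Rates and costs of the game under mixed actions\<close>

context nonzero_sum_game
begin

lemma compact_actions: "i \<in> states \<Longrightarrow> compact (A1 i)" "i \<in> states \<Longrightarrow> compact (A2 i)"
  using admissible1 admissible2 by blast+

definition relaxed_rate :: "(nat \<Rightarrow> 'a measure) \<Rightarrow> (nat \<Rightarrow> 'b measure) \<Rightarrow> nat \<Rightarrow> nat \<Rightarrow> real"
  where "relaxed_rate v1 v2 x j = (if x \<in> states \<and> j \<in> states \<and> x \<noteq> j then relaxed (q x j) (v1 x) (v2 x) else 0)"

definition relaxed_cost :: "(nat \<Rightarrow> 'a \<Rightarrow> 'b \<Rightarrow> real) \<Rightarrow> (nat \<Rightarrow> 'a measure) \<Rightarrow> (nat \<Rightarrow> 'b measure) \<Rightarrow> nat \<Rightarrow> real"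
  where "relaxed_cost c v1 v2 x = (if x \<in> states then relaxed (c x) (v1 x) (v2 x) else 0)"

end

lemma stationaryD: "v \<in> stationary A \<Longrightarrow> i \<in> states \<Longrightarrow> v i \<in> probs (A i)"
  by (simp add: stationary_def relaxed_actions_def)

lemma relaxed_le:
  fixes A :: "'a::{metric_space, second_countable_topology} set" and C :: "'b::{metric_space, second_countable_topology} set"
  assumes "compact A" "compact C" "continuous_on (A \<times> C) (\<lambda>(x, y). f x y)" "v \<in> probs A" "w \<in> probs C"
    and "\<And>x y. x \<in> A \<Longrightarrow> y \<in> C \<Longrightarrow> f x y \<le> B"
  shows "relaxed f v w \<le> B"
proof -
  interpret v: prob_space v using probsD assms by blast
  interpret w: prob_space w using probsD assms by blast
  interpret vw: pair_prob_space v w ..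
  have "relaxed f v w \<le> (\<integral>p. B \<partial>(v \<Otimes>\<^sub>M w))"
    unfolding relaxed_pair(1)[OF assms(1-5)]
    using integrable_pair_probs[OF assms(1-5)] assms(6)
    by (intro integral_mono) (auto simp: space_pair_measure probsD(3)[OF assms(4)] probsD(3)[OF assms(5)] case_prod_unfold)
  then show ?thesis by (simp add: vw.P.prob_space)
qed

lemma relaxed_uminus: "relaxed (\<lambda>x y. - f x y) v w = - relaxed f v w"
  by (simp add: relaxed_def)

lemma relaxed_ge:
  fixes A :: "'a::{metric_space, second_countable_topology} set" and C :: "'b::{metric_space, second_countable_topology} set"
  assumes "compact A" "compact C" "continuous_on (A \<times> C) (\<lambda>(x, y). f x y)" "v \<in> probs A" "w \<in> probs C"
    and "\<And>x y. x \<in> A \<Longrightarrow> y \<in> C \<Longrightarrow> B \<le> f x y"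
  shows "B \<le> relaxed f v w"
proof -
  have "continuous_on (A \<times> C) (\<lambda>(x, y). - f x y)"
    using continuous_on_minus[OF assms(3)] by (simp add: case_prod_unfold)
  from relaxed_le[OF assms(1,2) this assms(4,5), of "- B"] assms(6) show ?thesis by (simp add: relaxed_uminus)
qed

lemma relaxed_pos:
  fixes A :: "'a::{metric_space, second_countable_topology} set" and C :: "'b::{metric_space, second_countable_topology} set"
  assumes "compact A" "compact C" "A \<noteq> {}" "C \<noteq> {}" "continuous_on (A \<times> C) (\<lambda>(x, y). f x y)" "v \<in> probs A" "w \<in> probs C"
    and pos: "\<And>x y. x \<in> A \<Longrightarrow> y \<in> C \<Longrightarrow> 0 < f x y"
  shows "0 < relaxed f v w"
proof -
  obtain p where p: "p \<in> A \<times> C" "\<forall>r\<in>A \<times> C. (case p of (x, y) \<Rightarrow> f x y) \<le> (case r of (x, y) \<Rightarrow> f x y)"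
    using continuous_attains_inf[OF compact_Times[OF assms(1,2)] _ assms(5)] assms(3,4) by auto
  have "0 < f (fst p) (snd p)" using p(1) pos by auto
  also have "\<dots> \<le> relaxed f v w"
    using p(2) by (intro relaxed_ge[OF assms(1,2,5-7)]) (auto simp: case_prod_unfold)
  finally show ?thesis .
qed

context nonzero_sum_game
begin

context
  fixes i m1 m2
  assumes i: "i \<in> states" and m1: "m1 \<in> probs (A1 i)" and m2: "m2 \<in> probs (A2 i)"
    and q_cont: "\<And>j. j \<in> states \<Longrightarrow> continuous_on (A1 i \<times> A2 i) (\<lambda>(u1, u2). q i j u1 u2)"
begin

text \<open>Sum and expectation over both mixed actions are interchanged for the nonnegative
  off-diagonal part; the diagonal term is split off. The bound \<open>B\<close> for pure actions is
  then averaged.\<close>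

lemma relaxed_weighted_sum:
  assumes w: "\<And>j. j \<in> states \<Longrightarrow> 0 \<le> w j"
    and summ: "\<And>u1 u2. u1 \<in> A1 i \<Longrightarrow> u2 \<in> A2 i \<Longrightarrow> (\<lambda>j. w j * q i j u1 u2) summable_on states"
    and bound: "\<And>u1 u2. u1 \<in> A1 i \<Longrightarrow> u2 \<in> A2 i \<Longrightarrow> (\<Sum>\<^sub>\<infinity>j\<in>states. w j * q i j u1 u2) \<le> B"
  shows "(\<lambda>j. w j * relaxed (q i j) m1 m2) summable_on states - {i}"
    and "(\<Sum>\<^sub>\<infinity>j\<in>states - {i}. w j * relaxed (q i j) m1 m2) + w i * relaxed (q i i) m1 m2 =
      (\<integral>p. (\<Sum>\<^sub>\<infinity>j\<in>states. w j * q i j (fst p) (snd p)) \<partial>(m1 \<Otimes>\<^sub>M m2))"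
    and "(\<Sum>\<^sub>\<infinity>j\<in>states - {i}. w j * relaxed (q i j) m1 m2) + w i * relaxed (q i i) m1 m2 \<le> B"
proof -
  interpret m1: prob_space m1 using probsD m1 by blast
  interpret m2: prob_space m2 using probsD m2 by blast
  interpret M: pair_prob_space m1 m2 ..
  let ?J = "states - {i}"
  note comp = compact_actions[OF i]
  have sp: "fst p \<in> A1 i \<and> snd p \<in> A2 i" if "p \<in> space (m1 \<Otimes>\<^sub>M m2)" for p
    using that by (auto simp: space_pair_measure probsD(3)[OF m1] probsD(3)[OF m2])
  have int: "integrable (m1 \<Otimes>\<^sub>M m2) (\<lambda>p. q i j (fst p) (snd p))" if "j \<in> states" for j
    using integrable_pair_probs[OF comp q_cont[OF that] m1 m2] by (simp add: case_prod_unfold)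
  have rel: "w j * relaxed (q i j) m1 m2 = (\<integral>p. w j * q i j (fst p) (snd p) \<partial>(m1 \<Otimes>\<^sub>M m2))" if "j \<in> states" for j
    using relaxed_pair(1)[OF comp q_cont[OF that] m1 m2] by simp
  obtain M where M: "\<And>u1 u2. u1 \<in> A1 i \<Longrightarrow> u2 \<in> A2 i \<Longrightarrow> \<bar>q i i u1 u2\<bar> \<le> M"
    using jointly_bounded[OF comp q_cont[OF i]] by blast
  have split: "(\<Sum>\<^sub>\<infinity>j\<in>states. w j * q i j u1 u2) = w i * q i i u1 u2 + (\<Sum>\<^sub>\<infinity>j\<in>?J. w j * q i j u1 u2)"
    and summ': "(\<lambda>j. w j * q i j u1 u2) summable_on ?J"
    if "u1 \<in> A1 i" "u2 \<in> A2 i" for u1 u2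
  proof -
    show s: "(\<lambda>j. w j * q i j u1 u2) summable_on ?J"
      by (rule summable_on_subset_banach[OF summ[OF that]]) auto
    have "(\<Sum>\<^sub>\<infinity>j\<in>states. w j * q i j u1 u2) = (\<Sum>\<^sub>\<infinity>j\<in>insert i ?J. w j * q i j u1 u2)"
      using i by (simp add: insert_absorb)
    also have "\<dots> = w i * q i i u1 u2 + (\<Sum>\<^sub>\<infinity>j\<in>?J. w j * q i j u1 u2)" using s by (intro infsum_insert) auto
    finally show "(\<Sum>\<^sub>\<infinity>j\<in>states. w j * q i j u1 u2) = w i * q i i u1 u2 + (\<Sum>\<^sub>\<infinity>j\<in>?J. w j * q i j u1 u2)" .
  qed
  have nonneg: "0 \<le> w j * q i j u1 u2" if "j \<in> ?J" "u1 \<in> A1 i" "u2 \<in> A2 i" for j u1 u2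
    using w[of j] rate_nonneg[of i u1 u2 j] that i by (auto simp: K_graph_def)
  \<comment> \<open>The diagonal rate is continuous on a compact set, hence bounded by
    \<open>M\<close>; this gives the uniform bound that the interchange requires.\<close>
  have bound': "(\<Sum>\<^sub>\<infinity>j\<in>?J. w j * q i j u1 u2) \<le> B + w i * M" if "u1 \<in> A1 i" "u2 \<in> A2 i" for u1 u2
  proof -
    have "w i * - q i i u1 u2 \<le> w i * M" using M[OF that] w[OF i] by (intro mult_left_mono) auto
    then show ?thesis using split[OF that] bound[OF that] by simp
  qed
  have I: "(\<lambda>j. \<integral>p. w j * q i j (fst p) (snd p) \<partial>(m1 \<Otimes>\<^sub>M m2)) summable_on ?J"
    "(\<Sum>\<^sub>\<infinity>j\<in>?J. \<integral>p. w j * q i j (fst p) (snd p) \<partial>(m1 \<Otimes>\<^sub>M m2)) = (\<integral>p. (\<Sum>\<^sub>\<infinity>j\<in>?J. w j * q i j (fst p) (snd p)) \<partial>(m1 \<Otimes>\<^sub>M m2))"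
    "integrable (m1 \<Otimes>\<^sub>M m2) (\<lambda>p. \<Sum>\<^sub>\<infinity>j\<in>?J. w j * q i j (fst p) (snd p))"
    using infsum_integral[OF M.P.prob_space_axioms, of ?J "\<lambda>j p. w j * q i j (fst p) (snd p)" "B + w i * M"]
      nonneg int summ' bound' sp by auto
  show "(\<lambda>j. w j * relaxed (q i j) m1 m2) summable_on ?J"
    using I(1) by (rule summable_on_cong[THEN iffD1, rotated]) (simp add: rel)
  have sum_J: "(\<Sum>\<^sub>\<infinity>j\<in>?J. w j * relaxed (q i j) m1 m2) = (\<Sum>\<^sub>\<infinity>j\<in>?J. \<integral>p. w j * q i j (fst p) (snd p) \<partial>(m1 \<Otimes>\<^sub>M m2))"
    by (rule infsum_cong) (use rel in auto)
  have int_ii: "integrable (m1 \<Otimes>\<^sub>M m2) (\<lambda>p. w i * q i i (fst p) (snd p))" using int[OF i] by simp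
  have "(\<Sum>\<^sub>\<infinity>j\<in>?J. w j * relaxed (q i j) m1 m2) + w i * relaxed (q i i) m1 m2 =
    (\<integral>p. (\<Sum>\<^sub>\<infinity>j\<in>?J. w j * q i j (fst p) (snd p)) + w i * q i i (fst p) (snd p) \<partial>(m1 \<Otimes>\<^sub>M m2))"
    unfolding sum_J I(2) rel[OF i] using I(3) int_ii by (rule Bochner_Integration.integral_add[symmetric])
  also have "\<dots> = (\<integral>p. (\<Sum>\<^sub>\<infinity>j\<in>states. w j * q i j (fst p) (snd p)) \<partial>(m1 \<Otimes>\<^sub>M m2))"
    using sp split by (intro Bochner_Integration.integral_cong) auto
  finally show eq: "(\<Sum>\<^sub>\<infinity>j\<in>?J. w j * relaxed (q i j) m1 m2) + w i * relaxed (q i i) m1 m2 =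
      (\<integral>p. (\<Sum>\<^sub>\<infinity>j\<in>states. w j * q i j (fst p) (snd p)) \<partial>(m1 \<Otimes>\<^sub>M m2))" .
  have "integrable (m1 \<Otimes>\<^sub>M m2) (\<lambda>p. \<Sum>\<^sub>\<infinity>j\<in>states. w j * q i j (fst p) (snd p))"
    using Bochner_Integration.integrable_add[OF int_ii I(3)]
    by (rule Bochner_Integration.integrable_cong[THEN iffD1, rotated 2]) (use sp split in auto)
  then have "(\<integral>p. (\<Sum>\<^sub>\<infinity>j\<in>states. w j * q i j (fst p) (snd p)) \<partial>(m1 \<Otimes>\<^sub>M m2)) \<le> (\<integral>p. B \<partial>(m1 \<Otimes>\<^sub>M m2))"
    using bound sp by (intro integral_mono) auto
  then show "(\<Sum>\<^sub>\<infinity>j\<in>?J. w j * relaxed (q i j) m1 m2) + w i * relaxed (q i i) m1 m2 \<le> B"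
    unfolding eq by (simp add: M.P.prob_space)
qed

text \<open>Conservativity survives averaging: the case of weights 1 and bound 0.\<close>

lemma relaxed_conservative:
  "(\<lambda>j. relaxed (q i j) m1 m2) summable_on states - {i}"
  "(\<Sum>\<^sub>\<infinity>j\<in>states - {i}. relaxed (q i j) m1 m2) = - relaxed (q i i) m1 m2"
proof -
  have cons: "((\<lambda>j. 1 * q i j u1 u2) has_sum 0) states" if "u1 \<in> A1 i" "u2 \<in> A2 i" for u1 u2
    using conservative[of i u1 u2] that i by (simp add: K_graph_def)
  note R = relaxed_weighted_sum[of "\<lambda>_. 1" 0]
  have 1: "(\<lambda>j. 1 * q i j u1 u2) summable_on states" "(\<Sum>\<^sub>\<infinity>j\<in>states. 1 * q i j u1 u2) = 0"
    if "u1 \<in> A1 i" "u2 \<in> A2 i" for u1 u2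
    using cons[OF that] by (auto simp only: summable_on_def infsumI)
  show "(\<lambda>j. relaxed (q i j) m1 m2) summable_on states - {i}"
    using R(1) 1 by simp
  have "(\<integral>p. (\<Sum>\<^sub>\<infinity>j\<in>states. 1 * q i j (fst p) (snd p)) \<partial>(m1 \<Otimes>\<^sub>M m2)) = (\<integral>p. 0 \<partial>(m1 \<Otimes>\<^sub>M m2))"
    using 1(2) by (intro Bochner_Integration.integral_cong) (auto simp: space_pair_measure probsD(3)[OF m1] probsD(3)[OF m2])
  then show "(\<Sum>\<^sub>\<infinity>j\<in>states - {i}. relaxed (q i j) m1 m2) = - relaxed (q i i) m1 m2"
    using R(2) 1 by simp
qed

lemma relaxed_off_diagonal_nonneg:
  assumes "j \<in> states" "i \<noteq> j" shows "0 \<le> relaxed (q i j) m1 m2"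
  using assms rate_nonneg i
  by (intro relaxed_ge[OF compact_actions[OF i] q_cont m1 m2]) (auto simp: K_graph_def)

end

end

locale controlled_game = nonzero_sum_game U1 U2 A1 A2 q c1 c2
  for U1 :: "'a::polish_space set" and U2 :: "'b::polish_space set"
    and A1 :: "nat \<Rightarrow> 'a set" and A2 :: "nat \<Rightarrow> 'b set"
    and q :: "nat \<Rightarrow> nat \<Rightarrow> 'a \<Rightarrow> 'b \<Rightarrow> real"
    and c1 c2 :: "nat \<Rightarrow> 'a \<Rightarrow> 'b \<Rightarrow> real" +
  fixes Wt :: "nat \<Rightarrow> real" and C1 C2 C3 :: real
  assumes C2_nonneg: "0 \<le> C2" and C3_pos: "0 < C3"
    and Wt_ge_1: "\<And>i. i \<in> states \<Longrightarrow> 1 \<le> Wt i"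
    and Wt_drift: "\<And>i u1 u2. i \<in> states \<Longrightarrow> u1 \<in> A1 i \<Longrightarrow> u2 \<in> A2 i \<Longrightarrow>
      (\<lambda>j. Wt j * q i j u1 u2) summable_on states \<and>
      (\<Sum>\<^sub>\<infinity>j\<in>states. Wt j * q i j u1 u2) \<le> C1 * Wt i + C2"
    and Wt_rate: "\<And>i. i \<in> states \<Longrightarrow> max_rate A1 A2 q i \<le> C3 * Wt i"
    and rates_continuous: "\<And>i j. i \<in> states \<Longrightarrow> j \<in> states \<Longrightarrow>
      continuous_on (A1 i \<times> A2 i) (\<lambda>(u1, u2). q i j u1 u2)"
begin

lemma has_sum_relaxed_rate:
  assumes "v1 \<in> stationary A1" "v2 \<in> stationary A2" "i \<in> states"
  shows "(relaxed_rate v1 v2 i has_sum - relaxed (q i i) (v1 i) (v2 i)) UNIV"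
proof -
  note R = relaxed_conservative[OF assms(3) stationaryD[OF assms(1,3)] stationaryD[OF assms(2,3)] rates_continuous[OF assms(3)]]
  have "((\<lambda>j. relaxed (q i j) (v1 i) (v2 i)) has_sum - relaxed (q i i) (v1 i) (v2 i)) (states - {i})"
    using R by (metis has_sum_infsum)
  then show ?thesis
    by (rule has_sum_cong_neutral[THEN iffD1, rotated 3]) (auto simp: relaxed_rate_def assms(3))
qed

lemma jump_rates_relaxed:
  assumes "v1 \<in> stationary A1" "v2 \<in> stationary A2"
  shows "jump_rates (relaxed_rate v1 v2)"
proof
  show "0 \<le> relaxed_rate v1 v2 i j" for i j
    using relaxed_off_diagonal_nonneg[OF _ stationaryD[OF assms(1)] stationaryD[OF assms(2)] rates_continuous]
    by (auto simp: relaxed_rate_def)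
  show "summable (relaxed_rate v1 v2 i)" for i
  proof (cases "i \<in> states")
    case True
    show ?thesis using has_sum_imp_sums[OF has_sum_relaxed_rate[OF assms True]] by (rule sums_summable)
  next
    case False
    then have "relaxed_rate v1 v2 i = (\<lambda>_. 0)" by (auto simp: relaxed_rate_def)
    then show ?thesis by simp
  qed
qed (auto simp: relaxed_rate_def)

lemma total_relaxed_rate:
  assumes "v1 \<in> stationary A1" "v2 \<in> stationary A2" "i \<in> states"
  shows "jump_rates.total_rate (relaxed_rate v1 v2) i = - relaxed (q i i) (v1 i) (v2 i)"
  unfolding jump_rates.total_rate_def[OF jump_rates_relaxed[OF assms(1,2)]]
  using has_sum_imp_sums[OF has_sum_relaxed_rate[OF assms]] by (rule sums_unique[symmetric])

text \<open>Brings drift bounds for pure actions into the finite-sum form of supersolutions, with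
  the diagonal on the right.\<close>

lemma finite_weighted_rates_le:
  assumes "v1 \<in> stationary A1" "v2 \<in> stationary A2" and i: "i \<in> states"
    and w: "\<And>j. j \<in> states \<Longrightarrow> 0 \<le> w j"
    and summ: "\<And>u1 u2. u1 \<in> A1 i \<Longrightarrow> u2 \<in> A2 i \<Longrightarrow> (\<lambda>j. w j * q i j u1 u2) summable_on states"
    and bound: "\<And>u1 u2. u1 \<in> A1 i \<Longrightarrow> u2 \<in> A2 i \<Longrightarrow> (\<Sum>\<^sub>\<infinity>j\<in>states. w j * q i j u1 u2) \<le> B"
    and F: "finite F" "F \<subseteq> states"
  shows "(\<Sum>j\<in>F. relaxed_rate v1 v2 i j * w j) \<le> B - w i * relaxed (q i i) (v1 i) (v2 i)"
proof -
  note m = stationaryD[OF assms(1) i] stationaryD[OF assms(2) i] rates_continuous[OF i]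
  note R = relaxed_weighted_sum[OF i m w summ bound]
  have "(\<Sum>j\<in>F. relaxed_rate v1 v2 i j * w j) = (\<Sum>j\<in>F - {i}. w j * relaxed (q i j) (v1 i) (v2 i))"
    using F i by (intro sum.mono_neutral_cong_right) (auto simp: relaxed_rate_def)
  also have "\<dots> \<le> (\<Sum>\<^sub>\<infinity>j\<in>states - {i}. w j * relaxed (q i j) (v1 i) (v2 i))"
    using F w relaxed_off_diagonal_nonneg[OF i m] by (intro finite_sum_le_infsum R(1)) auto
  finally show ?thesis using R(3) by simp
qed

lemma not_exploded:
  assumes v: "v1 \<in> stationary A1" "v2 \<in> stationary A2" and i: "i \<in> states"
  shows "AE \<omega> in jump_rates.path_law (relaxed_rate v1 v2) i. \<forall>T. Y \<omega> T \<noteq> cemetery"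
proof -
  interpret J: jump_rates "relaxed_rate v1 v2" by (rule jump_rates_relaxed[OF v])
  show ?thesis
  \<comment> \<open>Since \<open>1 \<le> Wt\<close>, the constant \<open>C2\<close> can be absorbed
    into the factor of \<open>Wt\<close>; \<open>\<bar>C1\<bar>\<close> takes the place of
    \<open>C1\<close>, whose sign is open.\<close>
  proof (rule J.AE_not_exploded[OF i, where Wt = Wt and \<mu> = "\<bar>C1\<bar> + C2" and C = C3])
    show "0 \<le> Wt j" if "j \<in> states" for j using Wt_ge_1[OF that] by simp
    show "0 \<le> C3" using C3_pos by simp
    show "supersolution (relaxed_rate v1 v2) J.total_rate (\<bar>C1\<bar> + C2) Wt"
      unfolding supersolution_def
    proof (intro ballI allI impI)
      fix k F assume k: "k \<in> states" and F: "finite F \<and> F \<subseteq> states"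
      have "C1 * Wt k \<le> \<bar>C1\<bar> * Wt k" using Wt_ge_1[OF k] by (intro mult_right_mono) auto
      moreover have "C2 * 1 \<le> C2 * Wt k" using Wt_ge_1[OF k] C2_nonneg by (intro mult_left_mono)
      ultimately have le: "C1 * Wt k + C2 \<le> (\<bar>C1\<bar> + C2) * Wt k" by (simp add: distrib_right)
      have "(\<Sum>j\<in>F. relaxed_rate v1 v2 k j * Wt j) \<le> (C1 * Wt k + C2) - Wt k * relaxed (q k k) (v1 k) (v2 k)"
        using Wt_drift[OF k] F by (intro finite_weighted_rates_le[OF v k]) (auto intro: order.trans[OF zero_le_one Wt_ge_1])
      then show "(\<Sum>j\<in>F. relaxed_rate v1 v2 k j * Wt j) \<le> (\<bar>C1\<bar> + C2 + J.total_rate k) * Wt k"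
        using le unfolding total_relaxed_rate[OF v k] by (simp add: algebra_simps)
    qed
    show "J.total_rate j \<le> C3 * Wt j" if j: "j \<in> states" for j
    proof -
      have "- q j j u1 u2 \<le> max_rate A1 A2 q j" if "u1 \<in> A1 j" "u2 \<in> A2 j" for u1 u2
        unfolding max_rate_def using cSUP_upper[OF _ stable[OF j], of "(u1, u2)"] that by auto
      then have "- (C3 * Wt j) \<le> relaxed (q j j) (v1 j) (v2 j)"
        using Wt_rate[OF j]
        by (intro relaxed_ge[OF compact_actions[OF j] rates_continuous[OF j j] stationaryD[OF v(1) j] stationaryD[OF v(2) j]])
          (metis minus_le_iff order.trans)
      then show ?thesis unfolding total_relaxed_rate[OF v j] by simp
    qed
  qed
qed

end

section \<open>Stationary strategies\<close>

lemma ext_actions_generator: "insert {None} {Some ` B | B. B \<in> sets borel \<and> B \<subseteq> U} \<subseteq> Pow (insert None (Some ` U))"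
  by auto

lemma space_ext_actions [simp]: "space (ext_actions U) = insert None (Some ` U)"
  unfolding ext_actions_def by (rule space_measure_of[OF ext_actions_generator])

lemma sets_ext_actions: "sets (ext_actions U) = sigma_sets (insert None (Some ` U)) (insert {None} {Some ` B | B. B \<in> sets borel \<and> B \<subseteq> U})"
  unfolding ext_actions_def by (rule sets_measure_of[OF ext_actions_generator])

lemma None_in_ext_actions: "{None} \<in> sets (ext_actions U)"
  unfolding sets_ext_actions by (rule sigma_sets.Basic) simp

lemma Some_image_in_ext_actions: "B \<in> sets borel \<Longrightarrow> B \<subseteq> U \<Longrightarrow> Some ` B \<in> sets (ext_actions U)"
  unfolding sets_ext_actions by (rule sigma_sets.Basic) blast

text \<open>\<open>None\<close> is an isolated measurable point, so the value of \<open>g\<close>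
  there is free.\<close>

lemma measurable_ext_actions:
  fixes g :: "'a::topological_space option \<Rightarrow> real"
  assumes U: "U \<in> sets borel" and h: "h \<in> borel_measurable borel" and g: "\<And>u. u \<in> U \<Longrightarrow> g (Some u) = h u"
  shows "g \<in> borel_measurable (ext_actions U)"
proof (rule measurableI)
  fix S :: "real set" assume S: "S \<in> sets borel"
  have "h -` S \<inter> U \<in> sets borel" using measurable_sets[OF h S] U by auto
  then have 1: "Some ` (h -` S \<inter> U) \<in> sets (ext_actions U)" by (rule Some_image_in_ext_actions) auto
  have 2: "(if g None \<in> S then {None} else {}) \<in> sets (ext_actions U)" by (simp add: None_in_ext_actions)
  have "g -` S \<inter> space (ext_actions U) = Some ` (h -` S \<inter> U) \<union> (if g None \<in> S then {None} else {})"
    using g by auto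
  then show "g -` S \<inter> space (ext_actions U) \<in> sets (ext_actions U)" using sets.Un[OF 1 2] by simp
qed simp

lemma measurable_Some_ext_actions:
  assumes v: "v \<in> probs A" and A: "A \<subseteq> U"
  shows "Some \<in> v \<rightarrow>\<^sub>M ext_actions U"
  unfolding ext_actions_def
proof (rule measurable_measure_of[OF ext_actions_generator])
  show "Some \<in> space v \<rightarrow> insert None (Some ` U)" using A probsD(3)[OF v] by auto
  fix y assume "y \<in> insert {None} {Some ` B | B. B \<in> sets borel \<and> B \<subseteq> U}"
  then consider "y = {None}" | B where "y = Some ` B" "B \<in> sets borel" by blast
  then show "Some -` y \<inter> space v \<in> sets v"
  proof cases
    case 1
    then show ?thesis by (simp add: vimage_def)
  next
    case 2
    have "Some -` y = B" unfolding 2(1) by auto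
    then show ?thesis unfolding probsD(1)[OF v] probsD(3)[OF v] sets_restrict_space using 2(2) by (auto simp: Int_commute)
  qed
qed

text \<open>\<open>ext_zero\<close> vanishes outside the admissible actions, so each integrand is an
  indicator times a continuous function, hence measurable, and \<open>Some\<close> transports the
  integrals.\<close>

lemma relaxed_ext_zero:
  fixes A1 :: "nat \<Rightarrow> 'a::{metric_space, second_countable_topology} set"
    and A2 :: "nat \<Rightarrow> 'b::{metric_space, second_countable_topology} set"
  assumes x: "x \<in> states" and U: "U1 \<in> sets borel" "U2 \<in> sets borel"
    and sub: "A1 x \<subseteq> U1" "A2 x \<subseteq> U2" and compact: "compact (A1 x)" "compact (A2 x)"
    and f: "continuous_on (A1 x \<times> A2 x) (\<lambda>(u1, u2). f x u1 u2)"
    and v: "v \<in> probs (A1 x)" and w: "w \<in> probs (A2 x)"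
  shows "relaxed (ext_zero A1 A2 f x) (distr v (ext_actions U1) Some) (distr w (ext_actions U2) Some) = relaxed (f x) v w"
proof -
  let ?e = "ext_zero A1 A2 f x"
  have closed: "A1 x \<in> sets borel" "A2 x \<in> sets borel"
    using compact by (auto intro!: borel_closed compact_imp_closed)
  have e_Some: "?e (Some u1) (Some u2) = (if u1 \<in> A1 x \<and> u2 \<in> A2 x then f x u1 u2 else 0)" for u1 u2
    using x by (simp add: ext_zero_def K_graph_def)
  have e_None: "?e a1 None = 0" "?e None a2 = 0" for a1 a2
    by (auto simp: ext_zero_def split: option.split)
  have inner: "(\<integral>a1. ?e a1 (Some u2) \<partial>distr v (ext_actions U1) Some) = (\<integral>u1. f x u1 u2 \<partial>v)" if u2: "u2 \<in> A2 x" for u2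
  proof -
    have "(\<lambda>u1. indicator (A1 x) u1 *\<^sub>R f x u1 u2) \<in> borel_measurable borel"
      using sections_continuous(2)[OF compact f u2] by (rule borel_measurable_continuous_on_indicator[OF closed(1)])
    then have "(\<lambda>a1. ?e a1 (Some u2)) \<in> borel_measurable (ext_actions U1)"
      by (rule measurable_ext_actions[OF U(1)]) (simp add: e_Some u2 indicator_def)
    then have "(\<integral>a1. ?e a1 (Some u2) \<partial>distr v (ext_actions U1) Some) = (\<integral>u1. ?e (Some u1) (Some u2) \<partial>v)"
      by (intro integral_distr measurable_Some_ext_actions[OF v sub(1)])
    also have "\<dots> = (\<integral>u1. f x u1 u2 \<partial>v)"
      by (intro Bochner_Integration.integral_cong) (auto simp: e_Some u2 probsD(3)[OF v])
    finally show ?thesis .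
  qed
  have "(\<lambda>u2. indicator (A2 x) u2 *\<^sub>R (\<integral>u1. f x u1 u2 \<partial>v)) \<in> borel_measurable borel"
    using continuous_on_inner_integral2[OF compact f v] by (rule borel_measurable_continuous_on_indicator[OF closed(2)])
  then have "(\<lambda>a2. \<integral>a1. ?e a1 a2 \<partial>distr v (ext_actions U1) Some) \<in> borel_measurable (ext_actions U2)"
  proof (rule measurable_ext_actions[OF U(2)])
    fix u2
    show "(\<integral>a1. ?e a1 (Some u2) \<partial>distr v (ext_actions U1) Some) = indicator (A2 x) u2 *\<^sub>R (\<integral>u1. f x u1 u2 \<partial>v)"
    proof (cases "u2 \<in> A2 x")
      case False
      then have "?e a1 (Some u2) = 0" for a1 by (cases a1) (auto simp: e_Some e_None)
      then show ?thesis using False by simp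
    qed (simp add: inner)
  qed
  then have "relaxed ?e (distr v (ext_actions U1) Some) (distr w (ext_actions U2) Some) =
    (\<integral>u2. (\<integral>a1. ?e a1 (Some u2) \<partial>distr v (ext_actions U1) Some) \<partial>w)"
    unfolding relaxed_def by (intro integral_distr measurable_Some_ext_actions[OF w sub(2)])
  also have "\<dots> = (\<integral>u2. (\<integral>u1. f x u1 u2 \<partial>v) \<partial>w)"
    by (intro Bochner_Integration.integral_cong) (auto simp: inner probsD(3)[OF w])
  finally show ?thesis by (simp add: relaxed_def)
qed

text \<open>Apart from time 0, being in \<open>j\<close> is a union over \<open>m\<close> of the
  times after jump \<open>m\<close> up to and including jump \<open>m + 1\<close>, which is
  predictable; the cemetery follows by complement.\<close>

lemma measurable_Y_left: "(\<lambda>x. Y_left (fst x) (snd x)) \<in> predictable \<rightarrow>\<^sub>M count_space UNIV"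
proof -
  have states: "{x \<in> space predictable. Y_left (fst x) (snd x) = j} \<in> sets predictable" if j: "j \<in> states" for j
  proof -
    let ?D = "\<lambda>m. {(\<omega>, t). \<omega> \<in> {\<omega> \<in> paths. post_jump \<omega> m = j} \<and> jump_time \<omega> m < ennreal t} \<inter>
      {(\<omega>, t). \<omega> \<in> paths \<and> 0 \<le> t \<and> ennreal t \<le> jump_time \<omega> (Suc m)}"
    have "{x \<in> space predictable. Y_left (fst x) (snd x) = j} =
      {\<omega> \<in> paths. jump_time \<omega> 0 \<le> ennreal 0 \<and> post_jump \<omega> 0 = j} \<times> {0} \<union> (\<Union>m. ?D m)" (is "?L = ?R")
    proof (intro equalityI subsetI)
      fix x assume x: "x \<in> ?L"
      then obtain \<omega> t where xe: "x = (\<omega>, t)" "\<omega> \<in> paths" "0 \<le> t" "Y_left \<omega> t = j" by (cases x) auto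
      show "x \<in> ?R"
      proof (cases "t = 0")
        case True
        then show ?thesis using xe Y_0[OF xe(2)] by (auto simp: Y_left_def)
      next
        case False
        then have "0 < t" using xe(3) by simp
        show ?thesis
        proof (cases \<omega> rule: Y_left_cases[OF \<open>0 < t\<close>])
          case (1 m)
          then have "x \<in> ?D m" using xe by auto
          then show ?thesis by blast
        next
          case 2
          then show ?thesis using xe j states_iff by simp
        qed
      qed
    next
      fix x assume "x \<in> ?R"
      then consider "x \<in> {\<omega> \<in> paths. jump_time \<omega> 0 \<le> ennreal 0 \<and> post_jump \<omega> 0 = j} \<times> {0}" | m where "x \<in> ?D m" by blast
      then show "x \<in> ?L"
      proof cases
        case 1
        then show ?thesis using Y_0 by (auto simp: Y_left_def)
      next
        case 2
        then obtain \<omega> t where xe: "x = (\<omega>, t)" "\<omega> \<in> paths" "0 \<le> t" "post_jump \<omega> m = j"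
          "jump_time \<omega> m < ennreal t" "ennreal t \<le> jump_time \<omega> (Suc m)" by (cases x) auto
        then have "0 < t" by (cases "t = 0") auto
        then show ?thesis using xe Y_left_eqI[of t \<omega> m] by simp
      qed
    qed
    also have "\<dots> \<in> sets predictable"
    proof (intro sets.Un sets.countable_UN' sets.Int)
      have "{\<omega> \<in> paths. jump_time \<omega> 0 \<le> ennreal 0 \<and> post_jump \<omega> 0 = j} \<in> sets (history 0)"
        unfolding sets_history by (rule sigma_sets.Basic) blast
      then show "{\<omega> \<in> paths. jump_time \<omega> 0 \<le> ennreal 0 \<and> post_jump \<omega> 0 = j} \<times> {0} \<in> sets predictable"
        unfolding sets_predictable by (intro sigma_sets.Basic) (auto simp: predictable_generator_def)
      have "?D m \<in> sets predictable" for m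
      proof (intro sets.Int predictable_until predictable_after_stopping)
        fix r :: real assume r: "0 \<le> r"
        have "{\<omega> \<in> {\<omega> \<in> paths. post_jump \<omega> m = j}. jump_time \<omega> m \<le> ennreal r} = {\<omega> \<in> paths. jump_time \<omega> m \<le> ennreal r \<and> post_jump \<omega> m = j}"
          by auto
        also have "\<dots> \<in> sets (history r)" unfolding sets_history using r by (intro sigma_sets.Basic) blast
        finally show "{\<omega> \<in> {\<omega> \<in> paths. post_jump \<omega> m = j}. jump_time \<omega> m \<le> ennreal r} \<in> sets (history r)" .
      qed
      then show "range ?D \<subseteq> sets predictable" by blast
    qed simp
    finally show ?thesis .
  qed
  have "{x \<in> space predictable. Y_left (fst x) (snd x) = j} \<in> sets predictable" for j
  proof (cases "j \<in> states")
    case False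
    then have "{x \<in> space predictable. Y_left (fst x) (snd x) = j} =
      space predictable - (\<Union>k\<in>states. {x \<in> space predictable. Y_left (fst x) (snd x) = k})"
      by (auto simp: states_iff)
    also have "\<dots> \<in> sets predictable" using states by (intro sets.Diff sets.top sets.countable_UN') auto
    finally show ?thesis .
  qed (rule states)
  moreover have "(\<lambda>x. Y_left (fst x) (snd x)) -` {j} \<inter> space predictable = {x \<in> space predictable. Y_left (fst x) (snd x) = j}" for j
    by (rule set_eqI, rule iffI) (simp_all only: vimage_eq Int_iff mem_Collect_eq singleton_iff simp_thms)
  ultimately have "(\<lambda>x. Y_left (fst x) (snd x)) -` {j} \<inter> space predictable \<in> sets predictable" for j by (simp only:)
  then show ?thesis
    by (intro measurable_count_space_eq2_countable[THEN iffD2] conjI ballI) simp_all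
qed

text \<open>Makes stationary deviations available in the Nash property, which quantifies over
  \<open>strategies\<close>.\<close>

lemma markov_in_strategies:
  fixes A :: "nat \<Rightarrow> 'a::metric_space set"
  assumes v: "v \<in> stationary A" and A: "\<And>i. i \<in> states \<Longrightarrow> A i \<subseteq> U \<and> compact (A i)"
  shows "markov U v \<in> strategies U A"
proof -
  define g where "g x = (if x = cemetery then return (ext_actions U) None else distr (v x) (ext_actions U) Some)" for x
  have markov: "markov U v = (\<lambda>x. g (Y_left (fst x) (snd x)))"
    by (auto simp: markov_def g_def fun_eq_iff)
  have Some_meas: "Some \<in> v x \<rightarrow>\<^sub>M ext_actions U" if "x \<noteq> cemetery" for x
    using that A stationaryD[OF v] by (intro measurable_Some_ext_actions) (auto simp: states_iff)
  have prob: "prob_space (v x)" if "x \<noteq> cemetery" for x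
    using probsD(2)[OF stationaryD[OF v, of x]] that by (simp add: states_iff)
  have g: "g x \<in> space (prob_algebra (ext_actions U))" for x
    unfolding space_prob_algebra g_def using Some_meas prob
    by (auto intro!: prob_space_return prob_space.prob_space_distr)
  have "(\<lambda>x. g (Y_left (fst x) (snd x))) \<in> predictable \<rightarrow>\<^sub>M prob_algebra (ext_actions U)"
    by (rule measurable_compose[OF measurable_Y_left]) (use g in simp)
  moreover have "emeasure (markov U v (\<omega>, t)) (ext_admissible A (Y_left \<omega> t)) = 1" for \<omega> t
  proof (cases "Y_left \<omega> t = cemetery")
    case True
    then show ?thesis by (simp add: markov_def ext_admissible_def None_in_ext_actions)
  next
    case False
    let ?x = "Y_left \<omega> t"
    interpret prob_space "v ?x" using prob[OF False] .
    have x: "?x \<in> states" using False states_iff by simp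
    have "A ?x \<in> sets borel" using A[OF x] by (intro borel_closed compact_imp_closed) auto
    then have "Some ` A ?x \<in> sets (ext_actions U)" using A[OF x] by (intro Some_image_in_ext_actions) auto
    then have "emeasure (distr (v ?x) (ext_actions U) Some) (Some ` A ?x) = emeasure (v ?x) (Some -` (Some ` A ?x) \<inter> space (v ?x))"
      using Some_meas[OF False] by (intro emeasure_distr)
    also have "Some -` (Some ` A ?x) \<inter> space (v ?x) = space (v ?x)"
      using probsD(3)[OF stationaryD[OF v x]] by auto
    finally show ?thesis using False emeasure_space_1 by (simp add: markov_def ext_admissible_def)
  qed
  ultimately show ?thesis unfolding strategies_def markov by auto
qed

context controlled_game
begin

text \<open>Serves for jump rates too, with \<open>f\<close> a column of \<open>q\<close>. At the
  cemetery both sides are 0.\<close>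

lemma relaxed_markov:
  assumes v: "v1 \<in> stationary A1" "v2 \<in> stationary A2"
    and f: "\<And>x. x \<in> states \<Longrightarrow> continuous_on (A1 x \<times> A2 x) (\<lambda>(u1, u2). f x u1 u2)"
  shows "relaxed (ext_zero A1 A2 f (Y_left \<omega> t)) (markov U1 v1 (\<omega>, t)) (markov U2 v2 (\<omega>, t)) = relaxed_cost f v1 v2 (Y_left \<omega> t)"
proof (cases "Y_left \<omega> t = cemetery")
  case True
  have "ext_zero A1 A2 f cemetery = (\<lambda>_ _. 0)"
    by (auto simp: ext_zero_def K_graph_def fun_eq_iff split: option.split)
  then show ?thesis using True by (simp add: relaxed_cost_def relaxed_def)
next
  case False
  then have x: "Y_left \<omega> t \<in> states" using states_iff by simp
  show ?thesis
    using relaxed_ext_zero[where f=f and ?A1.0=A1 and ?A2.0=A2, OF x borel_U1 borel_U2 _ _ compact_actions[OF x] f[OF x] stationaryD[OF v(1) x] stationaryD[OF v(2) x]]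
      admissible1[OF x] admissible2[OF x] False x by (simp add: markov_def relaxed_cost_def)
qed

lemma jump_rate_markov:
  assumes v: "v1 \<in> stationary A1" "v2 \<in> stationary A2" and j: "j \<in> states"
  shows "jump_rate A1 A2 q (markov U1 v1) (markov U2 v2) \<omega> t j = relaxed_rate v1 v2 (Y_left \<omega> t) j"
  using relaxed_markov[OF v, of "\<lambda>i. q i j" \<omega> t] rates_continuous j
  by (auto simp: jump_rate_def relaxed_rate_def relaxed_cost_def)

lemma is_law_markov_iff:
  assumes v: "v1 \<in> stationary A1" "v2 \<in> stationary A2"
  shows "is_law A1 A2 q (markov U1 v1) (markov U2 v2) i P \<longleftrightarrow>
    sets P = sets path_space \<and> prob_space P \<and> (AE \<omega> in P. post_jump \<omega> 0 = i) \<and>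
    jump_rates.compensated (relaxed_rate v1 v2) P"
proof -
  interpret J: jump_rates "relaxed_rate v1 v2" by (rule jump_rates_relaxed[OF v])
  have start: "emeasure P {\<omega> \<in> paths. Y \<omega> 0 = i} = 1 \<longleftrightarrow> (AE \<omega> in P. post_jump \<omega> 0 = i)"
    if P: "sets P = sets path_space" "prob_space P"
  proof -
    interpret P: prob_space P by fact
    note [measurable_cong] = P(1)
    have space_P: "space P = paths" using sets_eq_imp_space_eq[OF P(1)] by simp
    have eq: "{\<omega> \<in> paths. Y \<omega> 0 = i} = {\<omega> \<in> space P. post_jump \<omega> 0 = i}" using Y_0 by (auto simp: space_P)
    have meas: "{\<omega> \<in> space P. post_jump \<omega> 0 = i} \<in> sets P" by measurable
    show ?thesis unfolding eq using P.AE_iff_emeasure_eq_1[of "\<lambda>\<omega>. post_jump \<omega> 0 = i"] meas by simp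
  qed
  have comp: "(\<forall>j\<in>states. \<forall>D\<in>sets predictable.
      (\<integral>\<^sup>+\<omega>. (\<Sum>n. if jump_time \<omega> (Suc n) < \<infinity> \<and> post_jump \<omega> (Suc n) = j
               then indicator D (\<omega>, enn2real (jump_time \<omega> (Suc n))) else 0) \<partial>P) =
      (\<integral>\<^sup>+\<omega>. (\<integral>\<^sup>+t\<in>{0<..}. indicator D (\<omega>, t) * ennreal (jump_rate A1 A2 q (markov U1 v1) (markov U2 v2) \<omega> t j) \<partial>lborel) \<partial>P)) \<longleftrightarrow>
    J.compensated P"
    unfolding J.compensated_def by (simp add: jump_rate_markov[OF v] cong: ball_cong)
  show ?thesis unfolding is_law_def comp using start by blast
qed

text \<open>The constructed chain gives existence and \<open>compensated_unique\<close> gives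
  uniqueness, which resolves the definite description in \<open>law\<close>.\<close>

lemma law_markov:
  assumes v: "v1 \<in> stationary A1" "v2 \<in> stationary A2" and i: "i \<in> states"
  shows "law A1 A2 q (markov U1 v1) (markov U2 v2) i = jump_rates.path_law (relaxed_rate v1 v2) i"
  unfolding law_def is_law_markov_iff[OF v]
proof (rule the_equality)
  interpret J: jump_rates "relaxed_rate v1 v2" by (rule jump_rates_relaxed[OF v])
  show *: "sets (J.path_law i) = sets path_space \<and> prob_space (J.path_law i) \<and> (AE \<omega> in J.path_law i. post_jump \<omega> 0 = i) \<and> J.compensated (J.path_law i)"
    using J.prob_space_path_law[OF i] J.AE_path_law_start[OF i] J.compensated_path_law[OF i] by simp
  show "P = J.path_law i"
    if "sets P = sets path_space \<and> prob_space P \<and> (AE \<omega> in P. post_jump \<omega> 0 = i) \<and> J.compensated P" for P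
    using that * by (intro J.compensated_unique) auto
qed

text \<open>The accumulated cost evaluates the cost rate at \<open>Y\<close> but the strategies at
  \<open>Y_left\<close>; the two agree at almost every time, which leaves a function of the state
  alone.\<close>

lemma risk_cost_markov:
  assumes v: "v1 \<in> stationary A1" "v2 \<in> stationary A2" and i: "i \<in> states"
    and c: "\<And>x. x \<in> states \<Longrightarrow> continuous_on (A1 x \<times> A2 x) (\<lambda>(u1, u2). c x u1 u2)"
  shows "risk_cost A1 A2 q c (markov U1 v1) (markov U2 v2) i =
    jump_rates.markov_risk (relaxed_rate v1 v2) (relaxed_cost c v1 v2) i"
proof -
  interpret J: jump_rates "relaxed_rate v1 v2" by (rule jump_rates_relaxed[OF v])
  have "accumulated_cost A1 A2 c (markov U1 v1) (markov U2 v2) T \<omega> = accumulated (relaxed_cost c v1 v2) \<omega> T" for T \<omega>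
    unfolding accumulated_cost_def accumulated_def
  proof (rule nn_integral_cong_AE, rule eventually_mono[OF AE_Y_eq_Y_left[of \<omega>]])
    fix t assume *: "0 \<le> t \<longrightarrow> Y \<omega> t = Y_left \<omega> t"
    show "ennreal (relaxed (ext_zero A1 A2 c (Y \<omega> t)) (markov U1 v1 (\<omega>, t)) (markov U2 v2 (\<omega>, t))) * indicator {0..T} t =
      ennreal (relaxed_cost c v1 v2 (Y \<omega> t)) * indicator {0..T} t"
      using * relaxed_markov[OF v c, of \<omega> t] by (cases "0 \<le> t") auto
  qed
  then show ?thesis
    unfolding risk_cost_def J.markov_risk_def J.expected_exp_cost_def law_markov[OF v i] by simp
qed

end

section \<open>The one-player problems\<close>

lemma supersolution_cong:
  assumes "\<And>i j. i \<in> states \<Longrightarrow> j \<in> states \<Longrightarrow> a i j = a' i j" "\<And>i. i \<in> states \<Longrightarrow> d i = d' i"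
  shows "supersolution a d \<mu> \<phi> \<longleftrightarrow> supersolution a' d' \<mu> \<phi>"
proof -
  have "(\<Sum>j\<in>F. a i j * \<phi> j) = (\<Sum>j\<in>F. a' i j * \<phi> j)" if "i \<in> states" "F \<subseteq> states" for i F
    using assms(1) that by (intro sum.cong) auto
  then show ?thesis unfolding supersolution_def using assms(2) by (metis (no_types, lifting))
qed

text \<open>\<open>dr\<close> is the decay rate in the drift condition, a constant or a norm-like
  function according to the alternative.\<close>

locale stable_game = controlled_game U1 U2 A1 A2 q c1 c2 Wt C1 C2 C3
  for U1 :: "'a::polish_space set" and U2 :: "'b::polish_space set"
    and A1 :: "nat \<Rightarrow> 'a set" and A2 :: "nat \<Rightarrow> 'b set"
    and q :: "nat \<Rightarrow> nat \<Rightarrow> 'a \<Rightarrow> 'b \<Rightarrow> real"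
    and c1 c2 :: "nat \<Rightarrow> 'a \<Rightarrow> 'b \<Rightarrow> real" and Wt C1 C2 C3 +
  fixes W dr :: "nat \<Rightarrow> real" and KK :: "nat set" and C4 :: real and i\<^sub>0 :: nat
  assumes C4_pos: "0 < C4" and W_ge_1: "\<And>i. i \<in> states \<Longrightarrow> 1 \<le> W i"
    and KK: "KK \<subseteq> states" "finite KK"
    and W_summable: "\<And>i u1 u2. i \<in> states \<Longrightarrow> u1 \<in> A1 i \<Longrightarrow> u2 \<in> A2 i \<Longrightarrow> (\<lambda>j. W j * q i j u1 u2) summable_on states"
    and W_drift: "\<And>i u1 u2. i \<in> states \<Longrightarrow> u1 \<in> A1 i \<Longrightarrow> u2 \<in> A2 i \<Longrightarrow>
      (\<Sum>\<^sub>\<infinity>j\<in>states. W j * q i j u1 u2) \<le> C4 * indicator KK i - dr i * W i"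
    and i0_state: "i\<^sub>0 \<in> states"
    and i0_rates: "\<And>j u1 u2. j \<in> states \<Longrightarrow> j \<noteq> i\<^sub>0 \<Longrightarrow> u1 \<in> A1 i\<^sub>0 \<Longrightarrow> u2 \<in> A2 i\<^sub>0 \<Longrightarrow> 0 < q i\<^sub>0 j u1 u2"
    and irreducible: "\<And>v1 v2. v1 \<in> stationary A1 \<Longrightarrow> v2 \<in> stationary A2 \<Longrightarrow> irreducible_under U1 U2 A1 A2 q v1 v2"
begin

lemma W_nonneg: "i \<in> states \<Longrightarrow> 0 \<le> W i"
  using W_ge_1[of i] by simp

lemma relaxed_W_sum:
  assumes i: "i \<in> states" and m: "m1 \<in> probs (A1 i)" "m2 \<in> probs (A2 i)"
  shows "(\<lambda>j. W j * relaxed (q i j) m1 m2) summable_on states - {i}"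
    and "(\<Sum>\<^sub>\<infinity>j\<in>states - {i}. W j * relaxed (q i j) m1 m2) + W i * relaxed (q i i) m1 m2 \<le> C4 * indicator KK i - dr i * W i"
  using relaxed_weighted_sum(1,3)[OF i m rates_continuous[OF i] W_nonneg W_summable[OF i] W_drift[OF i]] by blast+

text \<open>Comparison of \<open>\<psi>\<close> with a multiple of \<open>W\<close> gives a bound
  uniform over mixed actions, as the minimization over actions requires.\<close>

lemma relaxed_weighted_bounded:
  assumes i: "i \<in> states" and \<psi>: "pos_bounded W \<psi>"
  shows "\<exists>B. \<forall>m1\<in>probs (A1 i). \<forall>m2\<in>probs (A2 i).
    (\<lambda>j. \<psi> j * relaxed (q i j) m1 m2) summable_on states - {i} \<and>
    (\<Sum>\<^sub>\<infinity>j\<in>states - {i}. \<psi> j * relaxed (q i j) m1 m2) \<le> B"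
proof -
  let ?J = "states - {i}"
  obtain C where C: "\<And>j. j \<in> states \<Longrightarrow> \<psi> j \<le> C * W j" and \<psi>_pos: "\<And>j. j \<in> states \<Longrightarrow> 0 < \<psi> j"
    using \<psi> unfolding pos_bounded_def by blast
  have "0 < C * W i" using C[OF i] \<psi>_pos[OF i] by simp
  then have C_pos: "0 < C" using W_ge_1[OF i] by (simp add: zero_less_mult_iff)
  obtain M where M: "\<And>u1 u2. u1 \<in> A1 i \<Longrightarrow> u2 \<in> A2 i \<Longrightarrow> \<bar>q i i u1 u2\<bar> \<le> M"
    using jointly_bounded[OF compact_actions[OF i] rates_continuous[OF i i]] by blast
  have "(\<lambda>j. \<psi> j * relaxed (q i j) m1 m2) summable_on ?J \<and>
    (\<Sum>\<^sub>\<infinity>j\<in>?J. \<psi> j * relaxed (q i j) m1 m2) \<le> C * (C4 + \<bar>dr i\<bar> * W i + W i * M)"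
    if m: "m1 \<in> probs (A1 i)" "m2 \<in> probs (A2 i)" for m1 m2
  proof -
    note R = relaxed_W_sum[OF i m]
    have nonneg: "0 \<le> relaxed (q i j) m1 m2" if "j \<in> ?J" for j
      using relaxed_off_diagonal_nonneg[OF i m rates_continuous[OF i]] that by blast
    have le: "\<psi> j * relaxed (q i j) m1 m2 \<le> C * (W j * relaxed (q i j) m1 m2)" if "j \<in> ?J" for j
      using mult_right_mono[OF C nonneg[OF that], of j] that by (simp add: mult.assoc)
    have summ: "(\<lambda>j. C * (W j * relaxed (q i j) m1 m2)) summable_on ?J" by (rule summable_on_cmult_right[OF R(1)])
    have s: "(\<lambda>j. \<psi> j * relaxed (q i j) m1 m2) summable_on ?J"
      by (rule summable_on_comparison_test[OF summ le]) (use mult_nonneg_nonneg[OF less_imp_le[OF \<psi>_pos] nonneg] in auto)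
    have "(\<Sum>\<^sub>\<infinity>j\<in>?J. \<psi> j * relaxed (q i j) m1 m2) \<le> (\<Sum>\<^sub>\<infinity>j\<in>?J. C * (W j * relaxed (q i j) m1 m2))"
      by (rule infsum_mono[OF s summ le])
    also have "\<dots> = C * (\<Sum>\<^sub>\<infinity>j\<in>?J. W j * relaxed (q i j) m1 m2)" by (rule infsum_cmult_right) (use R(1) in auto)
    also have "\<dots> \<le> C * (C4 + \<bar>dr i\<bar> * W i + W i * M)"
    proof (rule mult_left_mono)
      have "- M \<le> relaxed (q i i) m1 m2"
        using M by (intro relaxed_ge[OF compact_actions[OF i] rates_continuous[OF i i] m]) (metis abs_le_D2 minus_le_iff)
      then have "W i * - M \<le> W i * relaxed (q i i) m1 m2" using W_nonneg[OF i] by (intro mult_left_mono)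
      moreover have "- dr i * W i \<le> \<bar>dr i\<bar> * W i" using W_nonneg[OF i] by (intro mult_right_mono) auto
      moreover have "C4 * indicator KK i \<le> C4" using C4_pos by (simp add: indicator_def)
      ultimately show "(\<Sum>\<^sub>\<infinity>j\<in>?J. W j * relaxed (q i j) m1 m2) \<le> C4 + \<bar>dr i\<bar> * W i + W i * M" using R(2) by simp
    qed (use C_pos in simp)
    finally show ?thesis using s by blast
  qed
  then show ?thesis by blast
qed

text \<open>Averaging over the opponent's fixed mixed action leaves functions of the player's own
  pure action, to which \<open>minimizer_probs\<close> applies. For the first player this uses the
  reversed order of integration.\<close>

lemma minimizer_player1:
  assumes i: "i \<in> states" and \<psi>: "pos_bounded W \<psi>" and m2: "m2 i \<in> probs (A2 i)"
    and c: "continuous_on (A1 i \<times> A2 i) (\<lambda>(u1, u2). c i u1 u2)"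
  shows "\<exists>v\<in>probs (A1 i). \<forall>v'\<in>probs (A1 i).
    hjb_term (\<lambda>i j v. relaxed (q i j) v (m2 i)) (\<lambda>i v. relaxed (c i) v (m2 i)) \<psi> i v \<le>
    hjb_term (\<lambda>i j v. relaxed (q i j) v (m2 i)) (\<lambda>i v. relaxed (c i) v (m2 i)) \<psi> i v'"
proof -
  note comp = compact_actions[OF i]
  note rc = rates_continuous[OF i]
  define g where "g j u1 = (\<integral>u2. q i j u1 u2 \<partial>m2 i)" for j u1
  define k where "k u1 = (\<integral>u2. c i u1 u2 \<partial>m2 i)" for u1
  have g_cont: "continuous_on (A1 i) (g j)" if "j \<in> states" for j
    unfolding g_def by (rule continuous_on_inner_integral1[OF comp rc[OF that] m2])
  have k_cont: "continuous_on (A1 i) k"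
    unfolding k_def by (rule continuous_on_inner_integral1[OF comp c m2])
  have rel: "relaxed (q i j) v (m2 i) = (\<integral>u. g j u \<partial>v)" if "j \<in> states" "v \<in> probs (A1 i)" for j v
    unfolding g_def by (rule relaxed_pair(2)[OF comp rc[OF that(1)] that(2) m2])
  have rel_c: "relaxed (c i) v (m2 i) = (\<integral>u. k u \<partial>v)" if "v \<in> probs (A1 i)" for v
    unfolding k_def by (rule relaxed_pair(2)[OF comp c that m2])
  have g_eq: "g j u = relaxed (q i j) (return (restrict_space borel (A1 i)) u) (m2 i)" if "j \<in> states" "u \<in> A1 i" for j u
    using rel[OF that(1) return_in_probs[OF that(2)]] integral_return_probs[OF that(2) g_cont[OF that(1)]] by simp
  obtain B where B: "\<And>m1. m1 \<in> probs (A1 i) \<Longrightarrow> (\<lambda>j. \<psi> j * relaxed (q i j) m1 (m2 i)) summable_on states - {i} \<and>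
    (\<Sum>\<^sub>\<infinity>j\<in>states - {i}. \<psi> j * relaxed (q i j) m1 (m2 i)) \<le> B"
    using relaxed_weighted_bounded[OF i \<psi>] m2 by blast
  have g_sum: "(\<lambda>j. \<psi> j * g j u) summable_on states - {i}" "(\<Sum>\<^sub>\<infinity>j\<in>states - {i}. \<psi> j * g j u) \<le> B" if u: "u \<in> A1 i" for u
  proof -
    have eq: "\<psi> j * g j u = \<psi> j * relaxed (q i j) (return (restrict_space borel (A1 i)) u) (m2 i)" if "j \<in> states - {i}" for j
      using g_eq[OF _ u] that by simp
    show "(\<lambda>j. \<psi> j * g j u) summable_on states - {i}" "(\<Sum>\<^sub>\<infinity>j\<in>states - {i}. \<psi> j * g j u) \<le> B"
      using B[OF return_in_probs[OF u]] summable_on_cong[of "states - {i}", OF eq] infsum_cong[of "states - {i}", OF eq] by simp_all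
  qed
  have "\<exists>v\<in>probs (A1 i). \<forall>v'\<in>probs (A1 i).
    (\<Sum>\<^sub>\<infinity>j\<in>states. \<psi> j * (\<integral>u. g j u \<partial>v)) + (\<integral>u. k u \<partial>v) * \<psi> i \<le>
    (\<Sum>\<^sub>\<infinity>j\<in>states. \<psi> j * (\<integral>u. g j u \<partial>v')) + (\<integral>u. k u \<partial>v') * \<psi> i"
  proof (rule minimizer_probs[OF comp(1) _ i g_cont k_cont _ g_sum])
    show "A1 i \<noteq> {}" using admissible1[OF i] by blast
    show "0 \<le> g j u" if "j \<in> states" "j \<noteq> i" "u \<in> A1 i" for j u
      unfolding g_eq[OF that(1,3)] using that
      by (intro relaxed_off_diagonal_nonneg[OF i return_in_probs m2 rc]) auto
    show "0 \<le> \<psi> j" if "j \<in> states" for j using \<psi> that by (auto simp: pos_bounded_def less_imp_le)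
  qed
  moreover have "hjb_term (\<lambda>i j v. relaxed (q i j) v (m2 i)) (\<lambda>i v. relaxed (c i) v (m2 i)) \<psi> i v =
    (\<Sum>\<^sub>\<infinity>j\<in>states. \<psi> j * (\<integral>u. g j u \<partial>v)) + (\<integral>u. k u \<partial>v) * \<psi> i" if "v \<in> probs (A1 i)" for v
    unfolding hjb_term_def using rel[OF _ that] rel_c[OF that] by (simp cong: infsum_cong)
  ultimately show ?thesis by simp
qed

lemma minimizer_player2:
  assumes i: "i \<in> states" and \<psi>: "pos_bounded W \<psi>" and m1: "m1 i \<in> probs (A1 i)"
    and c: "continuous_on (A1 i \<times> A2 i) (\<lambda>(u1, u2). c i u1 u2)"
  shows "\<exists>v\<in>probs (A2 i). \<forall>v'\<in>probs (A2 i).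
    hjb_term (\<lambda>i j v. relaxed (q i j) (m1 i) v) (\<lambda>i v. relaxed (c i) (m1 i) v) \<psi> i v \<le>
    hjb_term (\<lambda>i j v. relaxed (q i j) (m1 i) v) (\<lambda>i v. relaxed (c i) (m1 i) v) \<psi> i v'"
proof -
  note comp = compact_actions[OF i]
  note rc = rates_continuous[OF i]
  define g where "g j u2 = (\<integral>u1. q i j u1 u2 \<partial>m1 i)" for j u2
  define k where "k u2 = (\<integral>u1. c i u1 u2 \<partial>m1 i)" for u2
  have g_cont: "continuous_on (A2 i) (g j)" if "j \<in> states" for j
    unfolding g_def by (rule continuous_on_inner_integral2[OF comp rc[OF that] m1])
  have k_cont: "continuous_on (A2 i) k"
    unfolding k_def by (rule continuous_on_inner_integral2[OF comp c m1])
  have rel: "relaxed (q i j) (m1 i) v = (\<integral>u. g j u \<partial>v)" for j v by (simp add: relaxed_def g_def)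
  have rel_c: "relaxed (c i) (m1 i) v = (\<integral>u. k u \<partial>v)" for v by (simp add: relaxed_def k_def)
  have g_eq: "g j u = relaxed (q i j) (m1 i) (return (restrict_space borel (A2 i)) u)" if "j \<in> states" "u \<in> A2 i" for j u
    using rel integral_return_probs[OF that(2) g_cont[OF that(1)]] by simp
  obtain B where B: "\<And>m2. m2 \<in> probs (A2 i) \<Longrightarrow> (\<lambda>j. \<psi> j * relaxed (q i j) (m1 i) m2) summable_on states - {i} \<and>
    (\<Sum>\<^sub>\<infinity>j\<in>states - {i}. \<psi> j * relaxed (q i j) (m1 i) m2) \<le> B"
    using relaxed_weighted_bounded[OF i \<psi>] m1 by blast
  have g_sum: "(\<lambda>j. \<psi> j * g j u) summable_on states - {i}" "(\<Sum>\<^sub>\<infinity>j\<in>states - {i}. \<psi> j * g j u) \<le> B" if u: "u \<in> A2 i" for u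
  proof -
    have eq: "\<psi> j * g j u = \<psi> j * relaxed (q i j) (m1 i) (return (restrict_space borel (A2 i)) u)" if "j \<in> states - {i}" for j
      using g_eq[OF _ u] that by simp
    show "(\<lambda>j. \<psi> j * g j u) summable_on states - {i}" "(\<Sum>\<^sub>\<infinity>j\<in>states - {i}. \<psi> j * g j u) \<le> B"
      using B[OF return_in_probs[OF u]] summable_on_cong[of "states - {i}", OF eq] infsum_cong[of "states - {i}", OF eq] by simp_all
  qed
  have "\<exists>v\<in>probs (A2 i). \<forall>v'\<in>probs (A2 i).
    (\<Sum>\<^sub>\<infinity>j\<in>states. \<psi> j * (\<integral>u. g j u \<partial>v)) + (\<integral>u. k u \<partial>v) * \<psi> i \<le>
    (\<Sum>\<^sub>\<infinity>j\<in>states. \<psi> j * (\<integral>u. g j u \<partial>v')) + (\<integral>u. k u \<partial>v') * \<psi> i"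
  proof (rule minimizer_probs[OF comp(2) _ i g_cont k_cont _ g_sum])
    show "A2 i \<noteq> {}" using admissible2[OF i] by blast
    show "0 \<le> g j u" if "j \<in> states" "j \<noteq> i" "u \<in> A2 i" for j u
      unfolding g_eq[OF that(1,3)] using that
      by (intro relaxed_off_diagonal_nonneg[OF i m1 return_in_probs rc]) auto
    show "0 \<le> \<psi> j" if "j \<in> states" for j using \<psi> that by (auto simp: pos_bounded_def less_imp_le)
  qed
  then show ?thesis unfolding hjb_term_def rel rel_c .
qed

text \<open>The decision \<open>v\<close> enters through \<open>m1\<close> and \<open>m2\<close>;
  taking one of them as the identity and the other as the opponent's fixed strategy treats both
  players at once.\<close>

lemma player_mdp:
  fixes V :: "nat \<Rightarrow> 'v set" and m1 :: "nat \<Rightarrow> 'v \<Rightarrow> 'a measure" and m2 :: "nat \<Rightarrow> 'v \<Rightarrow> 'b measure"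
    and c :: "nat \<Rightarrow> 'a \<Rightarrow> 'b \<Rightarrow> real" and \<kappa> :: "nat \<Rightarrow> real"
  defines "p \<equiv> \<lambda>i j v. relaxed (q i j) (m1 i v) (m2 i v)"
    and "rc \<equiv> \<lambda>i v. relaxed (c i) (m1 i v) (m2 i v)"
  assumes m: "\<And>i v. i \<in> states \<Longrightarrow> v \<in> V i \<Longrightarrow> m1 i v \<in> probs (A1 i) \<and> m2 i v \<in> probs (A2 i)"
    and c_cont: "\<And>i. i \<in> states \<Longrightarrow> continuous_on (A1 i \<times> A2 i) (\<lambda>(u1, u2). c i u1 u2)"
    and c_nonneg: "\<And>i u1 u2. i \<in> states \<Longrightarrow> u1 \<in> A1 i \<Longrightarrow> u2 \<in> A2 i \<Longrightarrow> 0 \<le> c i u1 u2"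
    and c_le: "\<And>i u1 u2. i \<in> states \<Longrightarrow> u1 \<in> A1 i \<Longrightarrow> u2 \<in> A2 i \<Longrightarrow> c i u1 u2 \<le> \<kappa> i"
    and B: "finite B" "B \<subseteq> states" and \<delta>: "0 < \<delta>" and gap: "\<And>i. i \<in> states \<Longrightarrow> i \<notin> B \<Longrightarrow> \<delta> \<le> dr i - \<kappa> i"
    and vs: "\<forall>i\<in>states. vs i \<in> V i"
    and nash: "\<And>v i. \<forall>i\<in>states. v i \<in> V i \<Longrightarrow> i \<in> states \<Longrightarrow>
      risk_cost A1 A2 q c (markov U1 (\<lambda>i. m1 i (vs i))) (markov U2 (\<lambda>i. m2 i (vs i))) i \<le>
      risk_cost A1 A2 q c (markov U1 (\<lambda>i. m1 i (v i))) (markov U2 (\<lambda>i. m2 i (v i))) i"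
    and minimizer: "\<And>\<psi> i. pos_bounded W \<psi> \<Longrightarrow> i \<in> states \<Longrightarrow>
      \<exists>v\<in>V i. \<forall>v'\<in>V i. hjb_term p rc \<psi> i v \<le> hjb_term p rc \<psi> i v'"
  obtains K where "risk_sensitive_mdp V p rc W i\<^sub>0 (B \<union> KK) \<delta> K vs"
proof -
  define B' where "B' = B \<union> KK"
  have B': "finite B'" "B' \<subseteq> states" using B KK by (auto simp: B'_def)
  \<comment> \<open>On the finite set \<open>B'\<close> the sign of \<open>dr - \<kappa>\<close> is
    unknown; \<open>K\<close> collects the possible excess there together with
    \<open>C4\<close>.\<close>
  define K where "K = C4 + (\<Sum>b\<in>B'. (\<bar>\<kappa> b - dr b\<bar> + \<delta>) * W b)"
  have term_nonneg: "0 \<le> (\<bar>\<kappa> b - dr b\<bar> + \<delta>) * W b" if "b \<in> B'" for b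
    using W_nonneg[of b] that B' \<delta> by auto
  have K_nonneg: "0 \<le> K" unfolding K_def using C4_pos term_nonneg by (intro add_nonneg_nonneg sum_nonneg) auto
  have dr_bound: "C4 * indicator KK i - dr i * W i + \<kappa> i * W i \<le> K * indicator B' i - \<delta> * W i" if i: "i \<in> states" for i
  proof (cases "i \<in> B'")
    case True
    have "(\<bar>\<kappa> i - dr i\<bar> + \<delta>) * W i \<le> (\<Sum>b\<in>B'. (\<bar>\<kappa> b - dr b\<bar> + \<delta>) * W b)"
      using B' True term_nonneg by (intro member_le_sum) auto
    moreover have "(\<kappa> i - dr i) * W i \<le> \<bar>\<kappa> i - dr i\<bar> * W i" using W_nonneg[OF i] by (intro mult_right_mono) auto
    moreover have "C4 * indicator KK i \<le> C4" using C4_pos by (simp add: indicator_def)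
    ultimately show ?thesis using True by (simp add: K_def algebra_simps)
  next
    case False
    then have "\<delta> * W i \<le> (dr i - \<kappa> i) * W i" using gap[OF i] W_nonneg[OF i] by (intro mult_right_mono) (auto simp: B'_def)
    then show ?thesis using False by (simp add: B'_def algebra_simps)
  qed
  have rc_bounds: "0 \<le> rc i v" "rc i v \<le> \<kappa> i" if "i \<in> states" "v \<in> V i" for i v
    unfolding rc_def using m[OF that] c_nonneg c_le that(1)
    by (auto intro!: relaxed_ge[OF compact_actions c_cont] relaxed_le[OF compact_actions c_cont])
  have stat: "(\<lambda>i. m1 i (v i)) \<in> stationary A1" "(\<lambda>i. m2 i (v i)) \<in> stationary A2" if "\<forall>i\<in>states. v i \<in> V i" for v
    using that m by (auto simp: stationary_def relaxed_actions_def)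
  have p_eq: "off_diagonal p v i j = relaxed_rate (\<lambda>i. m1 i (v i)) (\<lambda>i. m2 i (v i)) i j" if "i \<in> states" "j \<in> states" for v i j
    using that by (simp add: off_diagonal_def relaxed_rate_def p_def)
  have d_eq: "diagonal_deficit p rc v i = jump_rates.total_rate (relaxed_rate (\<lambda>i. m1 i (v i)) (\<lambda>i. m2 i (v i))) i -
      relaxed_cost c (\<lambda>i. m1 i (v i)) (\<lambda>i. m2 i (v i)) i" if "i \<in> states" "\<forall>i\<in>states. v i \<in> V i" for v i
    using total_relaxed_rate[OF stat[OF that(2)] that(1)] that(1)
    by (simp add: diagonal_deficit_def relaxed_cost_def p_def rc_def)
  have super_iff: "supersolution (off_diagonal p v) (diagonal_deficit p rc v) \<mu> \<phi> \<longleftrightarrow>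
    supersolution (relaxed_rate (\<lambda>i. m1 i (v i)) (\<lambda>i. m2 i (v i)))
      (\<lambda>i. jump_rates.total_rate (relaxed_rate (\<lambda>i. m1 i (v i)) (\<lambda>i. m2 i (v i))) i -
        relaxed_cost c (\<lambda>i. m1 i (v i)) (\<lambda>i. m2 i (v i)) i) \<mu> \<phi>" if "\<forall>i\<in>states. v i \<in> V i" for v \<mu> \<phi>
    by (rule supersolution_cong) (auto simp: p_eq d_eq[OF _ that])
  have W_sum: "(\<lambda>j. W j * p i j v) summable_on states" "hjb_term p rc W i v \<le> K * indicator B' i - \<delta> * W i"
    if iv: "i \<in> states" "v \<in> V i" for i v
  proof -
    note R = relaxed_W_sum[OF iv(1) m[OF iv, THEN conjunct1] m[OF iv, THEN conjunct2], folded p_def]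
    have ins: "states = insert i (states - {i})" using iv by auto
    show s: "(\<lambda>j. W j * p i j v) summable_on states"
      using summable_on_insert_iff[of "\<lambda>j. W j * p i j v" i "states - {i}"] R(1) iv(1) by (simp add: p_def insert_absorb)
    have "(\<Sum>\<^sub>\<infinity>j\<in>states. W j * p i j v) = W i * p i i v + (\<Sum>\<^sub>\<infinity>j\<in>states - {i}. W j * p i j v)"
      by (subst ins, rule infsum_insert) (use R(1) in \<open>auto simp: p_def\<close>)
    then have "hjb_term p rc W i v \<le> C4 * indicator KK i - dr i * W i + \<kappa> i * W i"
      unfolding hjb_term_def using R(2) mult_right_mono[OF rc_bounds(2)[OF iv] W_nonneg[OF iv(1)]] by (simp add: p_def)
    then show "hjb_term p rc W i v \<le> K * indicator B' i - \<delta> * W i" using dr_bound[OF iv(1)] by simp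
  qed
  have "risk_sensitive_mdp V p rc W i\<^sub>0 B' \<delta> K vs"
  proof
    show "0 \<le> p i j v" if "i \<in> states" "j \<in> states" "i \<noteq> j" "v \<in> V i" for i j v
      unfolding p_def using m[OF that(1,4)] relaxed_off_diagonal_nonneg[OF that(1) _ _ rates_continuous that(2,3)] that(1) by blast
    show "0 < p i\<^sub>0 j v" if "j \<in> states" "j \<noteq> i\<^sub>0" "v \<in> V i\<^sub>0" for j v
      unfolding p_def using m[OF i0_state that(3)] i0_rates[OF that(1,2)] admissible1[OF i0_state] admissible2[OF i0_state]
      by (intro relaxed_pos[OF compact_actions[OF i0_state] _ _ rates_continuous[OF i0_state that(1)]]) auto
  next
    fix v Z assume v: "\<forall>i\<in>states. v i \<in> V i" and Z: "Z \<subseteq> states" "i\<^sub>0 \<notin> Z"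
      and closed: "\<And>i j. i \<in> Z \<Longrightarrow> j \<in> states - Z \<Longrightarrow> p i j (v i) = 0"
    show "Z = {}"
    proof (rule ccontr)
      assume "Z \<noteq> {}"
      then obtain i where i: "i \<in> Z" by blast
      then have "i \<in> states" using Z by blast
      let ?v1 = "\<lambda>i. m1 i (v i)" and ?v2 = "\<lambda>i. m2 i (v i)"
      interpret J: jump_rates "relaxed_rate ?v1 ?v2" by (rule jump_rates_relaxed[OF stat[OF v]])
      obtain t where t: "0 \<le> t" "0 < emeasure (law A1 A2 q (markov U1 ?v1) (markov U2 ?v2) i) {\<omega> \<in> paths. Y \<omega> t = i\<^sub>0}"
        using irreducible[OF stat[OF v]] \<open>i \<in> states\<close> i0_state unfolding irreducible_under_def by blast
      \<comment> \<open>The chain started in \<open>i\<close> stays in the closed set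
        \<open>Z\<close>, whereas irreducibility gives it a positive chance of being in
        \<open>i\<^sub>0\<close> at time \<open>t\<close>.\<close>
      have "emeasure (J.path_law i) {\<omega> \<in> paths. Y \<omega> t = i\<^sub>0} = 0"
      proof (rule J.closed_set_not_left[OF i Z(1) _ t(1)])
        show "relaxed_rate ?v1 ?v2 k j = 0" if "k \<in> Z" "j \<in> states - Z" for k j
          using closed[OF that] p_eq[of k j v] that Z by (auto simp: off_diagonal_def split: if_splits)
        show "i\<^sub>0 \<in> states - Z" using Z i0_state by blast
      qed
      then show False using t(2) unfolding law_markov[OF stat[OF v] \<open>i \<in> states\<close>] by simp
    qed
  next
    fix v \<mu> \<phi> assume v: "\<forall>i\<in>states. v i \<in> V i" and \<mu>: "- \<delta> < \<mu>" and \<phi>: "pos_bounded W \<phi>"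
      and super: "supersolution (off_diagonal p v) (diagonal_deficit p rc v) \<mu> \<phi>"
    let ?v1 = "\<lambda>i. m1 i (v i)" and ?v2 = "\<lambda>i. m2 i (v i)"
    let ?s1 = "\<lambda>i. m1 i (vs i)" and ?s2 = "\<lambda>i. m2 i (vs i)"
    interpret J: jump_rates "relaxed_rate ?v1 ?v2" by (rule jump_rates_relaxed[OF stat[OF v]])
    interpret S: jump_rates "relaxed_rate ?s1 ?s2" by (rule jump_rates_relaxed[OF stat[OF vs]])
    let ?c = "relaxed_cost c ?v1 ?v2" and ?sc = "relaxed_cost c ?s1 ?s2"
    have cost_nonneg: "0 \<le> ?c j" "0 \<le> ?sc j" if "j \<in> states" for j
      using rc_bounds(1)[OF that] v vs that by (auto simp: relaxed_cost_def rc_def)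
    have \<phi>_pos: "0 < \<phi> j" if "j \<in> states" for j using \<phi> that by (auto simp: pos_bounded_def)
    note super' = super[unfolded super_iff[OF v]]
    have risk: "J.markov_risk ?c i \<le> ereal (\<mu> + \<epsilon>)" if i: "i \<in> states" and \<epsilon>: "0 < \<epsilon>" for i \<epsilon>
    proof -
      \<comment> \<open>So large that on \<open>B'\<close> the slack \<open>\<epsilon>\<close> of
        \<open>M * \<phi>\<close> pays for the excess \<open>K\<close> in the drift of
        \<open>W\<close>.\<close>
      define M where "M = (\<Sum>b\<in>B'. K / (\<epsilon> * \<phi> b))"
      have M_terms: "0 \<le> K / (\<epsilon> * \<phi> b)" if "b \<in> B'" for b
        using K_nonneg \<epsilon> \<phi>_pos[of b] that B' by auto
      have M_nonneg: "0 \<le> M" unfolding M_def using M_terms by (intro sum_nonneg)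
      have M: "K \<le> M * \<epsilon> * \<phi> b" if b: "b \<in> B'" for b
      proof -
        have "K / (\<epsilon> * \<phi> b) \<le> M" unfolding M_def using B' M_terms b by (intro member_le_sum) auto
        then show ?thesis using \<epsilon> \<phi>_pos[of b] b B' by (auto simp: divide_le_eq mult.assoc)
      qed
      show ?thesis
      proof (rule J.markov_risk_supersolution[OF cost_nonneg(1) _ _ i not_exploded[OF stat[OF v] i]])
        show "1 \<le> W j + M * \<phi> j" if "j \<in> states" for j
          using W_ge_1[OF that] M_nonneg \<phi>_pos[OF that] by (simp add: add_increasing2)
        show "supersolution (relaxed_rate ?v1 ?v2) (\<lambda>i. J.total_rate i - ?c i) (\<mu> + \<epsilon>) (\<lambda>j. W j + M * \<phi> j)"
          unfolding supersolution_def
        proof (intro ballI allI impI)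
          fix k F assume k: "k \<in> states" and F: "finite F \<and> F \<subseteq> states"
          let ?d = "J.total_rate k - ?c k"
          have "(\<Sum>j\<in>F. relaxed_rate ?v1 ?v2 k j * W j) \<le> C4 * indicator KK k - dr k * W k - W k * relaxed (q k k) (?v1 k) (?v2 k)"
            using F by (intro finite_weighted_rates_le[OF stat[OF v] k W_nonneg W_summable[OF k] W_drift[OF k]]) auto
          moreover have "?c k * W k \<le> \<kappa> k * W k"
            using rc_bounds(2)[OF k] v k W_nonneg[OF k] by (intro mult_right_mono) (auto simp: relaxed_cost_def rc_def)
          ultimately have 1: "(\<Sum>j\<in>F. relaxed_rate ?v1 ?v2 k j * W j) \<le> K * indicator B' k - \<delta> * W k + ?d * W k"
            using dr_bound[OF k] unfolding total_relaxed_rate[OF stat[OF v] k] by (simp add: algebra_simps)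
          have "M * (\<Sum>j\<in>F. relaxed_rate ?v1 ?v2 k j * \<phi> j) \<le> M * ((\<mu> + ?d) * \<phi> k)"
            using supersolutionD[OF super' k] F M_nonneg by (intro mult_left_mono) auto
          moreover have "(\<Sum>j\<in>F. relaxed_rate ?v1 ?v2 k j * (W j + M * \<phi> j)) =
            (\<Sum>j\<in>F. relaxed_rate ?v1 ?v2 k j * W j) + M * (\<Sum>j\<in>F. relaxed_rate ?v1 ?v2 k j * \<phi> j)"
            by (simp add: distrib_left sum.distrib sum_distrib_left algebra_simps)
          moreover have "K * indicator B' k \<le> M * \<epsilon> * \<phi> k"
            using M[of k] M_nonneg \<epsilon> \<phi>_pos[OF k] by (auto simp: indicator_def)
          \<comment> \<open>Here the threshold \<open>- \<delta> < \<mu>\<close> enters: off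
            \<open>B'\<close> the function \<open>W\<close> alone satisfies the inequality for every
            eigenvalue above \<open>- \<delta>\<close>.\<close>
          moreover have "0 \<le> (\<mu> + \<epsilon> + \<delta>) * W k" using \<mu> \<epsilon> W_nonneg[OF k] by (intro mult_nonneg_nonneg) auto
          ultimately show "(\<Sum>j\<in>F. relaxed_rate ?v1 ?v2 k j * (W j + M * \<phi> j)) \<le> (\<mu> + \<epsilon> + ?d) * (W k + M * \<phi> k)"
            using 1 by (simp add: algebra_simps)
        qed
      qed
    qed
    have "0 \<le> \<mu>"
    proof (rule field_le_epsilon)
      fix \<epsilon> :: real assume "0 < \<epsilon>"
      have "ereal 0 \<le> ereal (\<mu> + \<epsilon>)"
        using order.trans[OF J.markov_risk_nonneg[OF i0_state] risk[OF i0_state \<open>0 < \<epsilon>\<close>]] by (simp add: zero_ereal_def)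
      then show "0 \<le> \<mu> + \<epsilon>" by simp
    qed
    moreover have "\<exists>u. supersolution (off_diagonal p vs) (diagonal_deficit p rc vs) \<mu>' u \<and> (\<forall>i\<in>states. 0 < u i)" if \<mu>': "\<mu> < \<mu>'" for \<mu>'
      unfolding super_iff[OF vs]
    proof (rule S.supersolution_above_markov_risk[OF cost_nonneg(2)])
      fix j assume j: "j \<in> states"
      have "S.markov_risk ?sc j \<le> J.markov_risk ?c j"
        using nash[OF v j] risk_cost_markov[OF stat[OF v] j, of c, OF c_cont] risk_cost_markov[OF stat[OF vs] j, of c, OF c_cont] by simp
      also have "\<dots> \<le> ereal (\<mu> + (\<mu>' - \<mu>) / 2)" using \<mu>' by (intro risk[OF j]) simp
      also have "\<dots> < ereal \<mu>'" using \<mu>' by (simp add: field_simps)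
      finally show "S.markov_risk ?sc j < ereal \<mu>'" .
    qed
    ultimately show "0 \<le> \<mu> \<and> (\<forall>\<mu>'>\<mu>. \<exists>u. supersolution (off_diagonal p vs) (diagonal_deficit p rc vs) \<mu>' u \<and> (\<forall>i\<in>states. 0 < u i))"
      by blast
  qed (use W_ge_1 W_sum B' \<delta> K_nonneg i0_state minimizer vs in auto)
  then show ?thesis using that unfolding B'_def by blast
qed

end

text \<open>
  What both alternatives of the drift condition provide: the drift rate \<open>dr\<close> exceeds the cost
  uniformly off a finite set.
\<close>

definition cost_dominated :: "(nat \<Rightarrow> 'a set) \<Rightarrow> (nat \<Rightarrow> 'b set) \<Rightarrow> (nat \<Rightarrow> real) \<Rightarrow> (nat \<Rightarrow> 'a \<Rightarrow> 'b \<Rightarrow> real) \<Rightarrow> bool"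
  where "cost_dominated A1 A2 dr c \<longleftrightarrow> (\<exists>\<kappa> B \<delta>. finite B \<and> B \<subseteq> states \<and> 0 < \<delta> \<and>
    (\<forall>i\<in>states. \<forall>u1\<in>A1 i. \<forall>u2\<in>A2 i. c i u1 u2 \<le> \<kappa> i) \<and> (\<forall>i\<in>states - B. \<delta> \<le> dr i - \<kappa> i))"

text \<open>The cost bound is the sup norm in all states, the exceptional set is empty and the gap
  is \<open>\<gamma> - sup_norm A1 A2 c\<close>.\<close>

lemma cost_dominated_bounded:
  assumes "bounded_cost A1 A2 c" "sup_norm A1 A2 c < \<gamma>"
  shows "cost_dominated A1 A2 (\<lambda>_. \<gamma>) c"
  unfolding cost_dominated_def
proof (intro exI[of _ "{}"] exI conjI ballI)
  fix i u1 u2 assume i: "i \<in> states" "u1 \<in> A1 i" "u2 \<in> A2 i"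
  obtain M where M: "\<forall>x\<in>(\<lambda>(i, u1, u2). c i u1 u2) ` K_graph A1 A2. norm x \<le> M"
    using assms(1) unfolding bounded_cost_def bounded_iff by blast
  have "\<bar>c i u1 u2\<bar> \<le> sup_norm A1 A2 c"
    unfolding sup_norm_def using i M
    by (intro cSUP_upper2[of _ _ "(i, u1, u2)"] bdd_aboveI[of _ M]) (auto simp: K_graph_def)
  then show "c i u1 u2 \<le> sup_norm A1 A2 c" by simp
next
  show "\<gamma> - sup_norm A1 A2 c \<le> \<gamma> - sup_norm A1 A2 c" by simp
qed (use assms(2) in auto)

text \<open>The cost bound is the largest cost in each state; by norm-likeness only finitely many
  states have a gap of at most 1, and these form the exceptional set.\<close>

lemma cost_dominated_norm_like:
  fixes A1 :: "nat \<Rightarrow> 'a::topological_space set" and A2 :: "nat \<Rightarrow> 'b::topological_space set"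
  assumes l: "norm_like (\<lambda>i. l i - (SUP (u1, u2)\<in>A1 i \<times> A2 i. c i u1 u2))"
    and compact: "\<And>i. i \<in> states \<Longrightarrow> compact (A1 i)" "\<And>i. i \<in> states \<Longrightarrow> compact (A2 i)"
    and c: "\<And>i. i \<in> states \<Longrightarrow> continuous_on (A1 i \<times> A2 i) (\<lambda>(u1, u2). c i u1 u2)"
  shows "cost_dominated A1 A2 l c"
  unfolding cost_dominated_def
proof (intro exI conjI ballI)
  let ?\<kappa> = "\<lambda>i. SUP (u1, u2)\<in>A1 i \<times> A2 i. c i u1 u2"
  show "finite {i \<in> states. l i - ?\<kappa> i \<le> 1}" using l unfolding norm_like_def by blast
  fix i u1 u2 assume i: "i \<in> states" "u1 \<in> A1 i" "u2 \<in> A2 i"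
  have "bdd_above ((\<lambda>(u1, u2). c i u1 u2) ` (A1 i \<times> A2 i))"
    using compact i by (intro bounded_imp_bdd_above compact_imp_bounded compact_continuous_image[OF c] compact_Times) auto
  from cSUP_upper[OF _ this, of "(u1, u2)"] show "c i u1 u2 \<le> ?\<kappa> i" using i by simp
next
  fix i assume "i \<in> states - {i \<in> states. l i - (SUP (u1, u2)\<in>A1 i \<times> A2 i. c i u1 u2) \<le> 1}"
  then show "1 \<le> l i - (SUP (u1, u2)\<in>A1 i \<times> A2 i. c i u1 u2)" by auto
qed auto

context stable_game
begin

lemma player_optimal:
  fixes V :: "nat \<Rightarrow> 'v set" and m1 :: "nat \<Rightarrow> 'v \<Rightarrow> 'a measure" and m2 :: "nat \<Rightarrow> 'v \<Rightarrow> 'b measure"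
    and c :: "nat \<Rightarrow> 'a \<Rightarrow> 'b \<Rightarrow> real"
  defines "p \<equiv> \<lambda>i j v. relaxed (q i j) (m1 i v) (m2 i v)"
    and "rc \<equiv> \<lambda>i v. relaxed (c i) (m1 i v) (m2 i v)"
  assumes m: "\<And>i v. i \<in> states \<Longrightarrow> v \<in> V i \<Longrightarrow> m1 i v \<in> probs (A1 i) \<and> m2 i v \<in> probs (A2 i)"
    and c_cont: "\<And>i. i \<in> states \<Longrightarrow> continuous_on (A1 i \<times> A2 i) (\<lambda>(u1, u2). c i u1 u2)"
    and c_nonneg: "\<And>i u1 u2. i \<in> states \<Longrightarrow> u1 \<in> A1 i \<Longrightarrow> u2 \<in> A2 i \<Longrightarrow> 0 \<le> c i u1 u2"
    and dom: "cost_dominated A1 A2 dr c"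
    and vs: "\<forall>i\<in>states. vs i \<in> V i"
    and nash: "\<And>v i. \<forall>i\<in>states. v i \<in> V i \<Longrightarrow> i \<in> states \<Longrightarrow>
      risk_cost A1 A2 q c (markov U1 (\<lambda>i. m1 i (vs i))) (markov U2 (\<lambda>i. m2 i (vs i))) i \<le>
      risk_cost A1 A2 q c (markov U1 (\<lambda>i. m1 i (v i))) (markov U2 (\<lambda>i. m2 i (v i))) i"
    and minimizer: "\<And>\<psi> i. pos_bounded W \<psi> \<Longrightarrow> i \<in> states \<Longrightarrow>
      \<exists>v\<in>V i. \<forall>v'\<in>V i. hjb_term p rc \<psi> i v \<le> hjb_term p rc \<psi> i v'"
    and me: "minimal_eigenpair V p rc W i\<^sub>0 \<rho> \<psi>" and i: "i \<in> states"
  shows "hjb_term p rc \<psi> i (vs i) = (INF v\<in>V i. hjb_term p rc \<psi> i v)"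
proof -
  obtain \<kappa> B \<delta> where B: "finite B" "B \<subseteq> states" "0 < \<delta>"
    and \<kappa>: "\<And>i u1 u2. i \<in> states \<Longrightarrow> u1 \<in> A1 i \<Longrightarrow> u2 \<in> A2 i \<Longrightarrow> c i u1 u2 \<le> \<kappa> i"
    and gap: "\<And>i. i \<in> states \<Longrightarrow> i \<notin> B \<Longrightarrow> \<delta> \<le> dr i - \<kappa> i"
    using dom unfolding cost_dominated_def by blast
  obtain K where "risk_sensitive_mdp V p rc W i\<^sub>0 (B \<union> KK) \<delta> K vs"
    by (rule player_mdp[OF m c_cont c_nonneg \<kappa> B gap vs nash minimizer[unfolded p_def rc_def], folded p_def rc_def])
  then show ?thesis by (rule risk_sensitive_mdp.optimal_strategy_minimizes[OF _ me i])
qed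

lemma nash_strategy1_minimizes:
  assumes cont: "\<And>i. i \<in> states \<Longrightarrow> continuous_on (A1 i \<times> A2 i) (\<lambda>(u1, u2). c1 i u1 u2)"
    and dom: "cost_dominated A1 A2 dr c1"
    and vs: "v1s \<in> stationary A1" "v2s \<in> stationary A2"
    and nash: "nash_equilibrium U1 U2 A1 A2 q c1 c2 v1s v2s"
    and me: "minimal_eigenpair (relaxed_actions A1) (\<lambda>i j v1. relaxed (q i j) v1 (v2s i))
      (\<lambda>i v1. relaxed (c1 i) v1 (v2s i)) W i\<^sub>0 \<rho> \<psi>" and i: "i \<in> states"
  shows "hjb_term (\<lambda>i j v1. relaxed (q i j) v1 (v2s i)) (\<lambda>i v1. relaxed (c1 i) v1 (v2s i)) \<psi> i (v1s i) =
    (INF v1\<in>relaxed_actions A1 i. hjb_term (\<lambda>i j v1. relaxed (q i j) v1 (v2s i)) (\<lambda>i v1. relaxed (c1 i) v1 (v2s i)) \<psi> i v1)"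
proof (rule player_optimal[where ?m1.0="\<lambda>i v. v" and ?m2.0="\<lambda>i v. v2s i", OF _ cont _ dom _ _ _ me i])
  show "v \<in> probs (A1 i) \<and> v2s i \<in> probs (A2 i)" if "i \<in> states" "v \<in> relaxed_actions A1 i" for i v
    using that stationaryD[OF vs(2)] by (simp add: relaxed_actions_def)
  show "0 \<le> c1 i u1 u2" if "i \<in> states" "u1 \<in> A1 i" "u2 \<in> A2 i" for i u1 u2
    using cost_nonneg[of i u1 u2] that by (simp add: K_graph_def)
  show "\<forall>i\<in>states. v1s i \<in> relaxed_actions A1 i" using vs(1) by (simp add: stationary_def)
  show "risk_cost A1 A2 q c1 (markov U1 (\<lambda>i. v1s i)) (markov U2 (\<lambda>i. v2s i)) i \<le>
    risk_cost A1 A2 q c1 (markov U1 (\<lambda>i. v i)) (markov U2 (\<lambda>i. v2s i)) i"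
    if "\<forall>i\<in>states. v i \<in> relaxed_actions A1 i" "i \<in> states" for v i
    using nash markov_in_strategies[of v A1 U1] that admissible1 by (auto simp: nash_equilibrium_def stationary_def)
  show "\<exists>v\<in>relaxed_actions A1 i. \<forall>v'\<in>relaxed_actions A1 i.
    hjb_term (\<lambda>i j v1. relaxed (q i j) v1 (v2s i)) (\<lambda>i v1. relaxed (c1 i) v1 (v2s i)) \<psi> i v \<le>
    hjb_term (\<lambda>i j v1. relaxed (q i j) v1 (v2s i)) (\<lambda>i v1. relaxed (c1 i) v1 (v2s i)) \<psi> i v'"
    if "pos_bounded W \<psi>" "i \<in> states" for \<psi> i
    using minimizer_player1[where ?m2.0=v2s and c=c1, OF that(2,1) stationaryD[OF vs(2) that(2)]] cont[OF that(2)] by (simp add: relaxed_actions_def)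
qed

lemma nash_strategy2_minimizes:
  assumes cont: "\<And>i. i \<in> states \<Longrightarrow> continuous_on (A1 i \<times> A2 i) (\<lambda>(u1, u2). c2 i u1 u2)"
    and dom: "cost_dominated A1 A2 dr c2"
    and vs: "v1s \<in> stationary A1" "v2s \<in> stationary A2"
    and nash: "nash_equilibrium U1 U2 A1 A2 q c1 c2 v1s v2s"
    and me: "minimal_eigenpair (relaxed_actions A2) (\<lambda>i j v2. relaxed (q i j) (v1s i) v2)
      (\<lambda>i v2. relaxed (c2 i) (v1s i) v2) W i\<^sub>0 \<rho> \<psi>" and i: "i \<in> states"
  shows "hjb_term (\<lambda>i j v2. relaxed (q i j) (v1s i) v2) (\<lambda>i v2. relaxed (c2 i) (v1s i) v2) \<psi> i (v2s i) =
    (INF v2\<in>relaxed_actions A2 i. hjb_term (\<lambda>i j v2. relaxed (q i j) (v1s i) v2) (\<lambda>i v2. relaxed (c2 i) (v1s i) v2) \<psi> i v2)"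
proof (rule player_optimal[where ?m1.0="\<lambda>i v. v1s i" and ?m2.0="\<lambda>i v. v", OF _ cont _ dom _ _ _ me i])
  show "v1s i \<in> probs (A1 i) \<and> v \<in> probs (A2 i)" if "i \<in> states" "v \<in> relaxed_actions A2 i" for i v
    using that stationaryD[OF vs(1)] by (simp add: relaxed_actions_def)
  show "0 \<le> c2 i u1 u2" if "i \<in> states" "u1 \<in> A1 i" "u2 \<in> A2 i" for i u1 u2
    using cost_nonneg[of i u1 u2] that by (simp add: K_graph_def)
  show "\<forall>i\<in>states. v2s i \<in> relaxed_actions A2 i" using vs(2) by (simp add: stationary_def)
  show "risk_cost A1 A2 q c2 (markov U1 (\<lambda>i. v1s i)) (markov U2 (\<lambda>i. v2s i)) i \<le>
    risk_cost A1 A2 q c2 (markov U1 (\<lambda>i. v1s i)) (markov U2 (\<lambda>i. v i)) i"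
    if "\<forall>i\<in>states. v i \<in> relaxed_actions A2 i" "i \<in> states" for v i
    using nash markov_in_strategies[of v A2 U2] that admissible2 by (auto simp: nash_equilibrium_def stationary_def)
  show "\<exists>v\<in>relaxed_actions A2 i. \<forall>v'\<in>relaxed_actions A2 i.
    hjb_term (\<lambda>i j v2. relaxed (q i j) (v1s i) v2) (\<lambda>i v2. relaxed (c2 i) (v1s i) v2) \<psi> i v \<le>
    hjb_term (\<lambda>i j v2. relaxed (q i j) (v1s i) v2) (\<lambda>i v2. relaxed (c2 i) (v1s i) v2) \<psi> i v'"
    if "pos_bounded W \<psi>" "i \<in> states" for \<psi> i
    using minimizer_player2[where ?m1.0=v1s and c=c2, OF that(2,1) stationaryD[OF vs(1) that(2)]] cont[OF that(2)] by (simp add: relaxed_actions_def)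
qed

end

theorem theorem3p3:
  fixes U1 :: "'a::polish_space set" and U2 :: "'b::polish_space set"
    and A1 :: "nat \<Rightarrow> 'a set" and A2 :: "nat \<Rightarrow> 'b set"
    and q :: "nat \<Rightarrow> nat \<Rightarrow> 'a \<Rightarrow> 'b \<Rightarrow> real"
    and c1 c2 :: "nat \<Rightarrow> 'a \<Rightarrow> 'b \<Rightarrow> real"
    and Wt W :: "nat \<Rightarrow> real" and C1 C2 C3 C4 :: real
    and KK :: "nat set" and i\<^sub>0 :: nat
    and v1s :: "nat \<Rightarrow> 'a measure" and v2s :: "nat \<Rightarrow> 'b measure"
    and \<rho>1 \<rho>2 :: real and \<psi>1 \<psi>2 :: "nat \<Rightarrow> real"
  assumes game: "nonzero_sum_game U1 U2 A1 A2 q c1 c2"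
    and A_const: "C1 \<noteq> 0" "C2 \<ge> 0" "C3 > 0"
    and A_Wt: "\<forall>i\<in>states. Wt i \<ge> 1"
    and A_drift: "\<forall>i\<in>states. \<forall>u1\<in>A1 i. \<forall>u2\<in>A2 i.
      (\<lambda>j. Wt j * q i j u1 u2) summable_on states \<and>
      (\<Sum>\<^sub>\<infinity>j\<in>states. Wt j * q i j u1 u2) \<le> C1 * Wt i + C2"
    and A_rate: "\<forall>i\<in>states. max_rate A1 A2 q i \<le> C3 * Wt i"
    and B_irreducible: "\<forall>v1\<in>stationary A1. \<forall>v2\<in>stationary A2.
      irreducible_under U1 U2 A1 A2 q v1 v2"
    and B_const: "C4 > 0" "\<forall>i\<in>states. W i \<ge> 1" "KK \<subseteq> states" "finite KK"
    and B_summable: "\<forall>i\<in>states. \<forall>u1\<in>A1 i. \<forall>u2\<in>A2 i.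
      (\<lambda>j. W j * q i j u1 u2) summable_on states"
    and B_drift:
      "(bounded_cost A1 A2 c1 \<and> bounded_cost A1 A2 c2 \<and>
        (\<exists>\<gamma>. \<gamma> > max (sup_norm A1 A2 c1) (sup_norm A1 A2 c2) \<and>
          (\<forall>i\<in>states. \<forall>u1\<in>A1 i. \<forall>u2\<in>A2 i.
            (\<Sum>\<^sub>\<infinity>j\<in>states. W j * q i j u1 u2) \<le> C4 * indicator KK i - \<gamma> * W i)))
       \<or> (\<exists>l. (\<forall>i\<in>states. l i \<ge> 0) \<and> norm_like l \<and>
          (\<forall>i\<in>states. \<forall>u1\<in>A1 i. \<forall>u2\<in>A2 i.
            (\<Sum>\<^sub>\<infinity>j\<in>states. W j * q i j u1 u2) \<le> C4 * indicator KK i - l i * W i) \<and>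
          norm_like (\<lambda>i. l i - (SUP (u1, u2)\<in>A1 i \<times> A2 i. c1 i u1 u2)) \<and>
          norm_like (\<lambda>i. l i - (SUP (u1, u2)\<in>A1 i \<times> A2 i. c2 i u1 u2)))"
    and C_rate: "\<forall>i\<in>states. \<forall>j\<in>states. continuous_on (A1 i \<times> A2 i) (\<lambda>(u1, u2). q i j u1 u2)"
    and C_cost: "\<forall>i\<in>states. continuous_on (A1 i \<times> A2 i) (\<lambda>(u1, u2). c1 i u1 u2) \<and>
      continuous_on (A1 i \<times> A2 i) (\<lambda>(u1, u2). c2 i u1 u2)"
    and C_drift: "\<forall>i\<in>states. continuous_on (A1 i \<times> A2 i)
      (\<lambda>(u1, u2). \<Sum>\<^sub>\<infinity>j\<in>states. W j * q i j u1 u2)"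
    and C_i0: "i\<^sub>0 \<in> states" "\<forall>j\<in>states. j \<noteq> i\<^sub>0 \<longrightarrow>
      (\<forall>u1\<in>A1 i\<^sub>0. \<forall>u2\<in>A2 i\<^sub>0. q i\<^sub>0 j u1 u2 > 0)"
    and stationary: "v1s \<in> stationary A1" "v2s \<in> stationary A2"
    and nash: "nash_equilibrium U1 U2 A1 A2 q c1 c2 v1s v2s"
    and eigenpair1: "minimal_eigenpair (relaxed_actions A1)
      (\<lambda>i j v1. relaxed (q i j) v1 (v2s i)) (\<lambda>i v1. relaxed (c1 i) v1 (v2s i)) W i\<^sub>0 \<rho>1 \<psi>1"
    and eigenpair2: "minimal_eigenpair (relaxed_actions A2)
      (\<lambda>i j v2. relaxed (q i j) (v1s i) v2) (\<lambda>i v2. relaxed (c2 i) (v1s i) v2) W i\<^sub>0 \<rho>2 \<psi>2"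
  shows "\<forall>i\<in>states.
    (\<Sum>\<^sub>\<infinity>j\<in>states. \<psi>1 j * relaxed (q i j) (v1s i) (v2s i)) + relaxed (c1 i) (v1s i) (v2s i) * \<psi>1 i
      = (INF v1\<in>relaxed_actions A1 i.
          (\<Sum>\<^sub>\<infinity>j\<in>states. \<psi>1 j * relaxed (q i j) v1 (v2s i)) + relaxed (c1 i) v1 (v2s i) * \<psi>1 i) \<and>
    (\<Sum>\<^sub>\<infinity>j\<in>states. \<psi>2 j * relaxed (q i j) (v1s i) (v2s i)) + relaxed (c2 i) (v1s i) (v2s i) * \<psi>2 i
      = (INF v2\<in>relaxed_actions A2 i.
          (\<Sum>\<^sub>\<infinity>j\<in>states. \<psi>2 j * relaxed (q i j) (v1s i) v2) + relaxed (c2 i) (v1s i) v2 * \<psi>2 i)"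
proof -
  interpret nonzero_sum_game U1 U2 A1 A2 q c1 c2 by (rule game)
  \<comment> \<open>Both alternatives are merged here, with \<open>dr\<close> the constant
    \<open>\<gamma>\<close> or the function \<open>l\<close>.\<close>
  have "\<exists>dr. (\<forall>i\<in>states. \<forall>u1\<in>A1 i. \<forall>u2\<in>A2 i. (\<Sum>\<^sub>\<infinity>j\<in>states. W j * q i j u1 u2) \<le> C4 * indicator KK i - dr i * W i) \<and>
    cost_dominated A1 A2 dr c1 \<and> cost_dominated A1 A2 dr c2"
    using B_drift
  proof (elim disjE exE conjE)
    fix \<gamma> assume "bounded_cost A1 A2 c1" "bounded_cost A1 A2 c2" "max (sup_norm A1 A2 c1) (sup_norm A1 A2 c2) < \<gamma>"
      and "\<forall>i\<in>states. \<forall>u1\<in>A1 i. \<forall>u2\<in>A2 i. (\<Sum>\<^sub>\<infinity>j\<in>states. W j * q i j u1 u2) \<le> C4 * indicator KK i - \<gamma> * W i"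
    then show ?thesis by (intro exI[of _ "\<lambda>_. \<gamma>"] conjI cost_dominated_bounded) auto
  next
    fix l assume "norm_like (\<lambda>i. l i - (SUP (u1, u2)\<in>A1 i \<times> A2 i. c1 i u1 u2))"
      "norm_like (\<lambda>i. l i - (SUP (u1, u2)\<in>A1 i \<times> A2 i. c2 i u1 u2))"
      and "\<forall>i\<in>states. \<forall>u1\<in>A1 i. \<forall>u2\<in>A2 i. (\<Sum>\<^sub>\<infinity>j\<in>states. W j * q i j u1 u2) \<le> C4 * indicator KK i - l i * W i"
    then show ?thesis using admissible1 admissible2 C_cost by (intro exI[of _ l] conjI cost_dominated_norm_like) auto
  qed
  then obtain dr where dr: "\<forall>i\<in>states. \<forall>u1\<in>A1 i. \<forall>u2\<in>A2 i. (\<Sum>\<^sub>\<infinity>j\<in>states. W j * q i j u1 u2) \<le> C4 * indicator KK i - dr i * W i"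
    and dom: "cost_dominated A1 A2 dr c1" "cost_dominated A1 A2 dr c2" by blast
  interpret stable_game U1 U2 A1 A2 q c1 c2 Wt C1 C2 C3 W dr KK C4 i\<^sub>0
    using A_const A_Wt A_drift A_rate B_irreducible B_const B_summable dr C_rate C_i0 by unfold_locales auto
  show ?thesis
    using nash_strategy1_minimizes[OF _ dom(1) stationary nash eigenpair1] nash_strategy2_minimizes[OF _ dom(2) stationary nash eigenpair2] C_cost
    unfolding hjb_term_def by blast
qed

end
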